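(* Let $\mathbb{K}$ be any field. (a) For any rational $n$-dimensional quantum torus $A$ over $\mathbb{K}$, the commutator group $C_A \subseteq \mathbb{K}^\times$ is cyclic. Let $q$ be a generator of $C_A$ and choose $P \subseteq \mathbb{Z}/(m)$ for $m = |C_A| = \operatorname{ord}(q)$ as described in the context. Then there exist $s \in \mathbb{N}_0$ with $2s \le n$ and $h_2 | \cdots | h_s$ in $P \setminus \{0\}$ such that $$ A \cong A_{q} \otimes A_{q^{h_2}} \otimes \cdots \otimes A_{q^{h_s}} \otimes \mathbb{K}[\mathbb{Z}^{n-2s}] \quad\text{and}\quad 2s < n, $$ or $$ A \cong A_{q} \otimes A_{q^{h_2}} \otimes \cdots \otimes A_{q^{h_{s-1}}} \otimes A_{q^{z h_s}} \quad\text{and}\quad 2s = n $$ for some $z \in \mathbb{N}$ with $\operatorname{ord}(q^{z h_s}) = \operatorname{ord}(q^{h_s})$. (b) If two $n$-dimensional rational quantum tori $A$ and $A'$ are (graded) isomorphic, then $C_A = C_{A'}$, and both can be described by some data $(h_2, \ldots, z h_s)$ and $(h_2', \ldots, z' h'_{s'})$ as in (a) related to the same choice of generator $q$ of $C_A = C_{A'}$. (c) Two $n$-dimensional rational quantum tori $A$ and $A'$ given by such data $(h_2,\ldots,zh_s)$ and $(h_2',\ldots,z'h'_{s'})$ (related to the same generator $q$ of $C_A = C_{A'}$) are (graded) isomorphic if and only if $s = s'$, $h_i = h_i'$ for $i = 2, \ldots, s$, and $$ z' \in \pm z \cdot D_{(1,h_2,\ldots,h_s)}, $$ where $$ D_{(h_1,\ldots,h_s)}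 = \{ \det(g) : g \in \operatorname{GL}_n(Z),\ g N(h_1,\ldots,h_s) g^\top = N(h_1,\ldots,h_s) \} \le Z^\times $$ for the ring $Z := \mathbb{Z}/(\operatorname{ord}(q))$. In this case $z^2 h_s = (z')^2 h_s$ holds in $Z$.
   Context: Let $\Gamma$ be an abelian group. A $\Gamma$-quantum torus over $\mathbb{K}$ is a unital associative $\Gamma$-graded $\mathbb{K}$-algebra $A = \bigoplus_{\gamma\in\Gamma} A_\gamma$ with all $A_\gamma$ one-dimensional and every non-zero element of every $A_\gamma$ invertible. An $n$-dimensional quantum torus is a $\mathbb{Z}^n$-quantum torus. Two $\Gamma$-quantum tori $A,B$ are graded isomorphic if there are an algebra isomorphism $\varphi: A \to B$ and $\varphi_\Gamma \in \operatorname{Aut}(\Gamma)$ with $\varphi(A_\gamma) = B_{\varphi_\Gamma(\gamma)}$ for all $\gamma\in\Gamma$. $C_A$ denotes the commutator group of the unit group $A^\times$; for a $\mathbb{Z}^n$-quantum torus every unit is homogeneous, so $C_A$ lies in $\mathbb{K}^\times\mathbf 1 \cong \mathbb{K}^\times$. $A$ is called rational if $C_A$ consists of roots of unity in $\mathbb{K}$. For $q \in \mathbb{K}^\times$, $A_q$ is the $\mathbb{Z}^2$-quantum torus with basis $(\delta_\gamma)_{\gamma \in \mathbb{Z}^2}$ and multiplication $\delta_\gamma\delta_{\gamma'} = q^{\gamma_1\gamma_2'}\delta_{\gamma+\gamma'}$; it is generated by $u_1=\delta_{(1,0)}$, $u_2=\delta_{(0,1)}$ and their inverses, with $u_1u_2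 = q u_2 u_1$. $\mathbb{K}[\mathbb{Z}^k]$ is the group algebra of $\mathbb{Z}^k$. Tensor products are over $\mathbb{K}$, and $\operatorname{ord}$ denotes the order of a group element. $\mathbb{N}=\{1,2,3,\ldots\}$ and $\mathbb{N}_0=\mathbb{N}\cup\{0\}$. For $m \in \mathbb{N}$ with prime factorization $m = p_1^{\ell_1}\cdots p_k^{\ell_k}$, the ring $Z = \mathbb{Z}/(m)$ has unit group $Z^\times$, and $P := \{ \bar p_1^{\,j_1}\cdots\bar p_k^{\,j_k} : 0 \le j_i \le \ell_i,\ i=1,\ldots,k\} \subseteq Z$ is a multiplicatively closed set of representatives of the multiplicative cosets of $Z^\times$ in $Z$ (bars denote classes modulo $m$). For $a,b\in Z$, $a|b$ means $bZ \subseteq aZ$. For $h \in Z$, $q^h$ is well defined because $q^m=1$. Integers such as $z,z'$ are identified with their classes in $Z$ where appropriate. Conventions: $h_1 := 1$, so the first tensor factor $A_q$ is $A_{q^{h_1}}$; for $s=1$ and $2s=n$ the decomposition in (a) reads $A\cong A_{q^z}$, and for $s=0$ (which occurs when $q=1$) it reads $A\cong\mathbb{K}[\mathbb{Z}^n]$, with statements about $h_s$ being void. If $2s<n$, no $z$ occurs in the decomposition, and one puts $z=1$ (similarly $z'=1$ if $2s'<n$). For $2s\le n$ and $h_1,\ldots,h_s\in Z$, $N(h_1,\ldots,h_s)$ is the block diagonal $n\times n$ matrix with diagonal blocks $\begin{pmatrix} 0 & h_i \\ -h_i & 0\end{pmatrix}$, $i=1,\ldots,s$, followed by an $(n-2s)\times(n-2s)$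 zero block.
   Formalization: In (c), false for z not prime to ord(q) (n=4, ord q=6, h_2=2, z=2, z'=5), z' in ±zD is read in Z only if z, z' are prime to ord(q); for all data it is read modulo ord(q^{h_s}). The data have s=0 exactly when q=1. *)

theory Defs
  imports
    "HOL-Algebra.Product_Groups"
    "HOL-Algebra.Generated_Groups"
    "HOL-Algebra.Multiplicative_Group"
    "HOL-Algebra.QuotRing"
    "HOL-Algebra.Module"
    "HOL-Number_Theory.Cong"
    "Jordan_Normal_Form.Determinant"
begin

section \<open>Quantum tori\<close>

locale assoc_algebra = module K A + K?: field K + ring A
  for K (structure) and A (structure) +
  assumes smult_mult_left: "\<lbrakk>k \<in> carrier K; x \<in> carrier A; y \<in> carrier A\<rbrakk> \<Longrightarrow>
      (k \<odot>\<^bsub>A\<^esub> x) \<otimes>\<^bsub>A\<^esub> y = k \<odot>\<^bsub>A\<^esub> (x \<otimes>\<^bsub>A\<^esub> y)"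
    and smult_mult_right: "\<lbrakk>k \<in> carrier K; x \<in> carrier A; y \<in> carrier A\<rbrakk> \<Longrightarrow>
      x \<otimes>\<^bsub>A\<^esub> (k \<odot>\<^bsub>A\<^esub> y) = k \<odot>\<^bsub>A\<^esub> (x \<otimes>\<^bsub>A\<^esub> y)"

text \<open>The abelian group \<open>\<Gamma>\<close> is written multiplicatively, as all groups of HOL-Algebra are.\<close>

locale graded_algebra = assoc_algebra K A + \<Gamma>?: comm_group \<Gamma>
  for K (structure) and \<Gamma> (structure) and A (structure) and Gr +
  assumes component: "\<gamma> \<in> carrier \<Gamma> \<Longrightarrow> submodule (Gr \<gamma>) K A"
    and direct_sum: "a \<in> carrier A \<Longrightarrow>
      \<exists>!c. (\<forall>\<gamma>\<in>carrier \<Gamma>. c \<gamma> \<in> Gr \<gamma>) \<and> (\<forall>\<gamma>. \<gamma> \<notin> carrier \<Gamma> \<longrightarrow> c \<gamma> = \<zero>\<^bsub>A\<^esub>) \<and>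
           finite {\<gamma>. c \<gamma> \<noteq> \<zero>\<^bsub>A\<^esub>} \<and> a = (\<Oplus>\<^bsub>A\<^esub>\<gamma>\<in>{\<gamma>. c \<gamma> \<noteq> \<zero>\<^bsub>A\<^esub>}. c \<gamma>)"
    and graded_mult: "\<lbrakk>\<gamma> \<in> carrier \<Gamma>; \<gamma>' \<in> carrier \<Gamma>; x \<in> Gr \<gamma>; y \<in> Gr \<gamma>'\<rbrakk> \<Longrightarrow>
      x \<otimes>\<^bsub>A\<^esub> y \<in> Gr (\<gamma> \<otimes>\<^bsub>\<Gamma>\<^esub> \<gamma>')"

locale quantum_torus = graded_algebra K \<Gamma> A Gr
  for K (structure) and \<Gamma> (structure) and A (structure) and Gr +
  assumes one_dimensional: "\<gamma> \<in> carrier \<Gamma> \<Longrightarrow>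
      \<exists>v\<in>carrier A. v \<noteq> \<zero>\<^bsub>A\<^esub> \<and> Gr \<gamma> = {k \<odot>\<^bsub>A\<^esub> v | k. k \<in> carrier K}"
    and homogeneous_unit: "\<lbrakk>\<gamma> \<in> carrier \<Gamma>; x \<in> Gr \<gamma>; x \<noteq> \<zero>\<^bsub>A\<^esub>\<rbrakk> \<Longrightarrow> x \<in> Units A"

definition graded_iso ::
  "('k, 'e) ring_scheme \<Rightarrow> ('g, 'c) monoid_scheme \<Rightarrow> ('k, 'a) module \<Rightarrow> ('g \<Rightarrow> 'a set) \<Rightarrow>
   ('k, 'b) module \<Rightarrow> ('g \<Rightarrow> 'b set) \<Rightarrow> bool" where
  "graded_iso K \<Gamma> A Gr B Gr' \<longleftrightarrow>
     (\<exists>\<phi> \<psi>. \<phi> \<in> ring_iso A B \<and>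
        (\<forall>k\<in>carrier K. \<forall>x\<in>carrier A. \<phi> (k \<odot>\<^bsub>A\<^esub> x) = k \<odot>\<^bsub>B\<^esub> \<phi> x) \<and>
        \<psi> \<in> iso \<Gamma> \<Gamma> \<and> (\<forall>\<gamma>\<in>carrier \<Gamma>. \<phi> ` Gr \<gamma> = Gr' (\<psi> \<gamma>)))"

definition commutator_group :: "('k, 'a) module \<Rightarrow> 'a set" where
  "commutator_group A = derived (units_of A) (Units A)"

text \<open>The commutator group transported to \<open>K\<^sup>\<times>\<close> along \<open>k \<mapsto> k 1\<close>.\<close>

definition C_group :: "('k, 'e) ring_scheme \<Rightarrow> ('k, 'a) module \<Rightarrow> 'k set" where
  "C_group K A = {k \<in> Units K. k \<odot>\<^bsub>A\<^esub> \<one>\<^bsub>A\<^esub> \<in> commutator_group A}"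

definition rational :: "('k, 'e) ring_scheme \<Rightarrow> ('k, 'a) module \<Rightarrow> bool" where
  "rational K A \<longleftrightarrow> (\<forall>c\<in>commutator_group A.
     \<exists>k\<in>Units K. c = k \<odot>\<^bsub>A\<^esub> \<one>\<^bsub>A\<^esub> \<and> (\<exists>N::nat. 0 < N \<and> k [^]\<^bsub>K\<^esub> N = \<one>\<^bsub>K\<^esub>))"

definition order_of :: "('k, 'e) ring_scheme \<Rightarrow> 'k \<Rightarrow> nat" where
  "order_of K q = group.ord (units_of K) q"

text \<open>\<open>\<int>\<^sup>n\<close> with coordinates indexed by \<open>0, \<dots>, n - 1\<close>.\<close>

definition Zn :: "nat \<Rightarrow> (nat \<Rightarrow> int) monoid" where
  "Zn n = product_group {..<n} (\<lambda>_. integer_group)"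


section \<open>Twisted group algebras\<close>

text \<open>Finitely supported functions on the monoid \<open>M\<close>, with \<open>\<delta>\<^sub>x \<delta>\<^sub>y = \<sigma> x y \<delta>\<^sub>x\<^sub>y\<close>. The unit is
  \<open>\<delta>\<^sub>1\<close>, which presupposes that \<open>\<sigma>\<close> is normalised.\<close>

definition delta :: "('k, 'e) ring_scheme \<Rightarrow> 'g \<Rightarrow> 'g \<Rightarrow> 'k" where
  "delta K x = (\<lambda>y. if y = x then \<one>\<^bsub>K\<^esub> else \<zero>\<^bsub>K\<^esub>)"

definition twisted_algebra ::
  "('k, 'e) ring_scheme \<Rightarrow> ('g, 'c) monoid_scheme \<Rightarrow> ('g \<Rightarrow> 'g \<Rightarrow> 'k) \<Rightarrow> ('k, 'g \<Rightarrow> 'k) module" where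
  "twisted_algebra K M \<sigma> =
    \<lparr>carrier = {f. (\<forall>x. f x \<in> carrier K) \<and> finite {x. f x \<noteq> \<zero>\<^bsub>K\<^esub>} \<and> {x. f x \<noteq> \<zero>\<^bsub>K\<^esub>} \<subseteq> carrier M},
     monoid.mult = (\<lambda>f g x.
       finsum K (\<lambda>(a, b). \<sigma> a b \<otimes>\<^bsub>K\<^esub> f a \<otimes>\<^bsub>K\<^esub> g b)
         {(a, b). f a \<noteq> \<zero>\<^bsub>K\<^esub> \<and> g b \<noteq> \<zero>\<^bsub>K\<^esub> \<and> a \<otimes>\<^bsub>M\<^esub> b = x}),
     monoid.one = delta K \<one>\<^bsub>M\<^esub>,
     ring.zero = (\<lambda>_. \<zero>\<^bsub>K\<^esub>),
     ring.add = (\<lambda>f g x. f x \<oplus>\<^bsub>K\<^esub> g x),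
     module.smult = (\<lambda>k f x. k \<otimes>\<^bsub>K\<^esub> f x)\<rparr>"

definition monoid_algebra ::
  "('k, 'e) ring_scheme \<Rightarrow> ('g, 'c) monoid_scheme \<Rightarrow> ('k, 'g \<Rightarrow> 'k) module" where
  "monoid_algebra K M = twisted_algebra K M (\<lambda>_ _. \<one>\<^bsub>K\<^esub>)"

definition A_torus :: "('k, 'e) ring_scheme \<Rightarrow> 'k \<Rightarrow> ('k, (nat \<Rightarrow> int) \<Rightarrow> 'k) module" where
  "A_torus K q = twisted_algebra K (Zn 2) (\<lambda>\<gamma> \<gamma>'. q [^]\<^bsub>K\<^esub> (\<gamma> 0 * \<gamma>' 1 :: int))"

definition line :: "('k, 'e) ring_scheme \<Rightarrow> 'g \<Rightarrow> ('g \<Rightarrow> 'k) set" where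
  "line K \<gamma> = {(\<lambda>x. k \<otimes>\<^bsub>K\<^esub> delta K \<gamma> x) | k. k \<in> carrier K}"


section \<open>Tensor products of finite families of algebras\<close>

text \<open>The free module on the Cartesian product of the \<open>A i\<close> is the monoid algebra of the product of
  their multiplicative monoids. The subspace spanned by the multilinearity relations is already an
  ideal there, so dividing by the generated ideal gives \<open>\<Otimes>i\<in>I. A i\<close> together with its
  product \<open>(\<otimes>a\<^sub>i) (\<otimes>b\<^sub>i) = \<otimes>a\<^sub>ib\<^sub>i\<close>.\<close>

definition free_on_product ::
  "('k, 'e) ring_scheme \<Rightarrow> 'i set \<Rightarrow> ('i \<Rightarrow> ('k, 'b) module) \<Rightarrow> ('k, ('i \<Rightarrow> 'b) \<Rightarrow> 'k) module" where
  "free_on_product K I A = monoid_algebra K (product_group I A)"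

definition multilinear_relations ::
  "('k, 'e) ring_scheme \<Rightarrow> 'i set \<Rightarrow> ('i \<Rightarrow> ('k, 'b) module) \<Rightarrow> (('i \<Rightarrow> 'b) \<Rightarrow> 'k) set" where
  "multilinear_relations K I A =
     {delta K (a(i := x \<oplus>\<^bsub>A i\<^esub> y)) \<ominus>\<^bsub>free_on_product K I A\<^esub>
        (delta K (a(i := x)) \<oplus>\<^bsub>free_on_product K I A\<^esub> delta K (a(i := y)))
      | a i x y. a \<in> (\<Pi>\<^sub>E i\<in>I. carrier (A i)) \<and> i \<in> I \<and> x \<in> carrier (A i) \<and> y \<in> carrier (A i)} \<union>
     {delta K (a(i := k \<odot>\<^bsub>A i\<^esub> x)) \<ominus>\<^bsub>free_on_product K I A\<^esub>
        (k \<odot>\<^bsub>free_on_product K I A\<^esub> delta K (a(i := x)))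
      | a i k x. a \<in> (\<Pi>\<^sub>E i\<in>I. carrier (A i)) \<and> i \<in> I \<and> k \<in> carrier K \<and> x \<in> carrier (A i)}"

definition multilinear_ideal ::
  "('k, 'e) ring_scheme \<Rightarrow> 'i set \<Rightarrow> ('i \<Rightarrow> ('k, 'b) module) \<Rightarrow> (('i \<Rightarrow> 'b) \<Rightarrow> 'k) set" where
  "multilinear_ideal K I A = Idl\<^bsub>free_on_product K I A\<^esub> (multilinear_relations K I A)"

definition tensor_product ::
  "('k, 'e) ring_scheme \<Rightarrow> 'i set \<Rightarrow> ('i \<Rightarrow> ('k, 'b) module) \<Rightarrow>
   ('k, (('i \<Rightarrow> 'b) \<Rightarrow> 'k) set) module" where
  "tensor_product K I A =
     ring.extend (free_on_product K I A Quot multilinear_ideal K I A)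
       \<lparr>module.smult = (\<lambda>k W. \<Union>f\<in>W. multilinear_ideal K I A +>\<^bsub>free_on_product K I A\<^esub>
                               (k \<odot>\<^bsub>free_on_product K I A\<^esub> f))\<rparr>"

definition pure_tensor ::
  "('k, 'e) ring_scheme \<Rightarrow> 'i set \<Rightarrow> ('i \<Rightarrow> ('k, 'b) module) \<Rightarrow> ('i \<Rightarrow> 'b) \<Rightarrow>
   (('i \<Rightarrow> 'b) \<Rightarrow> 'k) set" where
  "pure_tensor K I A a = multilinear_ideal K I A +>\<^bsub>free_on_product K I A\<^esub> delta K a"

text \<open>The subspace \<open>\<Otimes>i\<in>I. V i\<close>.\<close>

definition tensor_subspace ::
  "('k, 'e) ring_scheme \<Rightarrow> 'i set \<Rightarrow> ('i \<Rightarrow> ('k, 'b) module) \<Rightarrow> ('i \<Rightarrow> 'b set) \<Rightarrow>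
   (('i \<Rightarrow> 'b) \<Rightarrow> 'k) set set" where
  "tensor_subspace K I A V =
     \<Inter>{N. submodule N K (tensor_product K I A) \<and> pure_tensor K I A ` (\<Pi>\<^sub>E i\<in>I. V i) \<subseteq> N}"


section \<open>The standard rational quantum tori\<close>

text \<open>Tensor factors are numbered \<open>1, \<dots>, s\<close>, followed by \<open>K[\<int>\<^sup>n\<^sup>-\<^sup>2\<^sup>s]\<close> as factor \<open>s + 1\<close> if
  \<open>2 s < n\<close>. (For \<open>n = s = 0\<close> the index set is empty and the tensor product is \<open>K = K[\<int>\<^sup>0]\<close>.)\<close>

definition factor_index :: "nat \<Rightarrow> nat \<Rightarrow> nat set" where
  "factor_index n s = (if 2 * s < n then {1..s + 1} else {1..s})"

definition factor_algebra ::
  "('k, 'e) ring_scheme \<Rightarrow> nat \<Rightarrow> 'k \<Rightarrow> nat \<Rightarrow> (nat \<Rightarrow> int) \<Rightarrow> nat \<Rightarrow> nat \<Rightarrow>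
   ('k, (nat \<Rightarrow> int) \<Rightarrow> 'k) module" where
  "factor_algebra K n q s h z i =
     (if i < s then A_torus K (q [^]\<^bsub>K\<^esub> h i)
      else if i = s then A_torus K (q [^]\<^bsub>K\<^esub> (int z * h s))
      else monoid_algebra K (Zn (n - 2 * s)))"

definition standard_torus ::
  "('k, 'e) ring_scheme \<Rightarrow> nat \<Rightarrow> 'k \<Rightarrow> nat \<Rightarrow> (nat \<Rightarrow> int) \<Rightarrow> nat \<Rightarrow>
   ('k, ((nat \<Rightarrow> (nat \<Rightarrow> int) \<Rightarrow> 'k) \<Rightarrow> 'k) set) module" where
  "standard_torus K n q s h z = tensor_product K (factor_index n s) (factor_algebra K n q s h z)"

text \<open>The degree in \<open>\<int>\<^sup>n = \<int>\<^sup>2 \<times> \<dots> \<times> \<int>\<^sup>2 \<times> \<int>\<^sup>n\<^sup>-\<^sup>2\<^sup>s\<close>, split into its components.\<close>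

definition degree_block :: "nat \<Rightarrow> nat \<Rightarrow> (nat \<Rightarrow> int) \<Rightarrow> nat \<Rightarrow> nat \<Rightarrow> int" where
  "degree_block n s \<gamma> i =
     (if i \<le> s then (\<lambda>j\<in>{..<2}. \<gamma> (2 * (i - 1) + j)) else (\<lambda>j\<in>{..<n - 2 * s}. \<gamma> (2 * s + j)))"

definition standard_grading ::
  "('k, 'e) ring_scheme \<Rightarrow> nat \<Rightarrow> 'k \<Rightarrow> nat \<Rightarrow> (nat \<Rightarrow> int) \<Rightarrow> nat \<Rightarrow> (nat \<Rightarrow> int) \<Rightarrow>
   ((nat \<Rightarrow> (nat \<Rightarrow> int) \<Rightarrow> 'k) \<Rightarrow> 'k) set set" where
  "standard_grading K n q s h z \<gamma> =
     tensor_subspace K (factor_index n s) (factor_algebra K n q s h z)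
       (\<lambda>i. line K (degree_block n s \<gamma> i))"


section \<open>Classifying data\<close>

text \<open>Elements of \<open>\<int>/(m)\<close> are represented by the integers \<open>0, \<dots>, m - 1\<close>; this includes the zero
  ring \<open>m = 1\<close>.\<close>

definition P_set :: "nat \<Rightarrow> int set" where
  "P_set m = {(\<Prod>p\<in>prime_factors m. int p ^ j p) mod int m | j.
                \<forall>p\<in>prime_factors m. j p \<le> multiplicity p m}"

definition ideal_mod :: "nat \<Rightarrow> int \<Rightarrow> int set" where
  "ideal_mod m a = range (\<lambda>x. (a * x) mod int m)"

definition dvd_mod :: "nat \<Rightarrow> int \<Rightarrow> int \<Rightarrow> bool" where
  "dvd_mod m a b \<longleftrightarrow> ideal_mod m b \<subseteq> ideal_mod m a"

text \<open>The entry \<open>h 1 = 1\<close> is a convention, and only \<open>h 2, \<dots>, h s\<close> are genuine data. Since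
  \<open>\<int>/(m)\<close> has \<open>1 = 0\<close> for \<open>m = 1\<close>, the empty decomposition \<open>s = 0\<close> belongs to \<open>q = 1\<close>; without
  this convention \<open>K[\<int>\<^sup>n]\<close> would be described by both \<open>s = 0\<close> and \<open>s = 1\<close>.\<close>

definition torus_data ::
  "('k, 'e) ring_scheme \<Rightarrow> nat \<Rightarrow> 'k \<Rightarrow> nat \<Rightarrow> (nat \<Rightarrow> int) \<Rightarrow> nat \<Rightarrow> bool" where
  "torus_data K n q s h z \<longleftrightarrow>
     2 * s \<le> n \<and> (s = 0 \<longleftrightarrow> q = \<one>\<^bsub>K\<^esub>) \<and> h 1 = 1 \<and>
     (\<forall>i\<in>{2..s}. h i \<in> P_set (order_of K q) - {0}) \<and>
     (\<forall>i\<in>{2..<s}. dvd_mod (order_of K q) (h i) (h (i + 1))) \<and>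
     (if 0 < s \<and> 2 * s = n
      then 1 \<le> z \<and> order_of K (q [^]\<^bsub>K\<^esub> (int z * h s)) = order_of K (q [^]\<^bsub>K\<^esub> h s)
      else z = 1)"

definition described_by ::
  "('k, 'e) ring_scheme \<Rightarrow> nat \<Rightarrow> 'k \<Rightarrow> ('k, 'a) module \<Rightarrow> ((nat \<Rightarrow> int) \<Rightarrow> 'a set) \<Rightarrow>
   nat \<Rightarrow> (nat \<Rightarrow> int) \<Rightarrow> nat \<Rightarrow> bool" where
  "described_by K n q A Gr s h z \<longleftrightarrow>
     torus_data K n q s h z \<and>
     graded_iso K (Zn n) A Gr (standard_torus K n q s h z) (standard_grading K n q s h z)"

definition N_mat :: "nat \<Rightarrow> nat \<Rightarrow> (nat \<Rightarrow> int) \<Rightarrow> int mat" where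
  "N_mat n s h = diag_block_mat
     (map (\<lambda>i. mat_of_rows_list 2 [[0, h i], [- h i, 0]]) [1..<s + 1] @ [0\<^sub>m (n - 2 * s) (n - 2 * s)])"

text \<open>Matrices over \<open>\<int>/(m)\<close> are represented by integer matrices.\<close>

definition mat_mod :: "nat \<Rightarrow> int mat \<Rightarrow> int mat" where
  "mat_mod m M = map_mat (\<lambda>x. x mod int m) M"

definition GL_mod :: "nat \<Rightarrow> nat \<Rightarrow> int mat set" where
  "GL_mod m n = {g \<in> carrier_mat n n. \<exists>g'\<in>carrier_mat n n.
     mat_mod m (g * g') = mat_mod m (1\<^sub>m n) \<and> mat_mod m (g' * g) = mat_mod m (1\<^sub>m n)}"

definition D_group :: "nat \<Rightarrow> nat \<Rightarrow> nat \<Rightarrow> (nat \<Rightarrow> int) \<Rightarrow> int set" where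
  "D_group m n s h = {det g mod int m | g. g \<in> GL_mod m n \<and>
     mat_mod m (g * N_mat n s h * transpose_mat g) = mat_mod m (N_mat n s h)}"

text \<open>\<open>z' \<in> \<plusminus> z D\<close> in \<open>\<int>/(l)\<close>.\<close>

definition in_pm_coset :: "nat \<Rightarrow> nat \<Rightarrow> nat \<Rightarrow> int set \<Rightarrow> bool" where
  "in_pm_coset l z' z D \<longleftrightarrow>
     (\<exists>d\<in>D. [int z' = int z * d] (mod int l) \<or> [int z' = - (int z * d)] (mod int l))"

end

theory Submission
  imports Defs
begin

text \<open>A rational quantum torus over \<open>\<int>\<^sup>n\<close> whose commutator group is generated by \<open>q\<close> satisfies
  \<open>x y = q\<^bsup>\<gamma> M \<gamma>'\<^esup> y x\<close> for homogeneous \<open>x\<close>, \<open>y\<close> of degrees \<open>\<gamma>\<close>, \<open>\<gamma>'\<close>, with an alternating integer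
  matrix \<open>M\<close> that is unique modulo \<open>m = ord q\<close>. Graded isomorphism becomes congruence \<open>U M U\<^sup>T \<equiv> M'\<close>
  modulo \<open>m\<close> with \<open>U \<in> GL\<^sub>n(\<int>)\<close>. Since the matrices with determinant \<open>\<plusminus>1\<close> over \<open>\<int>/(m)\<close> are
  exactly the reductions of such \<open>U\<close>, the classical normal form of alternating integer matrices can be
  rescaled blockwise until only the determinant of the rescaling, a unit \<open>z\<close>, survives. If \<open>2 s < n\<close> a
  zero row absorbs \<open>z\<close>. Otherwise \<open>z\<close> matters up to sign and the determinants of the stabiliser of the
  form. The \<open>h i\<close> are recovered from the numbers of solutions of \<open>M x \<equiv> 0\<close> modulo the divisors of \<open>m\<close>.\<close>

section \<open>Alternating matrices modulo \<open>m\<close>\<close>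

text \<open>The order condition on \<open>z\<close> only says that \<open>z\<close> is a unit modulo
  \<open>l = m div h s\<close>, whereas the determinants of the stabiliser live modulo
  \<open>m\<close>. For \<open>z\<close> and \<open>z'\<close> coprime to \<open>m\<close> the
  criterion can be read modulo \<open>m\<close>; in general it is a congruence modulo
  \<open>l\<close>. Both versions are proved, and they are compared through the fact that a unit
  congruent to 1 modulo \<open>l\<close> fixes \<open>h s\<close>, so that it can be absorbed into
  the stabiliser.

  That \<open>q\<close> generates the commutator group has one consequence for the matrix: no prime
  divisor of \<open>m\<close> divides all entries of \<open>M\<close>. This makes the first
  elementary divisor a unit modulo \<open>m\<close>, hence \<open>h 1 = 1\<close>.

  Rationality makes every commutator of units a scalar. Comparing homogeneous components shows that
  this scalar already occurs between two homogeneous elements, so the commutator group is generated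
  by the values of a bicharacter of the grading group.

  Tensor products are quotients of an algebra on all tuples; a linear section of the map onto a
  twisted group algebra identifies its kernel with the multilinear ideal.\<close>

definition mcong :: "nat \<Rightarrow> nat \<Rightarrow> int mat \<Rightarrow> int mat \<Rightarrow> bool" where
  "mcong m n A B \<longleftrightarrow> A \<in> carrier_mat n n \<and> B \<in> carrier_mat n n \<and>
     (\<forall>i<n. \<forall>j<n. [A $$ (i,j) = B $$ (i,j)] (mod int m))"

definition unimod :: "nat \<Rightarrow> int mat \<Rightarrow> bool" where
  "unimod n U \<longleftrightarrow> U \<in> carrier_mat n n \<and> \<bar>det U\<bar> = 1"

definition congr :: "nat \<Rightarrow> nat \<Rightarrow> int mat \<Rightarrow> int mat \<Rightarrow> bool" where
  "congr m n M M' \<longleftrightarrow> (\<exists>U. unimod n U \<and> mcong m n (U * M * transpose_mat U) M')"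

definition alt_mat :: "nat \<Rightarrow> int mat \<Rightarrow> bool" where
  "alt_mat n M \<longleftrightarrow> M \<in> carrier_mat n n \<and> transpose_mat M = - M"

lemma mcong_carrier: "mcong m n A B \<Longrightarrow> A \<in> carrier_mat n n \<and> B \<in> carrier_mat n n"
  by (simp add: mcong_def)

lemma mcongD: "mcong m n A B \<Longrightarrow> i < n \<Longrightarrow> j < n \<Longrightarrow> [A $$ (i,j) = B $$ (i,j)] (mod int m)"
  by (simp add: mcong_def)

lemma mcong_refl: "A \<in> carrier_mat n n \<Longrightarrow> mcong m n A A"
  by (simp add: mcong_def)

lemma mcong_sym: "mcong m n A B \<Longrightarrow> mcong m n B A"
  by (auto simp: mcong_def cong_sym)

lemma mcong_trans [trans]: "mcong m n A B \<Longrightarrow> mcong m n B C \<Longrightarrow> mcong m n A C"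
  unfolding mcong_def by (metis cong_trans)

lemma mult_mat_entry:
  assumes "A \<in> carrier_mat n n" "B \<in> carrier_mat n n" "i < n" "j < n"
  shows "(A * B) $$ (i,j) = (\<Sum>k<n. A $$ (i,k) * B $$ (k,j))"
  using assms by (auto simp: scalar_prod_def atLeast0LessThan intro!: sum.cong)

lemma mcong_mult:
  assumes "mcong m n A B" "mcong m n C D"
  shows "mcong m n (A * C) (B * D)"
proof -
  have c: "A \<in> carrier_mat n n" "B \<in> carrier_mat n n" "C \<in> carrier_mat n n" "D \<in> carrier_mat n n"
    using assms mcong_carrier by blast+
  have "[(A * C) $$ (i,j) = (B * D) $$ (i,j)] (mod int m)" if "i < n" "j < n" for i j
    unfolding mult_mat_entry[OF c(1,3) that] mult_mat_entry[OF c(2,4) that]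
    by (intro cong_sum cong_mult mcongD[OF assms(1)] mcongD[OF assms(2)]) (use that in auto)
  then show ?thesis using c by (simp add: mcong_def)
qed

lemma mcong_transpose: "mcong m n A B \<Longrightarrow> mcong m n (transpose_mat A) (transpose_mat B)"
  by (auto simp: mcong_def)

lemma mcong_det: assumes "mcong m n A B" shows "[det A = det B] (mod int m)"
proof -
  have c: "A \<in> carrier_mat n n" "B \<in> carrier_mat n n"
    using assms mcong_carrier by blast+
  show ?thesis
    unfolding det_def'[OF c(1)] det_def'[OF c(2)]
    by (intro cong_sum cong_mult cong_prod mcongD[OF assms] cong_refl)
      (auto simp: permutes_in_image dest: permutes_in_image)
qed

lemma mcong_mat_mod:
  assumes "A \<in> carrier_mat n n" "B \<in> carrier_mat n n"
  shows "mat_mod m A = mat_mod m B \<longleftrightarrow> mcong m n A B"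
proof
  assume eq: "mat_mod m A = mat_mod m B"
  have "A $$ (i,j) mod int m = B $$ (i,j) mod int m" if "i < n" "j < n" for i j
    using arg_cong[OF eq, of "\<lambda>M. M $$ (i,j)"] that assms by (simp add: mat_mod_def)
  then show "mcong m n A B"
    using assms by (simp add: mcong_def cong_def)
next
  assume "mcong m n A B"
  then show "mat_mod m A = mat_mod m B"
    using assms by (intro eq_matI) (auto simp: mcong_def mat_mod_def cong_def)
qed

lemma mcong_conj:
  assumes "mcong m n U V" "mcong m n M M'"
  shows "mcong m n (U * M * transpose_mat U) (V * M' * transpose_mat V)"
  by (intro mcong_mult mcong_transpose assms)

lemma unimod_carrier: "unimod n U \<Longrightarrow> U \<in> carrier_mat n n"
  by (simp add: unimod_def)

lemma unimod_one: "unimod n (1\<^sub>m n)"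
  by (simp add: unimod_def)

lemma unimod_mult: "unimod n U \<Longrightarrow> unimod n V \<Longrightarrow> unimod n (U * V)"
  by (auto simp: unimod_def det_mult abs_mult)

lemma abs_one_square: "\<bar>x::int\<bar> = 1 \<Longrightarrow> x * x = 1"
  by (cases "x \<ge> 0") auto

text \<open>The adjugate satisfies \<open>U * adj_mat U = det U * 1\<close>, and
  \<open>det U\<close> is its own inverse, so the adjugate scaled by \<open>det U\<close> is an
  integral inverse.\<close>

lemma unimod_inverse:
  assumes "unimod n U"
  obtains V where "unimod n V" "U * V = 1\<^sub>m n" "V * U = 1\<^sub>m n"
proof
  have U: "U \<in> carrier_mat n n" and d: "det U * det U = 1"
    using assms abs_one_square by (auto simp: unimod_def)
  let ?V = "det U \<cdot>\<^sub>m adj_mat U"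
  have V: "?V \<in> carrier_mat n n" using adj_mat(1)[OF U] by simp
  show 1: "U * ?V = 1\<^sub>m n" "?V * U = 1\<^sub>m n"
    using U adj_mat[OF U] d
    by (auto simp: mult_smult_distrib[OF U] mult_smult_assoc_mat[of _ n n _ n] intro!: eq_matI)
  have "det U * det ?V = 1" using det_mult[OF U V] 1 by simp
  then have "\<bar>det ?V\<bar> = 1"
    using abs_zmult_eq_1[of "det ?V" "det U"] by (simp add: mult.commute)
  then show "unimod n ?V" using V by (simp add: unimod_def)
qed

lemma unimod_intro: "U \<in> carrier_mat n n \<Longrightarrow> V \<in> carrier_mat n n \<Longrightarrow> U * V = 1\<^sub>m n \<Longrightarrow> unimod n U"
  unfolding unimod_def using det_mult[of U n V] abs_zmult_eq_1[of "det U" "det V"] by simp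

lemma conj_conj:
  fixes U V M :: "int mat"
  assumes "U \<in> carrier_mat n n" "V \<in> carrier_mat n n" "M \<in> carrier_mat n n"
  shows "U * (V * M * transpose_mat V) * transpose_mat U = (U * V) * M * transpose_mat (U * V)"
proof -
  have "transpose_mat (U * V) = transpose_mat V * transpose_mat U"
    by (rule transpose_mult[OF assms(1,2)])
  moreover have "transpose_mat V \<in> carrier_mat n n" "transpose_mat U \<in> carrier_mat n n"
    using assms by auto
  ultimately show ?thesis using assms
    by (simp add: assoc_mult_mat[of _ n n _ n _ n])
qed

lemma conj_carrier:
  "U \<in> carrier_mat n n \<Longrightarrow> M \<in> carrier_mat n n \<Longrightarrow> U * M * transpose_mat U \<in> carrier_mat n n"
  by (meson mult_carrier_mat transpose_carrier_mat)

lemma conj_one: "(M::int mat) \<in> carrier_mat n n \<Longrightarrow> 1\<^sub>m n * M * transpose_mat (1\<^sub>m n) = M"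
  by simp

lemma congrI: "unimod n U \<Longrightarrow> mcong m n (U * M * transpose_mat U) M' \<Longrightarrow> congr m n M M'"
  unfolding congr_def by blast

lemma congr_mcong: assumes "mcong m n M M'" shows "congr m n M M'"
  by (rule congrI[OF unimod_one]) (use assms mcong_carrier[OF assms] conj_one[of M n] in simp)

lemma congr_trans:
  assumes "congr m n A B" "congr m n B C" "A \<in> carrier_mat n n"
  shows "congr m n A C"
proof -
  obtain U V where U: "unimod n U" "mcong m n (U * A * transpose_mat U) B"
    and V: "unimod n V" "mcong m n (V * B * transpose_mat V) C"
    using assms unfolding congr_def by blast
  have "mcong m n (V * (U * A * transpose_mat U) * transpose_mat V) (V * B * transpose_mat V)"
    by (rule mcong_conj[OF mcong_refl U(2)]) (rule unimod_carrier[OF V(1)])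
  from mcong_trans[OF this V(2)] show ?thesis
    unfolding conj_conj[OF unimod_carrier[OF V(1)] unimod_carrier[OF U(1)] assms(3)]
    by (rule congrI[OF unimod_mult[OF V(1) U(1)]])
qed

lemma congr_sym:
  assumes "congr m n A B" "A \<in> carrier_mat n n"
  shows "congr m n B A"
proof -
  obtain U where U: "unimod n U" "mcong m n (U * A * transpose_mat U) B"
    using assms unfolding congr_def by blast
  obtain V where V: "unimod n V" "U * V = 1\<^sub>m n" "V * U = 1\<^sub>m n"
    using unimod_inverse[OF U(1)] by blast
  have "mcong m n (V * B * transpose_mat V) (V * (U * A * transpose_mat U) * transpose_mat V)"
    by (rule mcong_conj[OF mcong_refl mcong_sym[OF U(2)]]) (rule unimod_carrier[OF V(1)])
  also have "V * (U * A * transpose_mat U) * transpose_mat V = A"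
    unfolding conj_conj[OF unimod_carrier[OF V(1)] unimod_carrier[OF U(1)] assms(2)] V(3)
    using assms(2) by simp
  finally show ?thesis by (rule congrI[OF V(1)])
qed

lemma unimod_addrow: "k \<noteq> l \<Longrightarrow> k < n \<Longrightarrow> l < n \<Longrightarrow> unimod n (addrow_mat n a k l)"
  unfolding unimod_def by (simp add: det_addrow_mat)

lemma unimod_swap: "k \<noteq> l \<Longrightarrow> k < n \<Longrightarrow> l < n \<Longrightarrow> unimod n (swaprows_mat n k l)"
  unfolding unimod_def by (simp add: det_swaprows_mat)

lemma ex_min_pos:
  fixes P :: "int \<Rightarrow> bool"
  assumes "P x" "x > 0"
  obtains d where "P d" "d > 0" "\<And>y. P y \<Longrightarrow> y > 0 \<Longrightarrow> d \<le> y"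
proof -
  define k where "k = (LEAST k. P (int k) \<and> k > 0)"
  have "P (int (nat x)) \<and> nat x > 0" using assms by simp
  then have k: "P (int k) \<and> k > 0" unfolding k_def by (rule LeastI)
  have "int k \<le> y" if "P y" "y > 0" for y
  proof -
    have "k \<le> nat y" unfolding k_def using that by (intro Least_le) simp
    then show ?thesis using that by simp
  qed
  with k that[of "int k"] show thesis by simp
qed

section \<open>Row reduction over the integers and lifting of matrices with determinant 1 or -1
  modulo \<open>m\<close>\<close>

text \<open>The Euclidean algorithm as a minimality argument: among all positive absolute values
  occurring in the first column of some \<open>U * A\<close> with \<open>U\<close> unimodular, the
  least one divides the column in which it stands, because the remainders of division occur in such
  columns as well.\<close>

lemma first_column_reduce:
  assumes A: "A \<in> carrier_mat n n" and n: "0 < n"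
  obtains U where "unimod n U" "\<And>i. 0 < i \<Longrightarrow> i < n \<Longrightarrow> (U * A) $$ (i,0) = 0"
proof (cases "\<forall>i<n. A $$ (i,0) = 0")
  case True
  then show ?thesis using that[OF unimod_one] A by simp
next
  case False
  define P where "P x \<longleftrightarrow> (\<exists>U i. unimod n U \<and> i < n \<and> \<bar>(U * A) $$ (i,0)\<bar> = x)" for x
  obtain i where i: "i < n" "A $$ (i,0) \<noteq> 0" using False by blast
  have "P \<bar>A $$ (i,0)\<bar>" unfolding P_def
    by (rule exI[of _ "1\<^sub>m n"], rule exI[of _ i]) (use i A unimod_one in auto)
  then obtain d where d: "P d" "d > 0" "\<And>y. P y \<Longrightarrow> y > 0 \<Longrightarrow> d \<le> y"
    using ex_min_pos[of P "\<bar>A $$ (i,0)\<bar>"] i by auto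
  from d(1) obtain U i where U: "unimod n U" "i < n" "\<bar>(U * A) $$ (i,0)\<bar> = d"
    unfolding P_def by blast
  obtain B V where V: "unimod n V" "B = V * A" "\<bar>B $$ (0,0)\<bar> = d"
  proof (cases "i = 0")
    case True then show ?thesis using that U by blast
  next
    case False
    have UA: "U * A \<in> carrier_mat n n" using U(1) A by (auto simp: unimod_def)
    have "swaprows_mat n 0 i * U * A = swaprows_mat n 0 i * (U * A)"
      using U(1) A by (simp add: unimod_def assoc_mult_mat[of _ n n _ n _ n])
    also have "\<dots> = swaprows 0 i (U * A)"
      using False U(2) n UA by (intro swaprows_mat[symmetric]) auto
    finally have "(swaprows_mat n 0 i * U * A) $$ (0,0) = (U * A) $$ (i,0)"
      using n U(2) A unimod_carrier[OF U(1)] by auto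
    then show ?thesis using that[of "swaprows_mat n 0 i * U"] unimod_mult[OF unimod_swap U(1)] False U n
      by auto
  qed
  have B: "B \<in> carrier_mat n n" using V A by (auto simp: unimod_def)
  \<comment> \<open>\<open>E\<close> subtracts from every lower row the quotient multiple of row 0,
    so that column 0 below the pivot consists of remainders modulo the pivot.\<close>
  define E where "E = mat n n (\<lambda>(i,j). if i = j then 1 else if j = 0 then - (B $$ (i,0) div B $$ (0,0)) else 0)"
  have E: "E \<in> carrier_mat n n" unfolding E_def by simp
  have "det E = prod_list (diag_mat E)"
    by (rule det_lower_triangular[OF _ E]) (auto simp: E_def)
  also have "diag_mat E = map (\<lambda>i. 1) [0..<n]" unfolding diag_mat_def E_def by (auto intro!: nth_equalityI)
  also have "prod_list \<dots> = 1" by (induct n) auto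
  finally have uE: "unimod n E" using E by (simp add: unimod_def)
  have EB: "E * B = (E * V) * A" using V A E by (simp add: unimod_def assoc_mult_mat[of _ n n _ n _ n])
  have uEV: "unimod n (E * V)" by (rule unimod_mult[OF uE V(1)])
  have "(E * B) $$ (i,0) = 0" if "0 < i" "i < n" for i
  proof -
    have "(E * B) $$ (i,0) = (\<Sum>k<n. E $$ (i,k) * B $$ (k,0))"
      by (rule mult_mat_entry[OF E B]) (use that n in auto)
    also have "\<dots> = (\<Sum>k\<in>{0,i}. E $$ (i,k) * B $$ (k,0))"
      by (rule sum.mono_neutral_right) (use that in \<open>auto simp: E_def\<close>)
    also have "\<dots> = B $$ (i,0) mod B $$ (0,0)"
      using that by (simp add: E_def minus_div_mult_eq_mod[symmetric])
    finally have *: "(E * B) $$ (i,0) = B $$ (i,0) mod B $$ (0,0)" .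
    have "P \<bar>(E * B) $$ (i,0)\<bar>" unfolding P_def EB using uEV that by blast
    moreover have "\<bar>(E * B) $$ (i,0)\<bar> < d" unfolding *
      using V(3) d(2) abs_mod_less[of "B $$ (0,0)" "B $$ (i,0)"] by auto
    ultimately show ?thesis using d(3) by force
  qed
  then show ?thesis using that[OF uEV] EB by simp
qed

lemma det_first_column:
  assumes A: "A \<in> carrier_mat (Suc n) (Suc n)"
    and z: "\<And>i. 0 < i \<Longrightarrow> i < Suc n \<Longrightarrow> A $$ (i,0) = (0::int)"
  obtains R B where "R \<in> carrier_mat 1 n" "B \<in> carrier_mat n n"
    "A = four_block_mat (A $$ (0,0) \<cdot>\<^sub>m 1\<^sub>m 1) R (0\<^sub>m n 1) B" "det A = A $$ (0,0) * det B"
proof -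
  define R where "R = mat 1 n (\<lambda>(i,j). A $$ (0, Suc j))"
  define B where "B = mat n n (\<lambda>(i,j). A $$ (Suc i, Suc j))"
  have c: "R \<in> carrier_mat 1 n" "B \<in> carrier_mat n n" unfolding R_def B_def by auto
  have eq: "A = four_block_mat (A $$ (0,0) \<cdot>\<^sub>m 1\<^sub>m 1) R (0\<^sub>m n 1) B" (is "_ = ?F")
  proof (rule eq_matI)
    fix i j assume "i < dim_row ?F" "j < dim_col ?F"
    then show "A $$ (i,j) = ?F $$ (i,j)"
      using A z[of i] by (cases i; cases j) (auto simp: R_def B_def)
  qed (use A c in auto)
  have "det A = det (A $$ (0,0) \<cdot>\<^sub>m 1\<^sub>m 1) * det B"
    by (subst eq) (rule det_four_block_mat_lower_left_zero_col, use c in auto)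
  also have "det (A $$ (0,0) \<cdot>\<^sub>m 1\<^sub>m 1) = A $$ (0,0)" by simp
  finally show ?thesis using that c eq by blast
qed

lemma cong_pm_mult:
  assumes "\<bar>e\<bar> = 1" "[x = (1::int)] (mod m) \<or> [x = -1] (mod m)"
  shows "[e * x = 1] (mod m) \<or> [e * x = -1] (mod m)"
proof -
  have "e = 1 \<or> e = -1" using assms(1) by linarith
  then show ?thesis using assms(2) cong_minus_minus_iff[of x 1 m] cong_minus_minus_iff[of x "-1" m] by auto
qed

text \<open>One row reduction does not suffice: it leaves a first column whose only entry is a unit
  modulo \<open>m\<close>, not 1 or -1. Writing \<open>m\<close>, which is 0 modulo
  \<open>m\<close>, below that entry makes the column primitive; a second reduction then produces a
  pivot 1 or -1, and the induction applies to the complementary block.\<close>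

lemma unimod_lift:
  assumes "g \<in> carrier_mat n n" "[det g = 1] (mod int m) \<or> [det g = -1] (mod int m)"
  shows "\<exists>U. unimod n U \<and> mcong m n U g"
  using assms
proof (induction n arbitrary: g)
  case 0
  then show ?case by (intro exI[of _ g]) (auto simp: unimod_def mcong_def)
next
  case (Suc n)
  show ?case
  proof (cases "n = 0")
    case True
    obtain e :: int where e: "\<bar>e\<bar> = 1" "[g $$ (0,0) = e] (mod int m)"
      using Suc.prems True det_single[of g] that[of 1] that[of "-1"] by auto
    have "unimod (Suc n) (e \<cdot>\<^sub>m 1\<^sub>m 1)" using e True by (simp add: unimod_def)
    moreover have "mcong m (Suc n) (e \<cdot>\<^sub>m 1\<^sub>m 1) g" using e Suc.prems True by (auto simp: mcong_def cong_sym)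
    ultimately show ?thesis by blast
  next
    case False
    let ?n = "Suc n"
    note g = Suc.prems(1)
    have pm: "[det (V * B) = 1] (mod int m) \<or> [det (V * B) = -1] (mod int m)"
      if "unimod ?n V" "B \<in> carrier_mat ?n ?n" "[det B = 1] (mod int m) \<or> [det B = -1] (mod int m)" for V B
    proof -
      have "det (V * B) = det V * det B"
        using that by (intro det_mult[of _ ?n]) (auto simp: unimod_def)
      then show ?thesis using cong_pm_mult[of "det V" "det B"] that by (simp add: unimod_def)
    qed
    obtain V where V: "unimod ?n V" "\<And>i. 0 < i \<Longrightarrow> i < ?n \<Longrightarrow> (V * g) $$ (i,0) = 0"
      using first_column_reduce[OF g] by blast
    have Vg: "V * g \<in> carrier_mat ?n ?n" using V(1) g by (auto simp: unimod_def)
    have pm1: "[det (V * g) = 1] (mod int m) \<or> [det (V * g) = -1] (mod int m)"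
      by (rule pm[OF V(1) g Suc.prems(2)])
    obtain B where dVg: "det (V * g) = (V * g) $$ (0,0) * det (B :: int mat)"
      using det_first_column[OF Vg V(2)] by blast
    \<comment> \<open>The pivot divides \<open>det (V * g)\<close>, which is 1 or -1 modulo
      \<open>m\<close>.\<close>
    have cop: "coprime ((V * g) $$ (0,0)) (int m)"
    proof -
      have "coprime (det (V * g)) (int m)"
        using pm1 cong_imp_coprime[OF cong_sym] by (metis coprime_1_left coprime_minus_left_iff)
      then show ?thesis unfolding dVg by simp
    qed
    \<comment> \<open>The position (1,0) exists only in size at least 2, hence the separate
      treatment of size 1.\<close>
    define g1 where "g1 = mat ?n ?n (\<lambda>(i,j). if i = 1 \<and> j = 0 then int m else (V * g) $$ (i,j))"
    have g1: "g1 \<in> carrier_mat ?n ?n" unfolding g1_def by simp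
    have g1c: "mcong m ?n g1 (V * g)"
      using Vg V(2)[of 1] False unfolding mcong_def by (auto simp: g1_def cong_def)
    have pm2: "[det g1 = 1] (mod int m) \<or> [det g1 = -1] (mod int m)"
      using mcong_det[OF g1c] pm1 cong_trans by blast
    obtain W where W: "unimod ?n W" "\<And>i. 0 < i \<Longrightarrow> i < ?n \<Longrightarrow> (W * g1) $$ (i,0) = 0"
      using first_column_reduce[OF g1] by blast
    define h where "h = W * g1"
    have h: "h \<in> carrier_mat ?n ?n" using W(1) g1 by (auto simp: h_def unimod_def)
    obtain W' where W': "unimod ?n W'" "W * W' = 1\<^sub>m ?n" "W' * W = 1\<^sub>m ?n"
      using unimod_inverse[OF W(1)] by blast
    have g1h: "g1 = W' * h"
      unfolding h_def using W'(3) g1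
      by (simp add: assoc_mult_mat[OF unimod_carrier[OF W'(1)] unimod_carrier[OF W(1)] g1, symmetric])
    \<comment> \<open>The first column of \<open>h\<close> is its pivot followed by zeros, so the
      pivot divides the whole first column of \<open>g1\<close>, which contains both
      \<open>m\<close> and an element coprime to \<open>m\<close>.\<close>
    have dv: "h $$ (0,0) dvd g1 $$ (i,0)" if "i < ?n" for i
    proof -
      have "g1 $$ (i,0) = (\<Sum>k<?n. W' $$ (i,k) * h $$ (k,0))"
        unfolding g1h by (rule mult_mat_entry[OF unimod_carrier[OF W'(1)] h that]) simp
      also have "h $$ (0,0) dvd \<dots>"
      proof (rule dvd_sum)
        fix k assume "k \<in> {..<?n}"
        then show "h $$ (0,0) dvd W' $$ (i,k) * h $$ (k,0)"
          using W(2)[of k] by (cases "k = 0") (auto simp: h_def)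
      qed
      finally show ?thesis .
    qed
    have "h $$ (0,0) dvd (V * g) $$ (0,0)" "h $$ (0,0) dvd int m"
      using dv[of 0] dv[of 1] False by (simp_all add: g1_def)
    then have abs1: "\<bar>h $$ (0,0)\<bar> = 1"
      using cop by (metis coprime_common_divisor zdvd1_eq)
    obtain R B where RB: "R \<in> carrier_mat 1 n" "B \<in> carrier_mat n n"
      "h = four_block_mat (h $$ (0,0) \<cdot>\<^sub>m 1\<^sub>m 1) R (0\<^sub>m n 1) B" "det h = h $$ (0,0) * det B"
      using det_first_column[OF h] W(2) unfolding h_def by blast
    have "det B = h $$ (0,0) * det h" using RB(4) abs_one_square[OF abs1]
      by (metis mult.assoc mult_1)
    moreover have "[det h = 1] (mod int m) \<or> [det h = -1] (mod int m)"
      unfolding h_def by (rule pm[OF W(1) g1 pm2])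
    ultimately have "[det B = 1] (mod int m) \<or> [det B = -1] (mod int m)"
      using cong_pm_mult[OF abs1] by simp
    from Suc.IH[OF RB(2) this] obtain U where U: "unimod n U" "mcong m n U B" by blast
    \<comment> \<open>Only the lower block of \<open>h\<close> has to be replaced by a lift: the
      pivot is already 1 or -1, and the row \<open>R\<close> does not enter the determinant.\<close>
    define X where "X = four_block_mat (h $$ (0,0) \<cdot>\<^sub>m 1\<^sub>m 1) R (0\<^sub>m n 1) U"
    have "det X = det (h $$ (0,0) \<cdot>\<^sub>m 1\<^sub>m 1) * det U" unfolding X_def
      by (rule det_four_block_mat_lower_left_zero_col) (use RB U in \<open>auto simp: unimod_def\<close>)
    then have uX: "unimod ?n X"
      using abs1 U(1) RB(1) by (auto simp: unimod_def X_def abs_mult intro!: carrier_matI)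
    have "mcong m ?n X h"
    proof -
      have "[X $$ (i,j) = h $$ (i,j)] (mod int m)" if "i < ?n" "j < ?n" for i j
        apply (subst RB(3)) unfolding X_def using that U RB(1,2)
        by (cases i; cases j) (auto simp: mcong_def unimod_def)
      then show ?thesis using h uX by (simp add: mcong_def unimod_def)
    qed
    then have "mcong m ?n (W' * X) (W' * h)"
      by (intro mcong_mult mcong_refl unimod_carrier[OF W'(1)])
    then have 1: "mcong m ?n (W' * X) (V * g)"
      using g1h g1c mcong_trans by metis
    obtain V' where V': "unimod ?n V'" "V * V' = 1\<^sub>m ?n" "V' * V = 1\<^sub>m ?n"
      using unimod_inverse[OF V(1)] by blast
    have "mcong m ?n (V' * (W' * X)) (V' * (V * g))"
      by (intro mcong_mult mcong_refl unimod_carrier[OF V'(1)] 1)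
    moreover have "V' * (V * g) = g"
      using V'(3) g
      by (simp add: assoc_mult_mat[OF unimod_carrier[OF V'(1)] unimod_carrier[OF V(1)] g, symmetric])
    ultimately show ?thesis
      using unimod_mult[OF V'(1) unimod_mult[OF W'(1) uX]] by metis
  qed
qed

section \<open>Alternating integer matrices and their normal form\<close>

lemma conj_entry:
  fixes U M :: "int mat"
  assumes U: "U \<in> carrier_mat n n" and M: "M \<in> carrier_mat n n" and ij: "i < n" "j < n"
  shows "(U * M * transpose_mat U) $$ (i,j) = (\<Sum>k<n. \<Sum>l<n. U $$ (i,k) * M $$ (k,l) * U $$ (j,l))"
proof -
  have "(U * M * transpose_mat U) $$ (i,j) = (\<Sum>l<n. (U * M) $$ (i,l) * transpose_mat U $$ (l,j))"
    by (rule mult_mat_entry) (use U M ij in auto)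
  also have "\<dots> = (\<Sum>l<n. \<Sum>k<n. U $$ (i,k) * M $$ (k,l) * U $$ (j,l))"
    using mult_mat_entry[OF U M ij(1)] U ij by (simp add: sum_distrib_right)
  finally show ?thesis by (subst sum.swap)
qed

lemma alt_mat_entry:
  assumes "alt_mat n M" "i < n" "j < n"
  shows "M $$ (j,i) = - M $$ (i,j)"
proof -
  have M: "M \<in> carrier_mat n n" and "transpose_mat M $$ (i,j) = (- M) $$ (i,j)"
    using assms by (simp_all add: alt_mat_def)
  then show ?thesis using assms(2,3) by simp
qed

lemma alt_mat_diag: "alt_mat n M \<Longrightarrow> i < n \<Longrightarrow> M $$ (i,i) = 0"
  using alt_mat_entry[of n M i i] by simp

lemma alt_matI:
  assumes "M \<in> carrier_mat n n" "\<And>i j. i < n \<Longrightarrow> j < n \<Longrightarrow> M $$ (j,i) = - M $$ (i,j)"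
  shows "alt_mat n M"
proof -
  have "transpose_mat M = - M"
  proof (rule eq_matI)
    fix i j assume "i < dim_row (- M)" "j < dim_col (- M)"
    then have ij: "i < n" "j < n" using assms(1) by auto
    show "transpose_mat M $$ (i,j) = (- M) $$ (i,j)"
      using assms(1) assms(2)[OF ij] ij by simp
  qed (use assms(1) in auto)
  then show ?thesis using assms(1) by (simp add: alt_mat_def)
qed

lemma alt_mat_conj:
  assumes "alt_mat n M" "U \<in> carrier_mat n n"
  shows "alt_mat n (U * M * transpose_mat U)"
proof (rule alt_matI)
  have M: "M \<in> carrier_mat n n" using assms by (simp add: alt_mat_def)
  show "U * M * transpose_mat U \<in> carrier_mat n n" by (rule conj_carrier[OF assms(2) M])
  fix i j assume ij: "i < n" "j < n"
  show "(U * M * transpose_mat U) $$ (j,i) = - (U * M * transpose_mat U) $$ (i,j)"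
    unfolding conj_entry[OF assms(2) M ij] conj_entry[OF assms(2) M ij(2,1)] sum_negf[symmetric]
  proof (subst sum.swap, intro sum.cong refl)
    fix k l assume "k \<in> {..<n}" "l \<in> {..<n}"
    then show "U $$ (j,l) * M $$ (l,k) * U $$ (i,k) = - (U $$ (i,k) * M $$ (k,l) * U $$ (j,l))"
      using alt_mat_entry[OF assms(1), of k l] by simp
  qed
qed

lemma permutation_unimod:
  assumes s: "s permutes {..<n}"
  defines "P \<equiv> mat n n (\<lambda>(i,j). if j = s i then 1 else (0::int))"
  shows "unimod n P" "M \<in> carrier_mat n n \<Longrightarrow> i < n \<Longrightarrow> j < n \<Longrightarrow>
           (P * M * transpose_mat P) $$ (i,j) = M $$ (s i, s j)"
proof -
  have P: "P \<in> carrier_mat n n" unfolding P_def by simp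
  have sn: "s i < n" if "i < n" for i using permutes_in_image[OF s, of i] that by simp
  show *: "(P * M * transpose_mat P) $$ (i,j) = M $$ (s i, s j)"
    if "M \<in> carrier_mat n n" "i < n" "j < n" for M i j
  proof -
    have "(P * M * transpose_mat P) $$ (i,j) =
       (\<Sum>k<n. \<Sum>l<n. (if k = s i then if l = s j then M $$ (k,l) else 0 else 0))"
      unfolding conj_entry[OF P that] using that by (intro sum.cong refl) (auto simp: P_def)
    also have "\<dots> = (\<Sum>k<n. if k = s i then M $$ (k,s j) else 0)"
      using sn that by (intro sum.cong refl) auto
    also have "\<dots> = M $$ (s i, s j)" using sn that by simp
    finally show ?thesis .
  qed
  \<comment> \<open>The entry formula for the identity matrix shows that the transpose inverts
    \<open>P\<close>.\<close>
  have "P * transpose_mat P = P * 1\<^sub>m n * transpose_mat P" using P by simp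
  also have "\<dots> = 1\<^sub>m n"
    by (rule eq_matI) (use *[of "1\<^sub>m n"] sn P permutes_inj[OF s] in \<open>auto simp: inj_eq simp del: right_mult_one_mat\<close>)
  finally show "unimod n P" by (intro unimod_intro[OF P]) (use P in auto)
qed

text \<open>\<open>E\<close> adds to every row from the third on the multiples \<open>p i\<close> of
  row 0 and \<open>r i\<close> of row 1. The first two rows of \<open>E\<close> are unit rows, so in
  the first two rows of the congruent matrix only the columns change. This is the operation that
  clears the entries beside a block split off in the upper left corner.\<close>

lemma clear_matrix:
  fixes p r :: "nat \<Rightarrow> int"
  assumes n: "2 \<le> n"
  defines "E \<equiv> mat n n (\<lambda>(i,k). of_bool (k = i) +
      (if 2 \<le> i then p i * of_bool (k = 0) + r i * of_bool (k = 1) else 0))"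
  shows "unimod n E"
    "M \<in> carrier_mat n n \<Longrightarrow> i < n \<Longrightarrow> j < 2 \<Longrightarrow>
       (E * M * transpose_mat E) $$ (j,i) =
          M $$ (j,i) + (if 2 \<le> i then p i * M $$ (j,0) + r i * M $$ (j,1) else 0)"
proof -
  have E: "E \<in> carrier_mat n n" unfolding E_def by simp
  have "det E = prod_list (diag_mat E)"
    by (rule det_lower_triangular[OF _ E]) (use n in \<open>auto simp: E_def\<close>)
  also have "diag_mat E = map (\<lambda>i. 1) [0..<n]"
    unfolding diag_mat_def E_def by (auto intro!: nth_equalityI)
  also have "prod_list \<dots> = 1" by (induct n) auto
  finally show "unimod n E" using E by (simp add: unimod_def)
  have Es: "(\<Sum>k<n. E $$ (i,k) * f k) = f i + (if 2 \<le> i then p i * f 0 + r i * f 1 else 0)"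
    if "i < n" for i and f :: "nat \<Rightarrow> int"
  proof -
    have "(\<Sum>k<n. E $$ (i,k) * f k) = (\<Sum>k<n. of_bool (k = i) * f k +
        (if 2 \<le> i then p i * (of_bool (k = 0) * f k) + r i * (of_bool (k = 1) * f k) else 0))"
      using that by (intro sum.cong refl) (auto simp: E_def algebra_simps)
    also have "\<dots> = f i + (if 2 \<le> i then p i * f 0 + r i * f 1 else 0)"
      using that n by (auto simp: sum.distrib of_bool_def if_distrib[of "\<lambda>x. x * _"] sum_distrib_left[symmetric] sum.delta cong: if_cong)
    finally show ?thesis .
  qed
  assume M: "M \<in> carrier_mat n n" and i: "i < n" and j: "j < 2"
  have "(E * M * transpose_mat E) $$ (j,i) = (\<Sum>k<n. E $$ (j,k) * (\<Sum>l<n. E $$ (i,l) * M $$ (k,l)))"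
    using conj_entry[OF E M, of j i] i j n by (simp add: sum_distrib_left mult_ac)
  then show "(E * M * transpose_mat E) $$ (j,i) =
          M $$ (j,i) + (if 2 \<le> i then p i * M $$ (j,0) + r i * M $$ (j,1) else 0)"
    using Es i j n by simp
qed

text \<open>\<open>d\<close> is the least positive integer that occurs as an entry of any matrix
  unimodularly congruent to \<open>M\<close>. Every remainder modulo \<open>d\<close> that can be
  produced by congruence is again such an entry, hence zero; this both clears the first two rows and
  gives divisibility of the complement by \<open>d\<close>.\<close>

lemma alternating_split:
  assumes M: "alt_mat n M" and nz: "M \<noteq> 0\<^sub>m n n"
  obtains U d M' where "2 \<le> n" "unimod n U" "d > 0" "alt_mat (n - 2) M'"
    "U * M * transpose_mat U = four_block_mat (mat_of_rows_list 2 [[0, d], [- d, 0]])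
        (0\<^sub>m 2 (n - 2)) (0\<^sub>m (n - 2) 2) M'"
    "\<And>i j. i < n - 2 \<Longrightarrow> j < n - 2 \<Longrightarrow> d dvd M' $$ (i,j)"
proof -
  have Mc: "M \<in> carrier_mat n n" using M by (simp add: alt_mat_def)
  define P where "P x \<longleftrightarrow> (\<exists>U i j. unimod n U \<and> i < n \<and> j < n \<and> (U * M * transpose_mat U) $$ (i,j) = x)" for x
  obtain i j where ij: "i < n" "j < n" "M $$ (i,j) \<noteq> 0"
    using nz Mc by (metis eq_matI carrier_matD index_zero_mat)
  have PI: "P ((U * M * transpose_mat U) $$ (i,j))" if "unimod n U" "i < n" "j < n" for U i j
    unfolding P_def using that by blast
  \<comment> \<open>An alternating matrix contains each entry with both signs, so a positive value
    occurs.\<close>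
  have "P (M $$ (i,j))" "P (M $$ (j,i))"
    using PI[OF unimod_one, of i j, unfolded conj_one[OF Mc]]
      PI[OF unimod_one, of j i, unfolded conj_one[OF Mc]] ij by auto
  then have "P \<bar>M $$ (i,j)\<bar>"
    using alt_mat_entry[OF M ij(1,2)] by (auto simp: abs_if)
  then obtain d where d: "P d" "d > 0" "\<And>y. P y \<Longrightarrow> y > 0 \<Longrightarrow> d \<le> y"
    using ex_min_pos[of P "\<bar>M $$ (i,j)\<bar>"] ij by auto
  then obtain U0 a b where U0: "unimod n U0" "a < n" "b < n" "(U0 * M * transpose_mat U0) $$ (a,b) = d"
    unfolding P_def by blast
  define B where "B = U0 * M * transpose_mat U0"
  have B: "alt_mat n B" "B \<in> carrier_mat n n" unfolding B_def
    using alt_mat_conj[OF M unimod_carrier[OF U0(1)]] by (auto simp: alt_mat_def)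
  have ab: "a \<noteq> b" using alt_mat_diag[OF B(1), of a] U0 d(2) by (auto simp: B_def)
  have n2: "2 \<le> n" using ab U0 by auto
  \<comment> \<open>A permutation with \<open>s 0 = a\<close> and \<open>s 1 = b\<close>. The inner
    index \<open>transpose 0 a b\<close> undoes the effect of the outer swap on \<open>b\<close>,
    which covers the case \<open>b = 0\<close>.\<close>
  define s where "s = transpose 0 a \<circ> transpose 1 (transpose 0 a b)"
  have s: "s permutes {..<n}" unfolding s_def using n2 U0
    by (intro permutes_compose permutes_swap_id) (auto simp: Transposition.transpose_def)
  have s01: "s 0 = a" "s 1 = b" using ab by (auto simp: s_def Transposition.transpose_def)
  define Q where "Q = mat n n (\<lambda>(i,j). if j = s i then 1 else (0::int))"
  have Q: "unimod n Q" "(Q * B * transpose_mat Q) $$ (0,1) = d"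
    using permutation_unimod[OF s] B n2 s01 U0(4) by (auto simp: Q_def B_def)
  have conj: "V * (W * M * transpose_mat W) * transpose_mat V = (V * W) * M * transpose_mat (V * W)"
    if "unimod n V" "unimod n W" for V W
    by (rule conj_conj) (use that Mc unimod_carrier in auto)
  define U1 where "U1 = Q * U0"
  have U1: "unimod n U1" "(U1 * M * transpose_mat U1) $$ (0,1) = d"
    using Q conj[OF Q(1) U0(1)] unimod_mult[OF Q(1) U0(1)] by (auto simp: U1_def B_def)
  \<comment> \<open>Stated for an arbitrary \<open>V\<close> that puts \<open>d\<close> at position
    (0,1), because it is used twice: once to clear the first two rows, once with a changed
    \<open>V\<close> to reach the entries of the complementary block.\<close>
  have step: "\<exists>E. unimod n E \<and>
        (\<forall>k<n. (E * (V * M * transpose_mat V) * transpose_mat E) $$ (0,k) = (if k = 1 then d else 0) \<and>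
             (E * (V * M * transpose_mat V) * transpose_mat E) $$ (1,k) = (if k = 0 then - d else 0) \<and>
             d dvd (V * M * transpose_mat V) $$ (0,k))"
    if V: "unimod n V" "(V * M * transpose_mat V) $$ (0,1) = d" for V
  proof -
    define C where "C = V * M * transpose_mat V"
    have C: "alt_mat n C" "C \<in> carrier_mat n n" unfolding C_def
      using alt_mat_conj[OF M unimod_carrier[OF V(1)]] by (auto simp: alt_mat_def)
    have C01: "C $$ (0,1) = d" "C $$ (1,0) = - d" "C $$ (0,0) = 0" "C $$ (1,1) = 0"
      using V(2) alt_mat_entry[OF C(1), of 0 1] alt_mat_diag[OF C(1)] n2 by (auto simp: C_def)
    \<comment> \<open>The block is antidiagonal: entry (0,i) changes by \<open>d\<close> times the
      coefficient of row 1 and entry (1,i) by \<open>- d\<close> times the coefficient of row 0,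
      which explains the exchanged quotients and the sign.\<close>
    define E where "E = mat n n (\<lambda>(i,k). of_bool (k = i) +
      (if 2 \<le> i then (C $$ (1,i) div d) * of_bool (k = 0) + (- (C $$ (0,i) div d)) * of_bool (k = 1) else 0))"
    have E: "unimod n E" unfolding E_def by (rule clear_matrix(1)[OF n2])
    have Er: "(E * C * transpose_mat E) $$ (j,i) =
          C $$ (j,i) + (if 2 \<le> i then (C $$ (1,i) div d) * C $$ (j,0) + (- (C $$ (0,i) div d)) * C $$ (j,1) else 0)"
      if "i < n" "j < 2" for i j
      unfolding E_def by (rule clear_matrix(2)[OF n2 C(2) that])
    \<comment> \<open>A remainder modulo \<open>d\<close> that occurs as an entry is smaller than
      the minimum \<open>d\<close>, so it cannot be positive.\<close>
    have z: "x mod d = 0" if "P (x mod d)" for x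
      using d(3)[OF that] d(2) pos_mod_bound[of d x] pos_mod_sign[of d x] by linarith
    have small: "(E * C * transpose_mat E) $$ (j,i) = C $$ (j,i) mod d" if "2 \<le> i" "i < n" "j < 2" for i j
    proof -
      have "j = 0 \<or> j = 1" using that by auto
      then show ?thesis using Er[OF that(2,3)] that C01 
        by (auto simp: minus_div_mult_eq_mod[symmetric])
    qed
    have m0: "C $$ (j,i) mod d = 0" if "2 \<le> i" "i < n" "j < 2" for i j
      using z[of "C $$ (j,i)"] PI[OF unimod_mult[OF E V(1)], of j i] conj[OF E V(1)] small[OF that] that n2
      by (simp add: C_def)
    show ?thesis
    proof (rule exI[of _ E], intro conjI allI impI E, unfold C_def[symmetric])
      fix k assume k: "k < n"
      have "k = 0 \<or> k = 1 \<or> 2 \<le> k" by auto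
      then show "(E * C * transpose_mat E) $$ (0,k) = (if k = 1 then d else 0)"
        "(E * C * transpose_mat E) $$ (1,k) = (if k = 0 then - d else 0)"
        "d dvd C $$ (0,k)"
        using Er[OF k, of 0] Er[OF k, of 1] C01 small[of k 0] small[of k 1] m0[of k 0] m0[of k 1] k
        by auto
    qed
  qed
  obtain E where E: "unimod n E"
     "\<And>k. k < n \<Longrightarrow> (E * (U1 * M * transpose_mat U1) * transpose_mat E) $$ (0,k) = (if k = 1 then d else 0)"
     "\<And>k. k < n \<Longrightarrow> (E * (U1 * M * transpose_mat U1) * transpose_mat E) $$ (1,k) = (if k = 0 then - d else 0)"
    using step[OF U1] by blast
  define V where "V = E * U1"
  define D where "D = V * M * transpose_mat V"
  have V: "unimod n V" unfolding V_def by (rule unimod_mult[OF E(1) U1(1)])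
  have D_eq: "E * (U1 * M * transpose_mat U1) * transpose_mat E = D"
    unfolding D_def V_def by (rule conj[OF E(1) U1(1)])
  have D: "alt_mat n D" "D \<in> carrier_mat n n" unfolding D_def
    using alt_mat_conj[OF M unimod_carrier[OF V(1)]] by (auto simp: alt_mat_def)
  have D0: "D $$ (0,k) = (if k = 1 then d else 0)" "D $$ (1,k) = (if k = 0 then - d else 0)" if "k < n" for k
    using E(2,3)[OF that] unfolding D_eq by auto
  have D0': "D $$ (k,0) = (if k = 1 then - d else 0)" "D $$ (k,1) = (if k = 0 then d else 0)" if "k < n" for k
    using alt_mat_entry[OF D(1), of 0 k] alt_mat_entry[OF D(1), of 1 k] D0[OF that] that n2 by auto
  have dvd: "d dvd D $$ (i,j)" if ij: "2 \<le> i" "i < n" "2 \<le> j" "j < n" for i j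
  proof -
    \<comment> \<open>Adding row \<open>i\<close> to row 0 keeps \<open>d\<close> at position (0,1),
      since row \<open>i\<close> vanishes in column 1, and carries row \<open>i\<close> into the
      first row, where divisibility by \<open>d\<close> is known.\<close>
    define F where "F = addrow_mat n (1::int) 0 i"
    have F: "unimod n F" unfolding F_def using ij by (intro unimod_addrow) auto
    have Fc: "F \<in> carrier_mat n n" by (rule unimod_carrier[OF F])
    have Fs: "(\<Sum>k<n. F $$ (x,k) * f k) = f x + (if x = 0 then f i else 0)" if "x < n" for x and f :: "nat \<Rightarrow> int"
    proof -
      have "(\<Sum>k<n. F $$ (x,k) * f k) = (\<Sum>k<n. (if k = x then f k else 0) + (if x = 0 then if k = i then f k else 0 else 0))"
        using that ij by (intro sum.cong refl) (auto simp: F_def)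
      also have "\<dots> = f x + (if x = 0 then f i else 0)"
        using that ij by (auto simp: sum.distrib)
      finally show ?thesis .
    qed
    have Fe: "(F * D * transpose_mat F) $$ (0,y) = D $$ (0,y) + D $$ (i,y)" if "0 < y" "y < n" for y
    proof -
      have "(F * D * transpose_mat F) $$ (0,y) = (\<Sum>k<n. F $$ (0,k) * (\<Sum>l<n. F $$ (y,l) * D $$ (k,l)))"
        using conj_entry[OF Fc D(2), of 0 y] that by (simp add: sum_distrib_left mult_ac)
      then show ?thesis using that by (simp add: Fs)
    qed
    have FV: "unimod n (F * V)" by (rule unimod_mult[OF F V])
    have FD: "F * D * transpose_mat F = (F * V) * M * transpose_mat (F * V)"
      unfolding D_def by (rule conj[OF F V])
    have "(F * V * M * transpose_mat (F * V)) $$ (0,1) = d"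
      using Fe[of 1] D0[of 1] D0'[OF ij(2)] n2 ij unfolding FD by simp
    from step[OF FV this] have "d dvd (F * D * transpose_mat F) $$ (0,j)"
      unfolding FD using ij by blast
    then show ?thesis using Fe[of j] D0[of j] ij by simp
  qed
  define M' where "M' = mat (n - 2) (n - 2) (\<lambda>(i,j). D $$ (i + 2, j + 2))"
  have M': "alt_mat (n - 2) M'"
    by (rule alt_matI) (auto simp: M'_def intro!: alt_mat_entry[OF D(1)])
  have "D = four_block_mat (mat_of_rows_list 2 [[0, d], [- d, 0]])
        (0\<^sub>m 2 (n - 2)) (0\<^sub>m (n - 2) 2) M'" (is "_ = ?F")
  proof (rule eq_matI)
    have dim: "dim_row ?F = n" "dim_col ?F = n" using n2 by (auto simp: M'_def mat_of_rows_list_def)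
    fix i j assume "i < dim_row ?F" "j < dim_col ?F"
    then have ij: "i < n" "j < n" unfolding dim by auto
    have "i = 0 \<or> i = 1 \<or> (\<exists>k. i = k + 2)" "j = 0 \<or> j = 1 \<or> (\<exists>k. j = k + 2)"
      by presburger+
    then show "D $$ (i,j) = ?F $$ (i,j)"
      using D0[OF ij(2)] D0'[OF ij(1)] ij n2
      by (elim disjE exE) (auto simp: M'_def mat_of_rows_list_def)
  qed (use D n2 in \<open>auto simp: M'_def mat_of_rows_list_def\<close>)
  then have "V * M * transpose_mat V = four_block_mat (mat_of_rows_list 2 [[0, d], [- d, 0]])
        (0\<^sub>m 2 (n - 2)) (0\<^sub>m (n - 2) 2) M'" unfolding D_def .
  moreover have "d dvd M' $$ (i,j)" if "i < n - 2" "j < n - 2" for i j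
    using dvd[of "i + 2" "j + 2"] that by (simp add: M'_def)
  ultimately show thesis
    using that[OF n2 V d(2) M'] by blast
qed

lemma N_mat_Suc:
  "2 * s \<le> n \<Longrightarrow> N_mat (n + 2) (Suc s) h =
     four_block_mat (mat_of_rows_list 2 [[0, h 1], [- h 1, 0]]) (0\<^sub>m 2 n) (0\<^sub>m n 2) (N_mat n s (\<lambda>i. h (Suc i)))"
proof -
  assume s: "2 * s \<le> n"
  have l: "[1..<Suc s + 1] = 1 # map Suc [1..<s + 1]"
    by (simp add: map_Suc_upt upt_conv_Cons del: upt_Suc)
  have dim: "dim_row (N_mat n s h') = n \<and> dim_col (N_mat n s h') = n" for h'
  proof -
    show ?thesis unfolding N_mat_def dim_diag_block_mat using s
      by (simp add: comp_def mat_of_rows_list_def sum_list_triv del: upt_Suc)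
  qed
  show ?thesis
    unfolding N_mat_def[of "n + 2"] l
    using dim[of "\<lambda>i. h (Suc i)"]
    by (simp add: Let_def N_mat_def comp_def mat_of_rows_list_def numeral_2_eq_2 del: upt_Suc)
qed

text \<open>Coordinates \<open>2 * a\<close> and \<open>2 * a + 1\<close> make up block
  \<open>a + 1\<close>: coordinates are counted from 0, blocks from 1. All later computations with
  the form use this description by entries.\<close>

lemma N_mat_entries:
  "2 * s \<le> n \<Longrightarrow> N_mat n s h = mat n n (\<lambda>(i,j). if i div 2 = j div 2 \<and> i div 2 < s then
     (if i < j then h (i div 2 + 1) else if j < i then - h (i div 2 + 1) else 0) else 0)"
proof (induction s arbitrary: n h)
  case 0
  then show ?case by (simp add: N_mat_def) (auto intro!: eq_matI)
next
  case (Suc s)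
  define n' where "n' = n - 2"
  have n: "n = n' + 2" "2 * s \<le> n'" using Suc.prems by (auto simp: n'_def)
  show ?case unfolding n(1) N_mat_Suc[OF n(2)] Suc.IH[OF n(2)]
  proof (rule eq_matI, goal_cases)
    case (1 i j)
    have "i = 0 \<or> i = 1 \<or> (\<exists>k. i = k + 2)" "j = 0 \<or> j = 1 \<or> (\<exists>k. j = k + 2)"
      by presburger+
    then show ?case using 1 by (elim disjE exE) (auto simp: mat_of_rows_list_def)
  qed (auto simp: mat_of_rows_list_def)
qed

lemma N_mat_carrier: "2 * s \<le> n \<Longrightarrow> N_mat n s h \<in> carrier_mat n n"
  by (simp add: N_mat_entries)

lemma N_mat_alt: "2 * s \<le> n \<Longrightarrow> alt_mat n (N_mat n s h)"
  by (rule alt_matI) (auto simp: N_mat_entries)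

text \<open>The classification of alternating bilinear forms over the integers: \<open>2 * s\<close>
  is the rank, and the \<open>d i\<close> are the elementary divisors, each of which occurs
  twice.\<close>

lemma alternating_normal_form:
  "alt_mat n M \<Longrightarrow> \<exists>U s d. unimod n U \<and> 2 * s \<le> n \<and> (\<forall>i\<in>{1..s}. d i > 0) \<and>
     (\<forall>i\<in>{1..<s}. d i dvd d (i + 1)) \<and> U * M * transpose_mat U = N_mat n s d"
proof (induction n arbitrary: M rule: less_induct)
  case (less n)
  note M = less.prems
  have Mc: "M \<in> carrier_mat n n" using M by (simp add: alt_mat_def)
  show ?case
  proof (cases "M = 0\<^sub>m n n")
    case True
    have "N_mat n 0 (\<lambda>_. 1) = 0\<^sub>m n n" by (auto simp: N_mat_entries intro!: eq_matI)
    then show ?thesis using True unimod_one conj_one[OF Mc]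
      by (intro exI[of _ "1\<^sub>m n"] exI[of _ 0] exI[of _ "\<lambda>_. 1"]) auto
  next
    case False
    obtain U d M' where U: "2 \<le> n" "unimod n U" "d > 0" "alt_mat (n - 2) M'"
    "U * M * transpose_mat U = four_block_mat (mat_of_rows_list 2 [[0, d], [- d, 0]])
        (0\<^sub>m 2 (n - 2)) (0\<^sub>m (n - 2) 2) M'"
    "\<And>i j. i < n - 2 \<Longrightarrow> j < n - 2 \<Longrightarrow> d dvd M' $$ (i,j)"
      using alternating_split[OF M False] by metis
    define k where "k = n - 2"
    have n: "n = k + 2" using U(1) by (simp add: k_def)
    note U' = U(4-6)[folded k_def]
    obtain V s e where V: "unimod k V" "2 * s \<le> k" "\<forall>i\<in>{1..s}. e i > 0"
     "\<forall>i\<in>{1..<s}. e i dvd e (i + 1)" "V * M' * transpose_mat V = N_mat k s e"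
      using less.IH[of k M'] U' n by auto
    have Vc: "V \<in> carrier_mat k k" by (rule unimod_carrier[OF V(1)])
    have M'c: "M' \<in> carrier_mat k k" using U'(1) by (simp add: alt_mat_def)
    define h where "h i = (if i = 1 then d else e (i - 1))" for i
    define B where "B = mat_of_rows_list 2 [[0, d], [- d, 0]]"
    have B: "B \<in> carrier_mat 2 2" by (simp add: B_def mat_of_rows_list_def numeral_2_eq_2)
    have Nh: "N_mat n (Suc s) h = four_block_mat B (0\<^sub>m 2 k) (0\<^sub>m k 2) (N_mat k s e)"
      unfolding n N_mat_Suc[OF V(2)] B_def
      by (rule cong_four_block_mat) (auto simp: h_def N_mat_entries[OF V(2)] intro!: eq_matI)
    define W where "W = four_block_mat (1\<^sub>m 2) (0\<^sub>m 2 k) (0\<^sub>m k 2) V"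
    have "det W = det (1\<^sub>m 2 :: int mat) * det V" unfolding W_def
      by (rule det_four_block_mat_lower_left_zero) (use Vc in auto)
    then have W: "unimod n W" using V(1) by (auto simp: unimod_def W_def n)
    have "W * four_block_mat B (0\<^sub>m 2 k) (0\<^sub>m k 2) M' * transpose_mat W =
        four_block_mat B (0\<^sub>m 2 k) (0\<^sub>m k 2) (V * M' * transpose_mat V)"
    proof -
      have t: "transpose_mat W = four_block_mat (1\<^sub>m 2) (0\<^sub>m 2 k) (0\<^sub>m k 2) (transpose_mat V)"
        unfolding W_def by (subst transpose_four_block_mat) (use Vc in auto)
      have 1: "W * four_block_mat B (0\<^sub>m 2 k) (0\<^sub>m k 2) M' = four_block_mat B (0\<^sub>m 2 k) (0\<^sub>m k 2) (V * M')"
        unfolding W_def using B Vc M'c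
        by (subst mult_four_block_mat[where ?nr1.0 = 2 and ?n1.0 = 2 and ?n2.0 = k and ?nr2.0 = k and ?nc1.0 = 2 and ?nc2.0 = k]) auto
      show ?thesis unfolding 1 t using B Vc M'c
        by (subst mult_four_block_mat[where ?nr1.0 = 2 and ?n1.0 = 2 and ?n2.0 = k and ?nr2.0 = k and ?nc1.0 = 2 and ?nc2.0 = k]) auto
    qed
    then have "W * (U * M * transpose_mat U) * transpose_mat W = N_mat n (Suc s) h"
      unfolding U(5)[folded k_def, folded B_def] Nh V(5) by simp
    then have eq: "(W * U) * M * transpose_mat (W * U) = N_mat n (Suc s) h"
      using conj_conj[OF unimod_carrier[OF W] unimod_carrier[OF U(2)] Mc] by simp
    \<comment> \<open>All entries of \<open>M'\<close> are multiples of \<open>d\<close>; congruence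
      preserves this, so \<open>d\<close> divides the first divisor of the complement and the chain
      continues.\<close>
    have e1: "d dvd e 1" if "0 < s"
    proof -
      have "e 1 = (V * M' * transpose_mat V) $$ (0,1)"
        unfolding V(5) N_mat_entries[OF V(2)] using V(2) that by simp
      also have "\<dots> = (\<Sum>a<k. \<Sum>b<k. V $$ (0,a) * M' $$ (a,b) * V $$ (1,b))"
        by (rule conj_entry[OF Vc M'c]) (use V(2) that in auto)
      also have "d dvd \<dots>" by (intro dvd_sum dvd_mult dvd_mult2 U'(3)) auto
      finally show ?thesis .
    qed
    have "\<forall>i\<in>{1..<Suc s}. h i dvd h (i + 1)"
    proof
      fix i assume i: "i \<in> {1..<Suc s}"
      show "h i dvd h (i + 1)"
      proof (cases "i = 1")
        case True then show ?thesis using e1 i by (simp add: h_def)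
      next
        case False
        then show ?thesis using V(4) i by (auto simp: h_def dest!: bspec[of _ _ "i - 1"])
      qed
    qed
    moreover have "\<forall>i\<in>{1..Suc s}. h i > 0"
    proof
      fix i assume "i \<in> {1..Suc s}"
      then show "h i > 0"
        using U(3) V(3) by (cases "i = 1") (auto simp: h_def dest!: bspec[of _ _ "i - 1"])
    qed
    ultimately show ?thesis using unimod_mult[OF W U(2)] eq V(2) n
      by (intro exI[of _ "W * U"] exI[of _ "Suc s"] exI[of _ h]) auto
  qed
qed

section \<open>Units modulo \<open>m\<close> and the representatives in \<open>P\<close>\<close>

text \<open>Units modulo a divisor \<open>l\<close> lift to units modulo \<open>m\<close>. With
  \<open>k\<close> the product of the primes of \<open>m\<close> that do not divide
  \<open>x\<close>, every prime of \<open>m\<close> divides exactly one of \<open>x\<close> and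
  \<open>l * k\<close>, hence not their sum.\<close>

lemma coprime_lift:
  fixes x l m :: int
  assumes "l dvd m" "m > 0" "coprime x l"
  obtains u where "coprime u m" "[u = x] (mod l)"
proof
  define k where "k = \<Prod>{p \<in> prime_factors m. \<not> p dvd x}"
  have k: "p dvd k \<longleftrightarrow> \<not> p dvd x" if pr: "prime p" "p dvd m" for p
  proof
    assume "p dvd k"
    then obtain q where q: "q \<in> prime_factors m" "\<not> q dvd x" "p dvd q"
      using prime_dvd_prod_iff[of "{p \<in> prime_factors m. \<not> p dvd x}" p "\<lambda>x. x"] pr(1)
      unfolding k_def by (auto simp del: in_prime_factors_iff)
    then have "p = q" using that(1) by (auto simp: primes_dvd_imp_eq in_prime_factors_iff)
    then show "\<not> p dvd x" using q by simp
  next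
    assume "\<not> p dvd x"
    then have "p \<in> {p \<in> prime_factors m. \<not> p dvd x}"
      using that assms(2) by (auto simp: in_prime_factors_iff)
    then show "p dvd k" unfolding k_def by (intro dvd_prodI) auto
  qed
  have "is_unit (gcd (x + l * k) m)"
  proof (rule ccontr)
    assume "\<not> is_unit (gcd (x + l * k) m)"
    then obtain p where p: "prime p" "p dvd x + l * k" "p dvd m"
      using assms(2) prime_divisor_exists[of "gcd (x + l * k) m"] by auto
    show False
    proof (cases "p dvd l")
      case True
      then have "p dvd x" using p(2) by (metis dvd_add_left_iff dvd_mult2)
      then show False using True assms(3) p(1) coprime_common_divisor not_prime_unit by blast
    next
      case False
      then have "\<not> (p dvd x \<longleftrightarrow> p dvd l * k)"
        using k[OF p(1,3)] p(1) prime_dvd_mult_iff by blast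
      then show False using p(2) by (cases "p dvd x") (auto simp: dvd_add_right_iff dvd_add_left_iff)
    qed
  qed
  then show "coprime (x + l * k) m" by (simp add: coprime_iff_gcd_eq_1)
  show "[x + l * k = x] (mod l)" by (simp add: cong_def)
qed

text \<open>With \<open>g = gcd d m\<close>, the quotient \<open>d / g\<close> is a unit modulo
  \<open>m / g\<close> and lifts to a unit modulo \<open>m\<close>; multiplication by
  \<open>g\<close> turns the congruence modulo \<open>m / g\<close> into one modulo
  \<open>m\<close>. This is how an elementary divisor is replaced by its associate among the
  divisors of \<open>m\<close>.\<close>

lemma unit_times_gcd:
  fixes d m :: int
  assumes "m > 0"
  obtains u where "coprime u m" "[d = u * gcd d m] (mod m)"
proof -
  define g where "g = gcd d m"
  have g: "g > 0" using assms by (auto simp: g_def)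
  obtain a b where ab: "d = g * a" "m = g * b"
    unfolding g_def by (metis dvd_def gcd_dvd1 gcd_dvd2)
  have "g * gcd a b = gcd d m" using g by (simp add: ab gcd_mult_left abs_of_pos)
  then have cop: "coprime a b" using g unfolding g_def[symmetric] coprime_iff_gcd_eq_1 by simp
  obtain u where u: "coprime u m" "[u = a] (mod b)"
    using coprime_lift[OF _ assms cop] ab by auto
  have "[g * u = g * a] (mod g * b)" using u(2) by (simp add: cong_iff_dvd_diff right_diff_distrib[symmetric])
  then have "[d = u * g] (mod m)" using ab by (simp add: cong_sym mult.commute)
  then show thesis using that u(1) unfolding g_def by blast
qed

text \<open>The divisor \<open>m\<close> itself enters \<open>P\<close> as the class 0, so the
  nonzero elements of \<open>P\<close> are the proper divisors of \<open>m\<close> and conditions on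
  the data turn into divisibility of integers.\<close>

lemma P_set_iff:
  assumes m: "m > 0" and x0: "x \<noteq> 0"
  shows "x \<in> P_set m \<longleftrightarrow> 0 < x \<and> x < int m \<and> x dvd int m"
proof
  assume "x \<in> P_set m"
  then obtain j where j: "x = (\<Prod>p\<in>prime_factors m. int p ^ j p) mod int m"
     "\<forall>p\<in>prime_factors m. j p \<le> multiplicity p m" unfolding P_set_def by blast
  define y where "y = (\<Prod>p\<in>prime_factors m. p ^ j p)"
  have x: "x = int (y mod m)" unfolding j(1) y_def by (simp add: zmod_int)
  have "y dvd (\<Prod>p\<in>prime_factors m. p ^ multiplicity p m)"
    unfolding y_def by (rule prod_dvd_prod) (use j(2) le_imp_power_dvd in blast)
  then have ym: "y dvd m" using m by (simp add: prod_prime_factors)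
  then have "y \<le> m" using m by (simp add: dvd_imp_le)
  then have "y < m" using x x0 by (cases "y = m") auto
  then show "0 < x \<and> x < int m \<and> x dvd int m" using x x0 ym by auto
next
  assume x: "0 < x \<and> x < int m \<and> x dvd int m"
  define y where "y = nat x"
  have y: "y > 0" "y dvd m" "x = int y" "y < m" using x unfolding y_def by (auto simp: nat_dvd_iff)
  have "y = (\<Prod>p\<in>prime_factors y. p ^ multiplicity p y)"
    using y(1) by (simp add: prod_prime_factors)
  also have "\<dots> = (\<Prod>p\<in>prime_factors m. p ^ multiplicity p y)"
  proof (rule prod.mono_neutral_left)
    show "prime_factors y \<subseteq> prime_factors m" using dvd_prime_factors[OF _ y(2)] m by simp
    show "\<forall>p\<in>prime_factors m - prime_factors y. p ^ multiplicity p y = 1"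
      by (auto simp: prime_factors_multiplicity)
  qed simp
  finally have "int y = (\<Prod>p\<in>prime_factors m. int p ^ multiplicity p y)"
    by (metis (no_types, lifting) of_nat_power of_nat_prod prod.cong)
  then have "x = (\<Prod>p\<in>prime_factors m. int p ^ multiplicity p y) mod int m"
    using x y(3) by simp
  moreover have "\<forall>p\<in>prime_factors m. multiplicity p y \<le> multiplicity p m"
    using y m by (intro ballI dvd_imp_multiplicity_le) auto
  ultimately show "x \<in> P_set m" unfolding P_set_def
    by (intro CollectI exI[of _ "\<lambda>p. multiplicity p y"] conjI)
qed

lemma dvd_mod_iff_dvd:
  assumes "a dvd int m" "0 < a" 
  shows "dvd_mod m a b \<longleftrightarrow> a dvd b"
proof
  assume "dvd_mod m a b"
  then have "(b * 1) mod int m \<in> range (\<lambda>x. (a * x) mod int m)"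
    unfolding dvd_mod_def ideal_mod_def by blast
  then obtain x where "b mod int m = (a * x) mod int m" by auto
  then show "a dvd b" using assms(1) by (metis dvd_mod_iff dvd_triv_left)
next
  assume "a dvd b"
  then obtain c where "b = a * c" by blast
  then show "dvd_mod m a b" unfolding dvd_mod_def ideal_mod_def by (auto simp: mult.assoc)
qed

text \<open>The bound \<open>h i < int m\<close> expresses that \<open>h i\<close> is nonzero in
  \<int>/(m); the index 1 is included, unlike in the data of the theorem.\<close>

definition divisor_chain :: "nat \<Rightarrow> nat \<Rightarrow> nat \<Rightarrow> (nat \<Rightarrow> int) \<Rightarrow> bool" where
  "divisor_chain m n s h \<longleftrightarrow> 2 * s \<le> n \<and> (\<forall>i\<in>{1..s}. 0 < h i \<and> h i < int m \<and> h i dvd int m) \<and>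
     (\<forall>i\<in>{1..<s}. h i dvd h (i + 1))"

lemma dvd_chain:
  fixes h :: "nat \<Rightarrow> int"
  assumes "\<forall>i\<in>{1..<s}. h i dvd h (i + 1)" "1 \<le> i" "i \<le> j" "j \<le> s"
  shows "h i dvd h j"
  using assms(3,4)
proof (induction j rule: dec_induct)
  case (step k)
  then have "h i dvd h k" "h k dvd h (Suc k)" using assms(1,2) by auto
  then show ?case by (rule dvd_trans)
qed simp

section \<open>Diagonal rescaling and the normal form modulo \<open>m\<close>\<close>

lemma det_mat_diag: "det (mat_diag n f) = (\<Prod>i<n. f i :: int)"
proof -
  have "det (mat_diag n f) = prod_list (diag_mat (mat_diag n f))"
    by (rule det_lower_triangular[of n]) (auto simp: mat_diag_def)
  also have "\<dots> = (\<Prod>i<n. f i)" unfolding prod_list_diag_prod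
    by (auto simp: mat_diag_def atLeast0LessThan intro!: prod.cong)
  finally show ?thesis .
qed

lemma mat_diag_conj_entry:
  fixes M :: "int mat"
  assumes "M \<in> carrier_mat n n" "i < n" "j < n"
  shows "(mat_diag n f * M * transpose_mat (mat_diag n f)) $$ (i,j) = f i * f j * M $$ (i,j)"
proof -
  have t: "transpose_mat (mat_diag n f) = mat_diag n f"
    by (rule eq_matI) (auto simp: mat_diag_def)
  have c: "mat_diag n f * M \<in> carrier_mat n n"
    by (rule mult_carrier_mat[OF mat_diag_dim assms(1)])
  show ?thesis unfolding t mat_diag_mult_right[OF c] using assms
    by (simp add: mat_diag_mult_left[OF assms(1)])
qed

lemma N_mat_cong:
  assumes "2 * s \<le> n" "\<And>i. 1 \<le> i \<Longrightarrow> i \<le> s \<Longrightarrow> [h i = h' i] (mod int m)"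
  shows "mcong m n (N_mat n s h) (N_mat n s h')"
  unfolding mcong_def
proof (intro conjI allI impI N_mat_carrier assms(1))
  fix i j assume "i < n" "j < n"
  then show "[N_mat n s h $$ (i,j) = N_mat n s h' $$ (i,j)] (mod int m)"
    using assms(2)[of "i div 2 + 1"] by (auto simp: N_mat_entries[OF assms(1)] cong_minus_minus_iff)
qed

text \<open>Rescaling a block is done on its first coordinate only, that is at an even index; the
  lemma evaluates the determinant of such a rescaling.\<close>

lemma prod_even_indices:
  fixes f :: "nat \<Rightarrow> int"
  assumes "2 * s \<le> n"
  shows "(\<Prod>k<n. if even k \<and> k div 2 < s then f (k div 2 + 1) else 1) = (\<Prod>i\<in>{1..s}. f i)"
proof -
  have "(\<Prod>k<n. if even k \<and> k div 2 < s then f (k div 2 + 1) else 1) =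
     (\<Prod>k\<in>{k \<in> {..<n}. even k \<and> k div 2 < s}. f (k div 2 + 1))"
    by (rule prod.inter_filter[symmetric]) simp
  also have "\<dots> = (\<Prod>i\<in>{1..s}. f i)"
    by (rule prod.reindex_bij_witness[of _ "\<lambda>i. 2 * (i - 1)" "\<lambda>k. k div 2 + 1"])
      (use assms in auto)
  finally show ?thesis .
qed

text \<open>Modulo \<open>m\<close> each surviving elementary divisor is a unit times
  \<open>h i = gcd (d i) m\<close>. A diagonal matrix removes the units, but only a matrix of
  determinant 1 or -1 modulo \<open>m\<close> lifts to a unimodular one; the compensating factor is
  put on the last coordinate and is visible only when that coordinate belongs to a block.\<close>

lemma standard_form_mod:
  assumes m: "m > 0" and M: "alt_mat n M"
    and prim: "\<And>p. prime p \<Longrightarrow> p dvd int m \<Longrightarrow> \<exists>i<n. \<exists>j<n. \<not> p dvd M $$ (i,j)"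
  shows "\<exists>s h z. divisor_chain m n s h \<and> (s = 0 \<longleftrightarrow> m = 1) \<and> h 1 = 1 \<and> coprime z m \<and>
     (if 0 < s \<and> 2 * s = n then 1 \<le> z else z = 1) \<and>
     congr m n M (N_mat n s (h(s := int z * h s)))"
proof (cases "m = 1")
  case True
  have "M \<in> carrier_mat n n" using M by (simp add: alt_mat_def)
  \<comment> \<open>Modulo 1 all matrices agree, and the zero ring is described by the empty list of
    blocks.\<close>
  then have "congr m n M (N_mat n 0 ((\<lambda>_. 1)(0 := int 1 * 1)))"
    using True N_mat_carrier[of 0 n] by (intro congr_mcong) (simp add: mcong_def)
  then show ?thesis using True
    by (intro exI[of _ 0] exI[of _ "\<lambda>_. 1"] exI[of _ 1]) (simp add: divisor_chain_def)
next
  case False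
  with m have m1: "int m > 1" by simp
  have Mc: "M \<in> carrier_mat n n" using M by (simp add: alt_mat_def)
  obtain U r d where U: "unimod n U" "2 * r \<le> n" "\<forall>i\<in>{1..r}. d i > 0"
     "\<forall>i\<in>{1..<r}. d i dvd d (i + 1)" "U * M * transpose_mat U = N_mat n r d"
    using alternating_normal_form[OF M] by blast
  obtain V where V: "unimod n V" "U * V = 1\<^sub>m n" "V * U = 1\<^sub>m n"
    using unimod_inverse[OF U(1)] by blast
  have MV: "M = V * N_mat n r d * transpose_mat V"
    unfolding U(5)[symmetric] conj_conj[OF unimod_carrier[OF V(1)] unimod_carrier[OF U(1)] Mc] V(3)
    using Mc by simp
  \<comment> \<open>The conjugation back by \<open>V\<close> would spread a common prime of the
    elementary divisors to all entries of \<open>M\<close>. It also shows that there is a block at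
    all and that \<open>d 1\<close> is coprime to \<open>m\<close>.\<close>
  have nall: "\<not> (\<forall>i\<in>{1..r}. p dvd d i)" if "prime p" "p dvd int m" for p
  proof
    assume p: "\<forall>i\<in>{1..r}. p dvd d i"
    have e: "p dvd N_mat n r d $$ (k,l)" if "k < n" "l < n" for k l
      using p that U(2) by (auto simp: N_mat_entries)
    have "p dvd M $$ (i,j)" if "i < n" "j < n" for i j
      unfolding MV conj_entry[OF unimod_carrier[OF V(1)] N_mat_carrier[OF U(2)] that]
      by (intro dvd_sum dvd_mult dvd_mult2 e) auto
    then show False using prim[OF that] by blast
  qed
  have r: "r \<ge> 1"
  proof -
    obtain p where "prime p" "p dvd int m"
      using prime_divisor_exists[of "int m"] m1 by auto
    from nall[OF this] show ?thesis by (cases r) auto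
  qed
  have d1: "coprime (d 1) (int m)"
  proof (rule ccontr)
    assume "\<not> coprime (d 1) (int m)"
    then have "\<not> is_unit (gcd (d 1) (int m))" by (simp add: coprime_iff_gcd_eq_1)
    then obtain p where p: "prime p" "p dvd d 1" "p dvd int m"
      using m prime_divisor_exists[of "gcd (d 1) (int m)"] by auto
    then have "\<forall>i\<in>{1..r}. p dvd d i"
      using dvd_chain[OF U(4), of 1] by (meson atLeastAtMost_iff dvd_trans order_refl)
    then show False using nall p by blast
  qed
  have nd1: "\<not> int m dvd d 1"
    using coprime_common_divisor[OF d1, of "int m"] m1 by auto
  \<comment> \<open>Divisors that are multiples of \<open>m\<close> vanish modulo \<open>m\<close>;
    by the chain condition they come last, so the surviving blocks form an initial segment.\<close>
  define s where "s = Max {i \<in> {1..r}. \<not> int m dvd d i}"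
  have fin: "finite {i \<in> {1..r}. \<not> int m dvd d i}" by simp
  have ne: "1 \<in> {i \<in> {1..r}. \<not> int m dvd d i}" using nd1 r by simp
  have sm: "s \<in> {i \<in> {1..r}. \<not> int m dvd d i}" unfolding s_def using Max_in[OF fin] ne by blast
  have s1: "1 \<le> s" "s \<le> r" using sm by auto
  have s2: "2 * s \<le> n" using s1 U(2) by simp
  have dv: "int m dvd d i" if "s < i" "i \<le> r" for i
    using Max_ge[OF fin, of i] that s1 unfolding s_def by fastforce
  have nd: "\<not> int m dvd d i" if "1 \<le> i" "i \<le> s" for i
    using sm dvd_chain[OF U(4) that(1,2) s1(2)] dvd_trans by blast
  have c1: "congr m n M (N_mat n r d)"
    by (rule congrI[OF U(1)]) (simp add: U(5) mcong_refl N_mat_carrier[OF U(2)])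
  have c2: "mcong m n (N_mat n r d) (N_mat n s d)"
    unfolding mcong_def
  proof (intro conjI allI impI N_mat_carrier U(2) s2)
    fix i j assume "i < n" "j < n"
    then show "[N_mat n r d $$ (i,j) = N_mat n s d $$ (i,j)] (mod int m)"
      using dv[of "i div 2 + 1"] s1
      by (auto simp: N_mat_entries[OF U(2)] N_mat_entries[OF s2] cong_0_iff)
  qed
  define h where "h i = gcd (d i) (int m)" for i
  have h: "0 < h i" "h i < int m" "h i dvd int m" if "1 \<le> i" "i \<le> s" for i
  proof -
    show "0 < h i" using m by (auto simp: h_def)
    show dm: "h i dvd int m" by (simp add: h_def)
    have "h i \<noteq> int m" using nd[OF that] unfolding h_def by (metis gcd_dvd1)
    then show "h i < int m" using zdvd_imp_le[OF dm] m by simp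
  qed
  have chain: "divisor_chain m n s h" unfolding divisor_chain_def
    using h s2 U(4) s1 by (auto simp: h_def intro: dvd_trans)
  have "\<exists>u. coprime u (int m) \<and> [d i = u * h i] (mod int m)" for i
    using unit_times_gcd[of "int m" "d i"] m unfolding h_def by auto
  then obtain u where u: "\<And>i. coprime (u i) (int m)" "\<And>i. [d i = u i * h i] (mod int m)"
    by metis
  have "\<exists>v. [v * u i = 1] (mod int m)" for i
    using cong_solve_coprime_int[OF u(1)[of i]] by (auto simp: mult.commute)
  then obtain v where v: "\<And>i. [v i * u i = 1] (mod int m)" by metis
  have c3: "mcong m n (N_mat n s d) (N_mat n s (\<lambda>i. u i * h i))"
    by (rule N_mat_cong[OF s2 u(2)])
  define w where "w = (\<Prod>i\<in>{1..s}. u i)"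
  \<comment> \<open>The inverse \<open>v\<close> on the first coordinate of a block cancels its unit
    \<open>u\<close>, and \<open>w\<close> on the last coordinate restores determinant 1 modulo
    \<open>m\<close>. If \<open>2 * s < n\<close> this coordinate lies in the zero block; otherwise
    it is the second coordinate of the last block.\<close>
  define t where "t k = (if even k \<and> k div 2 < s then v (k div 2 + 1) else 1) * (if k = n - 1 then w else 1)" for k
  have n0: "n - 1 < n" "n \<ge> 2" using s1 s2 by auto
  have "(\<Prod>k<n. t k) = (\<Prod>i\<in>{1..s}. v i) * w"
    unfolding t_def prod.distrib prod_even_indices[OF s2] using n0 by simp
  also have "\<dots> = (\<Prod>i\<in>{1..s}. v i * u i)" by (simp add: w_def prod.distrib)
  also have "[\<dots> = (\<Prod>i\<in>{1..s}. 1)] (mod int m)" by (intro cong_prod v)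
  finally have "[det (mat_diag n t) = 1] (mod int m)" by (simp add: det_mat_diag)
  then obtain W where W: "unimod n W" "mcong m n W (mat_diag n t)"
    using unimod_lift[of "mat_diag n t" n m] by auto
  \<comment> \<open>The data ask for a natural number, so the class of \<open>w\<close> is
    represented by its residue; the residue is positive because it is coprime to
    \<open>m > 1\<close>.\<close>
  define z where "z = (if 2 * s = n then nat (w mod int m) else 1)"
  have z: "[(if 2 * s = n then w else 1) = int z] (mod int m)"
    using m by (auto simp: z_def cong_def)
  have cw: "coprime w (int m)" unfolding w_def by (intro prod_coprime_left u)
  have cz: "coprime (int z) (int m)" using cong_imp_coprime[OF z] cw by auto
  define N1 where "N1 = N_mat n s (\<lambda>i. u i * h i)"
  define N2 where "N2 = N_mat n s (h(s := int z * h s))"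
  have c4: "mcong m n (mat_diag n t * N1 * transpose_mat (mat_diag n t)) N2"
    unfolding mcong_def
  proof (intro conjI allI impI conj_carrier mat_diag_dim)
    show N1: "N1 \<in> carrier_mat n n" "N2 \<in> carrier_mat n n" 
      unfolding N1_def N2_def by (rule N_mat_carrier[OF s2])+
    have key: "[t (2*a) * t (2*a+1) * (u (a+1) * h (a+1)) = (h(s := int z * h s)) (a+1)] (mod int m)"
      if a: "a < s" for a
    proof -
      have t1: "t (2*a) = v (a+1)" using a s2 by (simp add: t_def)
      have t2: "t (2*a+1) = (if 2 * a + 2 = n then w else 1)" using n0 by (auto simp: t_def)
      have "[v (a+1) * u (a+1) * (t (2*a+1) * h (a+1)) = 1 * (t (2*a+1) * h (a+1))] (mod int m)"
        by (rule cong_mult[OF v cong_refl])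
      then have 1: "[t (2*a) * t (2*a+1) * (u (a+1) * h (a+1)) = t (2*a+1) * h (a+1)] (mod int m)"
        unfolding t1 by (simp add: mult_ac)
      show ?thesis
      proof (cases "2 * a + 2 = n")
        case True
        then have s: "s = a + 1" "2 * s = n" using a s2 by auto
        have "[t (2*a+1) * h (a+1) = int z * h s] (mod int m)"
          unfolding t2 using True s(1) z s(2) by (intro cong_mult) auto
        then show ?thesis using 1 s(1) by (auto intro: cong_trans)
      next
        case F: False
        have "(h(s := int z * h s)) (a+1) = h (a+1)"
        proof (cases "a + 1 = s")
          case True
          then have "z = 1" using F by (simp add: z_def)
          then show ?thesis by simp
        qed simp
        moreover have "t (2*a+1) = 1" using t2 F by simp
        ultimately show ?thesis using 1 by simp
      qed
    qed
    fix i j assume ij: "i < n" "j < n"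
    have eq: "(mat_diag n t * N1 * transpose_mat (mat_diag n t)) $$ (i,j) = t i * t j * N1 $$ (i,j)"
      by (rule mat_diag_conj_entry[OF N1(1) ij])
    show "[(mat_diag n t * N1 * transpose_mat (mat_diag n t)) $$ (i,j) = N2 $$ (i,j)] (mod int m)"
    proof (cases "i div 2 = j div 2 \<and> i div 2 < s \<and> i \<noteq> j")
      case F: False
      then show ?thesis unfolding eq using ij by (auto simp: N1_def N2_def N_mat_entries[OF s2])
    next
      case True
      define a where "a = i div 2"
      have a: "a < s" using True by (simp add: a_def)
      have "i = 2*a + i mod 2" "j = 2*a + j mod 2" "i mod 2 < 2" "j mod 2 < 2" "i \<noteq> j"
        using True mult_div_mod_eq[of 2 i] mult_div_mod_eq[of 2 j] unfolding a_def by linarith+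
      then have "(i = 2*a \<and> j = 2*a+1) \<or> (i = 2*a+1 \<and> j = 2*a)" by linarith
      then show ?thesis
      proof
        assume "i = 2*a \<and> j = 2*a+1"
        then show ?thesis unfolding eq using key[OF a] ij a by (simp add: N1_def N2_def N_mat_entries[OF s2])
      next
        assume "i = 2*a+1 \<and> j = 2*a"
        then show ?thesis unfolding eq using key[OF a] ij a
          by (simp add: N1_def N2_def N_mat_entries[OF s2] cong_minus_minus_iff mult.commute[of "t (Suc (2*a))"])
      qed
    qed
  qed
  have N1c: "N1 \<in> carrier_mat n n" unfolding N1_def by (rule N_mat_carrier[OF s2])
  have "mcong m n (W * N1 * transpose_mat W) N2"
    by (rule mcong_trans[OF mcong_conj[OF W(2) mcong_refl[OF N1c]] c4])
  then have c5: "congr m n N1 N2" by (rule congrI[OF W(1)])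
  have "congr m n M N2"
    using congr_trans[OF congr_trans[OF c1 congr_mcong[OF mcong_trans[OF c2 c3]] Mc] c5[unfolded N1_def] Mc] .
  moreover have "h 1 = 1" using d1 by (simp add: h_def)
  moreover have "if 0 < s \<and> 2 * s = n then 1 \<le> z else z = 1"
  proof -
    have "z \<noteq> 0"
    proof
      assume "z = 0"
      then show False using cz m1 by simp
    qed
    then show ?thesis using s1 by (auto simp: z_def)
  qed
  ultimately show ?thesis using chain cz s1 False unfolding N2_def
    by (intro exI[of _ s] exI[of _ h] exI[of _ z]) auto
qed

section \<open>Recovering the divisor chain from numbers of solutions\<close>

text \<open>Induction on \<open>j\<close> with \<open>d = H j\<close>. The factors before
  \<open>j\<close> agree and cancel; from \<open>j\<close> on, those of \<open>H\<close> equal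
  \<open>H j\<close>, while those of \<open>H'\<close> are at most \<open>H j\<close>. Equality of
  the products forces \<open>H j dvd H' j\<close>, and the roles may be exchanged.\<close>

lemma chain_determined_by_gcd_products:
  fixes H H' :: "nat \<Rightarrow> int"
  assumes pos: "\<And>i. i < n \<Longrightarrow> H i > 0" "\<And>i. i < n \<Longrightarrow> H' i > 0"
    and dvd: "\<And>i j. i \<le> j \<Longrightarrow> j < n \<Longrightarrow> H i dvd H j" "\<And>i j. i \<le> j \<Longrightarrow> j < n \<Longrightarrow> H' i dvd H' j"
    and m: "\<And>i. i < n \<Longrightarrow> H i dvd m" "\<And>i. i < n \<Longrightarrow> H' i dvd m"
    and eq: "\<And>d. d > 0 \<Longrightarrow> d dvd m \<Longrightarrow> (\<Prod>i<n. gcd (H i) d) = (\<Prod>i<n. gcd (H' i) d)"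
    and j: "j < n"
  shows "H j = H' j"
proof -
  have half: "F j dvd G j"
    if F: "\<And>i. i < n \<Longrightarrow> F i > 0" "\<And>i j. i \<le> j \<Longrightarrow> j < n \<Longrightarrow> F i dvd F j"
      and j: "j < n" and IH: "\<And>i. i < j \<Longrightarrow> F i = G i"
      and eq: "(\<Prod>i<n. gcd (F i) (F j)) = (\<Prod>i<n. gcd (G i) (F j))"
    for F G :: "nat \<Rightarrow> int" and j
  proof -
    have split: "(\<Prod>i<n. f i) = (\<Prod>i<j. f i) * (\<Prod>i\<in>{j..<n}. f i)" for f :: "nat \<Rightarrow> int"
      using prod.atLeastLessThan_concat[of 0 j n f] j by (simp add: atLeast0LessThan)
    have "(\<Prod>i<j. gcd (F i) (F j)) = (\<Prod>i<j. gcd (G i) (F j))" using IH by simp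
    moreover have "(\<Prod>i<j. gcd (F i) (F j)) \<noteq> 0" using F(1)[OF j] by simp
    ultimately have "(\<Prod>i\<in>{j..<n}. gcd (F i) (F j)) = (\<Prod>i\<in>{j..<n}. gcd (G i) (F j))"
      using eq F(1)[OF j] unfolding split by simp
    moreover have "(\<Prod>i\<in>{j..<n}. gcd (F i) (F j)) = (\<Prod>i\<in>{j..<n}. F j)"
      by (intro prod.cong refl) (use F in \<open>auto simp: gcd_proj2_iff less_imp_le\<close>)
    ultimately have e: "(\<Prod>i\<in>{j..<n}. F j) = (\<Prod>i\<in>{j..<n}. gcd (G i) (F j))" by simp
    have le: "gcd (G i) (F j) \<le> F j" for i using F(1)[OF j] by (simp add: gcd_le2_int)
    have "gcd (G j) (F j) = F j"
    proof (rule ccontr)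
      assume "gcd (G j) (F j) \<noteq> F j"
      then have lt: "gcd (G j) (F j) < F j" using le[of j] by simp
      have gp: "0 < gcd (G i) (F j)" for i using F(1)[OF j] by simp
      have s: "{j..<n} = insert j {Suc j..<n}" using j by auto
      have "(\<Prod>i\<in>{Suc j..<n}. gcd (G i) (F j)) \<le> (\<Prod>i\<in>{Suc j..<n}. F j)"
        by (intro prod_mono) (use le gp less_imp_le in auto)
      moreover have "0 < (\<Prod>i\<in>{Suc j..<n}. gcd (G i) (F j))" by (intro prod_pos gp)
      ultimately have "(\<Prod>i\<in>{j..<n}. gcd (G i) (F j)) < (\<Prod>i\<in>{j..<n}. F j)"
        unfolding s using lt gp[of j] by (simp add: mult_strict_mono' mult_less_le_imp_less)
      then show False using e by simp
    qed
    then show ?thesis by (metis gcd_dvd1)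
  qed
  show ?thesis using j
  proof (induction j rule: less_induct)
    case (less j)
    have "H j dvd H' j"
      by (rule half) (use less pos dvd in \<open>auto intro: eq m\<close>)
    moreover have "H' j dvd H j"
      by (rule half) (use less pos dvd in \<open>auto intro: eq[symmetric] m\<close>)
    ultimately show ?case using pos[of j] less(2) zdvd_antisym_nonneg by force
  qed
qed

definition mv :: "nat \<Rightarrow> int mat \<Rightarrow> (nat \<Rightarrow> int) \<Rightarrow> nat \<Rightarrow> int" where
  "mv n M x i = (\<Sum>j<n. M $$ (i,j) * x j)"

definition kernel_mod :: "nat \<Rightarrow> nat \<Rightarrow> int mat \<Rightarrow> (nat \<Rightarrow> int) set" where
  "kernel_mod d n M = {x \<in> {..<n} \<rightarrow>\<^sub>E {0..<int d}. \<forall>i<n. int d dvd mv n M x i}"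

lemma mv_mult:
  assumes "A \<in> carrier_mat n n" "B \<in> carrier_mat n n" "i < n"
  shows "mv n (A * B) x i = mv n A (mv n B x) i"
proof -
  have "mv n (A * B) x i = (\<Sum>j<n. \<Sum>k<n. A $$ (i,k) * B $$ (k,j) * x j)"
    unfolding mv_def using assms
    by (intro sum.cong refl) (simp add: mult_mat_entry sum_distrib_right del: index_mult_mat)
  also have "\<dots> = (\<Sum>k<n. \<Sum>j<n. A $$ (i,k) * B $$ (k,j) * x j)" by (rule sum.swap)
  finally show ?thesis by (simp add: mv_def sum_distrib_left mult.assoc)
qed

lemma mv_cong:
  assumes "\<And>j. j < n \<Longrightarrow> [x j = y j] (mod d)"
  shows "[mv n A x i = mv n A y i] (mod d)"
  unfolding mv_def by (intro cong_sum cong_mult cong_refl assms) auto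

lemma mv_mcong:
  assumes "mcong d n A B" "i < n"
  shows "[mv n A x i = mv n B x i] (mod int d)"
  unfolding mv_def by (intro cong_sum cong_mult cong_refl mcongD[OF assms(1)] assms(2)) auto

lemma mv_dvd: "(\<And>j. j < n \<Longrightarrow> d dvd y j) \<Longrightarrow> d dvd mv n A y i"
  unfolding mv_def by (intro dvd_sum dvd_mult) auto

lemma mv_one: "i < n \<Longrightarrow> mv n (1\<^sub>m n) x i = x i"
  by (simp add: mv_def if_distrib[of "\<lambda>c. c * _"] sum.delta cong: if_cong)

lemma mcong_dvd: "mcong m n A B \<Longrightarrow> d dvd m \<Longrightarrow> mcong d n A B"
  unfolding mcong_def by (meson cong_dvd_modulus int_dvd_int_iff)

lemma finite_kernel_mod: "finite (kernel_mod d n M)"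
  unfolding kernel_mod_def by (rule finite_subset[of _ "{..<n} \<rightarrow>\<^sub>E {0..<int d}"]) (auto intro: finite_PiE)

text \<open>If \<open>B\<close> is \<open>U * A * transpose_mat U\<close>, then \<open>x\<close>
  solves \<open>B x = 0\<close> only if \<open>transpose_mat U\<close> applied to \<open>x\<close>
  solves \<open>A y = 0\<close>, and this map is injective modulo \<open>d\<close>. Equality of the
  two numbers follows from the symmetry of \<open>congr\<close>.\<close>

lemma card_kernel_mod_le:
  assumes c: "congr m n A B" and A: "A \<in> carrier_mat n n" and d: "d dvd m" "d > 0"
  shows "card (kernel_mod d n B) \<le> card (kernel_mod d n A)"
proof -
  obtain U where U: "unimod n U" "mcong m n (U * A * transpose_mat U) B"
    using c unfolding congr_def by blast
  obtain V where V: "unimod n V" "U * V = 1\<^sub>m n" "V * U = 1\<^sub>m n"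
    using unimod_inverse[OF U(1)] by blast
  have Uc: "U \<in> carrier_mat n n" "V \<in> carrier_mat n n"
    using U(1) V(1) by (auto simp: unimod_def)
  then have Ut: "transpose_mat U \<in> carrier_mat n n" "transpose_mat V \<in> carrier_mat n n" by auto
  have tt: "transpose_mat V * transpose_mat U = 1\<^sub>m n"
    using transpose_mult[OF Uc] V(2) by simp
  define f where "f x = (\<lambda>j\<in>{..<n}. mv n (transpose_mat U) x j mod int d)" for x
  have fc: "[f x j = mv n (transpose_mat U) x j] (mod int d)" if "j < n" for x j
    using that by (simp add: f_def)
  have inj: "inj_on f (kernel_mod d n B)"
  proof (rule inj_onI)
    fix x y assume xy: "x \<in> kernel_mod d n B" "y \<in> kernel_mod d n B" "f x = f y"
    have cancelV: "[mv n (transpose_mat V) (f x) i = x i] (mod int d)" if "i < n" for x i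
    proof -
      have "[mv n (transpose_mat V) (f x) i = mv n (transpose_mat V) (mv n (transpose_mat U) x) i] (mod int d)"
        by (rule mv_cong[OF fc])
      also have "mv n (transpose_mat V) (mv n (transpose_mat U) x) i = x i"
        using mv_mult[OF Ut(2,1) that, of x] tt mv_one[OF that] by simp
      finally show ?thesis .
    qed
    show "x = y"
    proof (rule ext)
      fix i show "x i = y i"
      proof (cases "i < n")
        case True
        then have "[x i = y i] (mod int d)" using cancelV[of i x] cancelV[of i y] xy(3) by (metis cong_sym cong_trans)
        moreover have "0 \<le> x i" "x i < int d" "0 \<le> y i" "y i < int d"
          using xy(1,2) True by (auto simp: kernel_mod_def PiE_iff)
        ultimately show ?thesis by (simp add: cong_def)
      next
        case False
        then show ?thesis using xy(1,2) by (auto simp: kernel_mod_def PiE_iff extensional_def)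
      qed
    qed
  qed
  have "f ` kernel_mod d n B \<subseteq> kernel_mod d n A"
  proof
    fix y assume "y \<in> f ` kernel_mod d n B"
    then obtain x where x: "x \<in> kernel_mod d n B" "y = f x" by blast
    have "int d dvd mv n A (f x) i" if i: "i < n" for i
    proof -
      have AUt: "A * transpose_mat U \<in> carrier_mat n n" using A Ut by auto
      have UAU: "U * (A * transpose_mat U) \<in> carrier_mat n n" using Uc AUt by auto
      have "[mv n A (f x) i = mv n A (mv n (transpose_mat U) x) i] (mod int d)"
        by (rule mv_cong[OF fc])
      also have "mv n A (mv n (transpose_mat U) x) i = mv n (A * transpose_mat U) x i"
        using mv_mult[OF A Ut(1) i] by simp
      also have "\<dots> = mv n (V * (U * (A * transpose_mat U))) x i"
        using assoc_mult_mat[OF Uc(2,1) AUt] V(3) left_mult_one_mat[OF AUt] by simp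
      also have "\<dots> = mv n V (mv n (U * (A * transpose_mat U)) x) i"
        by (rule mv_mult[OF Uc(2) UAU i])
      finally have 1: "[mv n A (f x) i = mv n V (mv n (U * (A * transpose_mat U)) x) i] (mod int d)" .
      have "int d dvd mv n (U * (A * transpose_mat U)) x j" if "j < n" for j
      proof -
        have "[mv n (U * A * transpose_mat U) x j = mv n B x j] (mod int d)"
          by (rule mv_mcong[OF mcong_dvd[OF U(2) d(1)] that])
        moreover have "int d dvd mv n B x j" using x(1) that by (simp add: kernel_mod_def)
        ultimately show ?thesis using assoc_mult_mat[OF Uc(1) A Ut(1)] by (simp add: cong_dvd_iff)
      qed
      then have "int d dvd mv n V (mv n (U * (A * transpose_mat U)) x) i" by (rule mv_dvd)
      then show ?thesis using 1 cong_dvd_iff by blast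
    qed
    moreover have "f x \<in> {..<n} \<rightarrow>\<^sub>E {0..<int d}" using d(2) by (auto simp: f_def)
    ultimately show "y \<in> kernel_mod d n A" using x(2) by (simp add: kernel_mod_def)
  qed
  then show ?thesis using card_inj_on_le[OF inj _ finite_kernel_mod] by blast
qed

text \<open>With \<open>g = gcd k d\<close> and \<open>d = g * b\<close>, the solutions are the
  multiples of \<open>b\<close>, of which \<open>g\<close> lie below \<open>d\<close>.\<close>

lemma card_annihilator:
  assumes "d > 0"
  shows "int (card {x \<in> {0..<int d}. int d dvd k * x}) = gcd k (int d)"
proof -
  define g where "g = gcd k (int d)"
  have g: "g > 0" using assms by (simp add: g_def)
  obtain a b where ab: "k = g * a" "int d = g * b" unfolding g_def by (metis dvd_def gcd_dvd1 gcd_dvd2)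
  have b: "b > 0" using ab(2) assms g by (metis of_nat_0_less_iff zero_less_mult_pos)
  have "g * gcd a b = gcd k (int d)" using g by (simp add: ab gcd_mult_left)
  then have cop: "coprime a b" using g by (simp add: g_def[symmetric] coprime_iff_gcd_eq_1)
  have "{x \<in> {0..<int d}. int d dvd k * x} = (\<lambda>t. b * t) ` {0..<g}"
  proof (intro Set.set_eqI iffI)
    fix x assume x: "x \<in> {x \<in> {0..<int d}. int d dvd k * x}"
    then have "g * b dvd g * (a * x)" using ab by (simp add: mult.assoc)
    then have "b dvd a * x" using g by simp
    then have "b dvd x" using cop by (simp add: coprime_commute coprime_dvd_mult_right_iff)
    then obtain t where t: "x = b * t" by blast
    then have "0 \<le> t" "t < g" using x b ab(2)
      by (auto simp: zero_le_mult_iff mult.commute[of g b])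
    then show "x \<in> (\<lambda>t. b * t) ` {0..<g}" using t by (intro image_eqI[of _ _ t]) auto
  next
    fix x assume "x \<in> (\<lambda>t. b * t) ` {0..<g}"
    then obtain t where "x = b * t" "t \<in> {0..<g}" by blast
    then show "x \<in> {x \<in> {0..<int d}. int d dvd k * x}"
      using b ab by (auto simp: mult_ac)
  qed
  moreover have "inj_on (\<lambda>t. b * t) {0..<g}" using b by (auto simp: inj_on_def)
  ultimately show ?thesis using g by (simp add: card_image g_def[symmetric])
qed

text \<open>Row \<open>i\<close> of the form involves only the partner of \<open>i\<close> in its
  block, so the system decouples into one condition for each coordinate; coordinates outside the
  blocks are free.\<close>

lemma card_kernel_N_mat:
  assumes s: "2 * s \<le> n" and d: "d > 0"
  shows "int (card (kernel_mod d n (N_mat n s k))) =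
    (\<Prod>i<n. if i div 2 < s then gcd (k (i div 2 + 1)) (int d) else int d)"
proof -
  have ev: "mv n (N_mat n s k) x i = (if i div 2 < s then
      if even i then k (i div 2 + 1) * x (i + 1) else - (k (i div 2 + 1) * x (i - 1)) else 0)"
    if i: "i < n" for x i
  proof (cases "i div 2 < s")
    case False
    then have "N_mat n s k $$ (i,j) = 0" if "j < n" for j
      using i that by (simp add: N_mat_entries[OF s])
    then show ?thesis using False by (simp add: mv_def)
  next
    case True
    \<comment> \<open>The other index of the block that contains \<open>i\<close>.\<close>
    define j where "j = (if even i then i + 1 else i - 1)"
    have j: "j < n" "j div 2 = i div 2" "j \<noteq> i"
    proof -
      obtain a where a: "i = 2 * a \<or> i = 2 * a + 1" by (metis oddE evenE)
      then show "j < n" "j div 2 = i div 2" "j \<noteq> i" using True s by (auto simp: j_def)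
    qed
    have other: "N_mat n s k $$ (i,l) = 0" if "l < n" "l \<noteq> j" for l
    proof -
      have "\<not> (l div 2 = i div 2 \<and> l \<noteq> i)"
      proof
        assume l: "l div 2 = i div 2 \<and> l \<noteq> i"
        have "i = 2 * (i div 2) + i mod 2" "l = 2 * (l div 2) + l mod 2" "i mod 2 < 2" "l mod 2 < 2" by auto
        then show False using l that(2) unfolding j_def by (auto split: if_splits elim!: evenE oddE)
      qed
      then show ?thesis using i that by (auto simp: N_mat_entries[OF s])
    qed
    have "mv n (N_mat n s k) x i = (\<Sum>l\<in>{j}. N_mat n s k $$ (i,l) * x l)"
      unfolding mv_def by (rule sum.mono_neutral_right) (use j other in auto)
    also have "\<dots> = N_mat n s k $$ (i,j) * x j" by simp
    also have "N_mat n s k $$ (i,j) = (if i < j then k (i div 2 + 1) else - k (i div 2 + 1))"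
      using i j True by (simp add: N_mat_entries[OF s])
    finally show ?thesis using True by (cases "even i") (auto simp: j_def elim!: oddE)
  qed
  define S where "S i = {x \<in> {0..<int d}. i div 2 < s \<longrightarrow> int d dvd k (i div 2 + 1) * x}" for i
  have "kernel_mod d n (N_mat n s k) = PiE {..<n} S"
  proof (intro Set.set_eqI iffI)
    fix x assume x: "x \<in> kernel_mod d n (N_mat n s k)"
    have "x i \<in> S i" if i: "i < n" for i
    proof -
      have "int d dvd k (i div 2 + 1) * x i" if a: "i div 2 < s"
      proof (cases "even i")
        case True
        then have "i + 1 < n" "(i + 1) div 2 = i div 2" using a s by (auto elim!: evenE)
        then have "int d dvd mv n (N_mat n s k) x (i + 1)" using x by (simp add: kernel_mod_def)
        then show ?thesis using ev[of "i + 1"] \<open>i + 1 < n\<close> \<open>(i + 1) div 2 = i div 2\<close> a True by simp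
      next
        case False
        then have *: "i - 1 < n" "(i - 1) div 2 = i div 2" "even (i - 1)" "i - 1 + 1 = i"
          using i by (auto elim!: oddE)
        then have "int d dvd mv n (N_mat n s k) x (i - 1)" using x by (simp add: kernel_mod_def)
        then show ?thesis using ev[OF *(1)] * a by simp
      qed
      then show ?thesis using x i by (auto simp: S_def kernel_mod_def PiE_iff)
    qed
    then show "x \<in> PiE {..<n} S" using x by (auto simp: kernel_mod_def PiE_iff)
  next
    fix x assume x: "x \<in> PiE {..<n} S"
    have "int d dvd mv n (N_mat n s k) x i" if i: "i < n" for i
    proof (cases "i div 2 < s")
      case False then show ?thesis by (simp add: ev[OF i])
    next
      case a: True
      show ?thesis
      proof (cases "even i")
        case True
        then have *: "i + 1 < n" "(i + 1) div 2 = i div 2" using a s by (auto elim!: evenE)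
        then have "x (i + 1) \<in> S (i + 1)" using x by auto
        then show ?thesis using ev[OF i, of x] a True * by (simp add: S_def)
      next
        case False
        then have *: "i - 1 < n" "(i - 1) div 2 = i div 2"
          using i by (auto elim!: oddE)
        then have "x (i - 1) \<in> S (i - 1)" using x by auto
        then show ?thesis using ev[OF i, of x] a False * by (simp add: S_def)
      qed
    qed
    moreover have "x \<in> {..<n} \<rightarrow>\<^sub>E {0..<int d}" using x by (auto simp: S_def PiE_iff)
    ultimately show "x \<in> kernel_mod d n (N_mat n s k)" by (simp add: kernel_mod_def)
  qed
  then have "int (card (kernel_mod d n (N_mat n s k))) = (\<Prod>i<n. int (card (S i)))"
    by (simp add: card_PiE)
  also have "\<dots> = (\<Prod>i<n. if i div 2 < s then gcd (k (i div 2 + 1)) (int d) else int d)"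
  proof (intro prod.cong refl)
    fix i
    show "int (card (S i)) = (if i div 2 < s then gcd (k (i div 2 + 1)) (int d) else int d)"
    proof (cases "i div 2 < s")
      case True
      then have "S i = {x \<in> {0..<int d}. int d dvd k (i div 2 + 1) * x}" by (simp add: S_def)
      then show ?thesis using card_annihilator[OF d, of "k (i div 2 + 1)"] True by simp
    next
      case False
      then have "S i = {0..<int d}" by (auto simp: S_def)
      then show ?thesis using False by simp
    qed
  qed
  finally show ?thesis .
qed

text \<open>The number of solutions of \<open>N x \<equiv> 0\<close> modulo \<open>d\<close> is invariant under congruence and equals a product
  of terms \<open>gcd (h i) d\<close>; letting \<open>d\<close> run through the divisors of \<open>m\<close> recovers the chain.\<close>

lemma normal_form_unique:
  assumes m: "m > 0"
    and h: "divisor_chain m n s h" "\<And>i. 1 \<le> i \<Longrightarrow> i \<le> s \<Longrightarrow> gcd (k i) (int m) = h i"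
    and h': "divisor_chain m n s' h'" "\<And>i. 1 \<le> i \<Longrightarrow> i \<le> s' \<Longrightarrow> gcd (k' i) (int m) = h' i"
    and c: "congr m n (N_mat n s k) (N_mat n s' k')"
  shows "s = s'" "\<And>i. 1 \<le> i \<Longrightarrow> i \<le> s \<Longrightarrow> h i = h' i"
proof -
  \<comment> \<open>The chain repeated twice per block and padded by \<open>m\<close> in the zero
    block. All proper entries are smaller than \<open>m\<close>, so \<open>F\<close> determines
    \<open>s\<close> as well as the \<open>h i\<close>.\<close>
  define F where "F s h i = (if i div 2 < s then h (i div 2 + 1) else int m)" for s :: nat and h :: "nat \<Rightarrow> int" and i :: nat
  have s2: "2 * s \<le> n" "2 * s' \<le> n" using h h' by (auto simp: divisor_chain_def)
  have N: "N_mat n s k \<in> carrier_mat n n" "N_mat n s' k' \<in> carrier_mat n n"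
    using s2 N_mat_carrier by auto
  have pos: "F s h i > 0" "F s h i dvd int m" if "divisor_chain m n s h" for i s h
    using that m by (auto simp: F_def divisor_chain_def)
  have mono: "F s h i dvd F s h j" if "divisor_chain m n s h" "i \<le> j" for i j s h
  proof (cases "j div 2 < s")
    case True
    have "i div 2 \<le> j div 2" using that(2) by (rule div_le_mono)
    then show ?thesis using True dvd_chain[of s h "i div 2 + 1" "j div 2 + 1"] that(1)
      by (auto simp: F_def divisor_chain_def)
  next
    case False
    then show ?thesis using pos(2)[OF that(1), of i] by (simp add: F_def)
  qed
  have eqF: "F s h i = F s' h' i" if "i < n" for i
  proof (rule chain_determined_by_gcd_products[where m = "int m" and n = n, OF _ _ _ _ _ _ _ that])
    fix d :: int assume d: "d > 0" "d dvd int m"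
    define e where "e = nat d"
    have e: "d = int e" "e > 0" "e dvd m" using d by (auto simp: e_def nat_dvd_iff)
    \<comment> \<open>For a divisor \<open>d\<close> of \<open>m\<close>, the gcd of
      \<open>k i\<close> with \<open>d\<close> depends on \<open>k i\<close> only through
      \<open>gcd (k i) m\<close>, that is through \<open>h i\<close>.\<close>
    have g: "gcd x d = gcd y d" if "gcd x (int m) = y" for x y :: int
      using that d(2) by (metis gcd.assoc gcd_proj2_if_dvd_int abs_of_pos d(1))
    have card: "int (card (kernel_mod e n (N_mat n s k))) = (\<Prod>i<n. gcd (F s h i) d)"
      if "2 * s \<le> n" "\<And>i. 1 \<le> i \<Longrightarrow> i \<le> s \<Longrightarrow> gcd (k i) (int m) = h i" for s h k
      unfolding card_kernel_N_mat[OF that(1) e(2)]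
    proof (intro prod.cong refl)
      fix i
      show "(if i div 2 < s then gcd (k (i div 2 + 1)) (int e) else int e) = gcd (F s h i) d"
        using g[OF that(2)[of "i div 2 + 1"]] e(1) d gcd_proj2_if_dvd_int[OF d(2)] by (auto simp: F_def)
    qed
    have "card (kernel_mod e n (N_mat n s k)) = card (kernel_mod e n (N_mat n s' k'))"
      using card_kernel_mod_le[OF c N(1) e(3,2)] card_kernel_mod_le[OF congr_sym[OF c N(1)] N(2) e(3,2)]
      by simp
    then show "(\<Prod>i<n. gcd (F s h i) d) = (\<Prod>i<n. gcd (F s' h' i) d)"
      using card[where k = k and h = h, OF s2(1) h(2)] card[where k = k' and h = h', OF s2(2) h'(2)]
      by simp
  qed (use pos mono h(1) h'(1) in auto)
  have lt: "F s h (2 * a) = h (a + 1)" if "a < s" for a s and h :: "nat \<Rightarrow> int" using that by (simp add: F_def)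
  \<comment> \<open>With fewer blocks, the first coordinate of the next block carries the padding
    value \<open>m\<close> on one side and a proper divisor on the other.\<close>
  have noless: False if "divisor_chain m n t g" "t < t'" "divisor_chain m n t' g'" "\<And>i. i < n \<Longrightarrow> F t g i = F t' g' i" for t t' g g'
  proof -
    have "2 * t < n" using that(2,3) by (auto simp: divisor_chain_def)
    from that(4)[OF this] have "int m = g' (t + 1)" using that(2) by (simp add: F_def)
    then show False using that(2,3) by (auto simp: divisor_chain_def)
  qed
  show ss: "s = s'"
    using noless[OF h(1) _ h'(1)] noless[OF h'(1) _ h(1)] eqF by (metis nat_neq_iff)
  fix i assume i: "1 \<le> i" "i \<le> s"
  then obtain a where a: "i = a + 1" "a < s" by (metis Suc_eq_plus1 Suc_le_lessD Suc_pred' not_less_eq_eq less_eq_Suc_le not_one_le_zero gr0I)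
  then have "2 * a < n" using s2 by simp
  from eqF[OF this] show "h i = h' i" using lt a ss by simp
qed

section \<open>Determinants of stabilisers and scaled forms\<close>

text \<open>Formally \<open>A = C\<^sup>-\<^sup>1 B C\<close> for \<open>C = diag c\<close>. Division is avoided by comparing Leibniz terms: along a
  permutation \<open>p\<close> the ratios \<open>c (p i) / c i\<close> multiply to \<open>1\<close>.\<close>

lemma det_quasi_conjugate:
  fixes A B :: "int mat" and c :: "nat \<Rightarrow> int"
  assumes A: "A \<in> carrier_mat n n" and B: "B \<in> carrier_mat n n"
    and c: "\<And>i. i < n \<Longrightarrow> c i > 0" "\<And>i. i < n \<Longrightarrow> c i dvd e" "\<And>i j. i \<le> j \<Longrightarrow> j < n \<Longrightarrow> c i dvd c j"
    and m: "m = e * l" "e > 0"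
    and AB: "\<And>i j. i < n \<Longrightarrow> j < n \<Longrightarrow> [c i * A $$ (i,j) = B $$ (i,j) * c j] (mod m)"
  shows "[det A = det B] (mod l)"
proof -
  have "[(\<Prod>i = 0..<n. A $$ (i, p i)) = (\<Prod>i = 0..<n. B $$ (i, p i))] (mod l)"
    if p: "p permutes {0..<n}" for p
  proof -
    have pn: "p i < n" if "i < n" for i using permutes_in_image[OF p, of i] that by simp
    \<comment> \<open>The ratio of \<open>c (p i)\<close> and \<open>c i\<close> is an integer in
      one direction only, decided by the chain order; the indices are split accordingly.\<close>
    define X where "X = {i \<in> {0..<n}. i \<le> p i}"
    define Y where "Y = {i \<in> {0..<n}. \<not> i \<le> p i}"
    have XY: "{0..<n} = X \<union> Y" "X \<inter> Y = {}" "finite X" "finite Y" unfolding X_def Y_def by auto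
    have split: "(\<Prod>i = 0..<n. f i) = prod f X * prod f Y" for f :: "nat \<Rightarrow> int"
      unfolding XY(1) by (rule prod.union_disjoint[OF XY(3,4,2)])
    define u where "u i = c (p i) div c i" for i
    define v where "v i = c i div c (p i)" for i
    have u: "c (p i) = c i * u i" if "i \<in> X" for i
      using c(3)[of i "p i"] that pn unfolding X_def u_def by auto
    have v: "c i = c (p i) * v i" if "i \<in> Y" for i
      using c(3)[of "p i" i] that pn unfolding Y_def v_def by auto
    \<comment> \<open>Cancelling a divisor \<open>a\<close> of \<open>e\<close> from a congruence
      modulo \<open>m = e * l\<close> leaves a modulus that is still a multiple of
      \<open>l\<close>.\<close>
    have cancel: "[x = y] (mod l)" if a: "[a * x = a * y] (mod m)" "a > 0" "a dvd e" for a x y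
    proof -
      obtain b where b: "e = a * b" using a(3) by blast
      have "a * (b * l) dvd a * (x - y)"
        using a(1) unfolding m(1) b by (simp add: cong_iff_dvd_diff right_diff_distrib mult.assoc)
      then have "b * l dvd x - y" using a(2) by simp
      then show ?thesis by (metis cong_iff_dvd_diff dvd_mult_right)
    qed
    have 1: "[A $$ (i, p i) = B $$ (i, p i) * u i] (mod l)" if "i \<in> X" for i
    proof -
      have i: "i < n" using that by (simp add: X_def)
      have "[c i * A $$ (i, p i) = c i * (B $$ (i, p i) * u i)] (mod m)"
        using AB[OF i pn[OF i]] u[OF that] by (simp add: mult_ac)
      from cancel[OF this c(1)[OF i] c(2)[OF i]] show ?thesis .
    qed
    have 2: "[A $$ (i, p i) * v i = B $$ (i, p i)] (mod l)" if "i \<in> Y" for i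
    proof -
      have i: "i < n" using that by (simp add: Y_def)
      have "[c (p i) * (A $$ (i, p i) * v i) = c (p i) * B $$ (i, p i)] (mod m)"
        using AB[OF i pn[OF i]] v[OF that] by (simp add: mult_ac)
      from cancel[OF this c(1)[OF pn[OF i]] c(2)[OF pn[OF i]]] show ?thesis .
    qed
    have "(\<Prod>i = 0..<n. c (p i)) = (\<Prod>i = 0..<n. c i)"
      using prod.permute[OF p, of c] by (simp add: comp_def)
    then have "(prod c X * prod u X) * (\<Prod>i\<in>Y. c (p i)) = prod c X * ((\<Prod>i\<in>Y. c (p i)) * prod v Y)"
      unfolding split using u v by (simp add: prod.distrib[symmetric])
    moreover have "prod c X \<noteq> 0" "(\<Prod>i\<in>Y. c (p i)) \<noteq> 0"
      unfolding prod_zero_iff[OF XY(3)] prod_zero_iff[OF XY(4)]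
      using c(1) c(1)[OF pn] by (force simp: X_def, force simp: Y_def)
    ultimately have uv: "prod u X = prod v Y" by simp
    have "[(\<Prod>i\<in>X. A $$ (i, p i)) * (\<Prod>i\<in>Y. A $$ (i, p i)) =
        (\<Prod>i\<in>X. B $$ (i, p i) * u i) * (\<Prod>i\<in>Y. A $$ (i, p i))] (mod l)"
      by (intro cong_mult cong_prod 1 cong_refl)
    also have "(\<Prod>i\<in>X. B $$ (i, p i) * u i) * (\<Prod>i\<in>Y. A $$ (i, p i)) =
       (\<Prod>i\<in>X. B $$ (i, p i)) * (\<Prod>i\<in>Y. A $$ (i, p i) * v i)"
      by (simp add: prod.distrib uv mult_ac)
    also have "[\<dots> = (\<Prod>i\<in>X. B $$ (i, p i)) * (\<Prod>i\<in>Y. B $$ (i, p i))] (mod l)"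
      by (intro cong_mult cong_prod 2 cong_refl)
    finally show ?thesis unfolding split .
  qed
  then show ?thesis unfolding det_def'[OF A] det_def'[OF B]
    by (intro cong_sum cong_mult cong_refl) auto
qed

lemma cong_inverse_mat:
  assumes g: "g \<in> carrier_mat n n" and cop: "coprime (det g) (int m)"
  obtains w where "w \<in> carrier_mat n n" "mcong m n (w * g) (1\<^sub>m n)" "mcong m n (g * w) (1\<^sub>m n)"
proof -
  obtain x where x: "[det g * x = 1] (mod int m)" using cong_solve_coprime_int[OF cop] by blast
  have a: "adj_mat g \<in> carrier_mat n n" "g * adj_mat g = det g \<cdot>\<^sub>m 1\<^sub>m n" "adj_mat g * g = det g \<cdot>\<^sub>m 1\<^sub>m n"
    using adj_mat[OF g] by auto
  let ?w = "x \<cdot>\<^sub>m adj_mat g"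
  have "?w * g = x \<cdot>\<^sub>m (det g \<cdot>\<^sub>m 1\<^sub>m n)" using mult_smult_assoc_mat[OF a(1) g] a(3) by simp
  moreover have "g * ?w = x \<cdot>\<^sub>m (det g \<cdot>\<^sub>m 1\<^sub>m n)" using mult_smult_distrib[OF g a(1)] a(2) by simp
  moreover have "mcong m n (x \<cdot>\<^sub>m (det g \<cdot>\<^sub>m 1\<^sub>m n)) (1\<^sub>m n)"
    using x by (auto simp: mcong_def mult.commute)
  ultimately show thesis using that[of ?w] a(1) by simp
qed

text \<open>Write \<open>N = J * H\<close> with \<open>J\<close> the unimodular standard form and
  \<open>H\<close> diagonal. The stabiliser equation becomes \<open>H * gt = k * H\<close> modulo
  \<open>m\<close>, where \<open>k\<close> is conjugate by \<open>J\<close> to the inverse of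
  \<open>g\<close>. Hence \<open>det g\<close> and its inverse agree modulo \<open>m / h s\<close>,
  and multiplication by \<open>h s\<close> gives the claim modulo \<open>m\<close>.\<close>

lemma det_stabilizer_square:
  assumes g: "g \<in> carrier_mat n n" "coprime (det g) (int m)"
    and h: "divisor_chain m n s h" "2 * s = n" "0 < s"
    and st: "mcong m n (g * N_mat n s h * transpose_mat g) (N_mat n s h)"
  shows "[(det g)\<^sup>2 * h s = h s] (mod int m)"
proof -
  have s2: "2 * s \<le> n" using h by simp
  define J where "J = N_mat n s (\<lambda>_. 1)"
  define c where "c i = h (i div 2 + 1)" for i
  define H where "H = mat_diag n c"
  define N where "N = N_mat n s h"
  have N: "N \<in> carrier_mat n n" "alt_mat n N" unfolding N_def using N_mat_carrier N_mat_alt s2 by auto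
  have J: "J \<in> carrier_mat n n" "alt_mat n J" unfolding J_def using N_mat_carrier N_mat_alt s2 by auto
  have H: "H \<in> carrier_mat n n" by (simp add: H_def)
  define Jt where "Jt = transpose_mat J"
  have Jt: "Jt \<in> carrier_mat n n" using J by (simp add: Jt_def)
  have NJH: "N = J * H"
    unfolding H_def mat_diag_mult_right[OF J(1)]
    by (rule eq_matI) (auto simp: N_def J_def N_mat_entries[OF s2] c_def)
  have JJ: "Jt * J = 1\<^sub>m n"
  proof (rule eq_matI)
    fix i j assume "i < dim_row (1\<^sub>m n :: int mat)" "j < dim_col (1\<^sub>m n :: int mat)"
    then have ij: "i < n" "j < n" by auto
    \<comment> \<open>The partner of \<open>i\<close> in its block carries the only nonzero entry of
      column \<open>i\<close> of \<open>J\<close>, so \<open>Jt * J\<close> reduces to a single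
      product.\<close>
    define i' where "i' = (if even i then i + 1 else i - 1)"
    have i': "i' < n" "i' div 2 = i div 2" "i' \<noteq> i"
    proof -
      obtain a where a: "i = 2 * a \<or> i = 2 * a + 1" by (metis oddE evenE)
      then show "i' < n" "i' div 2 = i div 2" "i' \<noteq> i" using h(2) ij by (auto simp: i'_def)
    qed
    have lt: "k div 2 < s" if "k < n" for k using that h(2) by auto
    have Jz: "J $$ (k,l) = 0" if "k < n" "l < n" "\<not> (k div 2 = l div 2 \<and> k \<noteq> l)" for k l
      using that by (auto simp: J_def N_mat_entries[OF s2])
    have un: "k = i'" if "k div 2 = i div 2" "k \<noteq> i" for k
    proof -
      have *: "i = 2 * (i div 2) + i mod 2" "k = 2 * (k div 2) + k mod 2" "i mod 2 < 2" "k mod 2 < 2" by auto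
      show ?thesis
      proof (cases "even i")
        case True
        then have "i mod 2 = 0" by presburger
        then have "k = i + 1" using * that by linarith
        then show ?thesis using True by (simp add: i'_def)
      next
        case False
        then have "i mod 2 = 1" by presburger
        then have "k + 1 = i" using * that by linarith
        then show ?thesis using False by (simp add: i'_def)
      qed
    qed
    have "(Jt * J) $$ (i,j) = (\<Sum>k<n. J $$ (k,i) * J $$ (k,j))"
      using mult_mat_entry[OF Jt J(1) ij] ij J by (simp add: Jt_def)
    also have "\<dots> = (\<Sum>k\<in>{i'}. J $$ (k,i) * J $$ (k,j))"
    proof (rule sum.mono_neutral_right)
      show "\<forall>k\<in>{..<n} - {i'}. J $$ (k,i) * J $$ (k,j) = 0"
      proof
        fix k assume "k \<in> {..<n} - {i'}"
        then have "J $$ (k,i) = 0" using un[of k] by (intro Jz ij) auto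
        then show "J $$ (k,i) * J $$ (k,j) = 0" by simp
      qed
    qed (use i' in auto)
    also have "\<dots> = J $$ (i',i) * J $$ (i',j)" by simp
    also have "\<dots> = 1\<^sub>m n $$ (i,j)"
    proof (cases "i = j")
      case True
      then show ?thesis using ij i' lt by (auto simp: J_def N_mat_entries[OF s2])
    next
      case False
      have "J $$ (i',j) = 0"
      proof (rule Jz[OF i'(1) ij(2)])
        show "\<not> (i' div 2 = j div 2 \<and> i' \<noteq> j)" using un[of j] i' False by auto
      qed
      then show ?thesis using False ij by simp
    qed
    finally show "(Jt * J) $$ (i,j) = 1\<^sub>m n $$ (i,j)" .
  qed (use J Jt in auto)
  obtain w where w: "w \<in> carrier_mat n n" "mcong m n (w * g) (1\<^sub>m n)" "mcong m n (g * w) (1\<^sub>m n)"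
    using cong_inverse_mat[OF g] .
  define gt where "gt = transpose_mat g"
  have gt: "gt \<in> carrier_mat n n" using g by (simp add: gt_def)
  define k where "k = Jt * w * J"
  have k: "k \<in> carrier_mat n n" using Jt w J by (simp add: k_def)
  note as = assoc_mult_mat[of _ n n _ n _ n]
  \<comment> \<open>Multiply the stabiliser equation from the left by \<open>Jt * w\<close>:
    \<open>w\<close> cancels \<open>g\<close> and \<open>Jt\<close> cancels
    \<open>J\<close>.\<close>
  have cong: "mcong m n (H * gt) (k * H)"
  proof -
    have "mcong m n (g * N * gt) N" using st by (simp add: N_def gt_def)
    then have "mcong m n ((Jt * w) * (g * N * gt)) ((Jt * w) * N)"
      by (intro mcong_mult mcong_refl) (use Jt w in auto)
    moreover have "(Jt * w) * (g * N * gt) = (Jt * (w * g)) * (N * gt)"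
      using Jt w(1) g(1) N(1) gt by (simp add: as)
    moreover have "mcong m n ((Jt * (w * g)) * (N * gt)) ((Jt * 1\<^sub>m n) * (N * gt))"
      by (intro mcong_mult mcong_refl w(2)) (use Jt N gt in auto)
    moreover have "(Jt * 1\<^sub>m n) * (N * gt) = (Jt * J) * (H * gt)"
      using Jt J(1) H gt N(1) unfolding NJH by (simp add: as)
    moreover have "(Jt * J) * (H * gt) = H * gt" unfolding JJ using H gt by simp
    moreover have "(Jt * w) * N = k * H" unfolding NJH k_def using Jt w(1) J(1) H by (simp add: as)
    ultimately show ?thesis by (metis mcong_sym mcong_trans)
  qed
  have hpos: "\<And>i. 1 \<le> i \<Longrightarrow> i \<le> s \<Longrightarrow> 0 < h i \<and> h i dvd int m"
    and hch: "\<forall>i\<in>{1..<s}. h i dvd h (i + 1)" using h(1) by (auto simp: divisor_chain_def)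
  have ct: "i div 2 + 1 \<le> s" if "i < n" for i using that h(2) by auto
  obtain l where l: "int m = h s * l" using hpos[of s] h(3) by auto
  have "[det gt = det k] (mod l)"
  proof (rule det_quasi_conjugate[OF gt k, where c = c and e = "h s" and m = "int m"])
    fix i assume "i < n"
    then show "c i > 0" "c i dvd h s"
      using hpos[of "i div 2 + 1"] ct[of i] dvd_chain[OF hch, of "i div 2 + 1" s] by (auto simp: c_def)
  next
    fix i j :: nat assume "i \<le> j" "j < n"
    then show "c i dvd c j"
      using dvd_chain[OF hch, of "i div 2 + 1" "j div 2 + 1"] ct[of j] div_le_mono[of i j 2] by (auto simp: c_def)
  next
    fix i j assume ij: "i < n" "j < n"
    have "(H * gt) $$ (i,j) = c i * gt $$ (i,j)" "(k * H) $$ (i,j) = k $$ (i,j) * c j"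
      unfolding H_def mat_diag_mult_left[OF gt] mat_diag_mult_right[OF k] using ij by auto
    then show "[c i * gt $$ (i,j) = k $$ (i,j) * c j] (mod int m)" using mcongD[OF cong ij] by simp
  qed (use l hpos[of s] h(3) in auto)
  moreover have "det gt = det g" unfolding gt_def by (rule det_transpose[OF g(1)])
  moreover have "det k = det w"
  proof -
    have "det Jt * det J = 1" using det_mult[OF Jt J(1)] JJ by simp
    then show ?thesis unfolding k_def using det_mult[of "Jt * w" n J] det_mult[OF Jt w(1)] Jt w(1) J(1)
      by (simp add: mult_ac)
  qed
  moreover have "[det w * det g = 1] (mod l)"
  proof -
    have "[det (w * g) = det (1\<^sub>m n)] (mod int m)" by (rule mcong_det[OF w(2)])
    then show ?thesis using det_mult[OF w(1) g(1)] l by (metis cong_dvd_modulus det_one dvd_triv_right)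
  qed
  ultimately have "[det g * det g = 1] (mod l)"
    by (metis cong_scalar_right cong_trans)
  then have "h s * l dvd h s * (det g * det g - 1)"
    by (intro mult_dvd_mono) (simp_all add: cong_iff_dvd_diff)
  then have "[h s * (det g)\<^sup>2 = h s * 1] (mod h s * l)"
    by (simp add: cong_iff_dvd_diff right_diff_distrib power2_eq_square)
  then show ?thesis unfolding l by (simp add: mult.commute)
qed

text \<open>By the adjugate, invertibility over \<int>/(m) is coprimality of the determinant to
  \<open>m\<close>; this removes the inverse matrix and the residues from the definition.\<close>

lemma D_group_iff:
  assumes s: "2 * s \<le> n"
  shows "x \<in> D_group m n s h \<longleftrightarrow> (\<exists>g\<in>carrier_mat n n. coprime (det g) (int m) \<and>
     mcong m n (g * N_mat n s h * transpose_mat g) (N_mat n s h) \<and> x = det g mod int m)"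
proof -
  have GL: "g \<in> GL_mod m n \<longleftrightarrow> g \<in> carrier_mat n n \<and> coprime (det g) (int m)" for g
  proof
    assume "g \<in> GL_mod m n"
    then obtain g' where g: "g \<in> carrier_mat n n" "g' \<in> carrier_mat n n" "mat_mod m (g * g') = mat_mod m (1\<^sub>m n)"
      unfolding GL_mod_def by blast
    then have "mcong m n (g * g') (1\<^sub>m n)" by (subst (asm) mcong_mat_mod) auto
    from mcong_det[OF this] have "[det g * det g' = 1] (mod int m)" using det_mult[OF g(1,2)] by simp
    then show "g \<in> carrier_mat n n \<and> coprime (det g) (int m)"
      using g(1) coprime_iff_invertible_int by blast
  next
    assume g: "g \<in> carrier_mat n n \<and> coprime (det g) (int m)"
    then obtain w where w: "w \<in> carrier_mat n n" "mcong m n (w * g) (1\<^sub>m n)" "mcong m n (g * w) (1\<^sub>m n)"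
      using cong_inverse_mat by blast
    then have "mat_mod m (w * g) = mat_mod m (1\<^sub>m n)" "mat_mod m (g * w) = mat_mod m (1\<^sub>m n)"
      using mcong_mat_mod[OF mult_carrier_mat[OF w(1) conjunct1[OF g]] one_carrier_mat, of m]
        mcong_mat_mod[OF mult_carrier_mat[OF conjunct1[OF g] w(1)] one_carrier_mat, of m] w by simp_all
    then show "g \<in> GL_mod m n" using g w(1) unfolding GL_mod_def by blast
  qed
  have st: "mat_mod m (g * N_mat n s h * transpose_mat g) = mat_mod m (N_mat n s h) \<longleftrightarrow>
     mcong m n (g * N_mat n s h * transpose_mat g) (N_mat n s h)" if "g \<in> carrier_mat n n" for g
    by (rule mcong_mat_mod[OF conj_carrier[OF that] ]) (use N_mat_carrier[OF s] in auto)
  show ?thesis unfolding D_group_def using GL st by auto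
qed

lemma N_mat_scale_last:
  assumes s: "2 * s = n" "0 < s"
  shows "mat_diag n (\<lambda>i. if i = n - 1 then y else 1) * N_mat n s (h(s := x)) *
      transpose_mat (mat_diag n (\<lambda>i. if i = n - 1 then y else 1)) = N_mat n s (h(s := y * x))"
    (is "?T * ?N * _ = _")
proof (rule eq_matI)
  have s2: "2 * s \<le> n" using s by simp
  fix i j assume "i < dim_row (N_mat n s (h(s := y * x)))" "j < dim_col (N_mat n s (h(s := y * x)))"
  then have ij: "i < n" "j < n" using N_mat_carrier[OF s2, of "h(s := y * x)"] by auto
  have "(?T * ?N * transpose_mat ?T) $$ (i,j) = (if i = n - 1 then y else 1) * (if j = n - 1 then y else 1) * ?N $$ (i,j)"
    by (rule mat_diag_conj_entry[OF N_mat_carrier[OF s2] ij])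
  also have "\<dots> = N_mat n s (h(s := y * x)) $$ (i,j)"
  proof (cases "i div 2 = j div 2 \<and> i div 2 < s \<and> i \<noteq> j")
    case False
    then have "N_mat n s k $$ (i,j) = 0" for k
      using ij by (auto simp: N_mat_entries[OF s2])
    then show ?thesis by simp
  next
    case True
    define a where "a = i div 2"
    have a: "a < s" "2 * a \<noteq> n - 1" "2 * a + 1 = n - 1 \<longleftrightarrow> a + 1 = s" using True s by (auto simp: a_def)
    have "i = 2*a + i mod 2" "j = 2*a + j mod 2" "i mod 2 < 2" "j mod 2 < 2" "i \<noteq> j"
      using True mult_div_mod_eq[of 2 i] mult_div_mod_eq[of 2 j] unfolding a_def by linarith+
    then have "(i = 2*a \<and> j = 2*a+1) \<or> (i = 2*a+1 \<and> j = 2*a)" by linarith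
    then show ?thesis using ij a by (elim disjE) (simp_all add: N_mat_entries[OF s2])
  qed
  finally show "(?T * ?N * transpose_mat ?T) $$ (i,j) = N_mat n s (h(s := y * x)) $$ (i,j)" .
next
  have s2: "2 * s \<le> n" using s by simp
  show "dim_row (?T * ?N * transpose_mat ?T) = dim_row (N_mat n s (h(s := y * x)))"
    "dim_col (?T * ?N * transpose_mat ?T) = dim_col (N_mat n s (h(s := y * x)))"
    using N_mat_carrier[OF s2, of "h(s := y * x)"] by (auto simp: mat_diag_def)
qed

text \<open>With \<open>T y\<close> the diagonal matrix scaling the last coordinate by
  \<open>y\<close>, the form with parameter \<open>z\<close> is the transform of the basic form by
  \<open>T z\<close>. A unimodular \<open>U\<close> between two parameters thus yields the
  stabiliser element \<open>T w * U * T z'\<close>, \<open>w\<close> inverse to \<open>z\<close>, of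
  determinant \<open>z' / z\<close> up to sign. Conversely \<open>T z * g * T w'\<close> has
  determinant 1 or -1 modulo \<open>m\<close> exactly when the coset condition holds, and then it
  lifts.\<close>

lemma congr_scaled_iff:
  assumes m: "m > 0" and s: "2 * s = n" "0 < s"
    and z: "coprime z (int m)" "coprime z' (int m)"
  shows "congr m n (N_mat n s (h(s := z * h s))) (N_mat n s (h(s := z' * h s))) \<longleftrightarrow>
     (\<exists>d\<in>D_group m n s h. [z' = z * d] (mod int m) \<or> [z' = - (z * d)] (mod int m))"
proof -
  define T where "T y = mat_diag n (\<lambda>i. if i = n - 1 then y else (1::int))" for y
  have s2: "2 * s \<le> n" using s by simp
  have T: "T y \<in> carrier_mat n n" for y by (simp add: T_def)
  have dT: "det (T y) = y" for y
    unfolding T_def det_mat_diag using s by (simp add: prod.delta)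
  define N where "N y = N_mat n s (h(s := y * h s))" for y
  have N: "N y \<in> carrier_mat n n" for y unfolding N_def by (rule N_mat_carrier[OF s2])
  have N1: "N 1 = N_mat n s h" by (simp add: N_def)
  have TN: "T y * N x * transpose_mat (T y) = N (y * x)" for x y
    unfolding T_def N_def using N_mat_scale_last[OF s, where y = y and x = "x * h s"] by (simp add: mult.assoc)
  have Ncong: "mcong m n (N x) (N y)" if "[x = y] (mod int m)" for x y
    unfolding N_def using that by (intro N_mat_cong[OF s2]) (auto intro: cong_mult)
  have inv: "\<exists>w. [w * z = 1] (mod int m)" if "coprime z (int m)" for z
    using cong_solve_coprime_int[OF that] by (auto simp: mult.commute)
  obtain w where w: "[w * z = 1] (mod int m)" using inv[OF z(1)] by blast
  obtain w' where w': "[w' * z' = 1] (mod int m)" using inv[OF z(2)] by blast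
  have "congr m n (N z) (N z') \<longleftrightarrow>
     (\<exists>d\<in>D_group m n s h. [z' = z * d] (mod int m) \<or> [z' = - (z * d)] (mod int m))"
  proof
    assume "congr m n (N z) (N z')"
    then have "congr m n (N z') (N z)" using congr_sym N by blast
    then obtain U where U: "unimod n U" "mcong m n (U * N z' * transpose_mat U) (N z)"
      unfolding congr_def by blast
    have Uc: "U \<in> carrier_mat n n" by (rule unimod_carrier[OF U(1)])
    define g where "g = T w * (U * T z')"
    have UT: "U * T z' \<in> carrier_mat n n" using Uc T by auto
    have g: "g \<in> carrier_mat n n" unfolding g_def by (rule mult_carrier_mat[OF T UT])
    have "g * N 1 * transpose_mat g = T w * (U * (T z' * N 1 * transpose_mat (T z')) * transpose_mat U) * transpose_mat (T w)"
      unfolding g_def conj_conj[OF Uc T N] conj_conj[OF T UT N] ..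
    also have "\<dots> = T w * (U * N z' * transpose_mat U) * transpose_mat (T w)" unfolding TN by simp
    finally have "mcong m n (g * N 1 * transpose_mat g) (T w * N z * transpose_mat (T w))"
      using mcong_conj[OF mcong_refl[OF T] U(2)] by simp
    also have "T w * N z * transpose_mat (T w) = N (w * z)" by (rule TN)
    also have "mcong m n (N (w * z)) (N 1)" by (rule Ncong[OF w])
    finally have gst: "mcong m n (g * N 1 * transpose_mat g) (N 1)" .
    have dg: "det g = w * (det U * z')"
      unfolding g_def using det_mult[OF T UT] det_mult[OF Uc T] dT by simp
    have dU: "det U = 1 \<or> det U = -1" using U(1) by (auto simp: unimod_def abs_if split: if_splits)
    have cw: "coprime w (int m)" using w coprime_iff_invertible_int by blast
    have "coprime (det g) (int m)" unfolding dg using cw z(2) dU by auto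
    then have "det g mod int m \<in> D_group m n s h"
      unfolding D_group_iff[OF s2] using g gst unfolding N1 by blast
    moreover have "[z' = z * (det g mod int m)] (mod int m) \<or> [z' = - (z * (det g mod int m))] (mod int m)"
    proof -
      have "[w * z * z' = 1 * z'] (mod int m)" by (rule cong_mult[OF w cong_refl])
      then have 1: "[z' = z * (w * z')] (mod int m)" by (simp add: cong_sym mult_ac)
      have 2: "[z * det g = z * (det g mod int m)] (mod int m)" by (intro cong_mult cong_refl) (simp add: cong_def)
      from dU show ?thesis
      proof
        assume "det U = 1"
        then have "det g = w * z'" by (simp add: dg)
        then show ?thesis using cong_trans[OF 1] 2 by simp
      next
        assume "det U = -1"
        then have "w * z' = - det g" by (simp add: dg)
        then have "[z' = - (z * det g)] (mod int m)" using 1 by simp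
        then show ?thesis using 2 cong_trans cong_minus_minus_iff by blast
      qed
    qed
    ultimately show "\<exists>d\<in>D_group m n s h. [z' = z * d] (mod int m) \<or> [z' = - (z * d)] (mod int m)" by blast
  next
    assume "\<exists>d\<in>D_group m n s h. [z' = z * d] (mod int m) \<or> [z' = - (z * d)] (mod int m)"
    then obtain d where d: "d \<in> D_group m n s h" "[z' = z * d] (mod int m) \<or> [z' = - (z * d)] (mod int m)" by blast
    then obtain g where g: "g \<in> carrier_mat n n" "coprime (det g) (int m)"
      "mcong m n (g * N 1 * transpose_mat g) (N 1)" "d = det g mod int m"
      unfolding D_group_iff[OF s2] N1 by blast
    define f where "f = T z * (g * T w')"
    have gT: "g * T w' \<in> carrier_mat n n" using g T by auto
    have f: "f \<in> carrier_mat n n" unfolding f_def by (rule mult_carrier_mat[OF T gT])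
    have "f * N z' * transpose_mat f = T z * (g * N (w' * z') * transpose_mat g) * transpose_mat (T z)"
      unfolding f_def TN[symmetric] conj_conj[OF g(1) T N] conj_conj[OF T gT N] ..
    also have "mcong m n \<dots> (T z * (g * N 1 * transpose_mat g) * transpose_mat (T z))"
      by (intro mcong_conj mcong_refl T g(1) Ncong w')
    also have "mcong m n \<dots> (T z * N 1 * transpose_mat (T z))"
      by (intro mcong_conj mcong_refl T g(3))
    also have "T z * N 1 * transpose_mat (T z) = N z" unfolding TN by simp
    finally have fN: "mcong m n (f * N z' * transpose_mat f) (N z)" .
    have df: "det f = z * det g * w'"
      unfolding f_def using det_mult[OF T gT] det_mult[OF g(1) T] dT by simp
    have zd: "[z * d = z * det g] (mod int m)" unfolding g(4) by (intro cong_mult cong_refl) (simp add: cong_def)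
    have "[det f = 1] (mod int m) \<or> [det f = -1] (mod int m)"
      using d(2)
    proof
      assume "[z' = z * d] (mod int m)"
      then have "[z' * w' = z * det g * w'] (mod int m)" using zd by (intro cong_mult cong_refl) (rule cong_trans)
      then show ?thesis unfolding df using w' by (metis cong_sym cong_trans mult.commute)
    next
      assume "[z' = - (z * d)] (mod int m)"
      then have "[z' = - (z * det g)] (mod int m)" using zd cong_minus_minus_iff cong_trans by blast
      then have "[- z' = z * det g] (mod int m)" using cong_minus_minus_iff by fastforce
      then have "[- z' * w' = z * det g * w'] (mod int m)" by (intro cong_mult cong_refl)
      moreover have "[- (w' * z') = -1] (mod int m)" using w' cong_minus_minus_iff by blast
      ultimately show ?thesis unfolding df by (metis cong_sym cong_trans mult.commute mult_minus_left)
    qed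
    then obtain U where U: "unimod n U" "mcong m n U f" using unimod_lift[OF f] by blast
    have "mcong m n (U * N z' * transpose_mat U) (N z)"
      using mcong_trans[OF mcong_conj[OF U(2) mcong_refl[OF N]] fN] .
    then show "congr m n (N z) (N z')" using congrI[OF U(1)] congr_sym N by blast
  qed
  then show ?thesis by (simp add: N_def)
qed

section \<open>Congruence of standard forms in terms of the data\<close>

lemma coprime_complement_gcd:
  fixes h m z :: int
  assumes "h dvd m" "h > 0" "m > 0"
  shows "gcd (z * h) m = h \<longleftrightarrow> coprime z (m div h)"
proof -
  obtain l where l: "m = h * l" using assms(1) by blast
  have "gcd (z * h) m = h * gcd z l" using assms(2) by (simp add: l gcd_mult_left mult.commute[of z])
  then show ?thesis using assms(2) by (simp add: l coprime_iff_gcd_eq_1)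
qed

text \<open>The arithmetic content of \<open>torus_data\<close>: the condition on the order of a
  power of \<open>q\<close> is expressed by a gcd, and the chain starts at index 1.\<close>

definition standard_data :: "nat \<Rightarrow> nat \<Rightarrow> nat \<Rightarrow> (nat \<Rightarrow> int) \<Rightarrow> nat \<Rightarrow> bool" where
  "standard_data m n s h z \<longleftrightarrow> divisor_chain m n s h \<and> (s = 0 \<longleftrightarrow> m = 1) \<and> h 1 = 1 \<and>
     (if 0 < s \<and> 2 * s = n then 1 \<le> z \<and> gcd (int z * h s) (int m) = h s else z = 1)"

lemma D_group_one: "2 * s \<le> n \<Longrightarrow> m > 0 \<Longrightarrow> 1 mod int m \<in> D_group m n s h"
  unfolding D_group_iff
  by (rule bexI[of _ "1\<^sub>m n"]) (use N_mat_carrier[of s n h] in \<open>auto intro!: mcong_refl\<close>)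

text \<open>The witness is multiplied by the diagonal matrix rescaling the last coordinate by \<open>u\<close>, which
  stabilises the form because \<open>u h s \<equiv> h s\<close>.\<close>

lemma D_group_absorb:
  assumes m: "m > 0" and s: "2 * s = n" "0 < s" and h: "divisor_chain m n s h"
    and u: "coprime u (int m)" "[u = 1] (mod (int m div h s))" and d: "d \<in> D_group m n s h"
  shows "(u * d) mod int m \<in> D_group m n s h"
proof -
  have s2: "2 * s \<le> n" using s by simp
  obtain g where g: "g \<in> carrier_mat n n" "coprime (det g) (int m)"
    "mcong m n (g * N_mat n s h * transpose_mat g) (N_mat n s h)" "d = det g mod int m"
    using d unfolding D_group_iff[OF s2] by blast
  define T where "T = mat_diag n (\<lambda>i. if i = n - 1 then u else (1::int))"
  have T: "T \<in> carrier_mat n n" by (simp add: T_def)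
  have dT: "det T = u" unfolding T_def det_mat_diag using s by (simp add: prod.delta)
  have N: "N_mat n s h \<in> carrier_mat n n" by (rule N_mat_carrier[OF s2])
  have hs: "h s > 0" "h s dvd int m" using h s by (auto simp: divisor_chain_def)
  have "[u * h s = h s] (mod int m)"
  proof -
    have "int m div h s dvd u - 1" using u(2) by (simp add: cong_iff_dvd_diff)
    then have "h s * (int m div h s) dvd h s * (u - 1)" by (rule mult_dvd_mono[OF dvd_refl])
    then show ?thesis using hs by (simp add: cong_iff_dvd_diff algebra_simps)
  qed
  then have c: "mcong m n (N_mat n s (h(s := u * h s))) (N_mat n s h)"
    by (intro N_mat_cong[OF s2]) auto
  have "T * N_mat n s h * transpose_mat T = N_mat n s (h(s := u * h s))"
    using N_mat_scale_last[OF s, of u h "h s"] by (simp add: T_def)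
  then have "mcong m n ((T * g) * N_mat n s h * transpose_mat (T * g)) (N_mat n s (h(s := u * h s)))"
    using mcong_conj[OF mcong_refl[OF T] g(3)] conj_conj[OF T g(1) N] by simp
  from mcong_trans[OF this c]
  have "mcong m n ((T * g) * N_mat n s h * transpose_mat (T * g)) (N_mat n s h)" .
  moreover have "det (T * g) = u * det g" using det_mult[OF T g(1)] dT by simp
  moreover have "coprime (u * det g) (int m)" using u(1) g(2) by simp
  moreover have "(u * d) mod int m = (u * det g) mod int m" unfolding g(4) by (simp add: mod_mult_right_eq)
  moreover have "T * g \<in> carrier_mat n n" using T g(1) by (rule mult_carrier_mat)
  ultimately show ?thesis unfolding D_group_iff[OF s2] by (intro bexI[of _ "T * g"]) auto
qed

text \<open>Since \<open>h s * l = m\<close>, the form depends on \<open>z\<close> only modulo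
  \<open>l\<close>. This allows \<open>z\<close> and \<open>z'\<close> to be replaced by units
  modulo \<open>m\<close>, for which the scaled criterion is available; the passage between the
  moduli \<open>l\<close> and \<open>m\<close> costs a unit congruent to 1 modulo \<open>l\<close>,
  which the stabiliser absorbs.\<close>

lemma standard_forms_congruent_iff:
  assumes m: "m > 0" and S: "standard_data m n s h z" and S': "standard_data m n s' h' z'"
  defines "l \<equiv> int m div (if s = 0 then 1 else h s)"
  shows "congr m n (N_mat n s (h(s := int z * h s))) (N_mat n s' (h'(s' := int z' * h' s'))) \<longleftrightarrow>
      s = s' \<and> (\<forall>i\<in>{2..s}. h i = h' i) \<and>
      (\<exists>d\<in>D_group m n s h. [int z' = int z * d] (mod l) \<or> [int z' = - (int z * d)] (mod l))"
    (is "?C \<longleftrightarrow> ?E \<and> ?H \<and> ?D l")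
    and "coprime z m \<Longrightarrow> coprime z' m \<Longrightarrow>
      congr m n (N_mat n s (h(s := int z * h s))) (N_mat n s' (h'(s' := int z' * h' s'))) \<longleftrightarrow>
      s = s' \<and> (\<forall>i\<in>{2..s}. h i = h' i) \<and>
      (\<exists>d\<in>D_group m n s h. [int z' = int z * d] (mod int m) \<or> [int z' = - (int z * d)] (mod int m))"
    and "congr m n (N_mat n s (h(s := int z * h s))) (N_mat n s' (h'(s' := int z' * h' s'))) \<Longrightarrow>
      0 < s \<Longrightarrow> [(int z)\<^sup>2 * h s = (int z')\<^sup>2 * h s] (mod int m)"
proof -
  have ch: "divisor_chain m n s h" "divisor_chain m n s' h'" using S S' by (auto simp: standard_data_def)
  have s2: "2 * s \<le> n" "2 * s' \<le> n" using ch by (auto simp: divisor_chain_def)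
  have g: "gcd ((h(s := int z * h s)) i) (int m) = h i" if "standard_data m n s h z" "1 \<le> i" "i \<le> s" for s h z i
  proof -
    have "h i dvd int m" "h i > 0" using that by (auto simp: standard_data_def divisor_chain_def)
    then have "gcd (h i) (int m) = h i" by (simp add: gcd_proj1_if_dvd_int)
    then show ?thesis using that by (cases "i = s") (auto simp: standard_data_def split: if_splits)
  qed
  have l_dvd: "l dvd int m"
  proof (cases "s = 0")
    case True then show ?thesis by (simp add: l_def)
  next
    case False
    then have "h s dvd int m" using ch(1) by (auto simp: divisor_chain_def)
    then have "int m = h s * l" using False by (simp add: l_def)
    then show ?thesis by simp
  qed
  have C_imp: "?E \<and> ?H" if ?C
    using normal_form_unique[OF m ch(1) g[OF S] ch(2) g[OF S'] that] by auto
  have scaled: "[u * h s = v * h s] (mod int m)" if "[u = v] (mod l)" "0 < s" for u v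
  proof -
    have "h s * l dvd h s * (u - v)" using that(1) by (intro mult_dvd_mono) (auto simp: cong_iff_dvd_diff)
    moreover have "h s * l = int m" using ch(1) that(2) by (auto simp: l_def divisor_chain_def)
    ultimately show ?thesis by (simp add: cong_iff_dvd_diff algebra_simps)
  qed
  have "(?C \<longleftrightarrow> ?E \<and> ?H \<and> ?D l) \<and>
      (coprime z m \<longrightarrow> coprime z' m \<longrightarrow> (?C \<longleftrightarrow> ?E \<and> ?H \<and> ?D (int m))) \<and>
      (?C \<and> 0 < s \<longrightarrow> [(int z)\<^sup>2 * h s = (int z')\<^sup>2 * h s] (mod int m))"
  proof (cases "?E \<and> ?H")
    case False
    then show ?thesis using C_imp by blast
  next
    case True
    then have ss: "s' = s" and hh: "\<forall>i\<in>{2..s}. h i = h' i" by auto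
    have hi: "h' i = h i" if "1 \<le> i" "i \<le> s" for i
      using hh that S S' by (cases "i = 1") (auto simp: standard_data_def)
    have N': "N_mat n s' (h'(s' := int z' * h' s')) = N_mat n s (h(s := int z' * h s))"
      unfolding ss N_mat_entries[OF s2(1)] using hi by (auto intro!: eq_matI)
    show ?thesis
    proof (cases "0 < s \<and> 2 * s = n")
      case False
      then have z: "z = 1" "z' = 1" using S S' ss by (auto simp: standard_data_def split: if_splits)
      \<comment> \<open>Here \<open>z = z' = 1\<close>, so the two forms coincide, and the
        determinant of the identity witnesses the coset condition for every modulus in
        question.\<close>
      have ?C unfolding N' unfolding z by (rule congr_mcong[OF mcong_refl[OF N_mat_carrier[OF s2(1)]]])
      moreover have "?D k" if "k dvd int m" for k
      proof (rule bexI[OF disjI1 D_group_one[OF s2(1) m]])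
        have "[1 = 1 mod int m] (mod int m)" by (simp add: cong_def)
        then show "[int z' = int z * (1 mod int m)] (mod k)"
          using cong_dvd_modulus[OF _ that] z by simp
      qed
      moreover note l_dvd
      ultimately show ?thesis using True z by auto
    next
      case sn: True
      then have s0: "0 < s" and n: "2 * s = n" by auto
      have hs: "h s > 0" "h s dvd int m" using ch(1) s0 by (auto simp: divisor_chain_def)
      have l: "l = int m div h s" "l dvd int m" using s0 l_dvd by (auto simp: l_def)
      have cl: "coprime (int z) l" "coprime (int z') l"
        using S S' sn ss hi[of s] coprime_complement_gcd[OF hs(2,1)] m
        by (auto simp: standard_data_def l(1) split: if_splits)
      \<comment> \<open>The last clause keeps \<open>x\<close> itself when it is already a unit
        modulo \<open>m\<close>; it is what yields the version modulo \<open>m\<close> for the given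
        \<open>z\<close> and \<open>z'\<close>.\<close>
      have lift: "\<exists>y. coprime y (int m) \<and> [y = int x] (mod l) \<and> (coprime x m \<longrightarrow> y = int x)"
        if x: "coprime (int x) l" for x
      proof -
        obtain y where "coprime y (int m)" "[y = int x] (mod l)"
          using coprime_lift[OF l(2) _ x] m by auto
        then show ?thesis by (cases "coprime x m") (auto intro: exI[of _ "int x"])
      qed
      obtain y where y: "coprime y (int m)" "[y = int z] (mod l)" "coprime z m \<Longrightarrow> y = int z"
        using lift[OF cl(1)] by blast
      obtain y' where y': "coprime y' (int m)" "[y' = int z'] (mod l)" "coprime z' m \<Longrightarrow> y' = int z'"
        using lift[OF cl(2)] by blast
      have Ny: "mcong m n (N_mat n s (h(s := int z * h s))) (N_mat n s (h(s := y * h s)))"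
        "mcong m n (N_mat n s (h(s := int z' * h s))) (N_mat n s (h(s := y' * h s)))"
        using scaled[OF y(2) s0] scaled[OF y'(2) s0]
        by (auto intro!: N_mat_cong[OF s2(1)] simp: cong_sym)
      have Nc: "N_mat n s k \<in> carrier_mat n n" for k by (rule N_mat_carrier[OF s2(1)])
      have C1: "?C \<longleftrightarrow> congr m n (N_mat n s (h(s := y * h s))) (N_mat n s (h(s := y' * h s)))"
        unfolding N' using congr_mcong[OF Ny(1)] congr_mcong[OF Ny(2)] congr_trans congr_sym Nc by metis
      define Dy where "Dy k \<longleftrightarrow> (\<exists>d\<in>D_group m n s h. [y' = y * d] (mod k) \<or> [y' = - (y * d)] (mod k))" for k
      have C2: "?C \<longleftrightarrow> Dy (int m)"
        unfolding C1 Dy_def by (rule congr_scaled_iff[OF m n s0 y(1) y'(1)])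
      have Dl: "Dy l \<longleftrightarrow> ?D l"
      proof -
        have a: "[y' = y * d] (mod l) \<longleftrightarrow> [int z' = int z * d] (mod l)" for d
          using y(2) y'(2) by (metis cong_scalar_right cong_sym cong_trans)
        have "[- (y * d) = - (int z * d)] (mod l)" for d
          using y(2) by (simp add: cong_minus_minus_iff cong_scalar_right)
        then have "[y' = - (y * d)] (mod l) \<longleftrightarrow> [int z' = - (int z * d)] (mod l)" for d
          using y'(2) by (metis cong_sym cong_trans)
        then show ?thesis unfolding Dy_def using a by simp
      qed
      have "Dy (int m) \<longleftrightarrow> Dy l"
      proof
        assume "Dy (int m)" then show "Dy l" unfolding Dy_def using l(2) cong_dvd_modulus by blast
      next
        assume "Dy l"
        then obtain d where d: "d \<in> D_group m n s h" "[y' = y * d] (mod l) \<or> [y' = - (y * d)] (mod l)"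
          unfolding Dy_def by blast
        have cd: "coprime d (int m)"
          using d(1) m unfolding D_group_iff[OF s2(1)] by (auto simp: coprime_mod_left_iff)
        obtain e :: int where e: "e = 1 \<or> e = -1" "[y' = e * (y * d)] (mod l)" using d(2)
          by (metis mult_1 mult_minus1)
        have c: "coprime (e * (y * d)) (int m)" using e(1) y(1) cd by auto
        obtain x where x: "[e * (y * d) * x = 1] (mod int m)" using cong_solve_coprime_int[OF c] by blast
        \<comment> \<open>\<open>u\<close> is the quotient of \<open>y'\<close> by
          \<open>e * (y * d)\<close> modulo \<open>m\<close>. It is 1 modulo \<open>l\<close> by
          assumption, so \<open>u * d\<close> is again the determinant of a stabiliser element, and
          with it the congruence holds modulo \<open>m\<close>.\<close>
        define u where "u = x * y'"
        have cx: "coprime x (int m)" using x coprime_iff_invertible_int by (metis mult.commute)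
        have cu: "coprime u (int m)" using cx y'(1) by (simp add: u_def)
        have "[u = x * (e * (y * d))] (mod l)" unfolding u_def by (rule cong_scalar_left[OF e(2)])
        also have "[x * (e * (y * d)) = 1] (mod l)" using x l(2) by (metis cong_dvd_modulus mult.commute)
        finally have u1: "[u = 1] (mod int m div h s)" unfolding l(1) .
        have "[e * (y * d) * x * y' = 1 * y'] (mod int m)" by (rule cong_scalar_right[OF x])
        then have "[y' = e * (y * (u * d))] (mod int m)" by (simp add: u_def cong_sym mult_ac)
        moreover have "[e * (y * (u * d)) = e * (y * ((u * d) mod int m))] (mod int m)"
          by (intro cong_mult cong_refl) (simp add: cong_def)
        ultimately have y'': "[y' = e * (y * ((u * d) mod int m))] (mod int m)" by (rule cong_trans)
        have "(u * d) mod int m \<in> D_group m n s h"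
          by (rule D_group_absorb[OF m n s0 ch(1) cu u1 d(1)])
        then show "Dy (int m)" unfolding Dy_def using y'' e(1) by (intro bexI) auto
      qed
      then have C3: "?C \<longleftrightarrow> ?D l" using C2 Dl by blast
      have C4: "?C \<longleftrightarrow> ?D (int m)" if "coprime z m" "coprime z' m"
        unfolding C2 Dy_def y(3)[OF that(1)] y'(3)[OF that(2)] ..
      have C5: "[(int z)\<^sup>2 * h s = (int z')\<^sup>2 * h s] (mod int m)" if C: ?C
      proof -
        obtain d where d: "d \<in> D_group m n s h" "[int z' = int z * d] (mod l) \<or> [int z' = - (int z * d)] (mod l)"
          using C3 C by blast
        obtain gg where gg: "gg \<in> carrier_mat n n" "coprime (det gg) (int m)"
          "mcong m n (gg * N_mat n s h * transpose_mat gg) (N_mat n s h)" "d = det gg mod int m"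
          using d(1) unfolding D_group_iff[OF s2(1)] by blast
        have "[d\<^sup>2 * h s = (det gg)\<^sup>2 * h s] (mod int m)"
          unfolding gg(4) by (intro cong_mult cong_pow cong_refl) (simp add: cong_def)
        also have "[(det gg)\<^sup>2 * h s = h s] (mod int m)"
          by (rule det_stabilizer_square[OF gg(1,2) ch(1) n s0 gg(3)])
        finally have dd: "[d\<^sup>2 * h s = h s] (mod int m)" .
        \<comment> \<open>Squaring removes the sign, and the factor \<open>h s\<close> lifts the
          congruence from \<open>l\<close> to \<open>m\<close>.\<close>
        have "[(int z')\<^sup>2 = (int z * d)\<^sup>2] (mod l)"
          using d(2) cong_pow[of "int z'" _ l 2] by fastforce
        then have "[(int z')\<^sup>2 * h s = (int z * d)\<^sup>2 * h s] (mod int m)" by (rule scaled[OF _ s0])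
        also have "(int z * d)\<^sup>2 * h s = (int z)\<^sup>2 * (d\<^sup>2 * h s)" by (simp add: power_mult_distrib)
        also have "[\<dots> = (int z)\<^sup>2 * h s] (mod int m)" by (rule cong_scalar_left[OF dd])
        finally show ?thesis by (rule cong_sym)
      qed
      show ?thesis using C3 C4 C5 True by blast
    qed
  qed
  then show "?C \<longleftrightarrow> ?E \<and> ?H \<and> ?D l"
    "coprime z m \<Longrightarrow> coprime z' m \<Longrightarrow> ?C \<longleftrightarrow> ?E \<and> ?H \<and> ?D (int m)"
    "?C \<Longrightarrow> 0 < s \<Longrightarrow> [(int z)\<^sup>2 * h s = (int z')\<^sup>2 * h s] (mod int m)"
    by blast+
qed

section \<open>Twisted monoid algebras\<close>

text \<open>A monoid rather than a group, because the same construction has to serve both the group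
  algebras of \<int>^n and the free module on the multiplicative monoid of tuples of algebra
  elements.\<close>

locale twisted_monoid = K: field K + M: monoid M
  for K (structure) and M (structure) +
  fixes \<sigma> :: "'c \<Rightarrow> 'c \<Rightarrow> 'a"
  assumes cocycle_closed [simp, intro]: "\<lbrakk>x \<in> carrier M; y \<in> carrier M\<rbrakk> \<Longrightarrow> \<sigma> x y \<in> carrier K"
    and cocycle: "\<lbrakk>x \<in> carrier M; y \<in> carrier M; z \<in> carrier M\<rbrakk> \<Longrightarrow>
      \<sigma> x y \<otimes> \<sigma> (x \<otimes>\<^bsub>M\<^esub> y) z = \<sigma> x (y \<otimes>\<^bsub>M\<^esub> z) \<otimes> \<sigma> y z"
    and cocycle_one [simp]: "x \<in> carrier M \<Longrightarrow> \<sigma> \<one>\<^bsub>M\<^esub> x = \<one>" "x \<in> carrier M \<Longrightarrow> \<sigma> x \<one>\<^bsub>M\<^esub> = \<one>"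
begin

abbreviation T where "T \<equiv> twisted_algebra K M \<sigma>"

definition supp :: "('c \<Rightarrow> 'a) \<Rightarrow> 'c set" where "supp f = {x. f x \<noteq> \<zero>}"

definition mon :: "'a \<Rightarrow> 'c \<Rightarrow> 'c \<Rightarrow> 'a" where "mon k a = (\<lambda>x. if x = a then k else \<zero>)"

lemma T_simps:
  "f \<in> carrier T \<longleftrightarrow> (\<forall>x. f x \<in> carrier K) \<and> finite (supp f) \<and> supp f \<subseteq> carrier M"
  "\<one>\<^bsub>T\<^esub> = mon \<one> \<one>\<^bsub>M\<^esub>" "\<zero>\<^bsub>T\<^esub> = (\<lambda>_. \<zero>)" "f \<oplus>\<^bsub>T\<^esub> g = (\<lambda>x. f x \<oplus> g x)" "k \<odot>\<^bsub>T\<^esub> f = (\<lambda>x. k \<otimes> f x)"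
  by (simp_all add: twisted_algebra_def supp_def delta_def mon_def)

lemma delta_mon: "delta K a = mon \<one> a"
  by (simp add: delta_def mon_def)

lemma mon_carrier [simp, intro]: "k \<in> carrier K \<Longrightarrow> a \<in> carrier M \<Longrightarrow> mon k a \<in> carrier T"
  unfolding T_simps by (auto simp: mon_def supp_def)

lemma smult_mon: "k \<in> carrier K \<Longrightarrow> l \<in> carrier K \<Longrightarrow> k \<odot>\<^bsub>T\<^esub> mon l a = mon (k \<otimes> l) a"
  unfolding T_simps by (auto simp: mon_def)

lemma T_eval [simp]: "f \<in> carrier T \<Longrightarrow> f x \<in> carrier K"
  unfolding T_simps by blast

lemma supp_finite: "f \<in> carrier T \<Longrightarrow> finite (supp f)"
  unfolding T_simps by blast

lemma supp_sub: "f \<in> carrier T \<Longrightarrow> supp f \<subseteq> carrier M"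
  unfolding T_simps by blast

lemma add_closed [simp, intro]: "f \<in> carrier T \<Longrightarrow> g \<in> carrier T \<Longrightarrow> f \<oplus>\<^bsub>T\<^esub> g \<in> carrier T"
proof -
  assume fg: "f \<in> carrier T" "g \<in> carrier T"
  have "supp (\<lambda>x. f x \<oplus> g x) \<subseteq> supp f \<union> supp g" using fg by (auto simp: supp_def)
  then show ?thesis using fg unfolding T_simps by (meson K.add.m_closed finite_UnI finite_subset le_sup_iff subset_trans)
qed

lemma smult_closed [simp, intro]: "k \<in> carrier K \<Longrightarrow> f \<in> carrier T \<Longrightarrow> k \<odot>\<^bsub>T\<^esub> f \<in> carrier T"
proof -
  assume fg: "k \<in> carrier K" "f \<in> carrier T"
  have "supp (\<lambda>x. k \<otimes> f x) \<subseteq> supp f" using fg by (auto simp: supp_def)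
  then show ?thesis using fg unfolding T_simps by (meson K.m_closed finite_subset subset_trans)
qed

lemma abelian_group_T: "abelian_group T"
proof (rule abelian_groupI)
  fix f assume f: "f \<in> carrier T"
  then have "(\<ominus> \<one>) \<odot>\<^bsub>T\<^esub> f \<oplus>\<^bsub>T\<^esub> f = \<zero>\<^bsub>T\<^esub>"
    unfolding T_simps(3-5) by (auto simp: K.l_minus K.l_neg)
  then show "\<exists>g\<in>carrier T. g \<oplus>\<^bsub>T\<^esub> f = \<zero>\<^bsub>T\<^esub>" using f by blast
next
  show "\<zero>\<^bsub>T\<^esub> \<in> carrier T" unfolding T_simps by (simp add: supp_def)
next
  fix f g h assume "f \<in> carrier T" "g \<in> carrier T" "h \<in> carrier T"
  then show "f \<oplus>\<^bsub>T\<^esub> g \<oplus>\<^bsub>T\<^esub> h = f \<oplus>\<^bsub>T\<^esub> (g \<oplus>\<^bsub>T\<^esub> h)"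
    unfolding T_simps(4) by (simp add: K.a_assoc)
next
  fix f g assume "f \<in> carrier T" "g \<in> carrier T"
  then show "f \<oplus>\<^bsub>T\<^esub> g = g \<oplus>\<^bsub>T\<^esub> f"
    unfolding T_simps(4) by (simp add: K.a_comm)
next
  fix f assume "f \<in> carrier T"
  then show "\<zero>\<^bsub>T\<^esub> \<oplus>\<^bsub>T\<^esub> f = f" unfolding T_simps(3,4) by simp
qed auto

definition conv :: "('c \<Rightarrow> 'a) \<Rightarrow> ('c \<Rightarrow> 'a) \<Rightarrow> 'c \<Rightarrow> 'c \<times> 'c \<Rightarrow> 'a" where
  "conv f g x = (\<lambda>(a,b). if a \<otimes>\<^bsub>M\<^esub> b = x then \<sigma> a b \<otimes> f a \<otimes> g b else \<zero>)"

lemma conv_closed: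
  assumes "f \<in> carrier T" "g \<in> carrier T" "S \<subseteq> carrier M" "S' \<subseteq> carrier M"
  shows "conv f g x \<in> S \<times> S' \<rightarrow> carrier K"
proof
  fix p assume "p \<in> S \<times> S'"
  then obtain a b where "p = (a,b)" "a \<in> carrier M" "b \<in> carrier M" using assms by blast
  then show "conv f g x p \<in> carrier K" using assms by (simp add: conv_def)
qed

text \<open>The convolution sum is extended by zero terms to a rectangle containing both supports,
  so that products of different elements can be compared over a common index set.\<close>

lemma mult_T_eq:
  assumes f: "f \<in> carrier T" "finite S" "supp f \<subseteq> S" "S \<subseteq> carrier M"
    and g: "g \<in> carrier T" "finite S'" "supp g \<subseteq> S'" "S' \<subseteq> carrier M"
  shows "(f \<otimes>\<^bsub>T\<^esub> g) x = finsum K (conv f g x) (S \<times> S')"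
proof -
  have "(f \<otimes>\<^bsub>T\<^esub> g) x = finsum K (\<lambda>(a,b). \<sigma> a b \<otimes> f a \<otimes> g b) {(a, b). f a \<noteq> \<zero> \<and> g b \<noteq> \<zero> \<and> a \<otimes>\<^bsub>M\<^esub> b = x}"
    unfolding twisted_algebra_def by (simp only: monoid.select_convs)
  also have "\<dots> = finsum K (conv f g x) (S \<times> S')"
  proof (rule K.add.finprod_mono_neutral_cong_left)
    show "finite (S \<times> S')" using f g by blast
    show "conv f g x \<in> S \<times> S' \<rightarrow> carrier K" by (rule conv_closed[OF f(1) g(1) f(4) g(4)])
    show "{(a, b). f a \<noteq> \<zero> \<and> g b \<noteq> \<zero> \<and> a \<otimes>\<^bsub>M\<^esub> b = x} \<subseteq> S \<times> S'"
      using f g by (auto simp: supp_def)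
    fix p assume "p \<in> S \<times> S' - {(a, b). f a \<noteq> \<zero> \<and> g b \<noteq> \<zero> \<and> a \<otimes>\<^bsub>M\<^esub> b = x}"
    then obtain a b where "p = (a,b)" "a \<in> carrier M" "b \<in> carrier M" "f a = \<zero> \<or> g b = \<zero> \<or> a \<otimes>\<^bsub>M\<^esub> b \<noteq> x"
      using f(4) g(4) by blast
    then show "conv f g x p = \<zero>"
      using f(1) g(1) by (auto simp: conv_def)
  qed (simp_all add: conv_def case_prod_beta)
  finally show ?thesis .
qed

lemma mult_closed [simp, intro]:
  assumes f: "f \<in> carrier T" and g: "g \<in> carrier T" shows "f \<otimes>\<^bsub>T\<^esub> g \<in> carrier T"
proof -
  note * = mult_T_eq[OF f supp_finite[OF f] order_refl supp_sub[OF f] g supp_finite[OF g] order_refl supp_sub[OF g]]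
  have cl: "(f \<otimes>\<^bsub>T\<^esub> g) x \<in> carrier K" for x unfolding *
    by (rule K.finsum_closed[OF conv_closed[OF f g supp_sub[OF f] supp_sub[OF g]]])
  have "supp (f \<otimes>\<^bsub>T\<^esub> g) \<subseteq> (\<lambda>(a,b). a \<otimes>\<^bsub>M\<^esub> b) ` (supp f \<times> supp g)"
  proof
    fix x assume x: "x \<in> supp (f \<otimes>\<^bsub>T\<^esub> g)"
    show "x \<in> (\<lambda>(a,b). a \<otimes>\<^bsub>M\<^esub> b) ` (supp f \<times> supp g)"
    proof (rule ccontr)
      assume "x \<notin> (\<lambda>(a,b). a \<otimes>\<^bsub>M\<^esub> b) ` (supp f \<times> supp g)"
      then have "(f \<otimes>\<^bsub>T\<^esub> g) x = \<zero>" unfolding * by (intro K.add.finprod_one_eqI) (auto simp: conv_def)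
      then show False using x by (simp add: supp_def)
    qed
  qed
  moreover have "(\<lambda>(a,b). a \<otimes>\<^bsub>M\<^esub> b) ` (supp f \<times> supp g) \<subseteq> carrier M"
    using supp_sub[OF f] supp_sub[OF g] by auto
  ultimately show ?thesis unfolding T_simps(1)
    using cl supp_finite[OF f] supp_finite[OF g] by (meson finite_SigmaI finite_imageI finite_subset subset_trans)
qed

lemma l_distr_T:
  assumes f: "f \<in> carrier T" and g: "g \<in> carrier T" and h: "h \<in> carrier T"
  shows "(f \<oplus>\<^bsub>T\<^esub> g) \<otimes>\<^bsub>T\<^esub> h = (f \<otimes>\<^bsub>T\<^esub> h) \<oplus>\<^bsub>T\<^esub> (g \<otimes>\<^bsub>T\<^esub> h)"
proof
  fix x
  let ?S = "supp f \<union> supp g"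
  have S: "finite ?S" "supp f \<subseteq> ?S" "supp g \<subseteq> ?S" "?S \<subseteq> carrier M" "supp (f \<oplus>\<^bsub>T\<^esub> g) \<subseteq> ?S"
    using supp_finite[OF f] supp_finite[OF g] supp_sub[OF f] supp_sub[OF g] f g
    by (auto simp: supp_def T_simps(4))
  have H: "finite (supp h)" "supp h \<subseteq> carrier M" using supp_finite[OF h] supp_sub[OF h] by auto
  have "finsum K (conv (f \<oplus>\<^bsub>T\<^esub> g) h x) (?S \<times> supp h) = finsum K (\<lambda>p. conv f h x p \<oplus> conv g h x p) (?S \<times> supp h)"
  proof (rule K.finsum_cong'[OF refl])
    show "(\<lambda>p. conv f h x p \<oplus> conv g h x p) \<in> ?S \<times> supp h \<rightarrow> carrier K"
      using conv_closed[OF f h S(4) H(2)] conv_closed[OF g h S(4) H(2)] by (auto simp: Pi_iff)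
    fix p assume "p \<in> ?S \<times> supp h"
    then obtain a b where "p = (a,b)" "a \<in> carrier M" "b \<in> carrier M" using S H by blast
    then show "conv (f \<oplus>\<^bsub>T\<^esub> g) h x p = conv f h x p \<oplus> conv g h x p"
      using f g h by (simp add: conv_def T_simps(4) K.r_distr K.l_distr)
  qed
  also have "\<dots> = finsum K (conv f h x) (?S \<times> supp h) \<oplus> finsum K (conv g h x) (?S \<times> supp h)"
    by (rule K.finsum_addf[OF conv_closed[OF f h S(4) H(2)] conv_closed[OF g h S(4) H(2)]])
  finally show "((f \<oplus>\<^bsub>T\<^esub> g) \<otimes>\<^bsub>T\<^esub> h) x = ((f \<otimes>\<^bsub>T\<^esub> h) \<oplus>\<^bsub>T\<^esub> (g \<otimes>\<^bsub>T\<^esub> h)) x"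
    unfolding T_simps(4)[of "f \<otimes>\<^bsub>T\<^esub> h"] mult_T_eq[OF f S(1,2,4) h H(1) order_refl H(2)]
      mult_T_eq[OF g S(1,3,4) h H(1) order_refl H(2)] mult_T_eq[OF add_closed[OF f g] S(1,5,4) h H(1) order_refl H(2)] .
qed

lemma r_distr_T:
  assumes f: "f \<in> carrier T" and g: "g \<in> carrier T" and h: "h \<in> carrier T"
  shows "h \<otimes>\<^bsub>T\<^esub> (f \<oplus>\<^bsub>T\<^esub> g) = (h \<otimes>\<^bsub>T\<^esub> f) \<oplus>\<^bsub>T\<^esub> (h \<otimes>\<^bsub>T\<^esub> g)"
proof
  fix x
  let ?S = "supp f \<union> supp g"
  have S: "finite ?S" "supp f \<subseteq> ?S" "supp g \<subseteq> ?S" "?S \<subseteq> carrier M" "supp (f \<oplus>\<^bsub>T\<^esub> g) \<subseteq> ?S"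
    using supp_finite[OF f] supp_finite[OF g] supp_sub[OF f] supp_sub[OF g] f g
    by (auto simp: supp_def T_simps(4))
  have H: "finite (supp h)" "supp h \<subseteq> carrier M" using supp_finite[OF h] supp_sub[OF h] by auto
  have "finsum K (conv h (f \<oplus>\<^bsub>T\<^esub> g) x) (supp h \<times> ?S) = finsum K (\<lambda>p. conv h f x p \<oplus> conv h g x p) (supp h \<times> ?S)"
  proof (rule K.finsum_cong'[OF refl])
    show "(\<lambda>p. conv h f x p \<oplus> conv h g x p) \<in> supp h \<times> ?S \<rightarrow> carrier K"
      using conv_closed[OF h f H(2) S(4)] conv_closed[OF h g H(2) S(4)] by (auto simp: Pi_iff)
    fix p assume "p \<in> supp h \<times> ?S"
    then obtain a b where "p = (a,b)" "a \<in> carrier M" "b \<in> carrier M" using S H by blast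
    then show "conv h (f \<oplus>\<^bsub>T\<^esub> g) x p = conv h f x p \<oplus> conv h g x p"
      using f g h by (simp add: conv_def T_simps(4) K.r_distr K.l_distr)
  qed
  also have "\<dots> = finsum K (conv h f x) (supp h \<times> ?S) \<oplus> finsum K (conv h g x) (supp h \<times> ?S)"
    by (rule K.finsum_addf[OF conv_closed[OF h f H(2) S(4)] conv_closed[OF h g H(2) S(4)]])
  finally show "(h \<otimes>\<^bsub>T\<^esub> (f \<oplus>\<^bsub>T\<^esub> g)) x = ((h \<otimes>\<^bsub>T\<^esub> f) \<oplus>\<^bsub>T\<^esub> (h \<otimes>\<^bsub>T\<^esub> g)) x"
    unfolding T_simps(4)[of "h \<otimes>\<^bsub>T\<^esub> f"] mult_T_eq[OF h H(1) order_refl H(2) f S(1,2,4)]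
      mult_T_eq[OF h H(1) order_refl H(2) g S(1,3,4)] mult_T_eq[OF h H(1) order_refl H(2) add_closed[OF f g] S(1,5,4)] .
qed

lemma mon_mult:
  assumes "k \<in> carrier K" "l \<in> carrier K" "a \<in> carrier M" "b \<in> carrier M"
  shows "mon k a \<otimes>\<^bsub>T\<^esub> mon l b = mon (\<sigma> a b \<otimes> k \<otimes> l) (a \<otimes>\<^bsub>M\<^esub> b)"
proof
  fix x
  have s: "supp (mon k a) \<subseteq> {a}" "supp (mon l b) \<subseteq> {b}" by (auto simp: mon_def supp_def)
  have "(mon k a \<otimes>\<^bsub>T\<^esub> mon l b) x = finsum K (conv (mon k a) (mon l b) x) ({a} \<times> {b})"
    by (rule mult_T_eq) (use assms s in auto)
  also have "{a} \<times> {b} = {(a,b)}" by simp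
  finally show "(mon k a \<otimes>\<^bsub>T\<^esub> mon l b) x = mon (\<sigma> a b \<otimes> k \<otimes> l) (a \<otimes>\<^bsub>M\<^esub> b) x"
    using assms by (simp add: mon_def conv_def)
qed

text \<open>Additive identities need only be checked on monomials; the induction is on a finite set
  containing the support.\<close>

lemma T_induct [consumes 1, case_names zero add]:
  assumes "f \<in> carrier T" "P (\<lambda>_. \<zero>)"
    "\<And>k a f. \<lbrakk>k \<in> carrier K; a \<in> carrier M; f \<in> carrier T; P f\<rbrakk> \<Longrightarrow> P (mon k a \<oplus>\<^bsub>T\<^esub> f)"
  shows "P f"
proof -
  have "\<forall>f. f \<in> carrier T \<longrightarrow> supp f \<subseteq> S \<longrightarrow> P f" if "finite S" for S
    using that
  proof induction
    case empty
    have "f = (\<lambda>_. \<zero>)" if "supp f \<subseteq> {}" for f using that by (auto simp: supp_def)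
    then show ?case using assms(2) by metis
  next
    case (insert a S)
    show ?case
    proof (intro allI impI)
      fix f assume f: "f \<in> carrier T" "supp f \<subseteq> insert a S"
      define g where "g = (\<lambda>x. if x = a then \<zero> else f x)"
      have "supp g \<subseteq> supp f" "supp g \<subseteq> S" using f(2) by (auto simp: supp_def g_def)
      then have g: "g \<in> carrier T" "supp g \<subseteq> S" using f(1) unfolding T_simps
        by (auto intro: finite_subset simp: g_def)
      show "P f"
      proof (cases "f a = \<zero>")
        case True
        then have "f = g" by (auto simp: g_def)
        then show ?thesis using g insert.IH by blast
      next
        case False
        then have "a \<in> carrier M" using f(1) unfolding T_simps by (auto simp: supp_def)
        moreover have "f = mon (f a) a \<oplus>\<^bsub>T\<^esub> g"
          using f(1) by (auto simp: T_simps(4) mon_def g_def)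
        ultimately show ?thesis using assms(3)[of "f a" a g] g f(1) insert.IH by simp
      qed
    qed
  qed
  from this[OF supp_finite[OF assms(1)]] show ?thesis using assms(1) by blast
qed

lemma zero_T_carrier [simp]: "(\<lambda>_. \<zero>) \<in> carrier T"
  unfolding T_simps by (simp add: supp_def)

lemma zero_mult_T:
  assumes f: "f \<in> carrier T"
  shows "(\<lambda>_. \<zero>) \<otimes>\<^bsub>T\<^esub> f = (\<lambda>_. \<zero>)" "f \<otimes>\<^bsub>T\<^esub> (\<lambda>_. \<zero>) = (\<lambda>_. \<zero>)"
proof -
  have s: "supp (\<lambda>_. \<zero>) \<subseteq> {}" by (simp add: supp_def)
  show "(\<lambda>_. \<zero>) \<otimes>\<^bsub>T\<^esub> f = (\<lambda>_. \<zero>)"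
    using mult_T_eq[OF zero_T_carrier finite.emptyI s empty_subsetI f supp_finite[OF f] order_refl supp_sub[OF f]]
    by (intro ext) simp
  show "f \<otimes>\<^bsub>T\<^esub> (\<lambda>_. \<zero>) = (\<lambda>_. \<zero>)"
    using mult_T_eq[OF f supp_finite[OF f] order_refl supp_sub[OF f] zero_T_carrier finite.emptyI s empty_subsetI]
    by (intro ext) simp
qed

text \<open>Three nested inductions reduce associativity to monomials, where it is the cocycle
  identity.\<close>

lemma assoc_T:
  assumes f: "f \<in> carrier T" and g: "g \<in> carrier T" and h: "h \<in> carrier T"
  shows "(f \<otimes>\<^bsub>T\<^esub> g) \<otimes>\<^bsub>T\<^esub> h = f \<otimes>\<^bsub>T\<^esub> (g \<otimes>\<^bsub>T\<^esub> h)"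
  using f
proof (induction f rule: T_induct)
  case zero then show ?case using g h by (simp add: zero_mult_T)
next
  case (add k a f)
  have "(mon k a \<otimes>\<^bsub>T\<^esub> g) \<otimes>\<^bsub>T\<^esub> h = mon k a \<otimes>\<^bsub>T\<^esub> (g \<otimes>\<^bsub>T\<^esub> h)"
    using g
  proof (induction g rule: T_induct)
    case zero then show ?case using h add.hyps by (simp add: zero_mult_T)
  next
    case (add l b g)
    note ka = \<open>k \<in> carrier K\<close> \<open>a \<in> carrier M\<close>
    have "(mon k a \<otimes>\<^bsub>T\<^esub> mon l b) \<otimes>\<^bsub>T\<^esub> h = mon k a \<otimes>\<^bsub>T\<^esub> (mon l b \<otimes>\<^bsub>T\<^esub> h)"
      using h
    proof (induction h rule: T_induct)
      case zero then show ?case using ka add.hyps by (simp add: zero_mult_T)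
    next
      case (add j c h)
      note lb = \<open>l \<in> carrier K\<close> \<open>b \<in> carrier M\<close>
      have "(\<sigma> a b \<otimes> \<sigma> (a \<otimes>\<^bsub>M\<^esub> b) c) \<otimes> (k \<otimes> l \<otimes> j) = (\<sigma> a (b \<otimes>\<^bsub>M\<^esub> c) \<otimes> \<sigma> b c) \<otimes> (k \<otimes> l \<otimes> j)"
        using cocycle[OF ka(2) lb(2) add.hyps(2)] by simp
      then have "\<sigma> (a \<otimes>\<^bsub>M\<^esub> b) c \<otimes> (\<sigma> a b \<otimes> k \<otimes> l) \<otimes> j = \<sigma> a (b \<otimes>\<^bsub>M\<^esub> c) \<otimes> k \<otimes> (\<sigma> b c \<otimes> l \<otimes> j)"
        using ka lb add.hyps by (simp add: K.m_ac)
      then have "(mon k a \<otimes>\<^bsub>T\<^esub> mon l b) \<otimes>\<^bsub>T\<^esub> mon j c = mon k a \<otimes>\<^bsub>T\<^esub> (mon l b \<otimes>\<^bsub>T\<^esub> mon j c)"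
        using ka lb add.hyps by (simp add: mon_mult M.m_assoc)
      then show ?case using ka lb add by (simp add: r_distr_T)
    qed
    then show ?case using ka add h by (simp add: r_distr_T l_distr_T)
  qed
  then show ?case using add g h by (simp add: l_distr_T)
qed

lemma one_T:
  assumes "f \<in> carrier T"
  shows "\<one>\<^bsub>T\<^esub> \<otimes>\<^bsub>T\<^esub> f = f" "f \<otimes>\<^bsub>T\<^esub> \<one>\<^bsub>T\<^esub> = f"
  using assms
proof (induction f rule: T_induct)
  case zero
  { case 1 then show ?case by (simp add: zero_mult_T T_simps(2)) }
  { case 2 then show ?case by (simp add: zero_mult_T T_simps(2)) }
next
  case (add k a f)
  { case 1 then show ?case using add by (simp add: T_simps(2) r_distr_T mon_mult) }
  { case 2 then show ?case using add by (simp add: T_simps(2) l_distr_T mon_mult) }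
qed

lemma ring_T: "ring T"
proof (rule ringI)
  show "monoid T" by (rule monoidI) (auto simp: assoc_T one_T[unfolded T_simps(2)] T_simps(2))
qed (auto simp: abelian_group_T l_distr_T r_distr_T)

text \<open>Scalars act through central multiples of the unit, which uses that the cocycle is
  normalised; compatibility of scalars with products then follows from associativity.\<close>

lemma smult_as_mult: "f \<in> carrier T \<Longrightarrow> k \<in> carrier K \<Longrightarrow>
   k \<odot>\<^bsub>T\<^esub> f = mon k \<one>\<^bsub>M\<^esub> \<otimes>\<^bsub>T\<^esub> f \<and> k \<odot>\<^bsub>T\<^esub> f = f \<otimes>\<^bsub>T\<^esub> mon k \<one>\<^bsub>M\<^esub>"
proof (induction f rule: T_induct)
  case zero then show ?case by (simp add: zero_mult_T) (simp add: T_simps)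
next
  case (add l a f)
  have "k \<odot>\<^bsub>T\<^esub> (mon l a \<oplus>\<^bsub>T\<^esub> f) = k \<odot>\<^bsub>T\<^esub> mon l a \<oplus>\<^bsub>T\<^esub> k \<odot>\<^bsub>T\<^esub> f"
    using add mon_carrier[of l a] unfolding T_simps(4,5) by (auto simp: K.r_distr simp del: mon_carrier)
  then show ?case using add conjunct2[OF add.IH[OF add.prems], symmetric]
    by (simp add: l_distr_T r_distr_T mon_mult smult_mon K.m_comm)
qed

lemma assoc_algebra_T: "assoc_algebra K T"
proof -
  have "module K T"
  proof (rule moduleI)
    fix k l f assume k: "k \<in> carrier K" "l \<in> carrier K" and f: "f \<in> carrier T"
    show "(k \<oplus> l) \<odot>\<^bsub>T\<^esub> f = k \<odot>\<^bsub>T\<^esub> f \<oplus>\<^bsub>T\<^esub> l \<odot>\<^bsub>T\<^esub> f"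
      unfolding T_simps(4,5) using k f by (simp add: K.l_distr)
    show "(k \<otimes> l) \<odot>\<^bsub>T\<^esub> f = k \<odot>\<^bsub>T\<^esub> (l \<odot>\<^bsub>T\<^esub> f)"
      unfolding T_simps(4,5) using k f by (simp add: K.m_assoc)
  next
    fix k f g assume k: "k \<in> carrier K" and f: "f \<in> carrier T" "g \<in> carrier T"
    show "k \<odot>\<^bsub>T\<^esub> (f \<oplus>\<^bsub>T\<^esub> g) = k \<odot>\<^bsub>T\<^esub> f \<oplus>\<^bsub>T\<^esub> k \<odot>\<^bsub>T\<^esub> g"
      unfolding T_simps(4,5) using k f by (simp add: K.r_distr)
  next
    fix f assume "f \<in> carrier T"
    then show "\<one> \<odot>\<^bsub>T\<^esub> f = f" unfolding T_simps(4,5) by simp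
  qed (auto simp: abelian_group_T K.is_cring)
  then show ?thesis
    by (intro assoc_algebra.intro assoc_algebra_axioms.intro ring_T K.field_axioms)
      (simp_all add: smult_as_mult assoc_T[symmetric], metis assoc_T mon_carrier smult_as_mult M.one_closed)
qed

end

section \<open>The universal property of a twisted monoid algebra\<close>

text \<open>The linear part is kept separate from multiplicativity, since the section of the tensor
  product map constructed later is set up as a linear map only.\<close>

locale twisted_lin = twisted_monoid K M \<sigma> + B: assoc_algebra K B
  for K (structure) and M (structure) and \<sigma> and B (structure) +
  fixes x
  assumes rep_closed [simp, intro]: "a \<in> carrier M \<Longrightarrow> x a \<in> carrier B"
begin

definition lin :: "('c \<Rightarrow> 'a) \<Rightarrow> 'e" where
  "lin f = finsum B (\<lambda>a. f a \<odot>\<^bsub>B\<^esub> x a) (supp f)"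

lemma lin_eq:
  assumes "f \<in> carrier T" "finite S" "supp f \<subseteq> S" "S \<subseteq> carrier M"
  shows "lin f = finsum B (\<lambda>a. f a \<odot>\<^bsub>B\<^esub> x a) S"
  unfolding lin_def
proof (rule B.add.finprod_mono_neutral_cong_left)
  fix a assume "a \<in> S - supp f"
  then show "f a \<odot>\<^bsub>B\<^esub> x a = \<zero>\<^bsub>B\<^esub>" using assms by (auto simp: supp_def)
qed (use assms in auto)

lemma lin_closed [simp, intro]: "f \<in> carrier T \<Longrightarrow> lin f \<in> carrier B"
  unfolding lin_def by (rule B.finsum_closed) (use supp_sub[of f] in auto)

lemma lin_add:
  assumes f: "f \<in> carrier T" and g: "g \<in> carrier T"
  shows "lin (f \<oplus>\<^bsub>T\<^esub> g) = lin f \<oplus>\<^bsub>B\<^esub> lin g"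
proof -
  let ?S = "supp f \<union> supp g"
  have S: "finite ?S" "supp f \<subseteq> ?S" "supp g \<subseteq> ?S" "?S \<subseteq> carrier M" "supp (f \<oplus>\<^bsub>T\<^esub> g) \<subseteq> ?S"
    using supp_finite[OF f] supp_finite[OF g] supp_sub[OF f] supp_sub[OF g] f g
    by (auto simp: supp_def T_simps(4))
  have "lin (f \<oplus>\<^bsub>T\<^esub> g) = finsum B (\<lambda>a. f a \<odot>\<^bsub>B\<^esub> x a \<oplus>\<^bsub>B\<^esub> g a \<odot>\<^bsub>B\<^esub> x a) ?S"
    unfolding lin_eq[OF add_closed[OF f g] S(1,5,4)]
    by (rule B.finsum_cong') (use f g S in \<open>auto simp: T_simps(4) B.smult_l_distr\<close>)
  also have "\<dots> = lin f \<oplus>\<^bsub>B\<^esub> lin g"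
    unfolding lin_eq[OF f S(1,2,4)] lin_eq[OF g S(1,3,4)]
    by (rule B.finsum_addf) (use f g S in auto)
  finally show ?thesis .
qed

lemma lin_mon:
  assumes "k \<in> carrier K" "a \<in> carrier M" shows "lin (mon k a) = k \<odot>\<^bsub>B\<^esub> x a"
proof -
  have "lin (mon k a) = finsum B (\<lambda>b. mon k a b \<odot>\<^bsub>B\<^esub> x b) {a}"
    by (rule lin_eq[OF mon_carrier[OF assms]]) (use assms in \<open>auto simp: mon_def supp_def\<close>)
  then show ?thesis using assms by (simp add: mon_def)
qed

lemma lin_zero: "lin (\<lambda>_. \<zero>) = \<zero>\<^bsub>B\<^esub>"
  by (simp add: lin_def supp_def)

lemma lin_smult:
  assumes k: "k \<in> carrier K" and f: "f \<in> carrier T"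
  shows "lin (k \<odot>\<^bsub>T\<^esub> f) = k \<odot>\<^bsub>B\<^esub> lin f"
  using f
proof (induction f rule: T_induct)
  case zero
  have "k \<odot>\<^bsub>T\<^esub> (\<lambda>_. \<zero>) = (\<lambda>_. \<zero>)" using k by (simp add: T_simps(5))
  then show ?case using k by (simp add: lin_zero)
next
  case (add l a f)
  interpret A: assoc_algebra K T by (rule assoc_algebra_T)
  have "k \<odot>\<^bsub>T\<^esub> (mon l a \<oplus>\<^bsub>T\<^esub> f) = mon (k \<otimes> l) a \<oplus>\<^bsub>T\<^esub> k \<odot>\<^bsub>T\<^esub> f"
    using k add by (simp add: A.smult_r_distr smult_mon)
  then show ?case using k add
    by (simp add: lin_add lin_mon B.smult_r_distr B.smult_assoc1)
qed

end

text \<open>The family \<open>x\<close> is a projective representation of the monoid with multiplier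
  \<open>\<sigma>\<close>; such families correspond to algebra homomorphisms out of the twisted
  algebra.\<close>

locale twisted_rep = twisted_lin +
  assumes rep_one: "x \<one>\<^bsub>M\<^esub> = \<one>\<^bsub>B\<^esub>"
    and rep_mult: "\<lbrakk>a \<in> carrier M; b \<in> carrier M\<rbrakk> \<Longrightarrow> x a \<otimes>\<^bsub>B\<^esub> x b = \<sigma> a b \<odot>\<^bsub>B\<^esub> x (a \<otimes>\<^bsub>M\<^esub> b)"
begin

lemma lin_one: "lin \<one>\<^bsub>T\<^esub> = \<one>\<^bsub>B\<^esub>"
  by (simp add: T_simps(2) lin_mon rep_one)

lemma lin_mult:
  assumes f: "f \<in> carrier T" and g: "g \<in> carrier T"
  shows "lin (f \<otimes>\<^bsub>T\<^esub> g) = lin f \<otimes>\<^bsub>B\<^esub> lin g"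
  using f
proof (induction f rule: T_induct)
  case zero then show ?case using g by (simp add: zero_mult_T lin_zero)
next
  case (add k a f)
  note ka = \<open>k \<in> carrier K\<close> \<open>a \<in> carrier M\<close>
  have "lin (mon k a \<otimes>\<^bsub>T\<^esub> g) = lin (mon k a) \<otimes>\<^bsub>B\<^esub> lin g" using g
  proof (induction g rule: T_induct)
    case zero then show ?case using ka by (simp add: zero_mult_T lin_zero lin_mon)
  next
    case (add l b g)
    have "(k \<odot>\<^bsub>B\<^esub> x a) \<otimes>\<^bsub>B\<^esub> (l \<odot>\<^bsub>B\<^esub> x b) = k \<odot>\<^bsub>B\<^esub> (l \<odot>\<^bsub>B\<^esub> (x a \<otimes>\<^bsub>B\<^esub> x b))"
      using ka add B.smult_mult_left[of k "x a" "l \<odot>\<^bsub>B\<^esub> x b"] B.smult_mult_right[of l "x a" "x b"] by simp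
    also have "\<dots> = (\<sigma> a b \<otimes> k \<otimes> l) \<odot>\<^bsub>B\<^esub> x (a \<otimes>\<^bsub>M\<^esub> b)"
      using ka add by (simp add: rep_mult B.smult_assoc1[symmetric] K.m_ac)
    finally have "lin (mon k a \<otimes>\<^bsub>T\<^esub> mon l b) = lin (mon k a) \<otimes>\<^bsub>B\<^esub> lin (mon l b)"
      using ka add by (simp add: mon_mult lin_mon)
    then show ?case using ka add by (simp add: r_distr_T lin_add B.r_distr)
  qed
  then show ?case using add g by (simp add: l_distr_T lin_add B.l_distr)
qed

lemma lin_ring_hom: "lin \<in> Ring.ring_hom T B"
  by (rule ring_hom_memI) (auto simp: lin_mult lin_add lin_one)

end

section \<open>Composition and inversion of graded isomorphisms\<close>

lemma graded_isoE:
  assumes "graded_iso K \<Gamma> A GA B GB"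
  obtains f p where "f \<in> ring_iso A B"
    "\<And>k x. k \<in> carrier K \<Longrightarrow> x \<in> carrier A \<Longrightarrow> f (k \<odot>\<^bsub>A\<^esub> x) = k \<odot>\<^bsub>B\<^esub> f x"
    "p \<in> iso \<Gamma> \<Gamma>" "\<And>\<gamma>. \<gamma> \<in> carrier \<Gamma> \<Longrightarrow> f ` GA \<gamma> = GB (p \<gamma>)"
  using assms unfolding graded_iso_def
proof (elim exE conjE)
  fix f p
  assume "f \<in> ring_iso A B" "\<forall>k\<in>carrier K. \<forall>x\<in>carrier A. f (k \<odot>\<^bsub>A\<^esub> x) = k \<odot>\<^bsub>B\<^esub> f x"
    "p \<in> iso \<Gamma> \<Gamma>" "\<forall>\<gamma>\<in>carrier \<Gamma>. f ` GA \<gamma> = GB (p \<gamma>)"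
  then show thesis by (intro that[of f p]) simp_all
qed

lemma graded_iso_trans:
  assumes "graded_iso K \<Gamma> A GA B GB" "graded_iso K \<Gamma> B GB C GC"
  shows "graded_iso K \<Gamma> A GA C GC"
proof -
  obtain f p where f: "f \<in> ring_iso A B" "\<And>k x. k \<in> carrier K \<Longrightarrow> x \<in> carrier A \<Longrightarrow> f (k \<odot>\<^bsub>A\<^esub> x) = k \<odot>\<^bsub>B\<^esub> f x"
    "p \<in> iso \<Gamma> \<Gamma>" "\<And>\<gamma>. \<gamma> \<in> carrier \<Gamma> \<Longrightarrow> f ` GA \<gamma> = GB (p \<gamma>)"
    using graded_isoE[OF assms(1)] by metis
  obtain g r where g: "g \<in> ring_iso B C" "\<And>k x. k \<in> carrier K \<Longrightarrow> x \<in> carrier B \<Longrightarrow> g (k \<odot>\<^bsub>B\<^esub> x) = k \<odot>\<^bsub>C\<^esub> g x"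
    "r \<in> iso \<Gamma> \<Gamma>" "\<And>\<gamma>. \<gamma> \<in> carrier \<Gamma> \<Longrightarrow> g ` GB \<gamma> = GC (r \<gamma>)"
    using graded_isoE[OF assms(2)] by metis
  have p: "p \<gamma> \<in> carrier \<Gamma>" if "\<gamma> \<in> carrier \<Gamma>" for \<gamma>
    using f(3) that by (auto simp: iso_def hom_def)
  show ?thesis unfolding graded_iso_def
  proof (intro exI[of _ "g \<circ> f"] exI[of _ "r \<circ> p"] conjI ballI)
    show "g \<circ> f \<in> ring_iso A C" by (rule ring_iso_set_trans[OF f(1) g(1)])
    show "r \<circ> p \<in> iso \<Gamma> \<Gamma>" by (rule iso_set_trans[OF f(3) g(3)])
    show "(g \<circ> f) (k \<odot>\<^bsub>A\<^esub> x) = k \<odot>\<^bsub>C\<^esub> (g \<circ> f) x" if "k \<in> carrier K" "x \<in> carrier A" for k x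
      using f(2) g(2) that ring_iso_memE(1)[OF f(1)] by simp
    show "(g \<circ> f) ` GA \<gamma> = GC ((r \<circ> p) \<gamma>)" if "\<gamma> \<in> carrier \<Gamma>" for \<gamma>
      unfolding image_comp[symmetric] f(4)[OF that] g(4)[OF p[OF that]] by simp
  qed
qed

text \<open>Formulated with closure conditions on the source, so that it applies to the tensor
  product, for which exactly these conditions are verified.\<close>

lemma graded_iso_sym_closed:
  assumes "graded_iso K \<Gamma> A GA B GB" "group \<Gamma>"
    and A: "\<And>x y. x \<in> carrier A \<Longrightarrow> y \<in> carrier A \<Longrightarrow> x \<otimes>\<^bsub>A\<^esub> y \<in> carrier A"
      "\<And>x y. x \<in> carrier A \<Longrightarrow> y \<in> carrier A \<Longrightarrow> x \<oplus>\<^bsub>A\<^esub> y \<in> carrier A" "\<one>\<^bsub>A\<^esub> \<in> carrier A"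
      "\<And>k x. k \<in> carrier K \<Longrightarrow> x \<in> carrier A \<Longrightarrow> k \<odot>\<^bsub>A\<^esub> x \<in> carrier A"
    and GA: "\<And>\<gamma>. \<gamma> \<in> carrier \<Gamma> \<Longrightarrow> GA \<gamma> \<subseteq> carrier A"
  shows "graded_iso K \<Gamma> B GB A GA"
proof -
  obtain f p where f: "f \<in> ring_iso A B" "\<And>k x. k \<in> carrier K \<Longrightarrow> x \<in> carrier A \<Longrightarrow> f (k \<odot>\<^bsub>A\<^esub> x) = k \<odot>\<^bsub>B\<^esub> f x"
    "p \<in> iso \<Gamma> \<Gamma>" "\<And>\<gamma>. \<gamma> \<in> carrier \<Gamma> \<Longrightarrow> f ` GA \<gamma> = GB (p \<gamma>)"
    using graded_isoE[OF assms(1)] by metis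
  have bf: "bij_betw f (carrier A) (carrier B)" by (rule ring_iso_memE(5)[OF f(1)])
  have bp: "bij_betw p (carrier \<Gamma>) (carrier \<Gamma>)" using f(3) by (simp add: iso_def)
  let ?g = "inv_into (carrier A) f" and ?r = "inv_into (carrier \<Gamma>) p"
  have gf: "?g (f x) = x" if "x \<in> carrier A" for x
    using bf that by (simp add: bij_betw_inv_into_left)
  have fg: "?g y \<in> carrier A" "f (?g y) = y" if "y \<in> carrier B" for y
    using bf that by (auto simp: bij_betw_def inv_into_into f_inv_into_f)
  show ?thesis unfolding graded_iso_def
  proof (intro exI[of _ ?g] exI[of _ ?r] conjI ballI)
    show "?g \<in> ring_iso B A"
    proof (rule ring_iso_memI)
      fix x y assume x: "x \<in> carrier B" and y: "y \<in> carrier B"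
      have "f (?g x \<otimes>\<^bsub>A\<^esub> ?g y) = x \<otimes>\<^bsub>B\<^esub> y"
        using ring_iso_memE(2)[OF f(1) fg(1)[OF x] fg(1)[OF y]] fg(2)[OF x] fg(2)[OF y] by simp
      then show "?g (x \<otimes>\<^bsub>B\<^esub> y) = ?g x \<otimes>\<^bsub>A\<^esub> ?g y"
        using gf[OF A(1)[OF fg(1)[OF x] fg(1)[OF y]]] by simp
      have "f (?g x \<oplus>\<^bsub>A\<^esub> ?g y) = x \<oplus>\<^bsub>B\<^esub> y"
        using ring_iso_memE(3)[OF f(1) fg(1)[OF x] fg(1)[OF y]] fg(2)[OF x] fg(2)[OF y] by simp
      then show "?g (x \<oplus>\<^bsub>B\<^esub> y) = ?g x \<oplus>\<^bsub>A\<^esub> ?g y"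
        using gf[OF A(2)[OF fg(1)[OF x] fg(1)[OF y]]] by simp
    next
      show "?g \<one>\<^bsub>B\<^esub> = \<one>\<^bsub>A\<^esub>" using gf[OF A(3)] ring_iso_memE(4)[OF f(1)] by simp
    qed (use fg bij_betw_inv_into[OF bf] in auto)
    show "?r \<in> iso \<Gamma> \<Gamma>" by (rule group.iso_set_sym[OF assms(2) f(3)])
    show "?g (k \<odot>\<^bsub>B\<^esub> y) = k \<odot>\<^bsub>A\<^esub> ?g y" if k: "k \<in> carrier K" and y: "y \<in> carrier B" for k y
      using f(2)[OF k fg(1)[OF y]] fg(2)[OF y] gf[OF A(4)[OF k fg(1)[OF y]]] by simp
    show "?g ` GB \<gamma> = GA (?r \<gamma>)" if g: "\<gamma> \<in> carrier \<Gamma>" for \<gamma>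
    proof -
      have r: "?r \<gamma> \<in> carrier \<Gamma>" "p (?r \<gamma>) = \<gamma>"
        using bp g by (auto simp: bij_betw_def inv_into_into f_inv_into_f)
      have "GB \<gamma> = f ` GA (?r \<gamma>)" using f(4)[OF r(1)] r(2) by simp
      also have "?g ` \<dots> = GA (?r \<gamma>)"
      proof -
        have "(\<lambda>x. ?g (f x)) ` GA (?r \<gamma>) = (\<lambda>x. x) ` GA (?r \<gamma>)"
          by (rule image_cong[OF refl]) (use gf GA[OF r(1)] in blast)
        then show ?thesis by (simp add: image_image)
      qed
      finally show ?thesis .
    qed
  qed
qed

lemma graded_iso_sym:
  assumes "graded_iso K \<Gamma> A GA B GB" "assoc_algebra K A" "group \<Gamma>"
    "\<And>\<gamma>. \<gamma> \<in> carrier \<Gamma> \<Longrightarrow> GA \<gamma> \<subseteq> carrier A"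
  shows "graded_iso K \<Gamma> B GB A GA"
proof -
  interpret A: assoc_algebra K A by fact
  show ?thesis by (rule graded_iso_sym_closed[OF assms(1,3) _ _ _ _ assms(4)]) auto
qed

section \<open>Quantum tori\<close>

text \<open>A \<open>quantum_torus\<close> with separate prefixes, which keep the operations of the
  field, the algebra and the grading group apart.\<close>

locale qt = F: field K + R: ring A + AL: assoc_algebra K A + G: comm_group \<Gamma> + Q: quantum_torus K \<Gamma> A Gr
  for K :: "('k, 'e) ring_scheme" (structure) and \<Gamma> :: "('g, 'c) monoid_scheme" (structure)
    and A :: "('k, 'a) module" (structure) and Gr

lemma qt_quantum_torus: "quantum_torus K \<Gamma> A Gr \<Longrightarrow> qt K \<Gamma> A Gr"
proof -
  assume "quantum_torus K \<Gamma> A Gr"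
  then interpret Q: quantum_torus K \<Gamma> A Gr .
  show ?thesis by unfold_locales
qed

context qt
begin

lemma Gr_sub: "\<gamma> \<in> carrier \<Gamma> \<Longrightarrow> x \<in> Gr \<gamma> \<Longrightarrow> x \<in> carrier A"
proof -
  assume g: "\<gamma> \<in> carrier \<Gamma>" "x \<in> Gr \<gamma>"
  obtain v where v: "v \<in> carrier A" "v \<noteq> \<zero>\<^bsub>A\<^esub>" "Gr \<gamma> = {k \<odot>\<^bsub>A\<^esub> v | k. k \<in> carrier K}"
    using Q.one_dimensional[OF g(1)] by blast
  then obtain k where "k \<in> carrier K" "x = k \<odot>\<^bsub>A\<^esub> v" using g(2) by blast
  then show ?thesis using v(1) by simp
qed

lemma Gr_smult: "\<gamma> \<in> carrier \<Gamma> \<Longrightarrow> x \<in> Gr \<gamma> \<Longrightarrow> k \<in> carrier K \<Longrightarrow> k \<odot>\<^bsub>A\<^esub> x \<in> Gr \<gamma>"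
  using submodule.smult_closed[OF Q.component] by blast

lemma Gr_mult: "\<lbrakk>\<gamma> \<in> carrier \<Gamma>; \<gamma>' \<in> carrier \<Gamma>; x \<in> Gr \<gamma>; y \<in> Gr \<gamma>'\<rbrakk> \<Longrightarrow> x \<otimes>\<^bsub>A\<^esub> y \<in> Gr (\<gamma> \<otimes>\<^bsub>\<Gamma>\<^esub> \<gamma>')"
  by (rule Q.graded_mult)

lemma unit_smult_cancel:
  assumes "k \<in> carrier K" "l \<in> carrier K" "x \<in> carrier A" "x \<noteq> \<zero>\<^bsub>A\<^esub>" "k \<odot>\<^bsub>A\<^esub> x = l \<odot>\<^bsub>A\<^esub> x"
  shows "k = l"
proof (rule ccontr)
  assume "k \<noteq> l"
  then have u: "k \<ominus>\<^bsub>K\<^esub> l \<in> Units K" using assms F.field_Units F.r_right_minus_eq by auto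
  have "(k \<ominus>\<^bsub>K\<^esub> l) \<odot>\<^bsub>A\<^esub> x = \<zero>\<^bsub>A\<^esub>"
    using assms unfolding F.minus_eq
    by (simp add: AL.smult_l_distr AL.smult_l_minus R.r_neg)
  then have "inv\<^bsub>K\<^esub> (k \<ominus>\<^bsub>K\<^esub> l) \<odot>\<^bsub>A\<^esub> ((k \<ominus>\<^bsub>K\<^esub> l) \<odot>\<^bsub>A\<^esub> x) = \<zero>\<^bsub>A\<^esub>"
    using u by (simp add: AL.smult_r_null F.Units_inv_closed)
  then have "x = \<zero>\<^bsub>A\<^esub>"
    using u assms F.Units_inv_closed[OF u] F.Units_closed[OF u] F.Units_l_inv[OF u] AL.smult_assoc1[symmetric] by simp
  then show False using assms by simp
qed

lemma Gr_nonzero: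
  assumes "\<gamma> \<in> carrier \<Gamma>"
  obtains v where "v \<in> Gr \<gamma>" "v \<noteq> \<zero>\<^bsub>A\<^esub>"
proof -
  obtain v where "v \<in> carrier A" "v \<noteq> \<zero>\<^bsub>A\<^esub>" "Gr \<gamma> = {k \<odot>\<^bsub>A\<^esub> v | k. k \<in> carrier K}"
    using Q.one_dimensional[OF assms] by blast
  moreover then have "v \<in> Gr \<gamma>" using AL.smult_one F.one_closed by force
  ultimately show thesis using that by blast
qed

lemma one_nonzero: "\<one>\<^bsub>A\<^esub> \<noteq> \<zero>\<^bsub>A\<^esub>"
proof
  assume z: "\<one>\<^bsub>A\<^esub> = \<zero>\<^bsub>A\<^esub>"
  obtain v where v: "v \<in> Gr \<one>\<^bsub>\<Gamma>\<^esub>" "v \<noteq> \<zero>\<^bsub>A\<^esub>" using Gr_nonzero[OF G.one_closed] .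
  then have "v \<in> carrier A" using Gr_sub by blast
  then have "v = \<one>\<^bsub>A\<^esub> \<otimes>\<^bsub>A\<^esub> v" by simp
  then show False using z v(2) \<open>v \<in> carrier A\<close> by simp
qed

lemma Units_nonzero: "x \<in> Units A \<Longrightarrow> x \<noteq> \<zero>\<^bsub>A\<^esub>"
proof
  assume x: "x \<in> Units A" "x = \<zero>\<^bsub>A\<^esub>"
  then have "\<one>\<^bsub>A\<^esub> = inv\<^bsub>A\<^esub> x \<otimes>\<^bsub>A\<^esub> \<zero>\<^bsub>A\<^esub>" using R.Units_l_inv[OF x(1)] by simp
  then show False using one_nonzero R.Units_inv_closed[OF x(1)] by simp
qed

lemma Gr_unit: "\<gamma> \<in> carrier \<Gamma> \<Longrightarrow> x \<in> Gr \<gamma> \<Longrightarrow> x \<noteq> \<zero>\<^bsub>A\<^esub> \<Longrightarrow> x \<in> Units A"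
  by (rule Q.homogeneous_unit)

lemma Gr_span:
  assumes "\<gamma> \<in> carrier \<Gamma>" "x \<in> Gr \<gamma>" "x \<noteq> \<zero>\<^bsub>A\<^esub>" "y \<in> Gr \<gamma>"
  obtains k where "k \<in> carrier K" "y = k \<odot>\<^bsub>A\<^esub> x"
proof -
  obtain v where v: "v \<in> carrier A" "v \<noteq> \<zero>\<^bsub>A\<^esub>" "Gr \<gamma> = {k \<odot>\<^bsub>A\<^esub> v | k. k \<in> carrier K}"
    using Q.one_dimensional[OF assms(1)] by blast
  obtain a b where ab: "a \<in> carrier K" "x = a \<odot>\<^bsub>A\<^esub> v" "b \<in> carrier K" "y = b \<odot>\<^bsub>A\<^esub> v"
    using assms(2,4) v(3) by blast
  have "a \<noteq> \<zero>\<^bsub>K\<^esub>" using assms(3) ab v by auto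
  then have a: "a \<in> Units K" using ab F.field_Units by auto
  have "(b \<otimes>\<^bsub>K\<^esub> inv\<^bsub>K\<^esub> a) \<odot>\<^bsub>A\<^esub> x = (b \<otimes>\<^bsub>K\<^esub> inv\<^bsub>K\<^esub> a \<otimes>\<^bsub>K\<^esub> a) \<odot>\<^bsub>A\<^esub> v"
    using ab a v by (simp add: AL.smult_assoc1)
  also have "\<dots> = y" using ab a v by (simp add: F.m_assoc F.Units_l_inv)
  finally show thesis using that[of "b \<otimes>\<^bsub>K\<^esub> inv\<^bsub>K\<^esub> a"] ab a by simp
qed

text \<open>A nonzero \<open>v\<close> of trivial degree satisfies \<open>v v = k v\<close> because
  its component is a line; cancelling the unit \<open>v\<close> shows that \<open>v\<close> is a
  nonzero multiple of 1.\<close>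

lemma Gr_one: "\<one>\<^bsub>A\<^esub> \<in> Gr \<one>\<^bsub>\<Gamma>\<^esub>"
proof -
  obtain v where v: "v \<in> Gr \<one>\<^bsub>\<Gamma>\<^esub>" "v \<noteq> \<zero>\<^bsub>A\<^esub>" using Gr_nonzero[OF G.one_closed] .
  have vA: "v \<in> carrier A" "v \<in> Units A" using Gr_sub[OF _ v(1)] Gr_unit[OF _ v] by auto
  have "v \<otimes>\<^bsub>A\<^esub> v \<in> Gr \<one>\<^bsub>\<Gamma>\<^esub>" using Gr_mult[OF _ _ v(1) v(1)] by simp
  then obtain k where k: "k \<in> carrier K" "v \<otimes>\<^bsub>A\<^esub> v = k \<odot>\<^bsub>A\<^esub> v"
    using Gr_span[OF G.one_closed v] by blast
  have "v \<otimes>\<^bsub>A\<^esub> v = (k \<odot>\<^bsub>A\<^esub> \<one>\<^bsub>A\<^esub>) \<otimes>\<^bsub>A\<^esub> v"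
    using k vA AL.smult_mult_left[of k "\<one>\<^bsub>A\<^esub>" v] by simp
  then have "(v \<otimes>\<^bsub>A\<^esub> v) \<otimes>\<^bsub>A\<^esub> inv\<^bsub>A\<^esub> v = ((k \<odot>\<^bsub>A\<^esub> \<one>\<^bsub>A\<^esub>) \<otimes>\<^bsub>A\<^esub> v) \<otimes>\<^bsub>A\<^esub> inv\<^bsub>A\<^esub> v" by simp
  moreover have "(v \<otimes>\<^bsub>A\<^esub> v) \<otimes>\<^bsub>A\<^esub> inv\<^bsub>A\<^esub> v = v \<otimes>\<^bsub>A\<^esub> (v \<otimes>\<^bsub>A\<^esub> inv\<^bsub>A\<^esub> v)"
    "((k \<odot>\<^bsub>A\<^esub> \<one>\<^bsub>A\<^esub>) \<otimes>\<^bsub>A\<^esub> v) \<otimes>\<^bsub>A\<^esub> inv\<^bsub>A\<^esub> v = (k \<odot>\<^bsub>A\<^esub> \<one>\<^bsub>A\<^esub>) \<otimes>\<^bsub>A\<^esub> (v \<otimes>\<^bsub>A\<^esub> inv\<^bsub>A\<^esub> v)"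
    by (rule R.m_assoc; use vA k in simp)+
  ultimately have vk: "v = k \<odot>\<^bsub>A\<^esub> \<one>\<^bsub>A\<^esub>"
    unfolding R.Units_r_inv[OF vA(2)] using vA(1) k(1) by simp
  then have "k \<noteq> \<zero>\<^bsub>K\<^esub>" using v(2) by auto
  then have ku: "k \<in> Units K" using k F.field_Units by auto
  have "inv\<^bsub>K\<^esub> k \<odot>\<^bsub>A\<^esub> v = \<one>\<^bsub>A\<^esub>"
    unfolding vk using ku k AL.smult_assoc1[symmetric] by (simp add: F.Units_l_inv)
  then show ?thesis using Gr_smult[OF G.one_closed v(1)] ku by (metis F.Units_inv_closed)
qed

text \<open>For a nonzero \<open>y\<close> of the inverse degree, \<open>y x\<close> is a nonzero
  multiple of 1, so the inverse of \<open>x\<close> is a multiple of \<open>y\<close>.\<close>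

lemma Gr_inv:
  assumes "\<gamma> \<in> carrier \<Gamma>" "x \<in> Gr \<gamma>" "x \<noteq> \<zero>\<^bsub>A\<^esub>"
  shows "inv\<^bsub>A\<^esub> x \<in> Gr (inv\<^bsub>\<Gamma>\<^esub> \<gamma>)"
proof -
  obtain y where y: "y \<in> Gr (inv\<^bsub>\<Gamma>\<^esub> \<gamma>)" "y \<noteq> \<zero>\<^bsub>A\<^esub>" using Gr_nonzero[of "inv\<^bsub>\<Gamma>\<^esub> \<gamma>"] assms by auto
  have x: "x \<in> Units A" "x \<in> carrier A" using Gr_unit Gr_sub assms by auto
  have yA: "y \<in> carrier A" "y \<in> Units A" using y Gr_sub Gr_unit assms(1) G.inv_closed by blast+
  have "y \<otimes>\<^bsub>A\<^esub> x \<in> Gr \<one>\<^bsub>\<Gamma>\<^esub>" using Gr_mult[OF _ _ y(1) assms(2)] assms(1) by simp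
  then obtain k where k: "k \<in> carrier K" "y \<otimes>\<^bsub>A\<^esub> x = k \<odot>\<^bsub>A\<^esub> \<one>\<^bsub>A\<^esub>"
    using Gr_span[OF G.one_closed Gr_one one_nonzero] by blast
  have "y \<otimes>\<^bsub>A\<^esub> x \<noteq> \<zero>\<^bsub>A\<^esub>" using Units_nonzero R.Units_m_closed yA x by blast
  then have "k \<noteq> \<zero>\<^bsub>K\<^esub>" using k(2) by auto
  then have ku: "k \<in> Units K" using k F.field_Units by auto
  have "(inv\<^bsub>K\<^esub> k \<odot>\<^bsub>A\<^esub> y) \<otimes>\<^bsub>A\<^esub> x = \<one>\<^bsub>A\<^esub>"
    using ku k x yA AL.smult_mult_left[of "inv\<^bsub>K\<^esub> k" y x] AL.smult_assoc1[symmetric] by (simp add: F.Units_l_inv)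
  moreover have c: "inv\<^bsub>K\<^esub> k \<odot>\<^bsub>A\<^esub> y \<in> carrier A" using ku yA by simp
  ultimately have "inv\<^bsub>A\<^esub> x = inv\<^bsub>K\<^esub> k \<odot>\<^bsub>A\<^esub> y"
    using x by (metis R.Units_inv_closed R.Units_r_inv R.l_one R.m_assoc R.r_one)
  then show ?thesis using Gr_smult[OF _ y(1)] ku assms(1) by simp
qed

lemma Gr_mult_nonzero:
  "\<lbrakk>\<gamma> \<in> carrier \<Gamma>; \<gamma>' \<in> carrier \<Gamma>; x \<in> Gr \<gamma>; y \<in> Gr \<gamma>'; x \<noteq> \<zero>\<^bsub>A\<^esub>; y \<noteq> \<zero>\<^bsub>A\<^esub>\<rbrakk> \<Longrightarrow> x \<otimes>\<^bsub>A\<^esub> y \<noteq> \<zero>\<^bsub>A\<^esub>"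
  using Units_nonzero R.Units_m_closed Gr_unit by meson

lemma commutation_factor:
  assumes "\<gamma> \<in> carrier \<Gamma>" "\<gamma>' \<in> carrier \<Gamma>"
  obtains k where "k \<in> Units K" "\<And>x y. x \<in> Gr \<gamma> \<Longrightarrow> y \<in> Gr \<gamma>' \<Longrightarrow> x \<otimes>\<^bsub>A\<^esub> y = k \<odot>\<^bsub>A\<^esub> (y \<otimes>\<^bsub>A\<^esub> x)"
proof -
  obtain v where v: "v \<in> Gr \<gamma>" "v \<noteq> \<zero>\<^bsub>A\<^esub>" using Gr_nonzero assms by blast
  obtain w where w: "w \<in> Gr \<gamma>'" "w \<noteq> \<zero>\<^bsub>A\<^esub>" using Gr_nonzero assms by blast
  have c: "v \<in> carrier A" "w \<in> carrier A" using v w Gr_sub assms by auto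
  have "v \<otimes>\<^bsub>A\<^esub> w \<in> Gr (\<gamma> \<otimes>\<^bsub>\<Gamma>\<^esub> \<gamma>')" "w \<otimes>\<^bsub>A\<^esub> v \<in> Gr (\<gamma> \<otimes>\<^bsub>\<Gamma>\<^esub> \<gamma>')"
    using Gr_mult v w assms G.m_comm by metis+
  moreover have "w \<otimes>\<^bsub>A\<^esub> v \<noteq> \<zero>\<^bsub>A\<^esub>" using Gr_mult_nonzero v w assms by blast
  ultimately obtain k where k: "k \<in> carrier K" "v \<otimes>\<^bsub>A\<^esub> w = k \<odot>\<^bsub>A\<^esub> (w \<otimes>\<^bsub>A\<^esub> v)"
    using Gr_span[of "\<gamma> \<otimes>\<^bsub>\<Gamma>\<^esub> \<gamma>'"] assms by (metis G.m_closed)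
  have "v \<otimes>\<^bsub>A\<^esub> w \<noteq> \<zero>\<^bsub>A\<^esub>" using Gr_mult_nonzero v w assms by blast
  then have "k \<noteq> \<zero>\<^bsub>K\<^esub>" using k(2) c by auto
  then have ku: "k \<in> Units K" using k F.field_Units by auto
  show thesis
  proof (rule that[OF ku])
    fix x y assume xy: "x \<in> Gr \<gamma>" "y \<in> Gr \<gamma>'"
    obtain a where a: "a \<in> carrier K" "x = a \<odot>\<^bsub>A\<^esub> v" using Gr_span[OF assms(1) v xy(1)] .
    obtain b where b: "b \<in> carrier K" "y = b \<odot>\<^bsub>A\<^esub> w" using Gr_span[OF assms(2) w xy(2)] .
    have e: "(s \<odot>\<^bsub>A\<^esub> p) \<otimes>\<^bsub>A\<^esub> (t \<odot>\<^bsub>A\<^esub> r) = (s \<otimes>\<^bsub>K\<^esub> t) \<odot>\<^bsub>A\<^esub> (p \<otimes>\<^bsub>A\<^esub> r)"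
      if "s \<in> carrier K" "t \<in> carrier K" "p \<in> carrier A" "r \<in> carrier A" for s t p r
      using that AL.smult_mult_left[of s p "t \<odot>\<^bsub>A\<^esub> r"] AL.smult_mult_right[of t p r] by (simp add: AL.smult_assoc1)
    show "x \<otimes>\<^bsub>A\<^esub> y = k \<odot>\<^bsub>A\<^esub> (y \<otimes>\<^bsub>A\<^esub> x)"
      unfolding a b using a(1) b(1) c k by (simp add: e AL.smult_assoc1[symmetric] F.m_ac)
  qed
qed

lemma Gr_int_pow:
  assumes g: "\<gamma> \<in> carrier \<Gamma>" "x \<in> Gr \<gamma>" "x \<noteq> \<zero>\<^bsub>A\<^esub>"
  shows "x [^]\<^bsub>units_of A\<^esub> (a::int) \<in> Gr (\<gamma> [^]\<^bsub>\<Gamma>\<^esub> a)" "x [^]\<^bsub>units_of A\<^esub> (a::int) \<in> Units A"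
proof -
  interpret U: group "units_of A" by (rule R.units_group)
  have xU: "x \<in> carrier (units_of A)" using Gr_unit assms by (simp add: units_of_carrier)
  show u: "x [^]\<^bsub>units_of A\<^esub> (a::int) \<in> Units A" for a
    using U.int_pow_closed[OF xU] by (simp add: units_of_carrier)
  have nat: "x [^]\<^bsub>units_of A\<^esub> (k::nat) \<in> Gr (\<gamma> [^]\<^bsub>\<Gamma>\<^esub> k)" for k
  proof (induction k)
    case 0 then show ?case using Gr_one by (simp add: units_of_one)
  next
    case (Suc k)
    then show ?case using Gr_mult[OF _ g(1) Suc g(2)] g(1) by (simp add: units_of_mult)
  qed
  show "x [^]\<^bsub>units_of A\<^esub> (a::int) \<in> Gr (\<gamma> [^]\<^bsub>\<Gamma>\<^esub> a)"
  proof (cases "a < 0")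
    case False
    then obtain k where "a = int k" by (metis not_less zero_le_imp_eq_int)
    then show ?thesis using nat[of k] by (simp add: int_pow_int)
  next
    case True
    then obtain k where a: "a = - int k" by (metis less_imp_le minus_minus neg_0_le_iff_le zero_le_imp_eq_int)
    have xk: "x [^]\<^bsub>units_of A\<^esub> k \<in> Units A" using U.nat_pow_closed[OF xU] by (simp add: units_of_carrier)
    have "inv\<^bsub>A\<^esub> (x [^]\<^bsub>units_of A\<^esub> k) \<in> Gr (inv\<^bsub>\<Gamma>\<^esub> (\<gamma> [^]\<^bsub>\<Gamma>\<^esub> k))"
      by (rule Gr_inv[OF _ nat Units_nonzero[OF xk]]) (use g in simp)
    then show ?thesis unfolding a U.int_pow_neg_int[OF xU] G.int_pow_neg_int[OF g(1)] R.units_of_inv[OF xk] .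
  qed
qed

text \<open>Homogeneous components are lines, so one nonzero element in each of them is a basis; if
  these elements multiply by the cocycle, linear extension is an isomorphism. The automorphism
  \<open>\<psi>\<close> records that the basis may be indexed by transformed degrees.\<close>

lemma graded_iso_twisted_algebra:
  assumes rep: "twisted_rep K \<Gamma> \<sigma> A x" and \<psi>: "\<psi> \<in> iso \<Gamma> \<Gamma>"
    and x: "\<And>\<gamma>. \<gamma> \<in> carrier \<Gamma> \<Longrightarrow> x \<gamma> \<in> Gr (\<psi> \<gamma>) \<and> x \<gamma> \<noteq> \<zero>\<^bsub>A\<^esub>"
  shows "graded_iso K \<Gamma> (twisted_algebra K \<Gamma> \<sigma>) (line K) A Gr"
proof -
  interpret V: twisted_rep K \<Gamma> \<sigma> A x by (rule rep)
  have b: "bij_betw \<psi> (carrier \<Gamma>) (carrier \<Gamma>)" using \<psi> by (simp add: iso_def)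
  define \<psi>' where "\<psi>' = inv_into (carrier \<Gamma>) \<psi>"
  have p1: "\<psi> \<gamma> \<in> carrier \<Gamma>" "\<psi>' \<gamma> \<in> carrier \<Gamma>" "\<psi> (\<psi>' \<gamma>) = \<gamma>" "\<psi>' (\<psi> \<gamma>) = \<gamma>" if "\<gamma> \<in> carrier \<Gamma>" for \<gamma>
    using b that unfolding \<psi>'_def
    by (auto simp: bij_betw_def inv_into_into f_inv_into_f)
  have inj: "inj_on \<psi> (carrier \<Gamma>)" using b by (simp add: bij_betw_def)
  \<comment> \<open>\<open>comp f\<close> is the family of homogeneous components of
    \<open>V.lin f\<close>. Uniqueness of the decomposition gives injectivity, its existence
    surjectivity.\<close>
  define comp where "comp f \<delta> = (if \<delta> \<in> carrier \<Gamma> then f (\<psi>' \<delta>) \<odot>\<^bsub>A\<^esub> x (\<psi>' \<delta>) else \<zero>\<^bsub>A\<^esub>)" for f \<delta>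
  define dec where "dec a c \<longleftrightarrow> (\<forall>\<gamma>\<in>carrier \<Gamma>. c \<gamma> \<in> Gr \<gamma>) \<and> (\<forall>\<gamma>. \<gamma> \<notin> carrier \<Gamma> \<longrightarrow> c \<gamma> = \<zero>\<^bsub>A\<^esub>) \<and>
           finite {\<gamma>. c \<gamma> \<noteq> \<zero>\<^bsub>A\<^esub>} \<and> a = (\<Oplus>\<^bsub>A\<^esub>\<gamma>\<in>{\<gamma>. c \<gamma> \<noteq> \<zero>\<^bsub>A\<^esub>}. c \<gamma>)" for a c
  have dec1: "\<exists>!c. dec a c" if "a \<in> carrier A" for a unfolding dec_def by (rule Q.direct_sum[OF that])
  have zero_iff: "k \<odot>\<^bsub>A\<^esub> x \<gamma> = \<zero>\<^bsub>A\<^esub> \<longleftrightarrow> k = \<zero>\<^bsub>K\<^esub>" if "k \<in> carrier K" "\<gamma> \<in> carrier \<Gamma>" for k \<gamma>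
    using unit_smult_cancel[of k "\<zero>\<^bsub>K\<^esub>" "x \<gamma>"] that x V.rep_closed by auto
  have sum: "V.lin f = (\<Oplus>\<^bsub>A\<^esub>\<gamma>\<in>{\<gamma>. c \<gamma> \<noteq> \<zero>\<^bsub>A\<^esub>}. c \<gamma>) \<and> finite {\<gamma>. c \<gamma> \<noteq> \<zero>\<^bsub>A\<^esub>}"
    if f: "f \<in> carrier V.T" and c: "c = comp f" for f c
  proof -
    have S: "V.supp f \<subseteq> carrier \<Gamma>" "finite (V.supp f)" using f V.supp_sub V.supp_finite by auto
    have im: "{\<gamma>. c \<gamma> \<noteq> \<zero>\<^bsub>A\<^esub>} = \<psi> ` V.supp f"
    proof (intro Set.set_eqI iffI)
      fix \<delta> assume "\<delta> \<in> {\<gamma>. c \<gamma> \<noteq> \<zero>\<^bsub>A\<^esub>}"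
      then have d: "\<delta> \<in> carrier \<Gamma>" "f (\<psi>' \<delta>) \<odot>\<^bsub>A\<^esub> x (\<psi>' \<delta>) \<noteq> \<zero>\<^bsub>A\<^esub>" by (auto simp: c comp_def split: if_splits)
      then have "\<psi>' \<delta> \<in> V.supp f" using zero_iff[of "f (\<psi>' \<delta>)" "\<psi>' \<delta>"] p1[OF d(1)] f by (auto simp: V.supp_def)
      then show "\<delta> \<in> \<psi> ` V.supp f" using p1[OF d(1)] by (metis imageI)
    next
      fix \<delta> assume "\<delta> \<in> \<psi> ` V.supp f"
      then obtain \<gamma> where g: "\<gamma> \<in> V.supp f" "\<delta> = \<psi> \<gamma>" by blast
      then have "\<gamma> \<in> carrier \<Gamma>" using S by blast
      then show "\<delta> \<in> {\<gamma>. c \<gamma> \<noteq> \<zero>\<^bsub>A\<^esub>}"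
        using g zero_iff[of "f \<gamma>" \<gamma>] p1[of \<gamma>] f by (auto simp: c comp_def V.supp_def)
    qed
    have "V.lin f = (\<Oplus>\<^bsub>A\<^esub>\<gamma>\<in>V.supp f. c (\<psi> \<gamma>))"
      unfolding V.lin_def
    proof (rule R.finsum_cong'[OF refl])
      show "(\<lambda>\<gamma>. c (\<psi> \<gamma>)) \<in> V.supp f \<rightarrow> carrier A"
        using S f p1 by (auto simp: c comp_def)
      fix \<gamma> assume "\<gamma> \<in> V.supp f"
      then show "f \<gamma> \<odot>\<^bsub>A\<^esub> x \<gamma> = c (\<psi> \<gamma>)" using S p1[of \<gamma>] by (auto simp: c comp_def)
    qed
    also have "\<dots> = (\<Oplus>\<^bsub>A\<^esub>\<gamma>\<in>\<psi> ` V.supp f. c \<gamma>)"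
      by (rule R.add.finprod_reindex[symmetric])
        (use S f p1 inj in \<open>auto simp: c comp_def intro: inj_on_subset\<close>)
    finally show ?thesis unfolding im using S by simp
  qed
  have dec_comp: "dec (V.lin f) (comp f)" if f: "f \<in> carrier V.T" for f
    unfolding dec_def
  proof (intro conjI ballI allI impI)
    fix \<delta> assume d: "\<delta> \<in> carrier \<Gamma>"
    have "x (\<psi>' \<delta>) \<in> Gr \<delta>" using x[of "\<psi>' \<delta>"] p1[OF d] by simp
    then show "comp f \<delta> \<in> Gr \<delta>" using Gr_smult[OF d] f d by (simp add: comp_def)
  qed (simp add: comp_def, (use sum[OF f refl] in blast)+)
  have "bij_betw V.lin (carrier V.T) (carrier A)"
    unfolding bij_betw_def
  proof (intro conjI inj_onI subset_antisym subsetI)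
    fix f g assume f: "f \<in> carrier V.T" and g: "g \<in> carrier V.T" and eq: "V.lin f = V.lin g"
    have "comp f = comp g" using dec1[OF V.lin_closed[OF f]] dec_comp[OF f] dec_comp[OF g] eq by auto
    show "f = g"
    proof
      fix \<gamma>
      show "f \<gamma> = g \<gamma>"
      proof (cases "\<gamma> \<in> carrier \<Gamma>")
        case True
        have "comp f (\<psi> \<gamma>) = comp g (\<psi> \<gamma>)" using \<open>comp f = comp g\<close> by simp
        then have "f \<gamma> \<odot>\<^bsub>A\<^esub> x \<gamma> = g \<gamma> \<odot>\<^bsub>A\<^esub> x \<gamma>" using p1[OF True] by (simp add: comp_def)
        then show ?thesis using unit_smult_cancel f g x[OF True] V.rep_closed[OF True] by (meson V.T_eval)
      next
        case False
        then have "\<gamma> \<notin> V.supp f" "\<gamma> \<notin> V.supp g" using V.supp_sub f g by blast+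
        then show ?thesis by (simp add: V.supp_def)
      qed
    qed
  next
    fix a assume "a \<in> V.lin ` carrier V.T" then show "a \<in> carrier A" by auto
  next
    fix a assume a: "a \<in> carrier A"
    then obtain c where c: "dec a c" using dec1 by blast
    have "\<exists>k. k \<in> carrier K \<and> c (\<psi> \<gamma>) = k \<odot>\<^bsub>A\<^esub> x \<gamma>" if g: "\<gamma> \<in> carrier \<Gamma>" for \<gamma>
    proof -
      have "c (\<psi> \<gamma>) \<in> Gr (\<psi> \<gamma>)" using c p1[OF g] unfolding dec_def by blast
      then show ?thesis using Gr_span[of "\<psi> \<gamma>" "x \<gamma>"] x[OF g] p1[OF g] by metis
    qed
    then obtain k where k: "\<And>\<gamma>. \<gamma> \<in> carrier \<Gamma> \<Longrightarrow> k \<gamma> \<in> carrier K \<and> c (\<psi> \<gamma>) = k \<gamma> \<odot>\<^bsub>A\<^esub> x \<gamma>" by metis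
    define f where "f \<gamma> = (if \<gamma> \<in> carrier \<Gamma> then k \<gamma> else \<zero>\<^bsub>K\<^esub>)" for \<gamma>
    have sf: "V.supp f \<subseteq> carrier \<Gamma>" by (auto simp: V.supp_def f_def)
    have "V.supp f \<subseteq> \<psi>' ` {\<gamma>. c \<gamma> \<noteq> \<zero>\<^bsub>A\<^esub>}"
    proof
      fix \<gamma> assume g: "\<gamma> \<in> V.supp f"
      then have gc: "\<gamma> \<in> carrier \<Gamma>" using sf by blast
      have "c (\<psi> \<gamma>) \<noteq> \<zero>\<^bsub>A\<^esub>" using k[OF gc] zero_iff[of "k \<gamma>" \<gamma>] g gc by (auto simp: V.supp_def f_def)
      then show "\<gamma> \<in> \<psi>' ` {\<gamma>. c \<gamma> \<noteq> \<zero>\<^bsub>A\<^esub>}" using p1(4)[OF gc] by (metis (mono_tags) imageI mem_Collect_eq)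
    qed
    then have fin: "finite (V.supp f)" using c unfolding dec_def by (meson finite_imageI finite_subset)
    have f: "f \<in> carrier V.T" unfolding V.T_simps using sf fin k by (simp add: f_def)
    have "comp f = c"
    proof
      fix \<delta> show "comp f \<delta> = c \<delta>"
        using k[of "\<psi>' \<delta>"] p1[of \<delta>] c unfolding dec_def by (auto simp: comp_def f_def)
    qed
    then have "a = V.lin f" using dec_comp[OF f] c unfolding dec_def by simp
    then show "a \<in> V.lin ` carrier V.T" using f by blast
  qed
  then have iso: "V.lin \<in> ring_iso V.T A"
    using V.lin_ring_hom by (simp add: ring_iso_def)
  have "V.lin ` line K \<gamma> = Gr (\<psi> \<gamma>)" if g: "\<gamma> \<in> carrier \<Gamma>" for \<gamma>
  proof -
    have l: "line K \<gamma> = (\<lambda>k. V.mon k \<gamma>) ` carrier K"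
    proof -
      have "(\<lambda>x. k \<otimes>\<^bsub>K\<^esub> delta K \<gamma> x) = V.mon k \<gamma>" if "k \<in> carrier K" for k
        using that by (auto simp: delta_def V.mon_def)
      note m = this
      show ?thesis
      proof (intro Set.set_eqI iffI)
        fix f assume "f \<in> line K \<gamma>"
        then obtain k where "k \<in> carrier K" "f = (\<lambda>x. k \<otimes>\<^bsub>K\<^esub> delta K \<gamma> x)" unfolding line_def by blast
        then show "f \<in> (\<lambda>k. V.mon k \<gamma>) ` carrier K" using m by blast
      next
        fix f assume "f \<in> (\<lambda>k. V.mon k \<gamma>) ` carrier K"
        then obtain k where "k \<in> carrier K" "f = (\<lambda>x. k \<otimes>\<^bsub>K\<^esub> delta K \<gamma> x)" using m by force
        then show "f \<in> line K \<gamma>" unfolding line_def by blast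
      qed
    qed
    have "V.lin ` line K \<gamma> = (\<lambda>k. k \<odot>\<^bsub>A\<^esub> x \<gamma>) ` carrier K"
      unfolding l image_image by (rule image_cong) (use g V.lin_mon in auto)
    also have "\<dots> = Gr (\<psi> \<gamma>)"
      using x[OF g] p1[OF g] Gr_smult Gr_span[of "\<psi> \<gamma>" "x \<gamma>"] by (auto simp: image_iff) metis+
    finally show ?thesis .
  qed
  then show ?thesis unfolding graded_iso_def
    using iso V.lin_smult \<psi> by (intro exI[of _ V.lin] exI[of _ \<psi>]) auto
qed

end

section \<open>Integral powers of a unit\<close>

context field
begin

lemma int_pow_units: "q \<in> Units R \<Longrightarrow> q [^]\<^bsub>R\<^esub> (z::int) = q [^]\<^bsub>units_of R\<^esub> z"
proof -
  assume q: "q \<in> Units R"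
  interpret U: group "units_of R" by (rule units_group)
  have n: "q [^]\<^bsub>R\<^esub> k = q [^]\<^bsub>units_of R\<^esub> k" for k :: nat using units_of_pow[OF q] by simp
  have u: "q [^]\<^bsub>units_of R\<^esub> k \<in> Units R" for k :: nat
    using U.nat_pow_closed[of q k] q by (simp add: units_of_carrier)
  show ?thesis unfolding int_pow_def2 n using units_of_inv[OF u] by (simp del: pow_nat)
qed

lemma int_pow_Units [simp, intro]: "q \<in> Units R \<Longrightarrow> q [^] (z::int) \<in> Units R"
  using group.int_pow_closed[OF units_group] by (simp add: int_pow_units units_of_carrier)

lemma int_pow_carrier [simp, intro]: "q \<in> Units R \<Longrightarrow> q [^] (z::int) \<in> carrier R"
  by (rule Units_closed[OF int_pow_Units])

lemma int_pow_plus: "q \<in> Units R \<Longrightarrow> q [^] (a + b :: int) = q [^] a \<otimes> q [^] b"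
  using group.int_pow_mult[OF units_group, of q a b] by (simp add: int_pow_units units_of_carrier units_of_mult)

lemma int_pow_times: "q \<in> Units R \<Longrightarrow> (q [^] (a::int)) [^] (b::int) = q [^] (a * b)"
  using group.int_pow_pow[OF units_group, of q a b] int_pow_Units[of q a]
  by (simp add: int_pow_units units_of_carrier)

lemma int_pow_eq_iff:
  assumes "q \<in> Units R"
  shows "q [^] (a::int) = q [^] (b::int) \<longleftrightarrow> [a = b] (mod int (order_of R q))"
  using group.int_pow_eq[OF units_group, of q b a] assms
  by (auto simp: int_pow_units units_of_carrier order_of_def cong_iff_dvd_diff)

end

section \<open>The group \<open>\<int>\<^sup>n\<close> and bilinear forms on it\<close>

lemma Zn_simps:
  "carrier (Zn n) = ({..<n} \<rightarrow>\<^sub>E UNIV)" "\<one>\<^bsub>Zn n\<^esub> = (\<lambda>i\<in>{..<n}. 0)"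
  "x \<otimes>\<^bsub>Zn n\<^esub> y = (\<lambda>i\<in>{..<n}. x i + y i)"
  by (simp_all add: Zn_def)

lemma Zn_comm_group: "comm_group (Zn n)"
proof (rule group.group_comm_groupI)
  show "group (Zn n)" unfolding Zn_def by (rule product_group) simp
  show "x \<otimes>\<^bsub>Zn n\<^esub> y = y \<otimes>\<^bsub>Zn n\<^esub> x" for x y
    unfolding Zn_simps(3) by (simp add: add.commute)
qed

lemma Zn_group: "group (Zn n)"
  using Zn_comm_group comm_group.axioms by blast

lemma Zn_ext: "x \<in> carrier (Zn n) \<Longrightarrow> y \<in> carrier (Zn n) \<Longrightarrow> (\<And>i. i < n \<Longrightarrow> x i = y i) \<Longrightarrow> x = y"
  by (auto simp: Zn_simps intro: PiE_ext)

lemma Zn_restrict [simp]: "(\<lambda>i\<in>{..<n}. f i) \<in> carrier (Zn n)"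
  by (simp add: Zn_simps)

lemma Zn_int_pow:
  assumes "x \<in> carrier (Zn n)"
  shows "x [^]\<^bsub>Zn n\<^esub> (a::int) = (\<lambda>i\<in>{..<n}. a * x i)"
proof -
  interpret G: comm_group "Zn n" by (rule Zn_comm_group)
  have n: "x [^]\<^bsub>Zn n\<^esub> k = (\<lambda>i\<in>{..<n}. int k * x i)" for k :: nat
  proof (induction k)
    case 0 show ?case by (simp add: Zn_simps)
  next
    case (Suc k)
    then show ?case by (auto simp: Zn_simps algebra_simps)
  qed
  show ?thesis
  proof (cases "a < 0")
    case False
    then obtain k where "a = int k" by (metis not_less zero_le_imp_eq_int)
    then show ?thesis using n by (simp add: int_pow_int)
  next
    case True
    then obtain k where a: "a = - int k" by (metis less_imp_le minus_minus neg_0_le_iff_le zero_le_imp_eq_int)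
    have "inv\<^bsub>Zn n\<^esub> (\<lambda>i\<in>{..<n}. int k * x i) = (\<lambda>i\<in>{..<n}. - (int k * x i))"
      by (rule G.inv_equality) (auto simp: Zn_simps)
    then show ?thesis unfolding a G.int_pow_neg_int[OF assms] n by simp
  qed
qed

definition bil :: "nat \<Rightarrow> int mat \<Rightarrow> (nat \<Rightarrow> int) \<Rightarrow> (nat \<Rightarrow> int) \<Rightarrow> int" where
  "bil n M x y = (\<Sum>i<n. \<Sum>j<n. x i * M $$ (i,j) * y j)"

text \<open>The cocycle \<open>q\<^bsup>upper n M x y\<^esup>\<close> has the commutation factors \<open>q\<^bsup>bil n M x y\<^esup>\<close>; no halving of \<open>M\<close>
  is needed.\<close>

definition upper :: "nat \<Rightarrow> int mat \<Rightarrow> (nat \<Rightarrow> int) \<Rightarrow> (nat \<Rightarrow> int) \<Rightarrow> int" where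
  "upper n M x y = (\<Sum>j<n. \<Sum>i<j. x i * M $$ (i,j) * y j)"

text \<open>The strict upper triangle minus its transpose is the whole alternating matrix; the
  induction borders the matrix by one row and column.\<close>

lemma upper_antisym:
  assumes "alt_mat n M"
  shows "upper n M x y - upper n M y x = bil n M x y"
proof -
  have "upper k M x y - upper k M y x = bil k M x y" if "k \<le> n" for k
    using that
  proof (induction k)
    case 0 then show ?case by (simp add: upper_def bil_def)
  next
    case (Suc k)
    have a: "M $$ (k,i) = - M $$ (i,k)" if "i \<le> k" for i
      using alt_mat_entry[OF assms, of i k] Suc.prems that by simp
    have "(\<Sum>i<k. x k * M $$ (k,i) * y i) = - (\<Sum>i<k. y i * M $$ (i,k) * x k)"
      unfolding sum_negf[symmetric] by (intro sum.cong refl) (simp add: a mult_ac)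
    moreover have "M $$ (k,k) = 0" using a[of k] by simp
    ultimately show ?case using Suc by (simp add: upper_def bil_def sum.distrib)
  qed
  then show ?thesis by simp
qed

lemma upper_add_left: "upper n M (\<lambda>i\<in>{..<n}. x i + x' i) y = upper n M x y + upper n M x' y"
  unfolding upper_def sum.distrib[symmetric] by (intro sum.cong refl) (auto simp: algebra_simps)

lemma upper_add_right: "upper n M x (\<lambda>i\<in>{..<n}. y i + y' i) = upper n M x y + upper n M x y'"
  unfolding upper_def sum.distrib[symmetric] by (intro sum.cong refl) (auto simp: algebra_simps)

lemma upper_zero [simp]: "upper n M (\<lambda>i\<in>{..<n}. 0) y = 0" "upper n M x (\<lambda>i\<in>{..<n}. 0) = 0"
  unfolding upper_def by (auto intro!: sum.neutral)

section \<open>The quantum torus of an alternating matrix\<close>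

definition torus_algebra :: "('k, 'e) ring_scheme \<Rightarrow> nat \<Rightarrow> 'k \<Rightarrow> int mat \<Rightarrow> ('k, (nat \<Rightarrow> int) \<Rightarrow> 'k) module" where
  "torus_algebra K n q M = twisted_algebra K (Zn n) (\<lambda>x y. q [^]\<^bsub>K\<^esub> upper n M x y)"

lemma twisted_monoid_torus:
  assumes K: "field K" and q: "q \<in> Units K"
  shows "twisted_monoid K (Zn n) (\<lambda>x y. q [^]\<^bsub>K\<^esub> upper n M x y)"
proof -
  interpret field K by (rule K)
  interpret G: comm_group "Zn n" by (rule Zn_comm_group)
  show ?thesis
  proof (unfold_locales, goal_cases)
    case (2 x y z)
    show ?case using q
      by (simp add: Zn_simps(3) upper_add_left upper_add_right int_pow_plus[symmetric] add_ac)
  qed (use q in \<open>auto simp: Zn_simps(2)\<close>)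
qed

definition has_form :: "('k, 'e) ring_scheme \<Rightarrow> nat \<Rightarrow> 'k \<Rightarrow> ('k, 'a) module \<Rightarrow> ((nat \<Rightarrow> int) \<Rightarrow> 'a set) \<Rightarrow> int mat \<Rightarrow> bool" where
  "has_form K n q A Gr M \<longleftrightarrow> alt_mat n M \<and> (\<forall>\<gamma>\<in>carrier (Zn n). \<forall>\<gamma>'\<in>carrier (Zn n). \<forall>x\<in>Gr \<gamma>. \<forall>y\<in>Gr \<gamma>'.
     x \<otimes>\<^bsub>A\<^esub> y = (q [^]\<^bsub>K\<^esub> bil n M \<gamma> \<gamma>') \<odot>\<^bsub>A\<^esub> (y \<otimes>\<^bsub>A\<^esub> x))"

lemma has_formD:
  "has_form K n q A Gr M \<Longrightarrow> \<gamma> \<in> carrier (Zn n) \<Longrightarrow> \<gamma>' \<in> carrier (Zn n) \<Longrightarrow> x \<in> Gr \<gamma> \<Longrightarrow> y \<in> Gr \<gamma>' \<Longrightarrow>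
     x \<otimes>\<^bsub>A\<^esub> y = (q [^]\<^bsub>K\<^esub> bil n M \<gamma> \<gamma>') \<odot>\<^bsub>A\<^esub> (y \<otimes>\<^bsub>A\<^esub> x)"
  unfolding has_form_def by blast

lemma (in twisted_monoid) line_mon: "line K a = (\<lambda>k. mon k a) ` carrier K"
proof -
  have m: "(\<lambda>x. k \<otimes>\<^bsub>K\<^esub> delta K a x) = mon k a" if "k \<in> carrier K" for k
    using that by (auto simp: delta_def mon_def)
  show ?thesis
  proof (intro Set.set_eqI iffI)
    fix f assume "f \<in> line K a"
    then obtain k where "k \<in> carrier K" "f = (\<lambda>x. k \<otimes>\<^bsub>K\<^esub> delta K a x)" unfolding line_def by blast
    then show "f \<in> (\<lambda>k. mon k a) ` carrier K" using m by blast
  next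
    fix f assume "f \<in> (\<lambda>k. mon k a) ` carrier K"
    then obtain k where "k \<in> carrier K" "f = (\<lambda>x. k \<otimes>\<^bsub>K\<^esub> delta K a x)" using m by force
    then show "f \<in> line K a" unfolding line_def by blast
  qed
qed

lemma torus_algebra_has_form:
  assumes K: "field K" and q: "q \<in> Units K" and M: "alt_mat n M"
  shows "has_form K n q (torus_algebra K n q M) (line K) M"
  unfolding has_form_def
proof (intro conjI ballI M)
  interpret T: twisted_monoid K "Zn n" "\<lambda>x y. q [^]\<^bsub>K\<^esub> upper n M x y"
    by (rule twisted_monoid_torus[OF K q])
  interpret G: comm_group "Zn n" by (rule Zn_comm_group)
  fix \<gamma> \<gamma>' x y assume g: "\<gamma> \<in> carrier (Zn n)" "\<gamma>' \<in> carrier (Zn n)" "x \<in> line K \<gamma>" "y \<in> line K \<gamma>'"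
  obtain k where k: "k \<in> carrier K" "x = T.mon k \<gamma>" using g(3) unfolding T.line_mon by blast
  obtain l where l: "l \<in> carrier K" "y = T.mon l \<gamma>'" using g(4) unfolding T.line_mon by blast
  have "upper n M \<gamma> \<gamma>' = bil n M \<gamma> \<gamma>' + upper n M \<gamma>' \<gamma>"
    using upper_antisym[OF M, of \<gamma> \<gamma>'] by simp
  then have u: "q [^]\<^bsub>K\<^esub> upper n M \<gamma> \<gamma>' = q [^]\<^bsub>K\<^esub> bil n M \<gamma> \<gamma>' \<otimes>\<^bsub>K\<^esub> q [^]\<^bsub>K\<^esub> upper n M \<gamma>' \<gamma>"
    using T.K.int_pow_plus[OF q] by simp
  have "x \<otimes>\<^bsub>T.T\<^esub> y = (q [^]\<^bsub>K\<^esub> bil n M \<gamma> \<gamma>') \<odot>\<^bsub>T.T\<^esub> (y \<otimes>\<^bsub>T.T\<^esub> x)"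
    unfolding k(2) l(2) using g(1,2) k(1) l(1) q
    by (simp add: T.mon_mult T.smult_mon u T.K.m_ac G.m_comm)
  then show "x \<otimes>\<^bsub>torus_algebra K n q M\<^esub> y = (q [^]\<^bsub>K\<^esub> bil n M \<gamma> \<gamma>') \<odot>\<^bsub>torus_algebra K n q M\<^esub> (y \<otimes>\<^bsub>torus_algebra K n q M\<^esub> x)"
    unfolding torus_algebra_def .
qed

section \<open>Endomorphisms of \<int>^n as integer matrices\<close>

definition unit_vec_Zn :: "nat \<Rightarrow> nat \<Rightarrow> nat \<Rightarrow> int" where
  "unit_vec_Zn n i = (\<lambda>j\<in>{..<n}. if j = i then 1 else 0)"

text \<open>Vectors are rows, so that transporting a form along \<open>row_mult n U\<close> yields
  \<open>U * M * transpose_mat U\<close> in the order used for congruence.\<close>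

definition row_mult :: "nat \<Rightarrow> int mat \<Rightarrow> (nat \<Rightarrow> int) \<Rightarrow> nat \<Rightarrow> int" where
  "row_mult n U x = (\<lambda>j\<in>{..<n}. \<Sum>i<n. x i * U $$ (i,j))"

lemma unit_vec_carrier [simp]: "unit_vec_Zn n i \<in> carrier (Zn n)"
  by (simp add: unit_vec_Zn_def)

lemma bil_unit_vec: "i < n \<Longrightarrow> j < n \<Longrightarrow> bil n M (unit_vec_Zn n i) (unit_vec_Zn n j) = M $$ (i,j)"
proof -
  assume ij: "i < n" "j < n"
  have "bil n M (unit_vec_Zn n i) (unit_vec_Zn n j) = (\<Sum>k<n. \<Sum>l<n. if l = j then if k = i then M $$ (k,l) else 0 else 0)"
    unfolding bil_def by (intro sum.cong refl) (auto simp: unit_vec_Zn_def)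
  then show ?thesis using ij by simp
qed

lemma hom_Zn_row_mult:
  assumes "p \<in> hom (Zn n) (Zn n)" "x \<in> carrier (Zn n)"
  shows "p x = row_mult n (mat n n (\<lambda>(i,j). p (unit_vec_Zn n i) j)) x"
proof -
  interpret G: comm_group "Zn n" by (rule Zn_comm_group)
  interpret h: group_hom "Zn n" "Zn n" p
    by (intro group_hom.intro group_hom_axioms.intro assms(1) Zn_group)
  \<comment> \<open>\<open>part k\<close> truncates \<open>x\<close> to its first \<open>k\<close>
    coordinates; each induction step adds a multiple of one unit vector.\<close>
  define part where "part k = (\<lambda>j\<in>{..<n}. if j < k then x j else 0)" for k
  have pc: "part k \<in> carrier (Zn n)" for k by (simp add: part_def)
  have "p (part k) = (\<lambda>j\<in>{..<n}. \<Sum>i<k. x i * p (unit_vec_Zn n i) j)" if "k \<le> n" for k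
    using that
  proof (induction k)
    case 0
    have "part 0 = \<one>\<^bsub>Zn n\<^esub>" by (auto simp: part_def Zn_simps)
    then have "p (part 0) = \<one>\<^bsub>Zn n\<^esub>" using h.hom_one by simp
    then show ?case unfolding Zn_simps(2) by simp
  next
    case (Suc k)
    have "part (Suc k) = part k \<otimes>\<^bsub>Zn n\<^esub> (unit_vec_Zn n k [^]\<^bsub>Zn n\<^esub> (x k))"
      unfolding Zn_int_pow[OF unit_vec_carrier]
      by (auto simp: part_def Zn_simps unit_vec_Zn_def less_Suc_eq)
    then have "p (part (Suc k)) = p (part k) \<otimes>\<^bsub>Zn n\<^esub> (p (unit_vec_Zn n k) [^]\<^bsub>Zn n\<^esub> (x k))"
      using h.hom_mult[OF pc] h.hom_int_pow[OF unit_vec_carrier, of k "x k"] G.int_pow_closed[OF unit_vec_carrier] by simp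
    also have "\<dots> = (\<lambda>j\<in>{..<n}. \<Sum>i<Suc k. x i * p (unit_vec_Zn n i) j)"
      using Suc unfolding Zn_int_pow[OF h.hom_closed[OF unit_vec_carrier]] by (auto simp: Zn_simps)
    finally show ?case .
  qed
  from this[of n] have "p (part n) = (\<lambda>j\<in>{..<n}. \<Sum>i<n. x i * p (unit_vec_Zn n i) j)" by simp
  moreover have "part n = x" using assms(2) by (intro Zn_ext[OF pc]) (auto simp: part_def)
  ultimately show ?thesis by (auto simp: row_mult_def intro!: restrict_ext sum.cong)
qed

lemma row_mult_mult:
  assumes "U \<in> carrier_mat n n" "V \<in> carrier_mat n n"
  shows "row_mult n V (row_mult n U x) = row_mult n (U * V) x"
proof -
  have "(\<Sum>i<n. row_mult n U x i * V $$ (i,j)) = (\<Sum>i<n. x i * (U * V) $$ (i,j))" if j: "j < n" for j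
  proof -
    have "(\<Sum>i<n. row_mult n U x i * V $$ (i,j)) = (\<Sum>i<n. \<Sum>k<n. x k * U $$ (k,i) * V $$ (i,j))"
      by (intro sum.cong refl) (simp add: row_mult_def sum_distrib_right)
    also have "\<dots> = (\<Sum>k<n. \<Sum>i<n. x k * U $$ (k,i) * V $$ (i,j))" by (rule sum.swap)
    also have "\<dots> = (\<Sum>k<n. x k * (U * V) $$ (k,j))"
      by (intro sum.cong refl) (simp add: mult_mat_entry[OF assms _ j] sum_distrib_left mult.assoc del: index_mult_mat)
    finally show ?thesis .
  qed
  then show ?thesis by (auto simp: row_mult_def[of n V] row_mult_def[of n "U * V"])
qed

lemma row_mult_one: "x \<in> carrier (Zn n) \<Longrightarrow> row_mult n (1\<^sub>m n) x = x"
proof (rule Zn_ext)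
  fix i assume i: "i < n"
  have "(\<Sum>k<n. x k * (1\<^sub>m n) $$ (k,i)) = (\<Sum>k<n. if k = i then x k else 0)"
    using i by (intro sum.cong refl) auto
  then show "row_mult n (1\<^sub>m n) x i = x i" using i by (simp add: row_mult_def)
qed (simp_all add: row_mult_def)

lemma row_mult_unit_vec: "i < n \<Longrightarrow> j < n \<Longrightarrow> row_mult n U (unit_vec_Zn n i) j = U $$ (i,j)"
proof -
  assume i: "i < n" "j < n"
  have "(\<Sum>k<n. unit_vec_Zn n i k * U $$ (k,j)) = (\<Sum>k<n. if k = i then U $$ (k,j) else 0)"
    by (intro sum.cong refl) (auto simp: unit_vec_Zn_def)
  then show ?thesis using i by (simp add: row_mult_def)
qed

lemma row_mult_iso:
  assumes "U \<in> carrier_mat n n" "V \<in> carrier_mat n n" "U * V = 1\<^sub>m n" "V * U = 1\<^sub>m n"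
  shows "row_mult n U \<in> iso (Zn n) (Zn n)"
  unfolding iso_def
proof (intro CollectI conjI homI)
  show "bij_betw (row_mult n U) (carrier (Zn n)) (carrier (Zn n))"
    by (rule bij_betw_byWitness[where f' = "row_mult n V"])
      (use assms in \<open>auto simp: row_mult_mult row_mult_one, auto simp: row_mult_def\<close>)
  show "row_mult n U x \<in> carrier (Zn n)" for x by (simp add: row_mult_def)
  show "row_mult n U (x \<otimes>\<^bsub>Zn n\<^esub> y) = row_mult n U x \<otimes>\<^bsub>Zn n\<^esub> row_mult n U y" for x y
  proof (rule Zn_ext)
    fix j assume "j < n"
    then show "row_mult n U (x \<otimes>\<^bsub>Zn n\<^esub> y) j = (row_mult n U x \<otimes>\<^bsub>Zn n\<^esub> row_mult n U y) j"
      by (simp add: row_mult_def Zn_simps(3) sum.distrib[symmetric] distrib_right)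
  qed (simp_all add: row_mult_def Zn_simps(3))
qed

lemma bil_row_mult:
  assumes U: "U \<in> carrier_mat n n" and M: "M \<in> carrier_mat n n" and ij: "i < n" "j < n"
  shows "bil n M (row_mult n U (unit_vec_Zn n i)) (row_mult n U (unit_vec_Zn n j)) = (U * M * transpose_mat U) $$ (i,j)"
  unfolding conj_entry[OF U M ij] bil_def
  by (intro sum.cong refl) (simp add: row_mult_unit_vec ij)

section \<open>Graded isomorphism as congruence of forms\<close>

text \<open>An isomorphism preserves commutation factors. Equality of the powers of \<open>q\<close>
  is congruence of the exponents modulo its order, and the automorphism of \<int>^n, written as a
  matrix, makes this a congruence of \<open>M\<close> and \<open>M'\<close>.\<close>

lemma form_congr_if_graded_iso:
  assumes A: "quantum_torus K (Zn n) A Gr" "has_form K n q A Gr M" and q: "q \<in> Units K"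
    and B: "has_form K n q B Gr' M'" and iso: "graded_iso K (Zn n) A Gr B Gr'"
  shows "congr (order_of K q) n M M'"
proof -
  interpret A: qt K "Zn n" A Gr by (rule qt_quantum_torus[OF A(1)])
  obtain f p where f: "f \<in> ring_iso A B"
    "\<And>k x. k \<in> carrier K \<Longrightarrow> x \<in> carrier A \<Longrightarrow> f (k \<odot>\<^bsub>A\<^esub> x) = k \<odot>\<^bsub>B\<^esub> f x"
    "p \<in> iso (Zn n) (Zn n)" "\<And>\<gamma>. \<gamma> \<in> carrier (Zn n) \<Longrightarrow> f ` Gr \<gamma> = Gr' (p \<gamma>)"
    using graded_isoE[OF iso] by metis
  have ph: "p \<in> hom (Zn n) (Zn n)" "bij_betw p (carrier (Zn n)) (carrier (Zn n))" using f(3) by (auto simp: iso_def)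
  have pc: "p \<gamma> \<in> carrier (Zn n)" if "\<gamma> \<in> carrier (Zn n)" for \<gamma> using ph(1) that by (auto simp: hom_def)
  have fi: "inj_on f (carrier A)" using ring_iso_memE(5)[OF f(1)] by (simp add: bij_betw_def)
  have form: "[bil n M \<gamma> \<gamma>' = bil n M' (p \<gamma>) (p \<gamma>')] (mod int (order_of K q))"
    if g: "\<gamma> \<in> carrier (Zn n)" "\<gamma>' \<in> carrier (Zn n)" for \<gamma> \<gamma>'
  proof -
    obtain x where x: "x \<in> Gr \<gamma>" "x \<noteq> \<zero>\<^bsub>A\<^esub>" using A.Gr_nonzero[OF g(1)] .
    obtain y where y: "y \<in> Gr \<gamma>'" "y \<noteq> \<zero>\<^bsub>A\<^esub>" using A.Gr_nonzero[OF g(2)] .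
    have c: "x \<in> carrier A" "y \<in> carrier A" using A.Gr_sub x y g by auto
    define a where "a = q [^]\<^bsub>K\<^esub> bil n M \<gamma> \<gamma>'"
    define b where "b = q [^]\<^bsub>K\<^esub> bil n M' (p \<gamma>) (p \<gamma>')"
    have ab: "a \<in> carrier K" "b \<in> carrier K" using q by (auto simp: a_def b_def)
    have "f x \<in> Gr' (p \<gamma>)" "f y \<in> Gr' (p \<gamma>')" using f(4) g x y by blast+
    then have "f x \<otimes>\<^bsub>B\<^esub> f y = b \<odot>\<^bsub>B\<^esub> (f y \<otimes>\<^bsub>B\<^esub> f x)"
      unfolding b_def by (rule has_formD[OF B pc[OF g(1)] pc[OF g(2)]])
    then have "f (x \<otimes>\<^bsub>A\<^esub> y) = f (b \<odot>\<^bsub>A\<^esub> (y \<otimes>\<^bsub>A\<^esub> x))"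
      using c ab f(2) ring_iso_memE(2)[OF f(1)] by simp
    then have "x \<otimes>\<^bsub>A\<^esub> y = b \<odot>\<^bsub>A\<^esub> (y \<otimes>\<^bsub>A\<^esub> x)" using fi c ab by (simp add: inj_on_def)
    moreover have "x \<otimes>\<^bsub>A\<^esub> y = a \<odot>\<^bsub>A\<^esub> (y \<otimes>\<^bsub>A\<^esub> x)" unfolding a_def by (rule has_formD[OF A(2) g x(1) y(1)])
    ultimately have "a \<odot>\<^bsub>A\<^esub> (y \<otimes>\<^bsub>A\<^esub> x) = b \<odot>\<^bsub>A\<^esub> (y \<otimes>\<^bsub>A\<^esub> x)" by simp
    then have "a = b"
      using A.unit_smult_cancel[OF ab _ A.Gr_mult_nonzero[OF g(2,1) y(1) x(1) y(2) x(2)]] c by simp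
    then show ?thesis unfolding a_def b_def A.F.int_pow_eq_iff[OF q] .
  qed
  have Mc: "M \<in> carrier_mat n n" "M' \<in> carrier_mat n n" using A(2) B by (auto simp: has_form_def alt_mat_def)
  define U where "U = mat n n (\<lambda>(i,j). p (unit_vec_Zn n i) j)"
  have U: "U \<in> carrier_mat n n" by (simp add: U_def)
  have pU: "p x = row_mult n U x" if "x \<in> carrier (Zn n)" for x
    unfolding U_def by (rule hom_Zn_row_mult[OF ph(1) that])
  \<comment> \<open>The matrix of the inverse automorphism inverts \<open>U\<close>, which makes
    \<open>U\<close> unimodular.\<close>
  define p' where "p' = inv_into (carrier (Zn n)) p"
  have "p' \<in> iso (Zn n) (Zn n)" unfolding p'_def by (rule group.iso_set_sym[OF Zn_group f(3)])
  then have p'h: "p' \<in> hom (Zn n) (Zn n)" by (simp add: iso_def)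
  define V where "V = mat n n (\<lambda>(i,j). p' (unit_vec_Zn n i) j)"
  have V: "V \<in> carrier_mat n n" by (simp add: V_def)
  have pV: "p' x = row_mult n V x" if "x \<in> carrier (Zn n)" for x
    unfolding V_def by (rule hom_Zn_row_mult[OF p'h that])
  have "U * V = 1\<^sub>m n"
  proof (rule eq_matI)
    fix i j assume "i < dim_row (1\<^sub>m n :: int mat)" "j < dim_col (1\<^sub>m n :: int mat)"
    then have ij: "i < n" "j < n" by auto
    have "p' (p (unit_vec_Zn n i)) = unit_vec_Zn n i"
      unfolding p'_def using ph(2) by (simp add: bij_betw_inv_into_left)
    then have "row_mult n V (row_mult n U (unit_vec_Zn n i)) = unit_vec_Zn n i"
      using pV[OF pc[OF unit_vec_carrier]] pU[OF unit_vec_carrier] by simp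
    then have "row_mult n (U * V) (unit_vec_Zn n i) j = unit_vec_Zn n i j" using row_mult_mult[OF U V] by simp
    then show "(U * V) $$ (i,j) = 1\<^sub>m n $$ (i,j)"
      unfolding row_mult_unit_vec[OF ij] using ij by (auto simp: unit_vec_Zn_def)
  qed (use U V in auto)
  then have uU: "unimod n U" by (rule unimod_intro[OF U V])
  have "mcong (order_of K q) n (U * M' * transpose_mat U) M"
    unfolding mcong_def
  proof (intro conjI allI impI Mc conj_carrier U)
    fix i j assume ij: "i < n" "j < n"
    show "[(U * M' * transpose_mat U) $$ (i,j) = M $$ (i,j)] (mod int (order_of K q))"
      using form[OF unit_vec_carrier unit_vec_carrier, of i j]
      unfolding bil_unit_vec[OF ij] pU[OF unit_vec_carrier] bil_row_mult[OF U Mc(2) ij]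
      by (rule cong_sym)
  qed
  then show ?thesis using congrI[OF uU] congr_sym Mc(2) by blast
qed

text \<open>Choose nonzero \<open>u i\<close> in the degrees given by the rows of \<open>U\<close>.
  Ordered monomials in the \<open>u i\<close> multiply up to the factors for restoring the order,
  and these are exactly the values of the cocycle of \<open>M'\<close>.\<close>

lemma graded_iso_torus_algebra:
  assumes A: "quantum_torus K (Zn n) A Gr" "has_form K n q A Gr M" and q: "q \<in> Units K"
    and M': "alt_mat n M'" and c: "congr (order_of K q) n M M'"
  shows "graded_iso K (Zn n) A Gr (torus_algebra K n q M') (line K)"
proof -
  interpret A: qt K "Zn n" A Gr by (rule qt_quantum_torus[OF A(1)])
  interpret G: comm_group "Zn n" by (rule Zn_comm_group)
  have Mc: "M \<in> carrier_mat n n" using A(2) by (auto simp: has_form_def alt_mat_def)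
  obtain U where U: "unimod n U" "mcong (order_of K q) n (U * M * transpose_mat U) M'"
    using c unfolding congr_def by blast
  have Uc: "U \<in> carrier_mat n n" by (rule unimod_carrier[OF U(1)])
  obtain V where V: "unimod n V" "U * V = 1\<^sub>m n" "V * U = 1\<^sub>m n" using unimod_inverse[OF U(1)] .
  have Vc: "V \<in> carrier_mat n n" by (rule unimod_carrier[OF V(1)])
  define e where "e i = row_mult n U (unit_vec_Zn n i)" for i
  have ec: "e i \<in> carrier (Zn n)" for i by (simp add: e_def row_mult_def)
  have "\<exists>v. v \<in> Gr (e i) \<and> v \<noteq> \<zero>\<^bsub>A\<^esub>" for i using A.Gr_nonzero[OF ec] by metis
  then obtain u where u: "\<And>i. u i \<in> Gr (e i)" "\<And>i. u i \<noteq> \<zero>\<^bsub>A\<^esub>" by metis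
  define pw where "pw i a = u i [^]\<^bsub>units_of A\<^esub> (a::int)" for i a
  have pw: "pw i a \<in> Gr (\<lambda>j\<in>{..<n}. a * e i j)" "pw i a \<in> Units A" for i a
    using A.Gr_int_pow[OF ec u(1) u(2), of i a] Zn_int_pow[OF ec] by (simp_all add: pw_def)
  interpret UA: group "units_of A" by (rule A.R.units_group)
  have uU: "u i \<in> carrier (units_of A)" for i using A.Gr_unit[OF ec u(1) u(2)] by (simp add: units_of_carrier)
  have pw_add: "pw i (a + b) = pw i a \<otimes>\<^bsub>A\<^esub> pw i b" for i a b
    using UA.int_pow_mult[OF uU] by (simp add: pw_def units_of_mult)
  \<comment> \<open>\<open>w k g\<close> is the product of the powers of \<open>u i\<close> to
    \<open>g i\<close> for \<open>i < k\<close>, with the highest index on the left.\<close>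
  define w where "w = rec_nat (\<lambda>_. \<one>\<^bsub>A\<^esub>) (\<lambda>k r g. pw k (g k) \<otimes>\<^bsub>A\<^esub> r g)"
  have w0: "w 0 g = \<one>\<^bsub>A\<^esub>" and wS: "w (Suc k) g = pw k (g k) \<otimes>\<^bsub>A\<^esub> w k g" for k g
    by (simp_all add: w_def)
  define dg where "dg k g = (\<lambda>j\<in>{..<n}. \<Sum>i<k. g i * e i j)" for k and g :: "nat \<Rightarrow> int"
  have dc: "dg k g \<in> carrier (Zn n)" for k g by (simp add: dg_def)
  have w: "w k g \<in> Gr (dg k g) \<and> w k g \<in> Units A" for k g
  proof (induction k)
    case 0
    have "dg 0 g = \<one>\<^bsub>Zn n\<^esub>" by (simp add: dg_def Zn_simps(2))
    then show ?case using A.Gr_one by (simp add: w0)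
  next
    case (Suc k)
    have "dg (Suc k) g = (\<lambda>j\<in>{..<n}. g k * e k j) \<otimes>\<^bsub>Zn n\<^esub> dg k g"
      by (auto simp: dg_def Zn_simps)
    then show ?case unfolding wS
      using Suc pw[of k "g k"] A.Gr_mult[OF Zn_restrict dc pw(1)] A.R.Units_m_closed by metis
  qed
  have wA: "w k g \<in> carrier A" and pA: "pw k a \<in> carrier A" for k g a
    using w pw A.R.Units_closed by blast+
  have bil_deg: "[bil n M (dg k g) (\<lambda>j\<in>{..<n}. b * e k j) = (\<Sum>i<k. g i * M' $$ (i,k) * b)] (mod int (order_of K q))"
    if "k < n" for k g b
  proof -
    have "bil n M (dg k g) (\<lambda>j\<in>{..<n}. b * e k j) = (\<Sum>a<n. \<Sum>c<n. \<Sum>i<k. g i * e i a * M $$ (a,c) * (b * e k c))"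
      unfolding bil_def by (intro sum.cong refl) (simp add: dg_def sum_distrib_right)
    also have "\<dots> = (\<Sum>a<n. \<Sum>i<k. \<Sum>c<n. g i * e i a * M $$ (a,c) * (b * e k c))"
      by (intro sum.cong refl sum.swap)
    also have "\<dots> = (\<Sum>i<k. \<Sum>a<n. \<Sum>c<n. g i * e i a * M $$ (a,c) * (b * e k c))"
      by (rule sum.swap)
    also have "\<dots> = (\<Sum>i<k. g i * bil n M (e i) (e k) * b)"
      by (intro sum.cong refl) (simp add: bil_def sum_distrib_left sum_distrib_right mult_ac)
    also have "[\<dots> = (\<Sum>i<k. g i * M' $$ (i,k) * b)] (mod int (order_of K q))"
    proof (intro cong_sum cong_mult cong_refl)
      fix i assume "i \<in> {..<k}"
      then have i: "i < n" using that by simp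
      show "[bil n M (e i) (e k) = M' $$ (i,k)] (mod int (order_of K q))"
        unfolding e_def bil_row_mult[OF Uc Mc i that] by (rule mcongD[OF U(2) i that])
    qed
    finally show ?thesis .
  qed
  have w_mult: "w k g \<otimes>\<^bsub>A\<^esub> w k g' = (q [^]\<^bsub>K\<^esub> upper k M' g g') \<odot>\<^bsub>A\<^esub> w k (g \<otimes>\<^bsub>Zn n\<^esub> g')" if "k \<le> n" for k g g'
    using that
  proof (induction k)
    case 0 then show ?case by (simp add: w0 upper_def)
  next
    case (Suc k)
    then have k: "k < n" by simp
    \<comment> \<open>The exponent for moving the \<open>k\<close>-th power of the second monomial
      to the left past the powers of lower index in the first; it is the contribution of column
      \<open>k\<close> to \<open>upper\<close>.\<close>
    define c where "c = (\<Sum>i<k. g i * M' $$ (i,k) * g' k)"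
    have comm: "w k g \<otimes>\<^bsub>A\<^esub> pw k (g' k) = (q [^]\<^bsub>K\<^esub> c) \<odot>\<^bsub>A\<^esub> (pw k (g' k) \<otimes>\<^bsub>A\<^esub> w k g)"
      using has_formD[OF A(2) dc Zn_restrict, of "w k g" k g "pw k (g' k)"] w pw(1)
        A.F.int_pow_eq_iff[OF q, THEN iffD2, OF bil_deg[OF k, of g "g' k"]] unfolding c_def by metis
    have qc: "q [^]\<^bsub>K\<^esub> (z::int) \<in> carrier K" for z using q by simp
    let ?p = "pw k (g k)" and ?p' = "pw k (g' k)" and ?w = "w k g" and ?w' = "w k g'"
    have "w (Suc k) g \<otimes>\<^bsub>A\<^esub> w (Suc k) g' = ?p \<otimes>\<^bsub>A\<^esub> ((?w \<otimes>\<^bsub>A\<^esub> ?p') \<otimes>\<^bsub>A\<^esub> ?w')"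
      unfolding wS using wA pA by (simp add: A.R.m_assoc)
    also have "\<dots> = (q [^]\<^bsub>K\<^esub> c) \<odot>\<^bsub>A\<^esub> (?p \<otimes>\<^bsub>A\<^esub> ((?p' \<otimes>\<^bsub>A\<^esub> ?w) \<otimes>\<^bsub>A\<^esub> ?w'))"
      unfolding comm using wA pA qc by (simp add: A.AL.smult_mult_left A.AL.smult_mult_right)
    also have "?p \<otimes>\<^bsub>A\<^esub> ((?p' \<otimes>\<^bsub>A\<^esub> ?w) \<otimes>\<^bsub>A\<^esub> ?w') = (?p \<otimes>\<^bsub>A\<^esub> ?p') \<otimes>\<^bsub>A\<^esub> (?w \<otimes>\<^bsub>A\<^esub> ?w')"
      using wA pA by (simp add: A.R.m_assoc)
    also have "?p \<otimes>\<^bsub>A\<^esub> ?p' = pw k ((g \<otimes>\<^bsub>Zn n\<^esub> g') k)" using k by (simp add: pw_add Zn_simps)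
    also have "?w \<otimes>\<^bsub>A\<^esub> ?w' = (q [^]\<^bsub>K\<^esub> upper k M' g g') \<odot>\<^bsub>A\<^esub> w k (g \<otimes>\<^bsub>Zn n\<^esub> g')" using Suc by simp
    also have "pw k ((g \<otimes>\<^bsub>Zn n\<^esub> g') k) \<otimes>\<^bsub>A\<^esub> \<dots> = (q [^]\<^bsub>K\<^esub> upper k M' g g') \<odot>\<^bsub>A\<^esub> w (Suc k) (g \<otimes>\<^bsub>Zn n\<^esub> g')"
      unfolding wS using wA pA qc by (simp add: A.AL.smult_mult_right)
    also have "(q [^]\<^bsub>K\<^esub> c) \<odot>\<^bsub>A\<^esub> \<dots> = (q [^]\<^bsub>K\<^esub> (c + upper k M' g g')) \<odot>\<^bsub>A\<^esub> w (Suc k) (g \<otimes>\<^bsub>Zn n\<^esub> g')"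
      using qc wA by (simp add: A.AL.smult_assoc1 A.F.int_pow_plus[OF q])
    also have "c + upper k M' g g' = upper (Suc k) M' g g'" by (simp add: upper_def c_def)
    finally show ?case .
  qed
  define \<psi> where "\<psi> = row_mult n U"
  have psi: "\<psi> \<in> iso (Zn n) (Zn n)" unfolding \<psi>_def by (rule row_mult_iso[OF Uc Vc V(2,3)])
  have dgn: "dg n g = \<psi> g" for g
    unfolding dg_def \<psi>_def row_mult_def[of n U g]
    by (intro restrict_ext sum.cong refl) (simp add: e_def row_mult_unit_vec)
  interpret T: twisted_monoid K "Zn n" "\<lambda>x y. q [^]\<^bsub>K\<^esub> upper n M' x y"
    by (rule twisted_monoid_torus[OF A.F.field_axioms q])
  have rep: "twisted_rep K (Zn n) (\<lambda>x y. q [^]\<^bsub>K\<^esub> upper n M' x y) A (w n)"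
  proof (intro twisted_rep.intro twisted_lin.intro twisted_lin_axioms.intro twisted_rep_axioms.intro T.twisted_monoid_axioms A.AL.assoc_algebra_axioms)
    have "w k \<one>\<^bsub>Zn n\<^esub> = \<one>\<^bsub>A\<^esub>" if "k \<le> n" for k
      using that
    proof (induction k)
      case (Suc k)
      have "pw k 0 = \<one>\<^bsub>A\<^esub>" by (simp add: pw_def units_of_one)
      then show ?case using Suc by (simp add: wS Zn_simps)
    qed (simp add: w0)
    then show "w n \<one>\<^bsub>Zn n\<^esub> = \<one>\<^bsub>A\<^esub>" by simp
  qed (use wA w_mult in auto)
  have "graded_iso K (Zn n) (torus_algebra K n q M') (line K) A Gr"
    unfolding torus_algebra_def
    by (rule A.graded_iso_twisted_algebra[OF rep psi]) (use w[of n] dgn A.Units_nonzero in metis)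
  then show ?thesis
    by (rule graded_iso_sym)
      (auto simp: torus_algebra_def T.line_mon Zn_group intro: T.assoc_algebra_T)
qed

lemma graded_iso_iff_congr:
  assumes A: "quantum_torus K (Zn n) A Gr" "has_form K n q A Gr M" and q: "q \<in> Units K"
    and B: "quantum_torus K (Zn n) B Gr'" "has_form K n q B Gr' M'"
  shows "graded_iso K (Zn n) A Gr B Gr' \<longleftrightarrow> congr (order_of K q) n M M'"
proof
  assume "graded_iso K (Zn n) A Gr B Gr'"
  then show "congr (order_of K q) n M M'" by (rule form_congr_if_graded_iso[OF A q B(2)])
next
  assume c: "congr (order_of K q) n M M'"
  interpret B: qt K "Zn n" B Gr' by (rule qt_quantum_torus[OF B(1)])
  have M': "alt_mat n M'" using B(2) by (simp add: has_form_def)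
  have "mcong (order_of K q) n M' M'" using M' by (simp add: mcong_refl alt_mat_def)
  then have "graded_iso K (Zn n) B Gr' (torus_algebra K n q M') (line K)"
    by (intro graded_iso_torus_algebra[OF B q M'] congr_mcong)
  then have "graded_iso K (Zn n) (torus_algebra K n q M') (line K) B Gr'"
    by (rule graded_iso_sym) (use B.AL.assoc_algebra_axioms Zn_group B.Gr_sub in auto)
  with graded_iso_torus_algebra[OF A q M' c] show "graded_iso K (Zn n) A Gr B Gr'"
    by (rule graded_iso_trans)
qed

lemma graded_iso_torus_algebra_iff:
  assumes A: "quantum_torus K (Zn n) A Gr" "has_form K n q A Gr M" and q: "q \<in> Units K"
    and M': "alt_mat n M'"
  shows "graded_iso K (Zn n) A Gr (torus_algebra K n q M') (line K) \<longleftrightarrow> congr (order_of K q) n M M'"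
proof -
  interpret A: qt K "Zn n" A Gr by (rule qt_quantum_torus[OF A(1)])
  show ?thesis
    using graded_iso_torus_algebra[OF A q M']
      form_congr_if_graded_iso[OF A q torus_algebra_has_form[OF A.F.field_axioms q M']] by blast
qed

section \<open>Tensor products of twisted monoid algebras\<close>

text \<open>\<open>block\<close> identifies the grading monoid with the product of the
  \<open>M i\<close>. An explicit identification is needed because \<int>^n is encoded by functions
  on one index range, not by tuples of blocks.\<close>

locale tensor_twisted = K: field K + C: twisted_monoid K \<Gamma> \<sigma>
  for K :: "('k, 'e) ring_scheme" (structure) and \<Gamma> :: "('h, 'd) monoid_scheme" (structure)
    and \<sigma> :: "'h \<Rightarrow> 'h \<Rightarrow> 'k" +
  fixes I :: "'i set" and M :: "'i \<Rightarrow> 'g monoid" and \<tau> :: "'i \<Rightarrow> 'g \<Rightarrow> 'g \<Rightarrow> 'k"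
    and F :: "'i \<Rightarrow> ('k, 'g \<Rightarrow> 'k) module" and block :: "'h \<Rightarrow> 'i \<Rightarrow> 'g"
  assumes finI: "finite I"
    and factor: "i \<in> I \<Longrightarrow> twisted_monoid K (M i) (\<tau> i)"
    and F_eq: "i \<in> I \<Longrightarrow> F i = twisted_algebra K (M i) (\<tau> i)"
    and block_closed: "\<gamma> \<in> carrier \<Gamma> \<Longrightarrow> i \<in> I \<Longrightarrow> block \<gamma> i \<in> carrier (M i)"
    and block_surj: "x \<in> (\<Pi>\<^sub>E i\<in>I. carrier (M i)) \<Longrightarrow> \<exists>\<gamma>\<in>carrier \<Gamma>. \<forall>i\<in>I. block \<gamma> i = x i"
    and block_inj: "\<gamma> \<in> carrier \<Gamma> \<Longrightarrow> \<gamma>' \<in> carrier \<Gamma> \<Longrightarrow> (\<And>i. i \<in> I \<Longrightarrow> block \<gamma> i = block \<gamma>' i) \<Longrightarrow> \<gamma> = \<gamma>'"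
    and block_mult: "\<gamma> \<in> carrier \<Gamma> \<Longrightarrow> \<gamma>' \<in> carrier \<Gamma> \<Longrightarrow> i \<in> I \<Longrightarrow>
      block (\<gamma> \<otimes>\<^bsub>\<Gamma>\<^esub> \<gamma>') i = block \<gamma> i \<otimes>\<^bsub>M i\<^esub> block \<gamma>' i"
    and block_one: "i \<in> I \<Longrightarrow> block \<one>\<^bsub>\<Gamma>\<^esub> i = \<one>\<^bsub>M i\<^esub>"
    and cocycle_prod: "\<gamma> \<in> carrier \<Gamma> \<Longrightarrow> \<gamma>' \<in> carrier \<Gamma> \<Longrightarrow>
      \<sigma> \<gamma> \<gamma>' = finprod K (\<lambda>i. \<tau> i (block \<gamma> i) (block \<gamma>' i)) I"
begin

abbreviation PF where "PF \<equiv> product_group I F"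
abbreviation X where "X \<equiv> (\<Pi>\<^sub>E i\<in>I. carrier (F i))"
abbreviation B where "B \<equiv> twisted_algebra K \<Gamma> \<sigma>"
abbreviation fmon :: "'k \<Rightarrow> 'g \<Rightarrow> 'g \<Rightarrow> 'k" where "fmon k g \<equiv> (\<lambda>x. if x = g then k else \<zero>)"

definition basis_tuple :: "'h \<Rightarrow> 'i \<Rightarrow> 'g \<Rightarrow> 'k" where
  "basis_tuple \<gamma> = (\<lambda>i\<in>I. fmon \<one> (block \<gamma> i))"

text \<open>The coefficient of an elementary tensor at a degree is the product of the coefficients
  of its factors at the components of that degree.\<close>

definition tens :: "('i \<Rightarrow> 'g \<Rightarrow> 'k) \<Rightarrow> 'h \<Rightarrow> 'k" where
  "tens a = (\<lambda>\<gamma>. if \<gamma> \<in> carrier \<Gamma> then finprod K (\<lambda>i. a i (block \<gamma> i)) I else \<zero>)"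

lemma F_mon: "i \<in> I \<Longrightarrow> twisted_monoid.mon K k g = fmon k g"
  using twisted_monoid.mon_def[OF factor] by blast

lemma F_algebra: "i \<in> I \<Longrightarrow> assoc_algebra K (F i)"
  using twisted_monoid.assoc_algebra_T[OF factor] F_eq by simp

lemma F_ring: "i \<in> I \<Longrightarrow> ring (F i)"
  using F_algebra assoc_algebra.axioms(3) by blast

lemma F_eval: "i \<in> I \<Longrightarrow> f \<in> carrier (F i) \<Longrightarrow> f g \<in> carrier K"
  using twisted_monoid.T_eval[OF factor] F_eq by simp

lemma F_add: "i \<in> I \<Longrightarrow> f \<oplus>\<^bsub>F i\<^esub> g = (\<lambda>x. f x \<oplus> g x)"
  using twisted_monoid.T_simps(4)[OF factor] F_eq by simp

lemma F_smult: "i \<in> I \<Longrightarrow> k \<odot>\<^bsub>F i\<^esub> f = (\<lambda>x. k \<otimes> f x)"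
  using twisted_monoid.T_simps(5)[OF factor] F_eq by simp

lemma F_add_closed: "i \<in> I \<Longrightarrow> f \<in> carrier (F i) \<Longrightarrow> g \<in> carrier (F i) \<Longrightarrow> f \<oplus>\<^bsub>F i\<^esub> g \<in> carrier (F i)"
  using twisted_monoid.add_closed[OF factor] F_eq by simp

lemma F_smult_closed: "i \<in> I \<Longrightarrow> k \<in> carrier K \<Longrightarrow> f \<in> carrier (F i) \<Longrightarrow> k \<odot>\<^bsub>F i\<^esub> f \<in> carrier (F i)"
  using twisted_monoid.smult_closed[OF factor] F_eq by simp

lemma F_mult_closed: "i \<in> I \<Longrightarrow> f \<in> carrier (F i) \<Longrightarrow> g \<in> carrier (F i) \<Longrightarrow> f \<otimes>\<^bsub>F i\<^esub> g \<in> carrier (F i)"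
  using twisted_monoid.mult_closed[OF factor] F_eq by simp

lemma fmon_closed: "i \<in> I \<Longrightarrow> k \<in> carrier K \<Longrightarrow> g \<in> carrier (M i) \<Longrightarrow> fmon k g \<in> carrier (F i)"
  using twisted_monoid.mon_carrier[OF factor] by (simp add: F_eq F_mon)

lemma basis_tuple_closed: "\<gamma> \<in> carrier \<Gamma> \<Longrightarrow> basis_tuple \<gamma> \<in> X"
  unfolding basis_tuple_def by (intro restrict_PiE_iff[THEN iffD2] ballI fmon_closed block_closed K.one_closed)

lemma PF_monoid: "monoid PF"
proof (rule monoidI)
  have r: "monoid (F i)" if "i \<in> I" for i using F_ring[OF that] ring_def by blast
  show "x \<otimes>\<^bsub>PF\<^esub> y \<in> carrier PF" if "x \<in> carrier PF" "y \<in> carrier PF" for x y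
    using that r by (auto simp: PiE_iff intro!: monoid.m_closed)
  show "\<one>\<^bsub>PF\<^esub> \<in> carrier PF" using r by (auto intro!: monoid.one_closed)
  show "x \<otimes>\<^bsub>PF\<^esub> y \<otimes>\<^bsub>PF\<^esub> z = x \<otimes>\<^bsub>PF\<^esub> (y \<otimes>\<^bsub>PF\<^esub> z)" if "x \<in> carrier PF" "y \<in> carrier PF" "z \<in> carrier PF" for x y z
    using that monoid.m_assoc[OF r] by (auto simp: PiE_iff intro!: restrict_ext)
  show "\<one>\<^bsub>PF\<^esub> \<otimes>\<^bsub>PF\<^esub> x = x" if "x \<in> carrier PF" for x
    using that monoid.l_one[OF r] by (auto simp: PiE_iff extensional_def intro!: ext)
  show "x \<otimes>\<^bsub>PF\<^esub> \<one>\<^bsub>PF\<^esub> = x" if "x \<in> carrier PF" for x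
    using that monoid.r_one[OF r] by (auto simp: PiE_iff extensional_def intro!: ext)
qed

text \<open>Multilinear statements about tuples need only be checked on tuples of basis elements.\<close>

lemma multilinear_induct [consumes 1, case_names base add smult]:
  assumes a: "a \<in> X"
    and base: "\<And>\<gamma>. \<gamma> \<in> carrier \<Gamma> \<Longrightarrow> P (basis_tuple \<gamma>)"
    and add: "\<And>a i x y. \<lbrakk>a \<in> X; i \<in> I; x \<in> carrier (F i); y \<in> carrier (F i); P (a(i := x)); P (a(i := y))\<rbrakk>
       \<Longrightarrow> P (a(i := x \<oplus>\<^bsub>F i\<^esub> y))"
    and smult: "\<And>a i k x. \<lbrakk>a \<in> X; i \<in> I; k \<in> carrier K; x \<in> carrier (F i); P (a(i := x))\<rbrakk>
       \<Longrightarrow> P (a(i := k \<odot>\<^bsub>F i\<^esub> x))"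
  shows "P a"
proof -
  \<comment> \<open>The induction is on the set \<open>S\<close> of positions at which arbitrary
    elements are allowed; at all other positions there is a basis element.\<close>
  have "\<forall>a\<in>X. (\<forall>i\<in>I - S. \<exists>g\<in>carrier (M i). a i = fmon \<one> g) \<longrightarrow> P a" if "finite S" "S \<subseteq> I" for S
    using that
  proof (induction S)
    case empty
    show ?case
    proof (intro ballI impI)
      fix a assume a: "a \<in> X" "\<forall>i\<in>I - {}. \<exists>g\<in>carrier (M i). a i = fmon \<one> g"
      then have "\<forall>i\<in>I. \<exists>g. g \<in> carrier (M i) \<and> a i = fmon \<one> g" by auto
      then obtain g where g: "\<And>i. i \<in> I \<Longrightarrow> g i \<in> carrier (M i) \<and> a i = fmon \<one> (g i)" by metis
      then have "(\<lambda>i\<in>I. g i) \<in> (\<Pi>\<^sub>E i\<in>I. carrier (M i))" by auto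
      then obtain \<gamma> where c: "\<gamma> \<in> carrier \<Gamma>" "\<forall>i\<in>I. block \<gamma> i = (\<lambda>i\<in>I. g i) i" using block_surj by blast
      have "a = basis_tuple \<gamma>"
      proof
        fix i show "a i = basis_tuple \<gamma> i"
          using a(1) g[of i] c(2) by (cases "i \<in> I") (auto simp: basis_tuple_def PiE_iff extensional_def)
      qed
      then show "P a" using base c(1) by simp
    qed
  next
    case (insert j S)
    interpret Fj: twisted_monoid K "M j" "\<tau> j" by (rule factor) (use insert.prems in simp)
    have j: "j \<in> I" using insert.prems by simp
    have mon: "Fj.mon k g = fmon k g" for k g by (simp add: Fj.mon_def)
    have Fj: "F j = Fj.T" by (rule F_eq[OF j])
    show ?case
    proof (intro ballI impI)
      fix a assume a: "a \<in> X" "\<forall>i\<in>I - insert j S. \<exists>g\<in>carrier (M i). a i = fmon \<one> g"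
      have up: "a(j := f) \<in> X" if "f \<in> carrier (F j)" for f using a(1) j that by (auto simp: PiE_iff extensional_def)
      have one: "P (a(j := fmon \<one> g))" if "g \<in> carrier (M j)" for g
      proof -
        have "\<forall>i\<in>I - S. \<exists>g'\<in>carrier (M i). (a(j := fmon \<one> g)) i = fmon \<one> g'"
          using a(2) that by auto
        then show ?thesis using insert.IH insert.prems up[OF fmon_closed[OF j _ that]] by simp
      qed
      have sc: "P (a(j := fmon k g))" if "k \<in> carrier K" "g \<in> carrier (M j)" for k g
      proof -
        have "fmon k g = k \<odot>\<^bsub>F j\<^esub> fmon \<one> g" unfolding F_smult[OF j] using that by auto
        then show ?thesis using smult[OF a(1) j that(1) fmon_closed[OF j _ that(2)] one[OF that(2)]] by simp
      qed
      have "P (a(j := f))" if "f \<in> carrier Fj.T" for f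
        using that
      proof (induction f rule: Fj.T_induct)
        case zero
        \<comment> \<open>The zero element is reached as the multiple of a basis element by the
          scalar 0.\<close>
        have "fmon \<zero> \<one>\<^bsub>M j\<^esub> = (\<lambda>_. \<zero>)" by auto
        then show ?case using sc[of \<zero> "\<one>\<^bsub>M j\<^esub>"] by (simp del: fun_upd_apply)
      next
        case (add k g f)
        show ?case
          unfolding mon Fj[symmetric]
          by (rule assms(3)[OF a(1) j fmon_closed[OF j add.hyps(1,2)] _ sc[OF add.hyps(1,2)] add.IH])
            (use add.hyps(3) Fj in simp)
      qed
      from this[of "a j"] show "P a" using a(1) j Fj by (auto simp: PiE_iff)
    qed
  qed
  from this[OF finI order_refl] show ?thesis using a by simp
qed

lemma tens_update:
  assumes a: "a \<in> X" and i: "i \<in> I" and x: "x \<in> carrier (F i)" and g: "\<gamma> \<in> carrier \<Gamma>"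
  shows "tens (a(i := x)) \<gamma> = x (block \<gamma> i) \<otimes> finprod K (\<lambda>j. a j (block \<gamma> j)) (I - {i})"
    "finprod K (\<lambda>j. a j (block \<gamma> j)) (I - {i}) \<in> carrier K"
proof -
  have ac: "a j \<in> carrier (F j)" if "j \<in> I" for j using a that by auto
  show c: "finprod K (\<lambda>j. a j (block \<gamma> j)) (I - {i}) \<in> carrier K"
    by (rule K.finprod_closed) (use ac F_eval in auto)
  have "tens (a(i := x)) \<gamma> = finprod K (\<lambda>j. (a(i := x)) j (block \<gamma> j)) (insert i (I - {i}))"
    using g i by (simp add: tens_def insert_absorb)
  also have "\<dots> = x (block \<gamma> i) \<otimes> finprod K (\<lambda>j. (a(i := x)) j (block \<gamma> j)) (I - {i})"
    by (subst K.finprod_insert) (use finI ac x i F_eval in auto)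
  also have "finprod K (\<lambda>j. (a(i := x)) j (block \<gamma> j)) (I - {i}) = finprod K (\<lambda>j. a j (block \<gamma> j)) (I - {i})"
    by (rule K.finprod_cong') (use ac F_eval in auto)
  finally show "tens (a(i := x)) \<gamma> = x (block \<gamma> i) \<otimes> finprod K (\<lambda>j. a j (block \<gamma> j)) (I - {i})" .
qed

lemma tens_add:
  assumes a: "a \<in> X" and i: "i \<in> I" and x: "x \<in> carrier (F i)" and y: "y \<in> carrier (F i)"
  shows "tens (a(i := x \<oplus>\<^bsub>F i\<^esub> y)) = tens (a(i := x)) \<oplus>\<^bsub>B\<^esub> tens (a(i := y))"
proof
  fix \<gamma>
  show "tens (a(i := x \<oplus>\<^bsub>F i\<^esub> y)) \<gamma> = (tens (a(i := x)) \<oplus>\<^bsub>B\<^esub> tens (a(i := y))) \<gamma>"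
  proof (cases "\<gamma> \<in> carrier \<Gamma>")
    case True
    show ?thesis unfolding C.T_simps(4) tens_update(1)[OF a i x True] tens_update(1)[OF a i y True]
        tens_update(1)[OF a i F_add_closed[OF i x y] True] unfolding F_add[OF i]
      using tens_update(2)[OF a i x True] F_eval[OF i] x y by (simp add: K.l_distr)
  qed (simp add: tens_def C.T_simps(4))
qed

lemma tens_smult:
  assumes a: "a \<in> X" and i: "i \<in> I" and k: "k \<in> carrier K" and x: "x \<in> carrier (F i)"
  shows "tens (a(i := k \<odot>\<^bsub>F i\<^esub> x)) = k \<odot>\<^bsub>B\<^esub> tens (a(i := x))"
proof
  fix \<gamma>
  show "tens (a(i := k \<odot>\<^bsub>F i\<^esub> x)) \<gamma> = (k \<odot>\<^bsub>B\<^esub> tens (a(i := x))) \<gamma>"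
  proof (cases "\<gamma> \<in> carrier \<Gamma>")
    case True
    show ?thesis unfolding C.T_simps(5) tens_update(1)[OF a i x True]
        tens_update(1)[OF a i F_smult_closed[OF i k x] True] unfolding F_smult[OF i]
      using tens_update(2)[OF a i x True] F_eval[OF i x] k by (simp add: K.m_assoc)
  qed (use k in \<open>simp add: tens_def C.T_simps(5)\<close>)
qed

text \<open>A tensor of monomials is a monomial: at any other degree some component differs, and the
  corresponding factor of the product is zero.\<close>

lemma finprod_fmon:
  assumes k: "\<And>i. i \<in> I \<Longrightarrow> k i \<in> carrier K" and g: "\<gamma> \<in> carrier \<Gamma>"
  shows "tens (\<lambda>i\<in>I. fmon (k i) (block \<gamma> i)) = C.mon (finprod K k I) \<gamma>"
proof
  fix \<delta>
  show "tens (\<lambda>i\<in>I. fmon (k i) (block \<gamma> i)) \<delta> = C.mon (finprod K k I) \<gamma> \<delta>"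
  proof (cases "\<delta> \<in> carrier \<Gamma>")
    case False
    then show ?thesis using g by (auto simp: tens_def C.mon_def)
  next
    case True
    have e: "tens (\<lambda>i\<in>I. fmon (k i) (block \<gamma> i)) \<delta> = finprod K (\<lambda>i. fmon (k i) (block \<gamma> i) (block \<delta> i)) I"
      unfolding tens_def using True k by (simp, intro K.finprod_cong') (auto simp: Pi_def)
    show ?thesis
    proof (cases "\<delta> = \<gamma>")
      case True
      have "finprod K (\<lambda>i. fmon (k i) (block \<gamma> i) (block \<delta> i)) I = finprod K k I"
        unfolding True using k by (intro K.finprod_cong') auto
      then show ?thesis unfolding e using True by (simp add: C.mon_def)
    next
      case False
      then obtain i where i: "i \<in> I" "block \<delta> i \<noteq> block \<gamma> i" using block_inj True g by blast
      have "finprod K (\<lambda>i. fmon (k i) (block \<gamma> i) (block \<delta> i)) (insert i (I - {i})) =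
          fmon (k i) (block \<gamma> i) (block \<delta> i) \<otimes> finprod K (\<lambda>i. fmon (k i) (block \<gamma> i) (block \<delta> i)) (I - {i})"
        by (rule K.finprod_insert) (use k finI i in auto)
      moreover have "finprod K (\<lambda>i. fmon (k i) (block \<gamma> i) (block \<delta> i)) (I - {i}) \<in> carrier K"
        by (rule K.finprod_closed) (use k in auto)
      ultimately show ?thesis unfolding e using i False by (simp add: insert_absorb C.mon_def)
    qed
  qed
qed

lemma tens_basis: "\<gamma> \<in> carrier \<Gamma> \<Longrightarrow> tens (basis_tuple \<gamma>) = C.mon \<one> \<gamma>"
  unfolding basis_tuple_def using finprod_fmon[of "\<lambda>_. \<one>" \<gamma>] by simp

lemma tens_closed: "a \<in> X \<Longrightarrow> tens a \<in> carrier B"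
  by (induction a rule: multilinear_induct)
    (simp_all add: tens_basis tens_add tens_smult C.add_closed C.smult_closed del: fun_upd_apply)

lemma one_PF: "\<one>\<^bsub>PF\<^esub> = basis_tuple \<one>\<^bsub>\<Gamma>\<^esub>"
proof -
  have "\<one>\<^bsub>F i\<^esub> = fmon \<one> (block \<one>\<^bsub>\<Gamma>\<^esub> i)" if "i \<in> I" for i
    using twisted_monoid.T_simps(2)[OF factor[OF that]] F_mon[OF that] F_eq[OF that] block_one[OF that] by simp
  then show ?thesis by (auto simp: basis_tuple_def intro!: restrict_ext)
qed

text \<open>Both sides are multilinear in \<open>a\<close> and in \<open>b\<close>. On tuples of
  basis elements the claim says that the cocycle of the product is the product of the cocycles of
  the factors.\<close>

lemma tens_mult:
  assumes "a \<in> X" "b \<in> X"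
  shows "tens (a \<otimes>\<^bsub>PF\<^esub> b) = tens a \<otimes>\<^bsub>B\<^esub> tens b"
  using assms(1)
proof (induction a rule: multilinear_induct)
  case (base \<gamma>)
  show ?case using assms(2)
  proof (induction b rule: multilinear_induct)
    case (base \<delta>)
    have "fmon \<one> (block \<gamma> i) \<otimes>\<^bsub>F i\<^esub> fmon \<one> (block \<delta> i) =
        fmon (\<tau> i (block \<gamma> i) (block \<delta> i)) (block (\<gamma> \<otimes>\<^bsub>\<Gamma>\<^esub> \<delta>) i)" if i: "i \<in> I" for i
    proof -
      interpret Fi: twisted_monoid K "M i" "\<tau> i" by (rule factor[OF i])
      show ?thesis
        using Fi.mon_mult[of \<one> \<one> "block \<gamma> i" "block \<delta> i"] block_closed[OF _ i] block_mult[OF _ _ i] base.hyps \<open>\<gamma> \<in> carrier \<Gamma>\<close>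
        by (simp add: Fi.mon_def F_eq[OF i])
    qed
    then have "basis_tuple \<gamma> \<otimes>\<^bsub>PF\<^esub> basis_tuple \<delta> = (\<lambda>i\<in>I. fmon (\<tau> i (block \<gamma> i) (block \<delta> i)) (block (\<gamma> \<otimes>\<^bsub>\<Gamma>\<^esub> \<delta>) i))"
      by (auto simp: basis_tuple_def intro!: restrict_ext)
    moreover have "\<tau> i (block \<gamma> i) (block \<delta> i) \<in> carrier K" if "i \<in> I" for i
      using twisted_monoid.cocycle_closed[OF factor[OF that]] block_closed[OF _ that] base.hyps \<open>\<gamma> \<in> carrier \<Gamma>\<close> by simp
    ultimately show ?case
      using finprod_fmon[of "\<lambda>i. \<tau> i (block \<gamma> i) (block \<delta> i)" "\<gamma> \<otimes>\<^bsub>\<Gamma>\<^esub> \<delta>"] base.hyps \<open>\<gamma> \<in> carrier \<Gamma>\<close>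
      by (simp add: tens_basis C.mon_mult cocycle_prod del: fun_upd_apply restrict_apply mult_product_group)
  next
    case (add b i x y)
    let ?e = "basis_tuple \<gamma>"
    interpret Fi: ring "F i" by (rule F_ring[OF add.hyps(2)])
    have e: "?e \<in> X" "?e i \<in> carrier (F i)" using basis_tuple_closed[OF \<open>\<gamma> \<in> carrier \<Gamma>\<close>] add.hyps(2) by auto
    have eb: "?e \<otimes>\<^bsub>PF\<^esub> b \<in> X" using monoid.m_closed[OF PF_monoid, of ?e b] e add.hyps(1) by simp
    \<comment> \<open>Multiplication of tuples is componentwise, so a change at position
      \<open>i\<close> stays at position \<open>i\<close>, and multilinearity of \<open>tens\<close>
      applies to the product tuple.\<close>
    have up: "?e \<otimes>\<^bsub>PF\<^esub> (b(i := z)) = (?e \<otimes>\<^bsub>PF\<^esub> b)(i := ?e i \<otimes>\<^bsub>F i\<^esub> z)" for z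
      using add.hyps(2) by auto
    have bc: "b(i := z) \<in> X" if "z \<in> carrier (F i)" for z using add.hyps(1,2) that by (auto simp: PiE_iff extensional_def)
    have "tens (?e \<otimes>\<^bsub>PF\<^esub> (b(i := x \<oplus>\<^bsub>F i\<^esub> y))) = tens (?e \<otimes>\<^bsub>PF\<^esub> (b(i := x))) \<oplus>\<^bsub>B\<^esub> tens (?e \<otimes>\<^bsub>PF\<^esub> (b(i := y)))"
      unfolding up using tens_add[OF eb add.hyps(2), of "?e i \<otimes>\<^bsub>F i\<^esub> x" "?e i \<otimes>\<^bsub>F i\<^esub> y"] add.hyps(3,4) e(2) by (simp add: Fi.r_distr del: mult_product_group)
    then show ?case unfolding add.IH tens_add[OF add.hyps(1-4)]
      using C.r_distr_T tens_closed bc[OF add.hyps(3)] bc[OF add.hyps(4)] e by (simp del: fun_upd_apply restrict_apply mult_product_group)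
  next
    case (smult b i k x)
    let ?e = "basis_tuple \<gamma>"
    interpret Fi: assoc_algebra K "F i" by (rule F_algebra[OF smult.hyps(2)])
    interpret BA: assoc_algebra K B by (rule C.assoc_algebra_T)
    have e: "?e \<in> X" "?e i \<in> carrier (F i)" using basis_tuple_closed[OF \<open>\<gamma> \<in> carrier \<Gamma>\<close>] smult.hyps(2) by auto
    have eb: "?e \<otimes>\<^bsub>PF\<^esub> b \<in> X" using monoid.m_closed[OF PF_monoid, of ?e b] e smult.hyps(1) by simp
    have up: "?e \<otimes>\<^bsub>PF\<^esub> (b(i := z)) = (?e \<otimes>\<^bsub>PF\<^esub> b)(i := ?e i \<otimes>\<^bsub>F i\<^esub> z)" for z
      using smult.hyps(2) by auto
    have bc: "b(i := z) \<in> X" if "z \<in> carrier (F i)" for z using smult.hyps(1,2) that by (auto simp: PiE_iff extensional_def)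
    have "tens (?e \<otimes>\<^bsub>PF\<^esub> (b(i := k \<odot>\<^bsub>F i\<^esub> x))) = k \<odot>\<^bsub>B\<^esub> tens (?e \<otimes>\<^bsub>PF\<^esub> (b(i := x)))"
      unfolding up using tens_smult[OF eb smult.hyps(2,3), of "?e i \<otimes>\<^bsub>F i\<^esub> x"] smult.hyps(3,4) e(2) F_mult_closed[OF smult.hyps(2)]
      by (simp add: Fi.smult_mult_right del: mult_product_group)
    then show ?case unfolding smult.IH tens_smult[OF smult.hyps(1-4)]
      using BA.smult_mult_right[OF smult.hyps(3)] tens_closed bc[OF smult.hyps(4)] e by (simp del: fun_upd_apply restrict_apply mult_product_group)
  qed
next
  case (add a i x y)
  interpret Fi: ring "F i" by (rule F_ring[OF add.hyps(2)])
  have b: "b i \<in> carrier (F i)" using assms(2) add.hyps(2) by auto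
  have ab: "a \<otimes>\<^bsub>PF\<^esub> b \<in> X" using monoid.m_closed[OF PF_monoid, of a b] assms(2) add.hyps(1) by simp
  have up: "(a(i := z)) \<otimes>\<^bsub>PF\<^esub> b = (a \<otimes>\<^bsub>PF\<^esub> b)(i := z \<otimes>\<^bsub>F i\<^esub> b i)" for z
    using add.hyps(2) by auto
  have ac: "a(i := z) \<in> X" if "z \<in> carrier (F i)" for z using add.hyps(1,2) that by (auto simp: PiE_iff extensional_def)
  have "tens ((a(i := x \<oplus>\<^bsub>F i\<^esub> y)) \<otimes>\<^bsub>PF\<^esub> b) = tens ((a(i := x)) \<otimes>\<^bsub>PF\<^esub> b) \<oplus>\<^bsub>B\<^esub> tens ((a(i := y)) \<otimes>\<^bsub>PF\<^esub> b)"
    unfolding up using tens_add[OF ab add.hyps(2), of "x \<otimes>\<^bsub>F i\<^esub> b i" "y \<otimes>\<^bsub>F i\<^esub> b i"] add.hyps(3,4) b by (simp add: Fi.l_distr del: mult_product_group)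
  then show ?case unfolding add.IH tens_add[OF add.hyps(1-4)]
    using C.l_distr_T tens_closed ac[OF add.hyps(3)] ac[OF add.hyps(4)] assms(2) by (simp del: fun_upd_apply restrict_apply mult_product_group)
next
  case (smult a i k x)
  interpret Fi: assoc_algebra K "F i" by (rule F_algebra[OF smult.hyps(2)])
  interpret BA: assoc_algebra K B by (rule C.assoc_algebra_T)
  have b: "b i \<in> carrier (F i)" using assms(2) smult.hyps(2) by auto
  have ab: "a \<otimes>\<^bsub>PF\<^esub> b \<in> X" using monoid.m_closed[OF PF_monoid, of a b] assms(2) smult.hyps(1) by simp
  have up: "(a(i := z)) \<otimes>\<^bsub>PF\<^esub> b = (a \<otimes>\<^bsub>PF\<^esub> b)(i := z \<otimes>\<^bsub>F i\<^esub> b i)" for z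
    using smult.hyps(2) by auto
  have ac: "a(i := z) \<in> X" if "z \<in> carrier (F i)" for z using smult.hyps(1,2) that by (auto simp: PiE_iff extensional_def)
  have "tens ((a(i := k \<odot>\<^bsub>F i\<^esub> x)) \<otimes>\<^bsub>PF\<^esub> b) = k \<odot>\<^bsub>B\<^esub> tens ((a(i := x)) \<otimes>\<^bsub>PF\<^esub> b)"
    unfolding up using tens_smult[OF ab smult.hyps(2,3), of "x \<otimes>\<^bsub>F i\<^esub> b i"] smult.hyps(3,4) b F_mult_closed[OF smult.hyps(2)]
    by (simp add: Fi.smult_mult_left del: mult_product_group)
  then show ?case unfolding smult.IH tens_smult[OF smult.hyps(1-4)]
    using BA.smult_mult_left[OF smult.hyps(3)] tens_closed ac[OF smult.hyps(4)] assms(2) by (simp del: fun_upd_apply restrict_apply mult_product_group)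
qed

end

section \<open>The quotient by the multilinear relations\<close>

context tensor_twisted
begin

declare carrier_product_group [simp del] mult_product_group [simp del] one_product_group [simp del]
  fun_upd_apply [simp del]

abbreviation FP where "FP \<equiv> free_on_product K I F"
abbreviation J where "J \<equiv> multilinear_ideal K I F"
abbreviation TP where "TP \<equiv> tensor_product K I F"

lemma twisted_PF: "twisted_monoid K PF (\<lambda>_ _. \<one>)"
  by (intro twisted_monoid.intro twisted_monoid_axioms.intro PF_monoid K.field_axioms) auto

sublocale P: twisted_monoid K PF "\<lambda>_ _. \<one>"
  by (rule twisted_PF)

sublocale BA: assoc_algebra K B
  by (rule C.assoc_algebra_T)

lemma FP_eq: "FP = P.T"
  by (simp add: free_on_product_def monoid_algebra_def)

lemma PF_carrier: "carrier PF = X"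
  by (rule carrier_product_group)

text \<open>The free module on tuples is the monoid algebra of \<open>PF\<close>, so the
  multiplicative map \<open>tens\<close> extends to an algebra homomorphism \<open>L.lin\<close>
  from it to the twisted algebra \<open>B\<close>.\<close>

sublocale L: twisted_rep K PF "\<lambda>_ _. \<one>" B tens
proof (intro twisted_rep.intro twisted_lin.intro twisted_lin_axioms.intro twisted_rep_axioms.intro
    P.twisted_monoid_axioms BA.assoc_algebra_axioms)
  show "tens \<one>\<^bsub>PF\<^esub> = \<one>\<^bsub>B\<^esub>" unfolding one_PF by (simp add: tens_basis C.T_simps(2))
  fix a b assume a: "a \<in> carrier PF" and b: "b \<in> carrier PF"
  then have "tens (a \<otimes>\<^bsub>PF\<^esub> b) \<in> carrier B"
    using tens_closed monoid.m_closed[OF PF_monoid a b] unfolding PF_carrier by blast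
  then show "tens a \<otimes>\<^bsub>B\<^esub> tens b = \<one> \<odot>\<^bsub>B\<^esub> tens (a \<otimes>\<^bsub>PF\<^esub> b)"
    using tens_mult[OF a[unfolded PF_carrier] b[unfolded PF_carrier]] BA.smult_one by simp
qed (simp add: tens_closed PF_carrier)

lemma FP_mon [simp, intro]: "k \<in> carrier K \<Longrightarrow> a \<in> X \<Longrightarrow> P.mon k a \<in> carrier FP"
  unfolding FP_eq by (rule P.mon_carrier) (simp_all only: PF_carrier)

lemma lin_pure: "k \<in> carrier K \<Longrightarrow> a \<in> X \<Longrightarrow> L.lin (P.mon k a) = k \<odot>\<^bsub>B\<^esub> tens a"
  by (rule L.lin_mon) (simp_all only: PF_carrier)

lemma lin_pure_one: "a \<in> X \<Longrightarrow> L.lin (P.mon \<one> a) = tens a"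
  using lin_pure[of \<one> a] BA.smult_one[OF tens_closed] by simp

lemma FP_assoc: "assoc_algebra K FP"
  unfolding FP_eq by (rule P.assoc_algebra_T)

sublocale FPA: assoc_algebra K FP
  by (rule FP_assoc)

text \<open>A linear section of \<open>L.lin\<close>: the basis element of a degree is sent to the
  tuple of basis elements of its components. It serves to compute the kernel of
  \<open>L.lin\<close>.\<close>

sublocale S: twisted_lin K \<Gamma> \<sigma> FP "\<lambda>\<gamma>. P.mon \<one> (basis_tuple \<gamma>)"
  by (intro twisted_lin.intro twisted_lin_axioms.intro C.twisted_monoid_axioms FP_assoc)
    (simp add: basis_tuple_closed)

sublocale H: ring_hom_ring FP B L.lin
  unfolding FP_eq by (rule ring_hom_ringI2[OF P.ring_T C.ring_T L.lin_ring_hom])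

lemma update_closed: "a \<in> X \<Longrightarrow> i \<in> I \<Longrightarrow> x \<in> carrier (F i) \<Longrightarrow> a(i := x) \<in> X"
  by (auto simp: PiE_iff extensional_def fun_upd_apply)

lemma relation_add_closed:
  assumes "a \<in> X" "i \<in> I" "x \<in> carrier (F i)" "y \<in> carrier (F i)"
  defines "r \<equiv> delta K (a(i := x \<oplus>\<^bsub>F i\<^esub> y)) \<ominus>\<^bsub>FP\<^esub> (delta K (a(i := x)) \<oplus>\<^bsub>FP\<^esub> delta K (a(i := y)))"
  shows "r \<in> carrier FP" "L.lin r = \<zero>\<^bsub>B\<^esub>"
proof -
  have c: "P.mon \<one> (a(i := x \<oplus>\<^bsub>F i\<^esub> y)) \<in> carrier FP" "P.mon \<one> (a(i := x)) \<in> carrier FP" "P.mon \<one> (a(i := y)) \<in> carrier FP"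
    by (intro FP_mon K.one_closed update_closed F_add_closed assms)+
  show "r \<in> carrier FP" unfolding r_def P.delta_mon by (intro FPA.minus_closed FPA.a_closed c)
  have t: "tens (a(i := x)) \<in> carrier B" "tens (a(i := y)) \<in> carrier B"
    using tens_closed update_closed assms by blast+
  have "L.lin r = tens (a(i := x \<oplus>\<^bsub>F i\<^esub> y)) \<ominus>\<^bsub>B\<^esub> (tens (a(i := x)) \<oplus>\<^bsub>B\<^esub> tens (a(i := y)))"
    unfolding r_def P.delta_mon a_minus_def using c
    by (simp add: lin_pure_one update_closed F_add_closed assms(1-4))
  also have "\<dots> = \<zero>\<^bsub>B\<^esub>" unfolding tens_add[OF assms(1-4)] using t by (simp add: BA.r_neg a_minus_def)
  finally show "L.lin r = \<zero>\<^bsub>B\<^esub>" .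
qed

lemma relation_smult_closed:
  assumes "a \<in> X" "i \<in> I" "k \<in> carrier K" "x \<in> carrier (F i)"
  defines "r \<equiv> delta K (a(i := k \<odot>\<^bsub>F i\<^esub> x)) \<ominus>\<^bsub>FP\<^esub> (k \<odot>\<^bsub>FP\<^esub> delta K (a(i := x)))"
  shows "r \<in> carrier FP" "L.lin r = \<zero>\<^bsub>B\<^esub>"
proof -
  have c: "P.mon \<one> (a(i := k \<odot>\<^bsub>F i\<^esub> x)) \<in> carrier FP" "P.mon \<one> (a(i := x)) \<in> carrier FP"
    by (intro FP_mon K.one_closed update_closed F_smult_closed assms)+
  show "r \<in> carrier FP" unfolding r_def P.delta_mon by (intro FPA.minus_closed FPA.smult_closed c assms)
  have t: "tens (a(i := x)) \<in> carrier B"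
    using tens_closed update_closed assms by blast+
  have s: "L.lin (k \<odot>\<^bsub>FP\<^esub> P.mon \<one> (a(i := x))) = k \<odot>\<^bsub>B\<^esub> tens (a(i := x))"
    using L.lin_smult[OF assms(3) c(2)[unfolded FP_eq]] lin_pure_one[OF update_closed[OF assms(1,2,4)]]
    by (simp add: FP_eq)
  have "L.lin r = tens (a(i := k \<odot>\<^bsub>F i\<^esub> x)) \<ominus>\<^bsub>B\<^esub> (k \<odot>\<^bsub>B\<^esub> tens (a(i := x)))"
    unfolding r_def P.delta_mon a_minus_def using c assms(3)
    by (simp add: s lin_pure_one update_closed F_smult_closed assms(1-4))
  also have "\<dots> = \<zero>\<^bsub>B\<^esub>" unfolding tens_smult[OF assms(1-4)] using t assms by (simp add: BA.r_neg a_minus_def)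
  finally show "L.lin r = \<zero>\<^bsub>B\<^esub>" .
qed

lemma relations_in_kernel: "multilinear_relations K I F \<subseteq> a_kernel FP B L.lin"
proof
  fix r assume "r \<in> multilinear_relations K I F"
  then have "r \<in> carrier FP \<and> L.lin r = \<zero>\<^bsub>B\<^esub>"
    unfolding multilinear_relations_def
  proof (elim UnE CollectE exE conjE)
    fix a i x y assume "r = delta K (a(i := x \<oplus>\<^bsub>F i\<^esub> y)) \<ominus>\<^bsub>FP\<^esub> (delta K (a(i := x)) \<oplus>\<^bsub>FP\<^esub> delta K (a(i := y)))"
      "a \<in> X" "i \<in> I" "x \<in> carrier (F i)" "y \<in> carrier (F i)"
    then show ?thesis using relation_add_closed by simp
  next
    fix a i k x assume "r = delta K (a(i := k \<odot>\<^bsub>F i\<^esub> x)) \<ominus>\<^bsub>FP\<^esub> (k \<odot>\<^bsub>FP\<^esub> delta K (a(i := x)))"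
      "a \<in> X" "i \<in> I" "k \<in> carrier K" "x \<in> carrier (F i)"
    then show ?thesis using relation_smult_closed by simp
  qed
  then show "r \<in> a_kernel FP B L.lin" unfolding a_kernel_def' by blast
qed

lemma relations_carrier: "multilinear_relations K I F \<subseteq> carrier FP"
  using relations_in_kernel unfolding a_kernel_def' by blast

sublocale JI: ideal J FP
  unfolding multilinear_ideal_def by (rule FPA.genideal_ideal[OF relations_carrier])

definition proj :: "(('i \<Rightarrow> 'g \<Rightarrow> 'k) \<Rightarrow> 'k) \<Rightarrow> (('i \<Rightarrow> 'g \<Rightarrow> 'k) \<Rightarrow> 'k) set" where
  "proj f = J +>\<^bsub>FP\<^esub> f"

lemma proj_hom: "proj \<in> Ring.ring_hom FP (FP Quot J)"
proof -
  have p: "proj = (+>\<^bsub>FP\<^esub>) J" by (rule ext) (simp only: proj_def)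
  show ?thesis unfolding p by (rule JI.rcos_ring_hom)
qed

lemma proj_eq_iff: "f \<in> carrier FP \<Longrightarrow> g \<in> carrier FP \<Longrightarrow> proj f = proj g \<longleftrightarrow> f \<ominus>\<^bsub>FP\<^esub> g \<in> J"
  unfolding proj_def by (rule FPA.quotient_eq_iff_same_a_r_cos[OF JI.ideal_axioms, symmetric])

lemma proj_add: "f \<in> carrier FP \<Longrightarrow> g \<in> carrier FP \<Longrightarrow> proj (f \<oplus>\<^bsub>FP\<^esub> g) = proj f \<oplus>\<^bsub>FP Quot J\<^esub> proj g"
  using proj_hom by (rule ring_hom_add)

text \<open>\<open>J\<close> is generated as a ring ideal; the quotient map respects scalars because
  a scalar acts as multiplication by a multiple of the unit.\<close>

lemma proj_smult:
  assumes f: "f \<in> carrier FP" and k: "k \<in> carrier K"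
  shows "proj (k \<odot>\<^bsub>FP\<^esub> f) = proj (P.mon k \<one>\<^bsub>PF\<^esub>) \<otimes>\<^bsub>FP Quot J\<^esub> proj f"
proof -
  have m: "P.mon k \<one>\<^bsub>PF\<^esub> \<in> carrier FP" unfolding FP_eq by (rule P.mon_carrier[OF k P.M.one_closed])
  have e: "k \<odot>\<^bsub>FP\<^esub> f = P.mon k \<one>\<^bsub>PF\<^esub> \<otimes>\<^bsub>FP\<^esub> f"
    using P.smult_as_mult[OF f[unfolded FP_eq] k] unfolding FP_eq by (rule conjunct1)
  show ?thesis unfolding e by (rule ring_hom_mult[OF proj_hom m f])
qed

lemma relation_in_J: "r \<in> multilinear_relations K I F \<Longrightarrow> r \<in> J"
  unfolding multilinear_ideal_def using FPA.genideal_self[OF relations_carrier] by blast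

text \<open>Modulo \<open>J\<close> every tuple is expressed by tuples of basis elements. The
  defining relations of \<open>J\<close> are precisely the two induction steps of
  \<open>multilinear_induct\<close>.\<close>

lemma proj_pure:
  assumes "a \<in> X"
  shows "proj (P.mon \<one> a) = proj (S.lin (tens a))"
  using assms
proof (induction a rule: multilinear_induct)
  case (base \<gamma>)
  show ?case
    unfolding tens_basis[OF base] S.lin_mon[OF K.one_closed base] FPA.smult_one[OF S.rep_closed[OF base]] ..
next
  case (add a i x y)
  note h = add.hyps
  have t: "tens (a(i := x)) \<in> carrier B" "tens (a(i := y)) \<in> carrier B"
    using tens_closed update_closed h by blast+
  have c: "P.mon \<one> (a(i := x \<oplus>\<^bsub>F i\<^esub> y)) \<in> carrier FP" "P.mon \<one> (a(i := x)) \<in> carrier FP" "P.mon \<one> (a(i := y)) \<in> carrier FP"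
    by (intro FP_mon K.one_closed update_closed F_add_closed h)+
  have "P.mon \<one> (a(i := x \<oplus>\<^bsub>F i\<^esub> y)) \<ominus>\<^bsub>FP\<^esub> (P.mon \<one> (a(i := x)) \<oplus>\<^bsub>FP\<^esub> P.mon \<one> (a(i := y))) \<in> J"
    by (rule relation_in_J) (use h in \<open>unfold multilinear_relations_def P.delta_mon[symmetric], blast\<close>)
  then have "proj (P.mon \<one> (a(i := x \<oplus>\<^bsub>F i\<^esub> y))) = proj (P.mon \<one> (a(i := x)) \<oplus>\<^bsub>FP\<^esub> P.mon \<one> (a(i := y)))"
    using proj_eq_iff c by simp
  also have "\<dots> = proj (S.lin (tens (a(i := x)))) \<oplus>\<^bsub>FP Quot J\<^esub> proj (S.lin (tens (a(i := y))))"
    unfolding proj_add[OF c(2,3)] add.IH ..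
  also have "\<dots> = proj (S.lin (tens (a(i := x \<oplus>\<^bsub>F i\<^esub> y))))"
    unfolding tens_add[OF h] S.lin_add[OF t] by (rule proj_add[symmetric]) (use t in auto)
  finally show ?case .
next
  case (smult a i k x)
  note h = smult.hyps
  have t: "tens (a(i := x)) \<in> carrier B" using tens_closed update_closed h by blast
  have c: "P.mon \<one> (a(i := k \<odot>\<^bsub>F i\<^esub> x)) \<in> carrier FP" "P.mon \<one> (a(i := x)) \<in> carrier FP"
    by (intro FP_mon K.one_closed update_closed F_smult_closed h)+
  have "P.mon \<one> (a(i := k \<odot>\<^bsub>F i\<^esub> x)) \<ominus>\<^bsub>FP\<^esub> (k \<odot>\<^bsub>FP\<^esub> P.mon \<one> (a(i := x))) \<in> J"
    by (rule relation_in_J) (use h in \<open>unfold multilinear_relations_def P.delta_mon[symmetric], blast\<close>)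
  then have "proj (P.mon \<one> (a(i := k \<odot>\<^bsub>F i\<^esub> x))) = proj (k \<odot>\<^bsub>FP\<^esub> P.mon \<one> (a(i := x)))"
    using proj_eq_iff c h(3) by simp
  also have "\<dots> = proj (k \<odot>\<^bsub>FP\<^esub> S.lin (tens (a(i := x))))"
    unfolding proj_smult[OF c(2) h(3)] smult.IH proj_smult[OF S.lin_closed[OF t] h(3)] ..
  also have "k \<odot>\<^bsub>FP\<^esub> S.lin (tens (a(i := x))) = S.lin (tens (a(i := k \<odot>\<^bsub>F i\<^esub> x)))"
    unfolding tens_smult[OF h] using S.lin_smult[OF h(3) t] by simp
  finally show ?case .
qed

lemma proj_section:
  assumes "f \<in> carrier FP"
  shows "proj f = proj (S.lin (L.lin f))"
proof -
  have "f \<in> carrier P.T" using assms by (simp only: FP_eq)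
  then show ?thesis
proof (induction f rule: P.T_induct)
  case zero
  have "(\<lambda>_. \<zero>) = \<zero>\<^bsub>FP\<^esub>" unfolding FP_eq P.T_simps(3) ..
  then show ?case unfolding L.lin_zero C.T_simps(3) S.lin_zero by simp
next
  case (add k a f)
  have a: "a \<in> X" using add.hyps(2) by (simp only: PF_carrier)
  have m: "P.mon \<one> a \<in> carrier FP" "P.mon k a \<in> carrier FP" "f \<in> carrier FP"
    by (rule FP_mon[OF K.one_closed a], rule FP_mon[OF add.hyps(1) a], unfold FP_eq, rule add.hyps(3))
  have mk: "P.mon k a = k \<odot>\<^bsub>FP\<^esub> P.mon \<one> a" 
    unfolding FP_eq P.smult_mon[OF add.hyps(1) K.one_closed] K.r_one[OF add.hyps(1)] ..
  have ta: "tens a \<in> carrier B" by (rule tens_closed[OF a])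
  have lf: "L.lin f \<in> carrier B" using add.hyps by blast
  have 1: "proj (P.mon k a) = proj (S.lin (L.lin (P.mon k a)))"
  proof -
    have "proj (P.mon k a) = proj (k \<odot>\<^bsub>FP\<^esub> S.lin (tens a))"
      unfolding mk proj_smult[OF m(1) add.hyps(1)] proj_pure[OF a] proj_smult[OF S.lin_closed[OF ta] add.hyps(1)] ..
    also have "k \<odot>\<^bsub>FP\<^esub> S.lin (tens a) = S.lin (L.lin (P.mon k a))"
      using S.lin_smult[OF add.hyps(1) ta] L.lin_mon[OF add.hyps(1,2)] by simp
    finally show ?thesis .
  qed
  have "proj (P.mon k a \<oplus>\<^bsub>P.T\<^esub> f) = proj (S.lin (L.lin (P.mon k a))) \<oplus>\<^bsub>FP Quot J\<^esub> proj (S.lin (L.lin f))"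
    using proj_add[OF m(2,3)] 1 add.IH by (simp add: FP_eq)
  also have "\<dots> = proj (S.lin (L.lin (P.mon k a)) \<oplus>\<^bsub>FP\<^esub> S.lin (L.lin f))"
    by (rule proj_add[symmetric]) (use m lf in \<open>auto simp: FP_eq[symmetric]\<close>)
  also have "S.lin (L.lin (P.mon k a)) \<oplus>\<^bsub>FP\<^esub> S.lin (L.lin f) = S.lin (L.lin (P.mon k a \<oplus>\<^bsub>P.T\<^esub> f))"
    using S.lin_add[of "L.lin (P.mon k a)" "L.lin f"] L.lin_add[of "P.mon k a" f] m lf by (simp add: FP_eq)
  finally show ?case .
qed
qed

text \<open>If \<open>L.lin f = 0\<close>, then \<open>f\<close> agrees modulo \<open>J\<close> with
  the section of 0, hence lies in \<open>J\<close>.\<close>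

lemma kernel_eq: "a_kernel FP B L.lin = J"
proof (rule subset_antisym)
  show "J \<subseteq> a_kernel FP B L.lin"
    unfolding multilinear_ideal_def by (rule FPA.genideal_minimal[OF H.kernel_is_ideal relations_in_kernel])
  show "a_kernel FP B L.lin \<subseteq> J"
  proof
    fix f assume "f \<in> a_kernel FP B L.lin"
    then have f: "f \<in> carrier FP" "L.lin f = \<zero>\<^bsub>B\<^esub>" unfolding a_kernel_def' by blast+
    have "proj f = proj \<zero>\<^bsub>FP\<^esub>"
      using proj_section[OF f(1)] unfolding f(2) C.T_simps(3) S.lin_zero .
    then have "f \<ominus>\<^bsub>FP\<^esub> \<zero>\<^bsub>FP\<^esub> \<in> J" using proj_eq_iff f(1) by simp
    then show "f \<in> J" using f(1) by (simp add: a_minus_def)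
  qed
qed

lemma lin_section:
  assumes "b \<in> carrier B"
  shows "L.lin (S.lin b) = b"
  using assms
proof (induction b rule: C.T_induct)
  case zero then show ?case by (simp add: S.lin_zero) (simp add: C.T_simps(3))
next
  case (add k \<gamma> f)
  have a: "basis_tuple \<gamma> \<in> X" by (rule basis_tuple_closed[OF add.hyps(2)])
  have e: "S.lin (C.mon k \<gamma>) = P.mon k (basis_tuple \<gamma>)"
    using S.lin_mon[OF add.hyps(1,2)] P.smult_mon[of k \<one> "basis_tuple \<gamma>"] add.hyps(1) by (simp add: FP_eq)
  have "L.lin (S.lin (C.mon k \<gamma>)) = C.mon k \<gamma>"
    unfolding e lin_pure[OF add.hyps(1) a] tens_basis[OF add.hyps(2)] using add.hyps C.smult_mon[of k \<one> \<gamma>] by simp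
  then show ?case using add.IH S.lin_add[of "C.mon k \<gamma>" f] add.hyps
    by (simp add: C.mon_carrier)
qed

section \<open>The tensor product as a graded twisted algebra\<close>

definition tensor_iso where "tensor_iso = (\<lambda>W. the_elem (L.lin ` W))"

lemma tensor_iso_proj: "f \<in> carrier FP \<Longrightarrow> tensor_iso (proj f) = L.lin f"
  unfolding tensor_iso_def proj_def using H.the_elem_simp[of f] kernel_eq by simp

lemma TP_simps:
  "carrier TP = carrier (FP Quot J)" "monoid.mult TP = monoid.mult (FP Quot J)" "monoid.one TP = monoid.one (FP Quot J)"
  "ring.zero TP = ring.zero (FP Quot J)" "ring.add TP = ring.add (FP Quot J)"
  "k \<odot>\<^bsub>TP\<^esub> W = (\<Union>f\<in>W. proj (k \<odot>\<^bsub>FP\<^esub> f))"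
  by (simp_all add: tensor_product_def ring.defs proj_def)

lemma TP_elem:
  assumes "W \<in> carrier TP" obtains f where "f \<in> carrier FP" "W = proj f"
  using assms unfolding TP_simps by (auto simp: FactRing_def A_RCOSETS_def' proj_def)

lemma proj_carrier: "f \<in> carrier FP \<Longrightarrow> proj f \<in> carrier TP"
  unfolding TP_simps using ring_hom_closed[OF proj_hom] .

text \<open>The scalar multiple of a coset is a union over all its representatives; every
  representative contributes the same coset.\<close>

lemma TP_smult:
  assumes f: "f \<in> carrier FP" and k: "k \<in> carrier K"
  shows "k \<odot>\<^bsub>TP\<^esub> proj f = proj (k \<odot>\<^bsub>FP\<^esub> f)"
proof -
  have "proj (k \<odot>\<^bsub>FP\<^esub> g) = proj (k \<odot>\<^bsub>FP\<^esub> f)" if g: "g \<in> proj f" for g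
  proof -
    have gc: "g \<in> carrier FP" by (rule JI.a_elemrcos_carrier[OF f g[unfolded proj_def]])
    have "proj g = proj f" unfolding proj_def
      by (rule JI.a_repr_independence'[OF g[unfolded proj_def] f, symmetric])
    then show ?thesis using proj_smult[OF gc k] proj_smult[OF f k] by simp
  qed
  moreover have "f \<in> proj f" unfolding proj_def by (rule JI.a_rcos_self[OF f])
  ultimately show ?thesis unfolding TP_simps(6) by blast
qed

lemma tensor_iso_ring_iso: "tensor_iso \<in> ring_iso TP B"
proof -
  have "L.lin ` carrier FP = carrier B"
  proof
    show "carrier B \<subseteq> L.lin ` carrier FP"
    proof
      fix b assume b: "b \<in> carrier B"
      show "b \<in> L.lin ` carrier FP"
        using imageI[OF S.lin_closed[OF b], of L.lin] unfolding lin_section[OF b] .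
    qed
    show "L.lin ` carrier FP \<subseteq> carrier B" using H.hom_closed by blast
  qed
  then have "tensor_iso \<in> ring_iso (FP Quot J) B"
    using H.FactRing_iso_set kernel_eq by (simp add: tensor_iso_def)
  then show ?thesis by (simp add: ring_iso_def Ring.ring_hom_def TP_simps)
qed

lemma tensor_iso_smult:
  assumes "k \<in> carrier K" "W \<in> carrier TP"
  shows "tensor_iso (k \<odot>\<^bsub>TP\<^esub> W) = k \<odot>\<^bsub>B\<^esub> tensor_iso W"
proof -
  obtain f where f: "f \<in> carrier FP" "W = proj f" using TP_elem[OF assms(2)] .
  then show ?thesis
    using assms(1) L.lin_smult[OF assms(1), of f] by (simp add: TP_smult tensor_iso_proj FP_eq[symmetric])
qed

text \<open>The preimage of a line is a submodule containing the relevant pure tensors, which bounds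
  their span from above; conversely the span contains all multiples of the pure tensor of basis
  elements, whose image is the whole line.\<close>

lemma tensor_iso_subspace:
  assumes g: "\<gamma> \<in> carrier \<Gamma>"
  shows "tensor_iso ` tensor_subspace K I F (\<lambda>i. line K (block \<gamma> i)) = (\<lambda>k. C.mon k \<gamma>) ` carrier K"
    (is "_ = ?line")
    and "tensor_subspace K I F (\<lambda>i. line K (block \<gamma> i)) \<subseteq> carrier TP"
proof -
  have line: "line K (block \<gamma> i) = (\<lambda>k. fmon k (block \<gamma> i)) ` carrier K" for i
  proof -
    have m: "(\<lambda>x. k \<otimes>\<^bsub>K\<^esub> delta K (block \<gamma> i) x) = fmon k (block \<gamma> i)" if "k \<in> carrier K" for k
      using that by (auto simp: delta_def)
    show ?thesis
    proof (intro Set.set_eqI iffI)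
      fix f assume "f \<in> line K (block \<gamma> i)"
      then obtain k where "k \<in> carrier K" "f = (\<lambda>x. k \<otimes>\<^bsub>K\<^esub> delta K (block \<gamma> i) x)" unfolding line_def by blast
      then show "f \<in> (\<lambda>k. fmon k (block \<gamma> i)) ` carrier K" using m by blast
    next
      fix f assume "f \<in> (\<lambda>k. fmon k (block \<gamma> i)) ` carrier K"
      then obtain k where "k \<in> carrier K" "f = (\<lambda>x. k \<otimes>\<^bsub>K\<^esub> delta K (block \<gamma> i) x)" using m by force
      then show "f \<in> line K (block \<gamma> i)" unfolding line_def by blast
    qed
  qed
  define N where "N = {W \<in> carrier TP. tensor_iso W \<in> ?line}"
  have TPinv: "inv\<^bsub>add_monoid TP\<^esub> V = inv\<^bsub>add_monoid (FP Quot J)\<^esub> V" for V by (simp add: m_inv_def TP_simps)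
  interpret Q: ring "FP Quot J" by (rule JI.quotient_is_ring)
  interpret TH: ring_hom_ring "FP Quot J" B tensor_iso
    by (rule ring_hom_ringI2[OF Q.ring_axioms C.ring_T])
      (use tensor_iso_ring_iso in \<open>simp add: ring_iso_def Ring.ring_hom_def TP_simps\<close>)
  have "submodule N K TP"
  proof (intro submodule.intro submodule_axioms.intro)
    show "subgroup N (add_monoid TP)"
    proof (rule subgroup.intro)
      show "N \<subseteq> carrier (add_monoid TP)" by (auto simp: N_def)
      show "\<one>\<^bsub>add_monoid TP\<^esub> \<in> N"
      proof -
        have "tensor_iso \<zero>\<^bsub>FP Quot J\<^esub> = C.mon \<zero> \<gamma>" unfolding TH.hom_zero C.T_simps(3) by (auto simp: C.mon_def)
        then show ?thesis by (auto simp: N_def TP_simps)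
      qed
      fix V W assume V: "V \<in> N" and W: "W \<in> N"
      then obtain k l where kl: "k \<in> carrier K" "tensor_iso V = C.mon k \<gamma>" "l \<in> carrier K" "tensor_iso W = C.mon l \<gamma>"
        by (auto simp: N_def)
      have VW: "V \<in> carrier (FP Quot J)" "W \<in> carrier (FP Quot J)" using V W by (auto simp: N_def TP_simps)
      have "tensor_iso (V \<oplus>\<^bsub>FP Quot J\<^esub> W) = C.mon (k \<oplus> l) \<gamma>"
        using VW kl by (auto simp: C.T_simps(4) C.mon_def)
      then show "V \<otimes>\<^bsub>add_monoid TP\<^esub> W \<in> N" using VW kl by (auto simp: N_def TP_simps)
    next
      fix V assume V: "V \<in> N"
      then obtain k where k: "k \<in> carrier K" "tensor_iso V = C.mon k \<gamma>" by (auto simp: N_def)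
      have Vc: "V \<in> carrier (FP Quot J)" using V by (auto simp: N_def TP_simps)
      have "C.mon (\<ominus> k) \<gamma> \<oplus>\<^bsub>B\<^esub> C.mon k \<gamma> = \<zero>\<^bsub>B\<^esub>"
        using k by (auto simp: C.T_simps(3,4) C.mon_def K.l_neg)
      then have "\<ominus>\<^bsub>B\<^esub> C.mon k \<gamma> = C.mon (\<ominus> k) \<gamma>"
        using BA.minus_equality[of "C.mon (\<ominus> k) \<gamma>" "C.mon k \<gamma>"] k g by simp
      then have "tensor_iso (\<ominus>\<^bsub>FP Quot J\<^esub> V) = C.mon (\<ominus> k) \<gamma>" using TH.hom_a_inv[OF Vc] k by simp
      moreover have "inv\<^bsub>add_monoid TP\<^esub> V = \<ominus>\<^bsub>FP Quot J\<^esub> V" unfolding TPinv a_inv_def ..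
      ultimately show "inv\<^bsub>add_monoid TP\<^esub> V \<in> N"
        using Vc k Q.a_inv_closed[OF Vc] by (auto simp: N_def TP_simps)
    qed
    fix k W assume k: "k \<in> carrier K" and W: "W \<in> N"
    then obtain l where l: "l \<in> carrier K" "tensor_iso W = C.mon l \<gamma>" by (auto simp: N_def)
    have Wc: "W \<in> carrier TP" using W by (simp add: N_def)
    obtain f where f: "f \<in> carrier FP" "W = proj f" using TP_elem[OF Wc] .
    have "k \<odot>\<^bsub>TP\<^esub> W \<in> carrier TP" unfolding f(2) TP_smult[OF f(1) k] by (rule proj_carrier) (use f k in simp)
    moreover have "tensor_iso (k \<odot>\<^bsub>TP\<^esub> W) = C.mon (k \<otimes> l) \<gamma>"
      using tensor_iso_smult[OF k Wc] l k C.smult_mon by simp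
    ultimately show "k \<odot>\<^bsub>TP\<^esub> W \<in> N" using k l by (auto simp: N_def)
  qed
  moreover have "pure_tensor K I F ` (\<Pi>\<^sub>E i\<in>I. line K (block \<gamma> i)) \<subseteq> N"
  proof
    fix W assume "W \<in> pure_tensor K I F ` (\<Pi>\<^sub>E i\<in>I. line K (block \<gamma> i))"
    then obtain a where a: "a \<in> (\<Pi>\<^sub>E i\<in>I. line K (block \<gamma> i))" "W = pure_tensor K I F a" by blast
    then have "\<forall>i\<in>I. \<exists>k. k \<in> carrier K \<and> a i = fmon k (block \<gamma> i)" unfolding line by auto
    then obtain k where k: "\<And>i. i \<in> I \<Longrightarrow> k i \<in> carrier K \<and> a i = fmon (k i) (block \<gamma> i)" by metis
    have aeq: "a = (\<lambda>i\<in>I. fmon (k i) (block \<gamma> i))"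
      using a(1) k by (auto simp: PiE_iff extensional_def intro!: ext)
    have aX: "a \<in> X" unfolding aeq
      by (intro restrict_PiE_iff[THEN iffD2] ballI fmon_closed block_closed[OF g]) (use k in auto)
    have Wp: "W = proj (P.mon \<one> a)" unfolding a(2) pure_tensor_def proj_def P.delta_mon ..
    have m: "P.mon \<one> a \<in> carrier FP" using aX by simp
    have "tensor_iso W = tens a" unfolding Wp tensor_iso_proj[OF m] by (rule lin_pure_one[OF aX])
    also have "\<dots> = C.mon (finprod K k I) \<gamma>" unfolding aeq by (rule finprod_fmon) (use k g in auto)
    finally have "tensor_iso W = C.mon (finprod K k I) \<gamma>" .
    moreover have "finprod K k I \<in> carrier K" by (rule K.finprod_closed) (use k in auto)
    ultimately show "W \<in> N" using proj_carrier[OF m] by (simp add: N_def Wp)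
  qed
  ultimately have sub: "tensor_subspace K I F (\<lambda>i. line K (block \<gamma> i)) \<subseteq> N"
    unfolding tensor_subspace_def by blast
  then show "tensor_subspace K I F (\<lambda>i. line K (block \<gamma> i)) \<subseteq> carrier TP"
    unfolding N_def by blast
  have "tensor_iso ` tensor_subspace K I F (\<lambda>i. line K (block \<gamma> i)) \<subseteq> ?line"
    using sub unfolding N_def by blast
  moreover have "?line \<subseteq> tensor_iso ` tensor_subspace K I F (\<lambda>i. line K (block \<gamma> i))"
  proof
    fix f assume "f \<in> ?line"
    then obtain k where k: "k \<in> carrier K" "f = C.mon k \<gamma>" by blast
    let ?e = "P.mon \<one> (basis_tuple \<gamma>)"
    have e: "?e \<in> carrier FP" using basis_tuple_closed[OF g] by simp
    have "k \<odot>\<^bsub>TP\<^esub> proj ?e \<in> tensor_subspace K I F (\<lambda>i. line K (block \<gamma> i))"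
      unfolding tensor_subspace_def
    proof (intro InterI, elim CollectE conjE)
      fix N' assume N': "submodule N' K TP" "pure_tensor K I F ` (\<Pi>\<^sub>E i\<in>I. line K (block \<gamma> i)) \<subseteq> N'"
      have "basis_tuple \<gamma> \<in> (\<Pi>\<^sub>E i\<in>I. line K (block \<gamma> i))"
        unfolding basis_tuple_def line by (intro restrict_PiE_iff[THEN iffD2] ballI imageI K.one_closed)
      then have "pure_tensor K I F (basis_tuple \<gamma>) \<in> N'" using N'(2) by blast
      then have "proj ?e \<in> N'" by (simp add: pure_tensor_def proj_def P.delta_mon)
      then show "k \<odot>\<^bsub>TP\<^esub> proj ?e \<in> N'" using submodule.smult_closed[OF N'(1) k(1)] by simp
    qed
    moreover have "tensor_iso (k \<odot>\<^bsub>TP\<^esub> proj ?e) = f"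
      unfolding tensor_iso_smult[OF k(1) proj_carrier[OF e]] tensor_iso_proj[OF e]
      using lin_pure_one[OF basis_tuple_closed[OF g]] tens_basis[OF g] k C.smult_mon[of k \<one> \<gamma>] by simp
    ultimately show "f \<in> tensor_iso ` tensor_subspace K I F (\<lambda>i. line K (block \<gamma> i))" by (metis imageI)
  qed
  ultimately show "tensor_iso ` tensor_subspace K I F (\<lambda>i. line K (block \<gamma> i)) = ?line"
    by (rule subset_antisym)
qed

lemma TP_closed:
  "V \<in> carrier TP \<Longrightarrow> W \<in> carrier TP \<Longrightarrow> V \<otimes>\<^bsub>TP\<^esub> W \<in> carrier TP"
  "V \<in> carrier TP \<Longrightarrow> W \<in> carrier TP \<Longrightarrow> V \<oplus>\<^bsub>TP\<^esub> W \<in> carrier TP"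
  "\<one>\<^bsub>TP\<^esub> \<in> carrier TP"
  "k \<in> carrier K \<Longrightarrow> W \<in> carrier TP \<Longrightarrow> k \<odot>\<^bsub>TP\<^esub> W \<in> carrier TP"
proof -
  interpret Q: ring "FP Quot J" by (rule JI.quotient_is_ring)
  show "V \<in> carrier TP \<Longrightarrow> W \<in> carrier TP \<Longrightarrow> V \<otimes>\<^bsub>TP\<^esub> W \<in> carrier TP"
    "V \<in> carrier TP \<Longrightarrow> W \<in> carrier TP \<Longrightarrow> V \<oplus>\<^bsub>TP\<^esub> W \<in> carrier TP"
    "\<one>\<^bsub>TP\<^esub> \<in> carrier TP"
    unfolding TP_simps(1-5) by (rule Q.m_closed Q.a_closed Q.one_closed; assumption)+
  assume k: "k \<in> carrier K" and W: "W \<in> carrier TP"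
  obtain f where f: "f \<in> carrier FP" "W = proj f" using TP_elem[OF W] .
  show "k \<odot>\<^bsub>TP\<^esub> W \<in> carrier TP" unfolding f(2) TP_smult[OF f(1) k]
    by (rule proj_carrier) (use f k in simp)
qed

end

section \<open>The standard tori\<close>

lemma (in field) finprod_int_pow:
  assumes "q \<in> Units R" "finite I"
  shows "finprod R (\<lambda>i. q [^] (e i :: int)) I = q [^] (\<Sum>i\<in>I. e i)"
  using assms(2)
proof induction
  case (insert i I)
  then show ?case using assms(1) by (simp add: int_pow_plus Pi_def)
qed simp

text \<open>Above the diagonal each block has the single entry \<open>k i\<close>, so the cocycle of
  the normal form is literally the product of the cocycles defining the factors
  \<open>A_torus\<close>.\<close>

lemma upper_N_mat:
  assumes s: "2 * s \<le> n"
  shows "upper n (N_mat n s k) x y = (\<Sum>i\<in>{1..s}. k i * (x (2 * (i - 1)) * y (2 * (i - 1) + 1)))"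
proof -
  define g where "g i = k i * (x (2 * (i - 1)) * y (2 * (i - 1) + 1))" for i
  have inner: "(\<Sum>i<j. x i * N_mat n s k $$ (i,j) * y j) = (if odd j \<and> j div 2 < s then g (j div 2 + 1) else 0)"
    if j: "j < n" for j
  proof (cases "odd j \<and> j div 2 < s")
    case True
    then obtain a where a: "j = 2 * a + 1" "a < s" by (auto elim!: oddE)
    have "(\<Sum>i<j. x i * N_mat n s k $$ (i,j) * y j) = (\<Sum>i\<in>{2 * a}. x i * N_mat n s k $$ (i,j) * y j)"
    proof (rule sum.mono_neutral_right)
      show "\<forall>i\<in>{..<j} - {2 * a}. x i * N_mat n s k $$ (i,j) * y j = 0"
      proof
        fix i assume i: "i \<in> {..<j} - {2 * a}"
        then have "i div 2 \<noteq> j div 2" using a by auto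
        then show "x i * N_mat n s k $$ (i,j) * y j = 0" using i j by (simp add: N_mat_entries[OF s])
      qed
    qed (use a in auto)
    also have "\<dots> = g (j div 2 + 1)" using a j by (simp add: N_mat_entries[OF s] g_def)
    finally show ?thesis using True by simp
  next
    case False
    have "x i * N_mat n s k $$ (i,j) * y j = 0" if "i < j" for i
    proof -
      have "\<not> (i div 2 = j div 2 \<and> i div 2 < s)"
      proof
        assume h: "i div 2 = j div 2 \<and> i div 2 < s"
        then have "even j" using False by simp
        then show False using h that by (auto elim!: evenE)
      qed
      then show ?thesis using that j by (auto simp: N_mat_entries[OF s])
    qed
    then have "(\<Sum>i<j. x i * N_mat n s k $$ (i,j) * y j) = 0" by (intro sum.neutral) simp
    with False show ?thesis by auto
  qed
  have "upper n (N_mat n s k) x y = (\<Sum>j<n. if odd j \<and> j div 2 < s then g (j div 2 + 1) else 0)"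
    unfolding upper_def by (intro sum.cong refl inner) simp
  also have "\<dots> = (\<Sum>j\<in>{j \<in> {..<n}. odd j \<and> j div 2 < s}. g (j div 2 + 1))"
    by (rule sum.inter_filter[symmetric]) simp
  also have "\<dots> = (\<Sum>i\<in>{1..s}. g i)"
    by (rule sum.reindex_bij_witness[of _ "\<lambda>i. 2 * (i - 1) + 1" "\<lambda>j. j div 2 + 1"])
      (use s in \<open>auto elim!: oddE\<close>)
  finally show ?thesis by (simp add: g_def)
qed

text \<open>The update \<open>h(s := int z * h s)\<close> reflects that \<open>z\<close> enters only
  the last two-dimensional factor. The group algebra factor corresponds to the zero block of
  \<open>N_mat\<close> and is present only for \<open>2 * s < n\<close>.\<close>

lemma standard_tensor_twisted:
  fixes K :: "('k, 'e) ring_scheme" and h :: "nat \<Rightarrow> int" and z n s :: nat and q :: 'k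
  assumes K: "field K" and q: "q \<in> Units K" and s: "2 * s \<le> n"
  defines "k \<equiv> h(s := int z * h s)"
  shows "tensor_twisted K (Zn n) (\<lambda>x y. q [^]\<^bsub>K\<^esub> upper n (N_mat n s k) x y) (factor_index n s)
    (\<lambda>i. if i \<le> s then Zn 2 else Zn (n - 2 * s))
    (\<lambda>i x y. if i \<le> s then (q [^]\<^bsub>K\<^esub> k i) [^]\<^bsub>K\<^esub> (x 0 * y 1 :: int) else \<one>\<^bsub>K\<^esub>)
    (factor_algebra K n q s h z) (degree_block n s)"
proof -
  interpret field K by (rule K)
  interpret T: twisted_monoid K "Zn n" "\<lambda>x y. q [^]\<^bsub>K\<^esub> upper n (N_mat n s k) x y"
    by (rule twisted_monoid_torus[OF K q])
  let ?I = "factor_index n s"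
  have I: "1 \<le> i" "i \<le> s \<or> (i = s + 1 \<and> 2 * s < n)" if "i \<in> ?I" for i
    using that by (auto simp: factor_index_def split: if_splits)
  have I1: "i \<in> ?I" if "1 \<le> i" "i \<le> s" for i using that by (auto simp: factor_index_def)
  have G: "comm_group (Zn k)" for k by (rule Zn_comm_group)
  have mon: "monoid (Zn k)" for k using Zn_group group.is_monoid by blast
  have db1: "degree_block n s \<gamma> i = (\<lambda>j\<in>{..<2}. \<gamma> (2 * (i - 1) + j))" if "i \<le> s" for \<gamma> i
    using that by (simp add: degree_block_def)
  have db2: "degree_block n s \<gamma> (s + 1) = (\<lambda>j\<in>{..<n - 2 * s}. \<gamma> (2 * s + j))" for \<gamma>
    by (simp add: degree_block_def)
  show ?thesis
  proof (intro tensor_twisted.intro tensor_twisted_axioms.intro K T.twisted_monoid_axioms)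
    show "finite ?I" by (simp add: factor_index_def)
  next
    fix i assume i: "i \<in> ?I"
    show "twisted_monoid K (if i \<le> s then Zn 2 else Zn (n - 2 * s))
       (\<lambda>x y. if i \<le> s then (q [^]\<^bsub>K\<^esub> k i) [^]\<^bsub>K\<^esub> (x 0 * y 1 :: int) else \<one>\<^bsub>K\<^esub>)"
    proof (cases "i \<le> s")
      case True
      have u: "q [^]\<^bsub>K\<^esub> k i \<in> Units K" using q by simp
      have "twisted_monoid K (Zn 2) (\<lambda>x y. (q [^]\<^bsub>K\<^esub> k i) [^]\<^bsub>K\<^esub> (x 0 * y 1 :: int))"
      proof (intro twisted_monoid.intro twisted_monoid_axioms.intro K mon)
        fix x y z :: "nat \<Rightarrow> int"
        show "(q [^]\<^bsub>K\<^esub> k i) [^]\<^bsub>K\<^esub> (x 0 * y 1) \<otimes>\<^bsub>K\<^esub> (q [^]\<^bsub>K\<^esub> k i) [^]\<^bsub>K\<^esub> ((x \<otimes>\<^bsub>Zn 2\<^esub> y) 0 * z 1) =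
          (q [^]\<^bsub>K\<^esub> k i) [^]\<^bsub>K\<^esub> (x 0 * (y \<otimes>\<^bsub>Zn 2\<^esub> z) 1) \<otimes>\<^bsub>K\<^esub> (q [^]\<^bsub>K\<^esub> k i) [^]\<^bsub>K\<^esub> (y 0 * z 1)"
          unfolding int_pow_plus[OF u, symmetric] by (simp add: Zn_simps(3) algebra_simps)
      qed (use u in \<open>auto simp: Zn_simps(2)\<close>)
      then show ?thesis using True by simp
    next
      case False
      have "twisted_monoid K (Zn (n - 2 * s)) (\<lambda>_ _. \<one>\<^bsub>K\<^esub>)"
        by (intro twisted_monoid.intro twisted_monoid_axioms.intro K mon) auto
      then show ?thesis using False by simp
    qed
    show "factor_algebra K n q s h z i = twisted_algebra K (if i \<le> s then Zn 2 else Zn (n - 2 * s))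
       (\<lambda>x y. if i \<le> s then (q [^]\<^bsub>K\<^esub> k i) [^]\<^bsub>K\<^esub> (x 0 * y 1 :: int) else \<one>\<^bsub>K\<^esub>)"
      using I[OF i] by (cases "i < s"; cases "i = s")
        (simp_all add: factor_algebra_def A_torus_def monoid_algebra_def k_def)
  next
    fix \<gamma> i assume "i \<in> ?I"
    then show "degree_block n s \<gamma> i \<in> carrier (if i \<le> s then Zn 2 else Zn (n - 2 * s))"
      using I by (auto simp: degree_block_def)
  next
    fix x assume x: "x \<in> (\<Pi>\<^sub>E i\<in>?I. carrier (if i \<le> s then Zn 2 else Zn (n - 2 * s)))"
    \<comment> \<open>The degree assembled from its components: coordinate \<open>j\<close> below
      \<open>2 * s\<close> belongs to block \<open>j div 2 + 1\<close>, the remaining ones to block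
      \<open>s + 1\<close>.\<close>
    define \<gamma> where "\<gamma> = (\<lambda>j\<in>{..<n}. if j < 2 * s then x (j div 2 + 1) (j mod 2) else x (s + 1) (j - 2 * s))"
    show "\<exists>\<gamma>\<in>carrier (Zn n). \<forall>i\<in>?I. degree_block n s \<gamma> i = x i"
    proof (intro bexI[of _ \<gamma>] ballI)
      fix i assume i: "i \<in> ?I"
      have xi: "x i \<in> carrier (if i \<le> s then Zn 2 else Zn (n - 2 * s))" by (rule PiE_mem[OF x i])
      show "degree_block n s \<gamma> i = x i"
      proof (cases "i \<le> s")
        case True
        show ?thesis
        proof (rule Zn_ext[where n = 2])
          fix j :: nat assume j: "j < 2"
          have "2 * (i - 1) + j < 2 * s" "(2 * (i - 1) + j) div 2 + 1 = i" "(2 * (i - 1) + j) mod 2 = j"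
            using I(1)[OF i] True j by auto
          then show "degree_block n s \<gamma> i j = x i j" using j s by (simp add: db1[OF True] \<gamma>_def)
        qed (use xi True in \<open>simp_all add: db1\<close>)
      next
        case False
        then have i': "i = s + 1" using I[OF i] by simp
        show ?thesis
        proof (rule Zn_ext[where n = "n - 2 * s"])
          fix j assume "j < n - 2 * s"
          then show "degree_block n s \<gamma> i j = x i j" using less_diff_conv2 s by (auto simp: i' degree_block_def \<gamma>_def)
        qed (use xi False in \<open>simp_all add: i' degree_block_def\<close>)
      qed
    qed (simp add: \<gamma>_def)
  next
    fix \<gamma> \<gamma>' assume g: "\<gamma> \<in> carrier (Zn n)" "\<gamma>' \<in> carrier (Zn n)"
      and eq: "\<And>i. i \<in> ?I \<Longrightarrow> degree_block n s \<gamma> i = degree_block n s \<gamma>' i"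
    show "\<gamma> = \<gamma>'"
    proof (rule Zn_ext[OF g])
      fix j assume j: "j < n"
      show "\<gamma> j = \<gamma>' j"
      proof (cases "j < 2 * s")
        case True
        then have i: "1 \<le> j div 2 + 1" "j div 2 + 1 \<le> s" by auto
        have "degree_block n s \<gamma> (j div 2 + 1) (j mod 2) = degree_block n s \<gamma>' (j div 2 + 1) (j mod 2)"
          using eq[OF I1[OF i]] by simp
        then show ?thesis unfolding db1[OF i(2)] by simp
      next
        case False
        then have "s + 1 \<in> ?I" using j by (auto simp: factor_index_def)
        then have "degree_block n s \<gamma> (s + 1) (j - 2 * s) = degree_block n s \<gamma>' (s + 1) (j - 2 * s)"
          using eq by simp
        moreover have "j - 2 * s < n - 2 * s" "2 * s + (j - 2 * s) = j" using False j by auto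
        ultimately show ?thesis unfolding db2 by (simp del: le_add_diff_inverse)
      qed
    qed
  next
    fix \<gamma> \<gamma>' i assume g: "\<gamma> \<in> carrier (Zn n)" "\<gamma>' \<in> carrier (Zn n)" and i: "i \<in> ?I"
    show "degree_block n s (\<gamma> \<otimes>\<^bsub>Zn n\<^esub> \<gamma>') i = degree_block n s \<gamma> i \<otimes>\<^bsub>if i \<le> s then Zn 2 else Zn (n - 2 * s)\<^esub> degree_block n s \<gamma>' i"
    proof (cases "i \<le> s")
      case True
      then have "2 * (i - 1) + j < n" if "j < 2" for j using that s I(1)[OF i] by simp
      then show ?thesis using True by (auto simp: db1 Zn_simps(3) intro!: restrict_ext)
    next
      case False
      then have i': "i = s + 1" using I[OF i] by simp
      show ?thesis unfolding i' db2 by (auto simp: Zn_simps(3) intro!: restrict_ext)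
    qed
  next
    fix \<gamma> \<gamma>' assume g: "\<gamma> \<in> carrier (Zn n)" "\<gamma>' \<in> carrier (Zn n)"
    have q1: "(\<lambda>i. if i \<le> s then (q [^]\<^bsub>K\<^esub> k i) [^]\<^bsub>K\<^esub> (degree_block n s \<gamma> i 0 * degree_block n s \<gamma>' i 1) else \<one>\<^bsub>K\<^esub>) i =
        q [^]\<^bsub>K\<^esub> (if i \<le> s then k i * (\<gamma> (2 * (i - 1)) * \<gamma>' (2 * (i - 1) + 1)) else 0)" for i
      using int_pow_times[OF q] by (simp add: db1)
    have "finprod K (\<lambda>i. if i \<le> s then (q [^]\<^bsub>K\<^esub> k i) [^]\<^bsub>K\<^esub> (degree_block n s \<gamma> i 0 * degree_block n s \<gamma>' i 1) else \<one>\<^bsub>K\<^esub>) ?I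
       = q [^]\<^bsub>K\<^esub> (\<Sum>i\<in>?I. if i \<le> s then k i * (\<gamma> (2 * (i - 1)) * \<gamma>' (2 * (i - 1) + 1)) else 0)"
      unfolding q1 by (rule finprod_int_pow[OF q]) (simp add: factor_index_def)
    also have "(\<Sum>i\<in>?I. if i \<le> s then k i * (\<gamma> (2 * (i - 1)) * \<gamma>' (2 * (i - 1) + 1)) else 0) =
        (\<Sum>i\<in>{1..s}. k i * (\<gamma> (2 * (i - 1)) * \<gamma>' (2 * (i - 1) + 1)))"
      by (rule sum.mono_neutral_cong_right) (auto simp: factor_index_def)
    finally show "q [^]\<^bsub>K\<^esub> upper n (N_mat n s k) \<gamma> \<gamma>' =
      finprod K (\<lambda>i. if i \<le> s then (q [^]\<^bsub>K\<^esub> k i) [^]\<^bsub>K\<^esub> (degree_block n s \<gamma> i 0 * degree_block n s \<gamma>' i 1) else \<one>\<^bsub>K\<^esub>) ?I"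
      unfolding upper_N_mat[OF s] by simp
  next
    fix i assume i: "i \<in> ?I"
    show "degree_block n s \<one>\<^bsub>Zn n\<^esub> i = \<one>\<^bsub>if i \<le> s then Zn 2 else Zn (n - 2 * s)\<^esub>"
    proof (cases "i \<le> s")
      case True
      then have "2 * (i - 1) + j < n" if "j < 2" for j using that s I(1)[OF i] by simp
      then show ?thesis using True by (auto simp: db1 Zn_simps(2) intro!: restrict_ext)
    next
      case False
      then have i': "i = s + 1" using I[OF i] by simp
      show ?thesis unfolding i' db2 by (auto simp: Zn_simps(2) intro!: restrict_ext)
    qed
  qed
qed

lemma standard_torus_graded_iso:
  fixes K :: "('k, 'e) ring_scheme" and h :: "nat \<Rightarrow> int" and z n s :: nat and q :: 'k
  assumes K: "field K" and q: "q \<in> Units K" and s: "2 * s \<le> n"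
  defines "N \<equiv> N_mat n s (h(s := int z * h s))"
  shows "graded_iso K (Zn n) (standard_torus K n q s h z) (standard_grading K n q s h z) (torus_algebra K n q N) (line K)"
    and "graded_iso K (Zn n) (torus_algebra K n q N) (line K) (standard_torus K n q s h z) (standard_grading K n q s h z)"
proof -
  interpret tensor_twisted K "Zn n" "\<lambda>x y. q [^]\<^bsub>K\<^esub> upper n N x y" "factor_index n s"
    "\<lambda>i. if i \<le> s then Zn 2 else Zn (n - 2 * s)"
    "\<lambda>i x y. if i \<le> s then (q [^]\<^bsub>K\<^esub> (h(s := int z * h s)) i) [^]\<^bsub>K\<^esub> (x 0 * y 1 :: int) else \<one>\<^bsub>K\<^esub>"
    "factor_algebra K n q s h z" "degree_block n s"
    unfolding N_def by (rule standard_tensor_twisted[OF K q s])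
  have id: "(\<lambda>x. x) \<in> iso (Zn n) (Zn n)" by (rule iso_set_refl)
  show 1: "graded_iso K (Zn n) (standard_torus K n q s h z) (standard_grading K n q s h z) (torus_algebra K n q N) (line K)"
    unfolding graded_iso_def standard_torus_def standard_grading_def torus_algebra_def
  proof (rule exI[of _ tensor_iso], rule exI[of _ "\<lambda>x. x"], intro conjI ballI)
    fix \<gamma> assume "\<gamma> \<in> carrier (Zn n)"
    then show "tensor_iso ` tensor_subspace K (factor_index n s) (factor_algebra K n q s h z)
        (\<lambda>i. line K (degree_block n s \<gamma> i)) = line K \<gamma>"
      using tensor_iso_subspace(1) C.line_mon[of \<gamma>] by simp
  qed (rule tensor_iso_ring_iso, rule tensor_iso_smult, assumption+, rule id)
  show "graded_iso K (Zn n) (torus_algebra K n q N) (line K) (standard_torus K n q s h z) (standard_grading K n q s h z)"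
    by (rule graded_iso_sym_closed[OF 1 Zn_group])
      (unfold standard_torus_def standard_grading_def, (intro TP_closed tensor_iso_subspace(2); assumption)+)
qed

section \<open>Finite groups of roots of unity\<close>

text \<open>A root splits off a linear factor; in a domain the other roots are roots of the
  cofactor, whose degree is smaller by one.\<close>

lemma (in UP_domain) card_roots_le_deg:
  assumes "finite X" "f \<in> carrier P" "f \<noteq> \<zero>\<^bsub>P\<^esub>" "X \<subseteq> carrier R" "\<And>x. x \<in> X \<Longrightarrow> eval R R id x f = \<zero>"
  shows "card X \<le> deg R f"
  using assms
proof (induction X arbitrary: f)
  case (insert a X)
  let ?l = "UnivPoly.monom P \<one> 1 \<ominus>\<^bsub>P\<^esub> UnivPoly.monom P a 0"
  have a: "a \<in> carrier R" using insert.prems by simp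
  have nt: "carrier R \<noteq> {\<zero>}" using R.one_zeroI R.zero_not_one by metis
  obtain q where q: "q \<in> carrier P" and "f = ?l \<otimes>\<^bsub>P\<^esub> q \<oplus>\<^bsub>P\<^esub> UnivPoly.monom P (eval R R id a f) 0"
    using remainder_theorem[OF insert.prems(1) a nt] by blast
  then have f: "f = ?l \<otimes>\<^bsub>P\<^esub> q" using insert.prems(4)[of a] a by simp
  have q0: "q \<noteq> \<zero>\<^bsub>P\<^esub>" using f insert.prems(2) a by auto
  have dl: "deg R ?l = 1" using a by (simp add: deg_minus_eq)
  then have l0: "?l \<noteq> \<zero>\<^bsub>P\<^esub>" by (metis deg_zero zero_neq_one)
  have "deg R f = 1 + deg R q" unfolding f using deg_mult[OF l0 q0 _ q] a dl by simp
  moreover have "card X \<le> deg R q"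
  proof (rule insert.IH[OF q q0])
    fix x assume x: "x \<in> X"
    then have xc: "x \<in> carrier R" "x \<noteq> a" using insert.prems insert.hyps by auto
    have "eval R R id x f = (x \<ominus> a) \<otimes> eval R R id x q"
      unfolding f using xc a q by (simp add: evalRR_simps)
    then have "(x \<ominus> a) \<otimes> eval R R id x q = \<zero>" using insert.prems(4)[of x] x by simp
    moreover have "x \<ominus> a \<noteq> \<zero>" using xc a by simp
    ultimately show "eval R R id x q = \<zero>"
      using R.integral_iff[of "x \<ominus> a" "eval R R id x q"] xc a q evalRR_simps by auto
  qed (use insert.prems in simp)
  ultimately show ?case using insert.hyps by simp
qed simp

lemma (in domain) card_roots_of_unity:
  assumes d: "0 < d"
  shows "finite {x \<in> carrier R. x [^] (d::nat) = \<one>}" "card {x \<in> carrier R. x [^] d = \<one>} \<le> d"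
proof -
  interpret U: UP_domain R "UP R" by unfold_locales simp
  let ?f = "UnivPoly.monom (UP R) \<one> d \<ominus>\<^bsub>UP R\<^esub> UnivPoly.monom (UP R) \<one> 0"
  have dg: "deg R ?f = d" using d by (simp add: U.deg_minus_eq)
  then have nz: "?f \<noteq> \<zero>\<^bsub>UP R\<^esub>" using d U.deg_zero by (metis less_irrefl)
  have e: "eval R R id x ?f = \<zero>" if "x \<in> carrier R" "x [^] d = \<one>" for x
    using that by (simp add: U.evalRR_simps)
  have b: "card X \<le> d" if "finite X" "X \<subseteq> {x \<in> carrier R. x [^] d = \<one>}" for X
    using U.card_roots_le_deg[OF that(1) _ nz _ e] that(2) unfolding dg by (simp add: subset_iff)
  show f: "finite {x \<in> carrier R. x [^] (d::nat) = \<one>}"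
  proof (rule ccontr)
    assume "infinite {x \<in> carrier R. x [^] d = \<one>}"
    then obtain X where "X \<subseteq> {x \<in> carrier R. x [^] d = \<one>}" "finite X" "card X = Suc d"
      using infinite_arbitrarily_large by blast
    then show False using b[of X] by simp
  qed
  show "card {x \<in> carrier R. x [^] d = \<one>} \<le> d" by (rule b[OF f order_refl])
qed

lemma (in comm_group) ord_mult_coprime:
  assumes x: "x \<in> carrier G" and y: "y \<in> carrier G" and c: "coprime (ord x) (ord y)"
  shows "ord (x \<otimes> y) = ord x * ord y"
proof (rule dvd_antisym)
  show "ord (x \<otimes> y) dvd ord x * ord y" by (rule abelian_ord_mul_divides[OF x y])
  have *: "ord u dvd ord (u \<otimes> v)" if "u \<in> carrier G" "v \<in> carrier G" "coprime (ord u) (ord v)" for u v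
  proof -
    let ?t = "ord (u \<otimes> v) * ord v"
    have "\<one> = (u \<otimes> v) [^] ?t" using that pow_eq_id[of "u \<otimes> v" ?t] by simp
    also have "\<dots> = u [^] ?t \<otimes> v [^] ?t" using that by (simp add: pow_mult_distrib m_comm)
    also have "v [^] ?t = \<one>" using that by (simp add: pow_eq_id)
    finally have "ord u dvd ?t" using that pow_eq_id[of u ?t] by simp
    then show ?thesis using that(3) by (simp add: coprime_dvd_mult_left_iff)
  qed
  show "ord x * ord y dvd ord (x \<otimes> y)"
    using *[OF x y c] *[OF y x] c by (simp add: m_comm[OF y x] coprime_commute divides_mult)
qed

text \<open>If \<open>p ^ l\<close> in \<open>ord x\<close> exceeded \<open>p ^ k\<close> in
  \<open>ord a\<close>, then \<open>a'\<close>, without the \<open>p\<close>-part, and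
  \<open>x'\<close>, of order \<open>p ^ l\<close>, would have coprime orders, and their product
  would have order greater than the maximum \<open>ord a\<close>.\<close>

lemma (in comm_group) ord_dvd_max_ord:
  assumes H: "subgroup H G" "finite H" and a: "a \<in> H" "\<And>y. y \<in> H \<Longrightarrow> ord y \<le> ord a" and x: "x \<in> H"
    and pos: "\<And>y. y \<in> H \<Longrightarrow> 0 < ord y"
  shows "ord x dvd ord a"
proof (rule ccontr)
  assume "\<not> ord x dvd ord a"
  then have "\<exists>p. prime p \<and> multiplicity p (ord a) < multiplicity p (ord x)"
    using multiplicity_le_imp_dvd[of "ord x" "ord a"] pos[OF x] by (auto simp: not_less[symmetric])
  then obtain p where p: "prime p" "multiplicity p (ord a) < multiplicity p (ord x)" by blast
  define k where "k = multiplicity p (ord a)"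
  define l where "l = multiplicity p (ord x)"
  have ac: "a \<in> carrier G" and xc: "x \<in> carrier G" using a x H subgroup.subset by auto
  define a' where "a' = a [^] (p ^ k)"
  define x' where "x' = x [^] (ord x div p ^ l)"
  have dk: "p ^ k dvd ord a" by (simp add: k_def multiplicity_dvd)
  have dl: "p ^ l dvd ord x" by (simp add: l_def multiplicity_dvd)
  have p0: "0 < p" using p prime_gt_0_nat by blast
  have oa: "ord a' = ord a div p ^ k" unfolding a'_def using dk ac p0 by (intro ord_pow) auto
  have d0: "ord x div p ^ l \<noteq> 0" using dl pos[OF x] by (metis dvd_div_eq_0_iff neq0_conv)
  have ox: "ord x' = p ^ l"
  proof -
    have "ord x' = ord x div (ord x div p ^ l)"
      unfolding x'_def by (rule ord_pow[OF xc _ d0]) (metis dl dvd_div_mult_self dvd_triv_left)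
    then show ?thesis using dl d0 by (metis dvd_div_mult_self nonzero_mult_div_cancel_left)
  qed
  have "\<not> p dvd ord a div p ^ k"
    unfolding k_def by (rule multiplicity_decompose) (use pos[OF a(1)] p in auto)
  then have "coprime (ord a') (ord x')"
    unfolding oa ox using p by (simp add: coprime_commute prime_imp_coprime coprime_power_left_iff)
  moreover have c: "a' \<in> carrier G" "x' \<in> carrier G" using ac xc by (auto simp: a'_def x'_def)
  ultimately have o: "ord (a' \<otimes> x') = (ord a div p ^ k) * p ^ l" using ord_mult_coprime oa ox by simp
  have "a' \<otimes> x' \<in> H"
    using subgroup.m_closed[OF H(1)] subgroup_int_pow_closed[OF H(1) a(1), of "int (p ^ k)"]
      subgroup_int_pow_closed[OF H(1) x, of "int (ord x div p ^ l)"] by (simp add: a'_def x'_def int_pow_int del: of_nat_power)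
  from a(2)[OF this] have "(ord a div p ^ k) * p ^ l \<le> ord a" by (simp add: o)
  moreover have "ord a = (ord a div p ^ k) * p ^ k" using dk by simp
  moreover have "p ^ k < p ^ l" using p prime_gt_1_nat by (simp add: k_def l_def)
  moreover have "0 < ord a div p ^ k" using pos[OF a(1)] dk by (simp add: dvd_imp_le p0 div_greater_zero_iff)
  ultimately show False by (metis mult_less_cancel1 not_less)
qed

text \<open>For \<open>c\<close> of maximal order every element of \<open>H\<close> is a root of the
  polynomial \<open>X ^ ord c - 1\<close>. So \<open>H\<close> has at most \<open>ord c\<close>
  elements, which is the number of powers of \<open>c\<close>.\<close>

lemma (in field) finite_subgroup_units_cyclic:
  assumes H: "subgroup H (units_of R)" "finite H"
  obtains c where "c \<in> H" "H = generate (units_of R) {c}"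
proof -
  interpret U: comm_group "units_of R" by (rule units_comm_group)
  have Hc: "x \<in> carrier (units_of R)" if "x \<in> H" for x using H(1) subgroup.subset that by blast
  have sub: "generate (units_of R) {x} \<subseteq> H" if "x \<in> H" for x
    using U.generate_subgroup_incl[OF _ H(1)] that by simp
  have pos: "0 < U.ord x" if "x \<in> H" for x
  proof -
    have "finite (generate (units_of R) {x})" using sub[OF that] H(2) finite_subset by blast
    moreover have "x \<in> generate (units_of R) {x}" by (simp add: generate.incl)
    ultimately have "card (generate (units_of R) {x}) \<noteq> 0" by auto
    then show ?thesis using U.generate_pow_card[OF Hc[OF that]] by simp
  qed
  have ne: "H \<noteq> {}" using H(1) subgroup.one_closed by blast
  obtain c where c: "c \<in> H" "\<And>y. y \<in> H \<Longrightarrow> U.ord y \<le> U.ord c"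
  proof -
    have "Max (U.ord ` H) \<in> U.ord ` H" using H(2) ne by simp
    then obtain c where "c \<in> H" "U.ord c = Max (U.ord ` H)" by auto
    with H(2) show thesis by (intro that[of c]) auto
  qed
  have "H \<subseteq> {x \<in> carrier R. x [^] U.ord c = \<one>}"
  proof
    fix x assume x: "x \<in> H"
    have "x [^]\<^bsub>units_of R\<^esub> U.ord c = \<one>\<^bsub>units_of R\<^esub>"
      using U.pow_eq_id[OF Hc[OF x]] U.ord_dvd_max_ord[OF H c x pos] by simp
    then show "x \<in> {x \<in> carrier R. x [^] U.ord c = \<one>}"
      using Hc[OF x] units_of_pow[of x] by (simp add: units_of_carrier units_of_one Units_closed)
  qed
  then have "card H \<le> U.ord c"
    using card_roots_of_unity[OF pos[OF c(1)]] card_mono order_trans by meson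
  also have "U.ord c = card (generate (units_of R) {c})" by (rule U.generate_pow_card[OF Hc[OF c(1)]])
  finally have "H = generate (units_of R) {c}" using card_seteq[OF H(2) sub[OF c(1)]] by simp
  with c(1) show thesis by (rule that)
qed

text \<open>Finiteness of \<open>S\<close> gives a common exponent, the product of the individual
  ones, so the generated group consists of roots of one polynomial and is finite. That
  \<open>c\<close> lies in this group is recorded, since the generator must belong to the commutator
  group.\<close>

lemma (in field) torsion_cyclic:
  assumes S: "finite S" "S \<subseteq> Units R" "\<And>x. x \<in> S \<Longrightarrow> \<exists>N::nat. 0 < N \<and> x [^] N = \<one>"
  obtains c where "c \<in> generate (units_of R) S" "S \<subseteq> generate (units_of R) {c}"
proof -
  interpret U: comm_group "units_of R" by (rule units_comm_group)
  obtain N where N: "\<And>x. x \<in> S \<Longrightarrow> 0 < (N x::nat) \<and> x [^] N x = \<one>" using S(3) by metis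
  define m where "m = prod N S"
  have m: "0 < m" using N by (simp add: m_def prod_pos)
  have "x [^] m = \<one>" if x: "x \<in> S" for x
  proof -
    have "N x dvd m" using x S(1) by (simp add: m_def dvd_prodI)
    then obtain r where "m = N x * r" by blast
    moreover have "x \<in> carrier R" using S(2) x by auto
    ultimately show ?thesis using N[OF x] nat_pow_pow[of x "N x" r] by simp
  qed
  then have sub: "S \<subseteq> {x \<in> Units R. x [^] m = \<one>}" using S(2) by auto
  have "subgroup {x \<in> Units R. x [^] m = \<one>} (units_of R)"
  proof
    show "{x \<in> Units R. x [^] m = \<one>} \<subseteq> carrier (units_of R)" by (auto simp: units_of_carrier)
    show "\<one>\<^bsub>units_of R\<^esub> \<in> {x \<in> Units R. x [^] m = \<one>}" by (simp add: units_of_one)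
    fix x assume x: "x \<in> {x \<in> Units R. x [^] m = \<one>}"
    then have "inv\<^bsub>units_of R\<^esub> x [^]\<^bsub>units_of R\<^esub> m = \<one>\<^bsub>units_of R\<^esub>"
      using U.nat_pow_inv[of x m] units_of_pow[of x m] U.inv_one by (simp add: units_of_carrier units_of_one)
    then show "inv\<^bsub>units_of R\<^esub> x \<in> {x \<in> Units R. x [^] m = \<one>}"
      using x units_of_inv[of x] units_of_pow[of "inv x" m] by (simp add: units_of_one)
    fix y assume "y \<in> {x \<in> Units R. x [^] m = \<one>}"
    with x show "x \<otimes>\<^bsub>units_of R\<^esub> y \<in> {x \<in> Units R. x [^] m = \<one>}"
      by (simp add: units_of_mult nat_pow_distrib Units_closed)
  qed
  from U.generate_subgroup_incl[OF sub this]
  have "generate (units_of R) S \<subseteq> {x \<in> carrier R. x [^] m = \<one>}" by auto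
  then have fin: "finite (generate (units_of R) S)" using card_roots_of_unity(1)[OF m] finite_subset by blast
  have "subgroup (generate (units_of R) S) (units_of R)"
    using S(2) by (intro U.generate_is_subgroup) (simp add: units_of_carrier)
  from finite_subgroup_units_cyclic[OF this fin] obtain c
    where c: "c \<in> generate (units_of R) S" "generate (units_of R) S = generate (units_of R) {c}" .
  show thesis by (rule that[OF c(1)]) (use c(2) generate.incl[of _ S "units_of R"] in auto)
qed

section \<open>The commutator group\<close>

context qt
begin

abbreviation KU where "KU \<equiv> units_of K"

lemma Units_K [simp]: "k \<in> Units K \<Longrightarrow> k \<in> carrier K" "k \<in> Units K \<Longrightarrow> inv\<^bsub>K\<^esub> k \<in> carrier K"
  by auto

definition lam :: "'g \<Rightarrow> 'g \<Rightarrow> 'k" where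
  "lam \<gamma> \<gamma>' = (SOME k. k \<in> Units K \<and> (\<forall>x\<in>Gr \<gamma>. \<forall>y\<in>Gr \<gamma>'. x \<otimes>\<^bsub>A\<^esub> y = k \<odot>\<^bsub>A\<^esub> (y \<otimes>\<^bsub>A\<^esub> x)))"

lemma lam:
  assumes "\<gamma> \<in> carrier \<Gamma>" "\<gamma>' \<in> carrier \<Gamma>"
  shows "lam \<gamma> \<gamma>' \<in> Units K"
    and "x \<in> Gr \<gamma> \<Longrightarrow> y \<in> Gr \<gamma>' \<Longrightarrow> x \<otimes>\<^bsub>A\<^esub> y = lam \<gamma> \<gamma>' \<odot>\<^bsub>A\<^esub> (y \<otimes>\<^bsub>A\<^esub> x)"
proof -
  obtain k where k: "k \<in> Units K" "\<And>x y. x \<in> Gr \<gamma> \<Longrightarrow> y \<in> Gr \<gamma>' \<Longrightarrow> x \<otimes>\<^bsub>A\<^esub> y = k \<odot>\<^bsub>A\<^esub> (y \<otimes>\<^bsub>A\<^esub> x)"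
    by (rule commutation_factor[OF assms]) (rule that)
  have "lam \<gamma> \<gamma>' \<in> Units K \<and> (\<forall>x\<in>Gr \<gamma>. \<forall>y\<in>Gr \<gamma>'. x \<otimes>\<^bsub>A\<^esub> y = lam \<gamma> \<gamma>' \<odot>\<^bsub>A\<^esub> (y \<otimes>\<^bsub>A\<^esub> x))"
    unfolding lam_def by (rule someI[of _ k]) (use k in blast)
  then show "lam \<gamma> \<gamma>' \<in> Units K" "x \<in> Gr \<gamma> \<Longrightarrow> y \<in> Gr \<gamma>' \<Longrightarrow> x \<otimes>\<^bsub>A\<^esub> y = lam \<gamma> \<gamma>' \<odot>\<^bsub>A\<^esub> (y \<otimes>\<^bsub>A\<^esub> x)"
    by blast+
qed

lemma lam_eqI:
  assumes "\<gamma> \<in> carrier \<Gamma>" "\<gamma>' \<in> carrier \<Gamma>" "x \<in> Gr \<gamma>" "y \<in> Gr \<gamma>'" "x \<noteq> \<zero>\<^bsub>A\<^esub>" "y \<noteq> \<zero>\<^bsub>A\<^esub>"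
    and "k \<in> carrier K" "x \<otimes>\<^bsub>A\<^esub> y = k \<odot>\<^bsub>A\<^esub> (y \<otimes>\<^bsub>A\<^esub> x)"
  shows "lam \<gamma> \<gamma>' = k"
proof (rule unit_smult_cancel)
  show "y \<otimes>\<^bsub>A\<^esub> x \<noteq> \<zero>\<^bsub>A\<^esub>" using Gr_mult_nonzero assms by blast
  show "y \<otimes>\<^bsub>A\<^esub> x \<in> carrier A" using assms Gr_sub by blast
  show "lam \<gamma> \<gamma>' \<odot>\<^bsub>A\<^esub> (y \<otimes>\<^bsub>A\<^esub> x) = k \<odot>\<^bsub>A\<^esub> (y \<otimes>\<^bsub>A\<^esub> x)" using lam(2)[OF assms(1-4)] assms(8) by simp
  show "lam \<gamma> \<gamma>' \<in> carrier K" using lam(1)[OF assms(1,2)] by simp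
qed (rule assms)

lemma swap_smult:
  assumes "k \<in> Units K" "x \<in> carrier A" "y \<in> carrier A" "x \<otimes>\<^bsub>A\<^esub> y = k \<odot>\<^bsub>A\<^esub> (y \<otimes>\<^bsub>A\<^esub> x)"
  shows "y \<otimes>\<^bsub>A\<^esub> x = inv\<^bsub>K\<^esub> k \<odot>\<^bsub>A\<^esub> (x \<otimes>\<^bsub>A\<^esub> y)"
  using assms by (simp add: AL.smult_assoc1[symmetric] F.Units_l_inv F.Units_inv_closed)

lemma lam_swap:
  assumes "\<gamma> \<in> carrier \<Gamma>" "\<gamma>' \<in> carrier \<Gamma>"
  shows "lam \<gamma>' \<gamma> = inv\<^bsub>K\<^esub> (lam \<gamma> \<gamma>')"
proof -
  obtain x where x: "x \<in> Gr \<gamma>" "x \<noteq> \<zero>\<^bsub>A\<^esub>" using Gr_nonzero assms by blast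
  obtain y where y: "y \<in> Gr \<gamma>'" "y \<noteq> \<zero>\<^bsub>A\<^esub>" using Gr_nonzero assms by blast
  show ?thesis
    by (rule lam_eqI[OF assms(2,1) y(1) x(1) y(2) x(2)])
      (use lam(1)[OF assms] swap_smult[OF _ _ _ lam(2)[OF assms x(1) y(1)]] Gr_sub assms x y in \<open>auto simp: F.Units_inv_closed\<close>)
qed

lemma lam_self:
  assumes "\<gamma> \<in> carrier \<Gamma>"
  shows "lam \<gamma> \<gamma> = \<one>\<^bsub>K\<^esub>"
proof -
  obtain x where x: "x \<in> Gr \<gamma>" "x \<noteq> \<zero>\<^bsub>A\<^esub>" using Gr_nonzero assms by blast
  show ?thesis by (rule lam_eqI[OF assms assms x(1) x(1) x(2) x(2)]) (use x assms Gr_sub in auto)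
qed

text \<open>Together with \<open>lam_swap\<close> and \<open>lam_self\<close> this makes
  \<open>lam\<close> an alternating bicharacter.\<close>

lemma lam_hom:
  assumes d: "\<delta> \<in> carrier \<Gamma>"
  shows "(\<lambda>\<gamma>. lam \<gamma> \<delta>) \<in> hom \<Gamma> KU"
proof (rule homI)
  fix \<gamma> assume "\<gamma> \<in> carrier \<Gamma>"
  then show "lam \<gamma> \<delta> \<in> carrier KU" using lam(1) d by (simp add: units_of_carrier)
next
  fix \<gamma> \<gamma>' assume g: "\<gamma> \<in> carrier \<Gamma>" "\<gamma>' \<in> carrier \<Gamma>"
  obtain x where x: "x \<in> Gr \<gamma>" "x \<noteq> \<zero>\<^bsub>A\<^esub>" using Gr_nonzero g by blast
  obtain y where y: "y \<in> Gr \<gamma>'" "y \<noteq> \<zero>\<^bsub>A\<^esub>" using Gr_nonzero g by blast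
  obtain z where z: "z \<in> Gr \<delta>" "z \<noteq> \<zero>\<^bsub>A\<^esub>" using Gr_nonzero d by blast
  have c: "x \<in> carrier A" "y \<in> carrier A" "z \<in> carrier A" using x y z g d Gr_sub by auto
  have l: "lam \<gamma> \<delta> \<in> carrier K" "lam \<gamma>' \<delta> \<in> carrier K" using lam(1) g d by auto
  have "(x \<otimes>\<^bsub>A\<^esub> y) \<otimes>\<^bsub>A\<^esub> z = x \<otimes>\<^bsub>A\<^esub> (lam \<gamma>' \<delta> \<odot>\<^bsub>A\<^esub> (z \<otimes>\<^bsub>A\<^esub> y))"
    using c lam(2)[OF g(2) d y(1) z(1)] by (simp add: R.m_assoc)
  also have "\<dots> = lam \<gamma>' \<delta> \<odot>\<^bsub>A\<^esub> ((x \<otimes>\<^bsub>A\<^esub> z) \<otimes>\<^bsub>A\<^esub> y)"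
    using c l by (simp add: AL.smult_mult_right R.m_assoc)
  also have "\<dots> = (lam \<gamma> \<delta> \<otimes>\<^bsub>K\<^esub> lam \<gamma>' \<delta>) \<odot>\<^bsub>A\<^esub> (z \<otimes>\<^bsub>A\<^esub> (x \<otimes>\<^bsub>A\<^esub> y))"
    using c l lam(2)[OF g(1) d x(1) z(1)]
    by (simp add: AL.smult_mult_left R.m_assoc AL.smult_assoc1[symmetric] F.m_comm)
  finally have "lam (\<gamma> \<otimes>\<^bsub>\<Gamma>\<^esub> \<gamma>') \<delta> = lam \<gamma> \<delta> \<otimes>\<^bsub>K\<^esub> lam \<gamma>' \<delta>"
    by (intro lam_eqI[OF _ d Gr_mult[OF g x(1) y(1)] z(1) Gr_mult_nonzero[OF g x(1) y(1) x(2) y(2)] z(2)]) (use g l in auto)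
  then show "lam (\<gamma> \<otimes>\<^bsub>\<Gamma>\<^esub> \<gamma>') \<delta> = lam \<gamma> \<delta> \<otimes>\<^bsub>KU\<^esub> lam \<gamma>' \<delta>" by (simp add: units_of_mult)
qed

definition lams :: "'k set" where
  "lams = {lam \<gamma> \<gamma>' | \<gamma> \<gamma>'. \<gamma> \<in> carrier \<Gamma> \<and> \<gamma>' \<in> carrier \<Gamma>}"

lemma lamsI [intro]: "\<gamma> \<in> carrier \<Gamma> \<Longrightarrow> \<gamma>' \<in> carrier \<Gamma> \<Longrightarrow> lam \<gamma> \<gamma>' \<in> lams"
  unfolding lams_def by blast

lemma lams_Units: "lams \<subseteq> Units K"
  using lam(1) by (auto simp: lams_def)

lemma decompose:
  assumes "a \<in> carrier A"
  obtains S c where "finite S" "S \<subseteq> carrier \<Gamma>" "\<And>\<gamma>. \<gamma> \<in> S \<Longrightarrow> c \<gamma> \<in> Gr \<gamma> \<and> c \<gamma> \<noteq> \<zero>\<^bsub>A\<^esub>"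
    "a = (\<Oplus>\<^bsub>A\<^esub>\<gamma>\<in>S. c \<gamma>)"
proof -
  from Q.direct_sum[OF assms] obtain c where c: "\<forall>\<gamma>\<in>carrier \<Gamma>. c \<gamma> \<in> Gr \<gamma>" "\<forall>\<gamma>. \<gamma> \<notin> carrier \<Gamma> \<longrightarrow> c \<gamma> = \<zero>\<^bsub>A\<^esub>"
     "finite {\<gamma>. c \<gamma> \<noteq> \<zero>\<^bsub>A\<^esub>}" "a = (\<Oplus>\<^bsub>A\<^esub>\<gamma>\<in>{\<gamma>. c \<gamma> \<noteq> \<zero>\<^bsub>A\<^esub>}. c \<gamma>)"
    by (elim ex1E conjE) (rule that)
  show thesis by (rule that[OF c(3) _ _ c(4)]) (use c(1,2) in auto)
qed

lemma components_unique:
  assumes S: "finite S" "S \<subseteq> carrier \<Gamma>"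
    and d: "\<And>\<gamma>. \<gamma> \<in> S \<Longrightarrow> d \<gamma> \<in> Gr \<gamma>" and e: "\<And>\<gamma>. \<gamma> \<in> S \<Longrightarrow> e \<gamma> \<in> Gr \<gamma>"
    and eq: "(\<Oplus>\<^bsub>A\<^esub>\<gamma>\<in>S. d \<gamma>) = (\<Oplus>\<^bsub>A\<^esub>\<gamma>\<in>S. e \<gamma>)" and g: "\<gamma> \<in> S"
  shows "d \<gamma> = e \<gamma>"
proof -
  define ext0 where "ext0 d \<gamma> = (if \<gamma> \<in> S then d \<gamma> else \<zero>\<^bsub>A\<^esub>)" for d :: "'g \<Rightarrow> 'a" and \<gamma>
  define dec where "dec a c \<longleftrightarrow> (\<forall>\<gamma>\<in>carrier \<Gamma>. c \<gamma> \<in> Gr \<gamma>) \<and> (\<forall>\<gamma>. \<gamma> \<notin> carrier \<Gamma> \<longrightarrow> c \<gamma> = \<zero>\<^bsub>A\<^esub>) \<and>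
           finite {\<gamma>. c \<gamma> \<noteq> \<zero>\<^bsub>A\<^esub>} \<and> a = (\<Oplus>\<^bsub>A\<^esub>\<gamma>\<in>{\<gamma>. c \<gamma> \<noteq> \<zero>\<^bsub>A\<^esub>}. c \<gamma>)" for a c
  have dec: "dec (\<Oplus>\<^bsub>A\<^esub>\<gamma>\<in>S. d \<gamma>) (ext0 d)" if d: "\<And>\<gamma>. \<gamma> \<in> S \<Longrightarrow> d \<gamma> \<in> Gr \<gamma>" for d
    unfolding dec_def
  proof (intro conjI ballI allI impI)
    fix \<gamma> assume h: "\<gamma> \<in> carrier \<Gamma>"
    obtain v where v: "v \<in> Gr \<gamma>" using Gr_nonzero[OF h] by blast
    have "\<zero>\<^bsub>K\<^esub> \<odot>\<^bsub>A\<^esub> v = \<zero>\<^bsub>A\<^esub>" using Gr_sub[OF h v] by simp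
    then have "\<zero>\<^bsub>A\<^esub> \<in> Gr \<gamma>" using Gr_smult[OF h v] by (metis F.zero_closed)
    then show "ext0 d \<gamma> \<in> Gr \<gamma>" using d by (simp add: ext0_def)
  next
    show "ext0 d \<gamma> = \<zero>\<^bsub>A\<^esub>" if "\<gamma> \<notin> carrier \<Gamma>" for \<gamma> using that S by (auto simp: ext0_def)
    have sub: "{\<gamma>. ext0 d \<gamma> \<noteq> \<zero>\<^bsub>A\<^esub>} \<subseteq> S" by (auto simp: ext0_def)
    then show "finite {\<gamma>. ext0 d \<gamma> \<noteq> \<zero>\<^bsub>A\<^esub>}" using S finite_subset by blast
    show "(\<Oplus>\<^bsub>A\<^esub>\<gamma>\<in>S. d \<gamma>) = (\<Oplus>\<^bsub>A\<^esub>\<gamma>\<in>{\<gamma>. ext0 d \<gamma> \<noteq> \<zero>\<^bsub>A\<^esub>}. ext0 d \<gamma>)"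
      by (rule R.add.finprod_mono_neutral_cong_right[OF S(1) sub])
        (use d S Gr_sub in \<open>auto simp: ext0_def\<close>)
  qed
  have cl: "(\<Oplus>\<^bsub>A\<^esub>\<gamma>\<in>S. d \<gamma>) \<in> carrier A"
    by (rule R.finsum_closed) (use d S Gr_sub in auto)
  have "\<exists>!c. dec (\<Oplus>\<^bsub>A\<^esub>\<gamma>\<in>S. d \<gamma>) c" unfolding dec_def by (rule Q.direct_sum[OF cl])
  moreover have "dec (\<Oplus>\<^bsub>A\<^esub>\<gamma>\<in>S. d \<gamma>) (ext0 e)" unfolding eq by (rule dec[OF e])
  ultimately have "ext0 d = ext0 e" using dec[OF d] by blast
  then show ?thesis using g by (auto simp: ext0_def dest: fun_cong[of _ _ \<gamma>])
qed

text \<open>Conjugation by \<open>w\<close> respects the grading, so the scalar is read off in each component.\<close>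

lemma component_commutation:
  assumes S: "finite S" "S \<subseteq> carrier \<Gamma>" and c: "\<And>\<gamma>. \<gamma> \<in> S \<Longrightarrow> c \<gamma> \<in> Gr \<gamma>"
    and w: "w \<in> Units A" "\<And>\<gamma> x. \<gamma> \<in> carrier \<Gamma> \<Longrightarrow> x \<in> Gr \<gamma> \<Longrightarrow> w \<otimes>\<^bsub>A\<^esub> x \<otimes>\<^bsub>A\<^esub> inv\<^bsub>A\<^esub> w \<in> Gr \<gamma>"
    and k: "k \<in> carrier K" and u: "w \<otimes>\<^bsub>A\<^esub> (\<Oplus>\<^bsub>A\<^esub>\<gamma>\<in>S. c \<gamma>) = k \<odot>\<^bsub>A\<^esub> ((\<Oplus>\<^bsub>A\<^esub>\<gamma>\<in>S. c \<gamma>) \<otimes>\<^bsub>A\<^esub> w)"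
    and g: "\<gamma> \<in> S"
  shows "w \<otimes>\<^bsub>A\<^esub> c \<gamma> = k \<odot>\<^bsub>A\<^esub> (c \<gamma> \<otimes>\<^bsub>A\<^esub> w)"
proof -
  have wc: "w \<in> carrier A" "inv\<^bsub>A\<^esub> w \<in> carrier A" using w(1) by (auto simp: R.Units_closed R.Units_inv_closed)
  have cc: "c \<gamma> \<in> carrier A" if "\<gamma> \<in> S" for \<gamma> using that c S Gr_sub by blast
  let ?u = "\<Oplus>\<^bsub>A\<^esub>\<gamma>\<in>S. c \<gamma>"
  have uc: "?u \<in> carrier A" by (rule R.finsum_closed) (use cc in auto)
  have "(\<Oplus>\<^bsub>A\<^esub>\<gamma>\<in>S. w \<otimes>\<^bsub>A\<^esub> c \<gamma> \<otimes>\<^bsub>A\<^esub> inv\<^bsub>A\<^esub> w) = (\<Oplus>\<^bsub>A\<^esub>\<gamma>\<in>S. w \<otimes>\<^bsub>A\<^esub> c \<gamma>) \<otimes>\<^bsub>A\<^esub> inv\<^bsub>A\<^esub> w"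
    by (rule R.finsum_ldistr[symmetric]) (use cc wc S in auto)
  also have "(\<Oplus>\<^bsub>A\<^esub>\<gamma>\<in>S. w \<otimes>\<^bsub>A\<^esub> c \<gamma>) = w \<otimes>\<^bsub>A\<^esub> ?u"
    by (rule R.finsum_rdistr[symmetric]) (use cc wc S in auto)
  also have "(w \<otimes>\<^bsub>A\<^esub> ?u) \<otimes>\<^bsub>A\<^esub> inv\<^bsub>A\<^esub> w = k \<odot>\<^bsub>A\<^esub> ?u"
    unfolding u using uc wc w(1) k by (simp add: AL.smult_mult_left R.m_assoc R.Units_r_inv)
  also have "\<dots> = (\<Oplus>\<^bsub>A\<^esub>\<gamma>\<in>S. k \<odot>\<^bsub>A\<^esub> c \<gamma>)"
    by (rule AL.finsum_smult_ldistr) (use cc S k in auto)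
  finally have "w \<otimes>\<^bsub>A\<^esub> c \<gamma> \<otimes>\<^bsub>A\<^esub> inv\<^bsub>A\<^esub> w = k \<odot>\<^bsub>A\<^esub> c \<gamma>"
    using components_unique[OF S, of "\<lambda>\<gamma>. w \<otimes>\<^bsub>A\<^esub> c \<gamma> \<otimes>\<^bsub>A\<^esub> inv\<^bsub>A\<^esub> w" "\<lambda>\<gamma>. k \<odot>\<^bsub>A\<^esub> c \<gamma>" \<gamma>]
      w(2) Gr_smult c S k g by blast
  then have "w \<otimes>\<^bsub>A\<^esub> c \<gamma> \<otimes>\<^bsub>A\<^esub> inv\<^bsub>A\<^esub> w \<otimes>\<^bsub>A\<^esub> w = k \<odot>\<^bsub>A\<^esub> (c \<gamma> \<otimes>\<^bsub>A\<^esub> w)"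
    using AL.smult_mult_left k cc[OF g] wc by simp
  then show ?thesis using cc[OF g] wc w(1) by (simp add: R.m_assoc R.Units_l_inv)
qed

lemma normalises_if_commutes:
  assumes g: "\<gamma> \<in> carrier \<Gamma>" and w: "w \<in> Units A" and v: "v \<in> Gr \<gamma>" "v \<noteq> \<zero>\<^bsub>A\<^esub>"
    and k: "k \<in> carrier K" "w \<otimes>\<^bsub>A\<^esub> v = k \<odot>\<^bsub>A\<^esub> (v \<otimes>\<^bsub>A\<^esub> w)" and x: "x \<in> Gr \<gamma>"
  shows "w \<otimes>\<^bsub>A\<^esub> x \<otimes>\<^bsub>A\<^esub> inv\<^bsub>A\<^esub> w \<in> Gr \<gamma>"
proof -
  have wc: "w \<in> carrier A" "inv\<^bsub>A\<^esub> w \<in> carrier A" using w by (auto simp: R.Units_closed R.Units_inv_closed)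
  have vc: "v \<in> carrier A" using Gr_sub g v by blast
  obtain b where b: "b \<in> carrier K" "x = b \<odot>\<^bsub>A\<^esub> v" using Gr_span[OF g v x] .
  have "w \<otimes>\<^bsub>A\<^esub> x \<otimes>\<^bsub>A\<^esub> inv\<^bsub>A\<^esub> w = b \<odot>\<^bsub>A\<^esub> (k \<odot>\<^bsub>A\<^esub> v)"
    unfolding b(2) using b(1) k wc vc w
    by (simp add: AL.smult_mult_right AL.smult_mult_left R.m_assoc R.Units_r_inv)
  then show ?thesis using Gr_smult[OF g] v k b by simp
qed

text \<open>A scalar commutator of two arbitrary units is also one of homogeneous elements: the
  scalar survives when first \<open>v\<close> and then \<open>u\<close> is replaced by one of its
  nonzero components.\<close>

lemma derived_set_lams:
  assumes comm: "\<And>u v. u \<in> Units A \<Longrightarrow> v \<in> Units A \<Longrightarrow> \<exists>k\<in>Units K. u \<otimes>\<^bsub>A\<^esub> v = k \<odot>\<^bsub>A\<^esub> (v \<otimes>\<^bsub>A\<^esub> u)"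
    and u: "u \<in> Units A" and v: "v \<in> Units A" and k: "k \<in> Units K" "u \<otimes>\<^bsub>A\<^esub> v = k \<odot>\<^bsub>A\<^esub> (v \<otimes>\<^bsub>A\<^esub> u)"
  shows "k \<in> lams"
proof -
  have uv: "u \<in> carrier A" "v \<in> carrier A" using u v by auto
  have norm: "w \<otimes>\<^bsub>A\<^esub> x \<otimes>\<^bsub>A\<^esub> inv\<^bsub>A\<^esub> w \<in> Gr \<gamma>" if w: "w \<in> Units A" and h: "\<gamma> \<in> carrier \<Gamma>" "x \<in> Gr \<gamma>" for w \<gamma> x
  proof -
    obtain y where y: "y \<in> Gr \<gamma>" "y \<noteq> \<zero>\<^bsub>A\<^esub>" using Gr_nonzero h by blast
    obtain l where l: "l \<in> Units K" "w \<otimes>\<^bsub>A\<^esub> y = l \<odot>\<^bsub>A\<^esub> (y \<otimes>\<^bsub>A\<^esub> w)" using comm[OF w Gr_unit[OF h(1) y]] by blast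
    show ?thesis using normalises_if_commutes[OF h(1) w y _ l(2) h(2)] l(1) by simp
  qed
  obtain S c where S: "finite S" "S \<subseteq> carrier \<Gamma>" "\<And>\<gamma>. \<gamma> \<in> S \<Longrightarrow> c \<gamma> \<in> Gr \<gamma> \<and> c \<gamma> \<noteq> \<zero>\<^bsub>A\<^esub>"
    "u = (\<Oplus>\<^bsub>A\<^esub>\<gamma>\<in>S. c \<gamma>)" using decompose[OF uv(1)] by metis
  obtain T e where T: "finite T" "T \<subseteq> carrier \<Gamma>" "\<And>\<gamma>. \<gamma> \<in> T \<Longrightarrow> e \<gamma> \<in> Gr \<gamma> \<and> e \<gamma> \<noteq> \<zero>\<^bsub>A\<^esub>"
    "v = (\<Oplus>\<^bsub>A\<^esub>\<gamma>\<in>T. e \<gamma>)" using decompose[OF uv(2)] by metis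
  have "S \<noteq> {}" using S(4) Units_nonzero[OF u] by auto
  then obtain \<gamma> where g: "\<gamma> \<in> S" by blast
  have "T \<noteq> {}" using T(4) Units_nonzero[OF v] by auto
  then obtain \<delta> where d: "\<delta> \<in> T" by blast
  have gd: "\<gamma> \<in> carrier \<Gamma>" "\<delta> \<in> carrier \<Gamma>" using g d S T by auto
  have ed: "e \<delta> \<in> carrier A" "e \<delta> \<in> Units A" using T(3)[OF d] gd Gr_unit by (auto intro: Gr_sub)
  have cg: "c \<gamma> \<in> carrier A" using S(3)[OF g] gd by (auto intro: Gr_sub)
  have kc: "k \<in> carrier K" "inv\<^bsub>K\<^esub> k \<in> Units K" "inv\<^bsub>K\<^esub> k \<in> carrier K" "inv\<^bsub>K\<^esub> (inv\<^bsub>K\<^esub> k) = k"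
    using k(1) by (auto simp: F.Units_inv_closed)
  have "u \<otimes>\<^bsub>A\<^esub> e \<delta> = k \<odot>\<^bsub>A\<^esub> (e \<delta> \<otimes>\<^bsub>A\<^esub> u)"
    by (rule component_commutation[OF T(1,2) _ u norm[OF u] kc(1) _ d]) (use T(3) k(2)[unfolded T(4)] in auto)
  \<comment> \<open>The roles are exchanged, which inverts the scalar, so that the component
    argument can be applied to \<open>u\<close> with the homogeneous unit \<open>e \<delta>\<close>
    as the conjugating element.\<close>
  note eu = swap_smult[OF k(1) uv(1) ed(1) this]
  have "e \<delta> \<otimes>\<^bsub>A\<^esub> c \<gamma> = inv\<^bsub>K\<^esub> k \<odot>\<^bsub>A\<^esub> (c \<gamma> \<otimes>\<^bsub>A\<^esub> e \<delta>)"
    by (rule component_commutation[OF S(1,2) _ ed(2) norm[OF ed(2)] kc(3) eu[unfolded S(4)] g]) (use S(3) in auto)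
  from swap_smult[OF kc(2) ed(1) cg this] have "c \<gamma> \<otimes>\<^bsub>A\<^esub> e \<delta> = k \<odot>\<^bsub>A\<^esub> (e \<delta> \<otimes>\<^bsub>A\<^esub> c \<gamma>)" unfolding kc(4) .
  then have "lam \<gamma> \<delta> = k"
    by (intro lam_eqI[OF gd, of "c \<gamma>" "e \<delta>"]) (use S(3)[OF g] T(3)[OF d] kc(1) in auto)
  then show ?thesis using gd by (auto simp: lams_def)
qed

lemma scalar_hom: "group_hom KU (units_of A) (\<lambda>k. k \<odot>\<^bsub>A\<^esub> \<one>\<^bsub>A\<^esub>)"
proof -
  have m: "(k \<otimes>\<^bsub>K\<^esub> l) \<odot>\<^bsub>A\<^esub> \<one>\<^bsub>A\<^esub> = (k \<odot>\<^bsub>A\<^esub> \<one>\<^bsub>A\<^esub>) \<otimes>\<^bsub>A\<^esub> (l \<odot>\<^bsub>A\<^esub> \<one>\<^bsub>A\<^esub>)" if "k \<in> carrier K" "l \<in> carrier K" for k l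
    using that by (simp add: AL.smult_mult_left AL.smult_assoc1)
  have u: "k \<odot>\<^bsub>A\<^esub> \<one>\<^bsub>A\<^esub> \<in> Units A" if k: "k \<in> Units K" for k
  proof -
    have "(k \<odot>\<^bsub>A\<^esub> \<one>\<^bsub>A\<^esub>) \<otimes>\<^bsub>A\<^esub> (inv\<^bsub>K\<^esub> k \<odot>\<^bsub>A\<^esub> \<one>\<^bsub>A\<^esub>) = \<one>\<^bsub>A\<^esub>" "(inv\<^bsub>K\<^esub> k \<odot>\<^bsub>A\<^esub> \<one>\<^bsub>A\<^esub>) \<otimes>\<^bsub>A\<^esub> (k \<odot>\<^bsub>A\<^esub> \<one>\<^bsub>A\<^esub>) = \<one>\<^bsub>A\<^esub>"
      using k by (simp_all add: m[symmetric] F.Units_r_inv F.Units_l_inv)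
    then show ?thesis using k by (auto simp: Units_def[of A] F.Units_inv_closed intro!: bexI[of _ "inv\<^bsub>K\<^esub> k \<odot>\<^bsub>A\<^esub> \<one>\<^bsub>A\<^esub>"])
  qed
  show ?thesis
    by (intro group_hom.intro group_hom_axioms.intro F.units_group R.units_group homI)
      (simp_all add: units_of_carrier units_of_mult u m)
qed

lemma rational_commutation:
  assumes "rational K A" "u \<in> Units A" "v \<in> Units A"
  shows "\<exists>k\<in>Units K. u \<otimes>\<^bsub>A\<^esub> v = k \<odot>\<^bsub>A\<^esub> (v \<otimes>\<^bsub>A\<^esub> u)"
proof -
  have uv: "u \<in> carrier A" "v \<in> carrier A" "inv\<^bsub>A\<^esub> u \<in> carrier A" "inv\<^bsub>A\<^esub> v \<in> carrier A"
    using assms by (auto simp: R.Units_inv_closed)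
  let ?c = "u \<otimes>\<^bsub>A\<^esub> v \<otimes>\<^bsub>A\<^esub> inv\<^bsub>A\<^esub> u \<otimes>\<^bsub>A\<^esub> inv\<^bsub>A\<^esub> v"
  have "?c \<in> derived_set (units_of A) (Units A)"
    using assms by (auto simp: units_of_mult R.units_of_inv)
  then have "?c \<in> commutator_group A" unfolding commutator_group_def derived_def by (rule generate.incl)
  then obtain k where k: "k \<in> Units K" "?c = k \<odot>\<^bsub>A\<^esub> \<one>\<^bsub>A\<^esub>" using assms(1) unfolding rational_def by blast
  have "u \<otimes>\<^bsub>A\<^esub> v = ?c \<otimes>\<^bsub>A\<^esub> v \<otimes>\<^bsub>A\<^esub> u"
    using uv assms by (simp add: R.m_assoc R.Units_l_inv)
  also have "\<dots> = k \<odot>\<^bsub>A\<^esub> (v \<otimes>\<^bsub>A\<^esub> u)"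
    unfolding k(2) using k(1) uv by (simp add: AL.smult_mult_left)
  finally show ?thesis using k(1) by blast
qed

text \<open>The commutators are exactly the images of the commutation factors, and
  \<open>k \<mapsto> k 1\<close> is an injective group homomorphism on the units of the field, so
  generating a subgroup commutes with it.\<close>

lemma commutator_group_rational:
  assumes "rational K A"
  shows "C_group K A = generate KU lams" "commutator_group A = (\<lambda>k. k \<odot>\<^bsub>A\<^esub> \<one>\<^bsub>A\<^esub>) ` C_group K A"
proof -
  let ?f = "\<lambda>k. k \<odot>\<^bsub>A\<^esub> \<one>\<^bsub>A\<^esub>"
  interpret h: group_hom KU "units_of A" ?f by (rule scalar_hom)
  have one: "u \<otimes>\<^bsub>A\<^esub> v \<otimes>\<^bsub>A\<^esub> inv\<^bsub>A\<^esub> u \<otimes>\<^bsub>A\<^esub> inv\<^bsub>A\<^esub> v = ?f k"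
    if "u \<in> Units A" "v \<in> Units A" "k \<in> Units K" "u \<otimes>\<^bsub>A\<^esub> v = k \<odot>\<^bsub>A\<^esub> (v \<otimes>\<^bsub>A\<^esub> u)" for u v k
  proof -
    have uv: "u \<in> carrier A" "v \<in> carrier A" "inv\<^bsub>A\<^esub> u \<in> carrier A" "inv\<^bsub>A\<^esub> v \<in> carrier A"
      using that by (auto simp: R.Units_inv_closed)
    have "v \<otimes>\<^bsub>A\<^esub> u \<otimes>\<^bsub>A\<^esub> inv\<^bsub>A\<^esub> u \<otimes>\<^bsub>A\<^esub> inv\<^bsub>A\<^esub> v = \<one>\<^bsub>A\<^esub>"
      using that(1,2) uv by (simp add: R.m_assoc[of v u "inv\<^bsub>A\<^esub> u"] R.Units_r_inv)
    then show ?thesis unfolding that(4) using that(3) uv by (simp add: AL.smult_mult_left)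
  qed
  have D: "derived_set (units_of A) (Units A) = ?f ` lams"
  proof (intro Set.set_eqI iffI)
    fix c assume "c \<in> derived_set (units_of A) (Units A)"
    then obtain u v where uv: "u \<in> Units A" "v \<in> Units A" "c = u \<otimes>\<^bsub>A\<^esub> v \<otimes>\<^bsub>A\<^esub> inv\<^bsub>A\<^esub> u \<otimes>\<^bsub>A\<^esub> inv\<^bsub>A\<^esub> v"
      by (auto simp: units_of_mult R.units_of_inv)
    obtain k where k: "k \<in> Units K" "u \<otimes>\<^bsub>A\<^esub> v = k \<odot>\<^bsub>A\<^esub> (v \<otimes>\<^bsub>A\<^esub> u)" using rational_commutation[OF assms uv(1,2)] by blast
    then show "c \<in> ?f ` lams"
      using one[OF uv(1,2) k] uv(3) derived_set_lams[OF rational_commutation[OF assms] uv(1,2) k] by blast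
  next
    fix c assume "c \<in> ?f ` lams"
    then obtain \<gamma> \<gamma>' where g: "\<gamma> \<in> carrier \<Gamma>" "\<gamma>' \<in> carrier \<Gamma>" "c = ?f (lam \<gamma> \<gamma>')" by (auto simp: lams_def)
    obtain x where x: "x \<in> Gr \<gamma>" "x \<noteq> \<zero>\<^bsub>A\<^esub>" using Gr_nonzero g by blast
    obtain y where y: "y \<in> Gr \<gamma>'" "y \<noteq> \<zero>\<^bsub>A\<^esub>" using Gr_nonzero g by blast
    have u: "x \<in> Units A" "y \<in> Units A" using Gr_unit x y g by auto
    have "c = x \<otimes>\<^bsub>units_of A\<^esub> y \<otimes>\<^bsub>units_of A\<^esub> inv\<^bsub>units_of A\<^esub> x \<otimes>\<^bsub>units_of A\<^esub> inv\<^bsub>units_of A\<^esub> y"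
      unfolding g(3) using one[OF u lam(1)[OF g(1,2)] lam(2)[OF g(1,2) x(1) y(1)]] u
      by (simp add: units_of_mult R.units_of_inv)
    then show "c \<in> derived_set (units_of A) (Units A)" using u by blast
  qed
  have cg: "commutator_group A = ?f ` generate KU lams"
    unfolding commutator_group_def derived_def D
    by (rule h.generate_img) (use lams_Units in \<open>simp add: units_of_carrier\<close>)
  have gU: "generate KU lams \<subseteq> Units K"
    using h.G.generate_in_carrier[of lams] lams_Units by (auto simp: units_of_carrier)
  have inj: "k = l" if "k \<in> Units K" "l \<in> Units K" "?f k = ?f l" for k l
    by (rule unit_smult_cancel[OF _ _ R.one_closed one_nonzero that(3)]) (use that in auto)
  show C: "C_group K A = generate KU lams"
    unfolding C_group_def cg using inj gU by auto
  show "commutator_group A = ?f ` C_group K A" unfolding cg C ..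
qed

lemma lams_torsion:
  assumes "rational K A" "k \<in> lams"
  shows "\<exists>N::nat. 0 < N \<and> k [^]\<^bsub>K\<^esub> N = \<one>\<^bsub>K\<^esub>"
proof -
  have kU: "k \<in> Units K" using lams_Units assms by blast
  have "k \<odot>\<^bsub>A\<^esub> \<one>\<^bsub>A\<^esub> \<in> commutator_group A"
    unfolding commutator_group_rational[OF assms(1)] using assms(2) by (auto intro: generate.incl)
  then obtain l where l: "l \<in> Units K" "k \<odot>\<^bsub>A\<^esub> \<one>\<^bsub>A\<^esub> = l \<odot>\<^bsub>A\<^esub> \<one>\<^bsub>A\<^esub>" "\<exists>N::nat. 0 < N \<and> l [^]\<^bsub>K\<^esub> N = \<one>\<^bsub>K\<^esub>"
    using assms(1) unfolding rational_def by blast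
  have "k = l" by (rule unit_smult_cancel[OF _ _ R.one_closed one_nonzero l(2)]) (use kU l in auto)
  then show ?thesis using l by simp
qed

end

section \<open>Commutation factors as powers of a generator\<close>

lemma Zn_hom_eqI:
  assumes H: "group H" and f: "f \<in> hom (Zn n) H" and g: "g \<in> hom (Zn n) H"
    and eq: "\<And>i. i < n \<Longrightarrow> f (unit_vec_Zn n i) = g (unit_vec_Zn n i)" and x: "x \<in> carrier (Zn n)"
  shows "f x = g x"
proof -
  interpret G: comm_group "Zn n" by (rule Zn_comm_group)
  interpret f: group_hom "Zn n" H f
    by (intro group_hom.intro group_hom_axioms.intro f H Zn_group)
  interpret g: group_hom "Zn n" H g
    by (intro group_hom.intro group_hom_axioms.intro g H Zn_group)
  define part where "part k = (\<lambda>j\<in>{..<n}. if j < k then x j else 0)" for k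
  have pc: "part k \<in> carrier (Zn n)" for k by (simp add: part_def)
  have "f (part k) = g (part k)" if "k \<le> n" for k
    using that
  proof (induction k)
    case 0
    have "part 0 = \<one>\<^bsub>Zn n\<^esub>" by (auto simp: part_def Zn_simps)
    then show ?case by simp
  next
    case (Suc k)
    have "part (Suc k) = part k \<otimes>\<^bsub>Zn n\<^esub> (unit_vec_Zn n k [^]\<^bsub>Zn n\<^esub> (x k))"
      unfolding Zn_int_pow[OF unit_vec_carrier]
      by (auto simp: part_def Zn_simps unit_vec_Zn_def less_Suc_eq)
    then show ?case
      using Suc pc eq[of k] f.hom_int_pow[OF unit_vec_carrier, of k "x k"] g.hom_int_pow[OF unit_vec_carrier, of k "x k"]
        G.int_pow_closed[OF unit_vec_carrier] by simp
  qed
  moreover have "part n = x" using x by (intro Zn_ext[OF pc]) (auto simp: part_def)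
  ultimately show ?thesis by auto
qed

lemma bil_add_left: "bil n M (\<lambda>i\<in>{..<n}. x i + x' i) y = bil n M x y + bil n M x' y"
  unfolding bil_def sum.distrib[symmetric] by (intro sum.cong refl) (auto simp: algebra_simps)

lemma pow_bil_hom:
  assumes "field K" "q \<in> Units K"
  shows "(\<lambda>x. q [^]\<^bsub>K\<^esub> bil n M x y) \<in> hom (Zn n) (units_of K)"
proof -
  interpret field K by (rule assms(1))
  show ?thesis
    by (rule homI) (simp_all add: units_of_carrier units_of_mult assms(2) Zn_simps(3) bil_add_left int_pow_plus)
qed

text \<open>Homomorphisms on \<int>^n are determined on unit vectors. This is used in the first
  argument, carried over to the second by antisymmetry, and used once more in the first.\<close>

lemma lam_eq_pow_bil:
  assumes A: "quantum_torus K (Zn n) A Gr" and q: "q \<in> Units K" and M: "alt_mat n M"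
    and e: "\<And>i j. i < n \<Longrightarrow> j < n \<Longrightarrow> qt.lam K A Gr (unit_vec_Zn n i) (unit_vec_Zn n j) = q [^]\<^bsub>K\<^esub> M $$ (i,j)"
    and g: "\<gamma> \<in> carrier (Zn n)" "\<gamma>' \<in> carrier (Zn n)"
  shows "qt.lam K A Gr \<gamma> \<gamma>' = q [^]\<^bsub>K\<^esub> bil n M \<gamma> \<gamma>'"
proof -
  interpret A: qt K "Zn n" A Gr by (rule qt_quantum_torus[OF A])
  have K: "field K" ..
  have anti: "bil n M y x = - bil n M x y" for x y
    using upper_antisym[OF M, of x y] upper_antisym[OF M, of y x] by simp
  have "A.lam \<gamma> (unit_vec_Zn n j) = q [^]\<^bsub>K\<^esub> bil n M \<gamma> (unit_vec_Zn n j)" if "\<gamma> \<in> carrier (Zn n)" "j < n" for \<gamma> j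
    by (rule Zn_hom_eqI[OF A.F.units_group A.lam_hom[OF unit_vec_carrier] pow_bil_hom[OF K q] _ that(1)])
      (simp add: e that bil_unit_vec)
  then have *: "A.lam (unit_vec_Zn n j) \<gamma> = q [^]\<^bsub>K\<^esub> bil n M (unit_vec_Zn n j) \<gamma>" if "\<gamma> \<in> carrier (Zn n)" "j < n" for \<gamma> j
    using that A.lam_swap[OF that(1) unit_vec_carrier[of n j]] A.F.int_pow_units[OF q]
      group.int_pow_neg[OF A.F.units_group, of q] q A.F.units_of_inv[OF A.F.int_pow_Units[OF q]]
    by (simp add: anti[of _ \<gamma>] units_of_carrier)
  show ?thesis
    by (rule Zn_hom_eqI[OF A.F.units_group A.lam_hom[OF g(2)] pow_bil_hom[OF K q] _ g(1)]) (rule *[OF g(2)])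
qed

lemma has_form_exists:
  assumes A: "quantum_torus K (Zn n) A Gr" and q: "q \<in> Units K"
    and e: "\<And>i j. i < n \<Longrightarrow> j < n \<Longrightarrow> qt.lam K A Gr (unit_vec_Zn n i) (unit_vec_Zn n j) \<in> generate (units_of K) {q}"
  shows "\<exists>M. has_form K n q A Gr M \<and>
    (\<forall>\<gamma>\<in>carrier (Zn n). \<forall>\<gamma>'\<in>carrier (Zn n). qt.lam K A Gr \<gamma> \<gamma>' = q [^]\<^bsub>K\<^esub> bil n M \<gamma> \<gamma>')"
proof -
  interpret A: qt K "Zn n" A Gr by (rule qt_quantum_torus[OF A])
  have "\<exists>a::int. i < n \<longrightarrow> j < n \<longrightarrow> A.lam (unit_vec_Zn n i) (unit_vec_Zn n j) = q [^]\<^bsub>K\<^esub> a" for i j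
    using e[of i j] group.generate_pow[OF A.F.units_group, of q] q A.F.int_pow_units[OF q]
    by (auto simp: units_of_carrier)
  then obtain a where a: "\<And>i j. i < n \<Longrightarrow> j < n \<Longrightarrow> A.lam (unit_vec_Zn n i) (unit_vec_Zn n j) = q [^]\<^bsub>K\<^esub> (a i j :: int)"
    by metis
  \<comment> \<open>Exponents are unique only modulo the order of \<open>q\<close>. They are chosen
    above the diagonal and extended by sign, which makes \<open>M\<close> alternating over the
    integers and not merely modulo the order.\<close>
  define M where "M = mat n n (\<lambda>(i,j). if i < j then a i j else if j < i then - a j i else 0)"
  have M: "alt_mat n M" by (auto simp: alt_mat_def M_def)
  have neg: "inv\<^bsub>K\<^esub> (q [^]\<^bsub>K\<^esub> b) = q [^]\<^bsub>K\<^esub> (- b)" for b :: int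
    using A.F.int_pow_units[OF q] group.int_pow_neg[OF A.F.units_group, of q] q
      A.F.units_of_inv[OF A.F.int_pow_Units[OF q]] by (simp add: units_of_carrier)
  have "A.lam (unit_vec_Zn n i) (unit_vec_Zn n j) = q [^]\<^bsub>K\<^esub> M $$ (i,j)" if "i < n" "j < n" for i j
  proof (cases i j rule: linorder_cases)
    case greater
    have "A.lam (unit_vec_Zn n i) (unit_vec_Zn n j) = inv\<^bsub>K\<^esub> (A.lam (unit_vec_Zn n j) (unit_vec_Zn n i))"
      by (rule A.lam_swap) simp_all
    then show ?thesis using greater that by (simp add: M_def neg a)
  qed (use that a A.lam_self[OF unit_vec_carrier] in \<open>auto simp: M_def\<close>)
  from lam_eq_pow_bil[OF A q M this]
  have l: "A.lam \<gamma> \<gamma>' = q [^]\<^bsub>K\<^esub> bil n M \<gamma> \<gamma>'" if "\<gamma> \<in> carrier (Zn n)" "\<gamma>' \<in> carrier (Zn n)" for \<gamma> \<gamma>'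
    using that by blast
  have "has_form K n q A Gr M"
    unfolding has_form_def
  proof (intro conjI ballI M)
    fix \<gamma> \<gamma>' x y assume g: "\<gamma> \<in> carrier (Zn n)" "\<gamma>' \<in> carrier (Zn n)" and xy: "x \<in> Gr \<gamma>" "y \<in> Gr \<gamma>'"
    show "x \<otimes>\<^bsub>A\<^esub> y = (q [^]\<^bsub>K\<^esub> bil n M \<gamma> \<gamma>') \<odot>\<^bsub>A\<^esub> (y \<otimes>\<^bsub>A\<^esub> x)"
      unfolding l[OF g, symmetric] by (rule A.lam(2)[OF g xy])
  qed
  with l show ?thesis by blast
qed

text \<open>Rationality gives each commutation factor a finite order, but no bound common to all
  degrees. The finitely many factors of pairs of unit vectors lie in one cyclic group, and
  bimultiplicativity puts all other factors there.\<close>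

lemma C_group_cyclic:
  assumes A: "quantum_torus K (Zn n) A Gr" and r: "rational K A"
  shows "cyclic_group ((units_of K)\<lparr>carrier := C_group K A\<rparr>)"
proof -
  interpret A: qt K "Zn n" A Gr by (rule qt_quantum_torus[OF A])
  interpret U: group "units_of K" by (rule A.F.units_group)
  define S where "S = (\<lambda>(i,j). A.lam (unit_vec_Zn n i) (unit_vec_Zn n j)) ` ({..<n} \<times> {..<n})"
  have S: "S \<subseteq> A.lams" by (auto simp: S_def)
  obtain c where c: "c \<in> generate (units_of K) S" "S \<subseteq> generate (units_of K) {c}"
  proof (rule A.F.torsion_cyclic)
    show "finite S" by (simp add: S_def)
    show "S \<subseteq> Units K" using S A.lams_Units by blast
    show "\<exists>N::nat. 0 < N \<and> x [^]\<^bsub>K\<^esub> N = \<one>\<^bsub>K\<^esub>" if "x \<in> S" for x using A.lams_torsion[OF r] S that by blast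
  qed
  have lU: "A.lams \<subseteq> carrier (units_of K)" using A.lams_Units by (simp add: units_of_carrier)
  have cC: "c \<in> C_group K A"
    unfolding A.commutator_group_rational(1)[OF r] using c(1) U.mono_generate[OF S] by blast
  have cU: "c \<in> carrier (units_of K)" using cC by (simp add: C_group_def units_of_carrier)
  have cK: "c \<in> Units K" using cU by (simp add: units_of_carrier)
  have "A.lam (unit_vec_Zn n i) (unit_vec_Zn n j) \<in> generate (units_of K) {c}" if "i < n" "j < n" for i j
    using c(2) that by (auto simp: S_def)
  from has_form_exists[OF A cK this]
  obtain M where M: "\<And>\<gamma> \<gamma>'. \<gamma> \<in> carrier (Zn n) \<Longrightarrow> \<gamma>' \<in> carrier (Zn n) \<Longrightarrow> A.lam \<gamma> \<gamma>' = c [^]\<^bsub>K\<^esub> bil n M \<gamma> \<gamma>'"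
    by blast
  have p: "c [^]\<^bsub>K\<^esub> (a::int) = c [^]\<^bsub>units_of K\<^esub> a" for a
    by (rule A.F.int_pow_units) (use cU in \<open>simp add: units_of_carrier\<close>)
  have "A.lams \<subseteq> generate (units_of K) {c}"
    unfolding U.generate_pow[OF cU] by (auto simp: A.lams_def M p)
  then have "C_group K A \<subseteq> generate (units_of K) {c}"
    unfolding A.commutator_group_rational(1)[OF r]
    using U.generate_subgroup_incl U.generate_is_subgroup[of "{c}"] cU by simp
  moreover have sub: "subgroup (C_group K A) (units_of K)"
    unfolding A.commutator_group_rational(1)[OF r] by (rule U.generate_is_subgroup[OF lU])
  moreover have "generate (units_of K) {c} \<subseteq> C_group K A"
    by (rule U.generate_subgroup_incl[OF _ sub]) (use cC in simp)
  ultimately have C: "C_group K A = {c [^]\<^bsub>units_of K\<^esub> a | a::int. a \<in> UNIV}"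
    unfolding U.generate_pow[OF cU] by (rule_tac subset_antisym)
  interpret C: group "(units_of K)\<lparr>carrier := C_group K A\<rparr>" by (rule U.subgroup_imp_group[OF sub])
  show ?thesis
    unfolding C.cyclic_group
  proof (rule bexI[of _ c])
    show "carrier ((units_of K)\<lparr>carrier := C_group K A\<rparr>) =
        range (\<lambda>a::int. c [^]\<^bsub>(units_of K)\<lparr>carrier := C_group K A\<rparr>\<^esub> a)"
      unfolding U.int_pow_consistent[OF sub cC, symmetric] by (simp add: C full_SetCompr_eq)
  qed (use cC in simp)
qed

lemma C_group_generator:
  assumes A: "quantum_torus K (Zn n) A Gr" and r: "rational K A" and q: "q \<in> Units K"
    and C: "C_group K A = generate (units_of K) {q}"
  shows "card (C_group K A) = order_of K q" "0 < order_of K q"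
    and "\<exists>M. has_form K n q A Gr M \<and> (\<forall>p. prime p \<longrightarrow> p dvd int (order_of K q) \<longrightarrow> (\<exists>i<n. \<exists>j<n. \<not> p dvd M $$ (i,j)))"
proof -
  interpret A: qt K "Zn n" A Gr by (rule qt_quantum_torus[OF A])
  interpret U: group "units_of K" by (rule A.F.units_group)
  have qU: "q \<in> carrier (units_of K)" using q by (simp add: units_of_carrier)
  show "card (C_group K A) = order_of K q" unfolding C order_of_def by (rule U.generate_pow_card[OF qU, symmetric])
  have qC: "q \<in> C_group K A" unfolding C by (simp add: generate.incl)
  then have "q \<odot>\<^bsub>A\<^esub> \<one>\<^bsub>A\<^esub> \<in> commutator_group A" by (simp add: C_group_def)
  then obtain l where l: "l \<in> Units K" "q \<odot>\<^bsub>A\<^esub> \<one>\<^bsub>A\<^esub> = l \<odot>\<^bsub>A\<^esub> \<one>\<^bsub>A\<^esub>" "\<exists>N::nat. 0 < N \<and> l [^]\<^bsub>K\<^esub> N = \<one>\<^bsub>K\<^esub>"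
    using r unfolding rational_def by blast
  \<comment> \<open>Rationality provides some scalar of finite order representing the same element;
    scalars act faithfully on 1, so it is \<open>q\<close> itself.\<close>
  have "q = l" by (rule A.unit_smult_cancel[OF _ _ A.R.one_closed A.one_nonzero l(2)]) (use q l in auto)
  then obtain N :: nat where N: "0 < N" "q [^]\<^bsub>units_of K\<^esub> N = \<one>\<^bsub>units_of K\<^esub>"
    using l(3) A.F.units_of_pow[OF q] by (auto simp: units_of_one)
  then show pos: "0 < order_of K q" using U.pow_eq_id[OF qU, of N] by (auto simp: order_of_def intro: Nat.gr0I)
  have "A.lam (unit_vec_Zn n i) (unit_vec_Zn n j) \<in> generate (units_of K) {q}" for i j
    unfolding C[symmetric] A.commutator_group_rational(1)[OF r] by (rule generate.incl) auto
  from has_form_exists[OF A q this] obtain M where M: "has_form K n q A Gr M"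
    "\<And>\<gamma> \<gamma>'. \<gamma> \<in> carrier (Zn n) \<Longrightarrow> \<gamma>' \<in> carrier (Zn n) \<Longrightarrow> A.lam \<gamma> \<gamma>' = q [^]\<^bsub>K\<^esub> bil n M \<gamma> \<gamma>'"
    by blast
  \<comment> \<open>If \<open>p\<close> divided all entries of \<open>M\<close>, every commutation
    factor would be a power of the \<open>p\<close>-th power of \<open>q\<close>, and so would
    \<open>q\<close>, a member of the commutator group. Then \<open>1 = p * b\<close> modulo the
    order of \<open>q\<close>, hence modulo \<open>p\<close>.\<close>
  have "\<exists>i<n. \<exists>j<n. \<not> p dvd M $$ (i,j)" if p: "prime p" "p dvd int (order_of K q)" for p
  proof (rule ccontr)
    assume "\<not> ?thesis"
    then have d: "p dvd M $$ (i,j)" if "i < n" "j < n" for i j using that by blast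
    let ?r = "q [^]\<^bsub>K\<^esub> p"
    have rU: "?r \<in> carrier (units_of K)" using q by (simp add: units_of_carrier)
    have "A.lam \<gamma> \<gamma>' \<in> generate (units_of K) {?r}" if g: "\<gamma> \<in> carrier (Zn n)" "\<gamma>' \<in> carrier (Zn n)" for \<gamma> \<gamma>'
    proof -
      have "p dvd bil n M \<gamma> \<gamma>'" unfolding bil_def by (intro dvd_sum) (simp add: d)
      then obtain b where "bil n M \<gamma> \<gamma>' = p * b" by blast
      then have "A.lam \<gamma> \<gamma>' = ?r [^]\<^bsub>units_of K\<^esub> b"
        using M(2)[OF g] A.F.int_pow_times[OF q, of p b] A.F.int_pow_units[of ?r b] q by simp
      then show ?thesis unfolding U.generate_pow[OF rU] by blast
    qed
    then have "A.lams \<subseteq> generate (units_of K) {?r}" by (auto simp: A.lams_def)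
    then have "C_group K A \<subseteq> generate (units_of K) {?r}"
      unfolding A.commutator_group_rational(1)[OF r]
      using U.generate_subgroup_incl U.generate_is_subgroup[of "{?r}"] rU by simp
    then obtain b :: int where "q = ?r [^]\<^bsub>units_of K\<^esub> b" using qC unfolding U.generate_pow[OF rU] by blast
    then have "q [^]\<^bsub>K\<^esub> (p * b) = q"
      using A.F.int_pow_times[OF q, of p b] A.F.int_pow_units[of ?r b] q by simp
    then have "q [^]\<^bsub>K\<^esub> (1::int) = q [^]\<^bsub>K\<^esub> (p * b)"
      using A.F.int_pow_units[OF q, of 1] U.int_pow_1[OF qU] by simp
    then have "[1 = p * b] (mod int (order_of K q))" by (rule iffD1[OF A.F.int_pow_eq_iff[OF q]])
    then have "[1 = p * b] (mod p)" by (rule cong_dvd_modulus[OF _ p(2)])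
    then have "p dvd 1" using cong_dvd_iff[of 1 "p * b" p] by simp
    have "\<not> p dvd 1" using p(1) Factorial_Ring.not_prime_unit by blast
    with \<open>p dvd 1\<close> show False by blast
  qed
  with M(1) show "\<exists>M. has_form K n q A Gr M \<and> (\<forall>p. prime p \<longrightarrow> p dvd int (order_of K q) \<longrightarrow> (\<exists>i<n. \<exists>j<n. \<not> p dvd M $$ (i,j)))"
    by (intro exI[of _ M] conjI allI impI)
qed

lemma C_group_graded_iso:
  assumes A: "quantum_torus K (Zn n) A Gr" "rational K A" and B: "quantum_torus K (Zn n) B Gr'" "rational K B"
    and iso: "graded_iso K (Zn n) A Gr B Gr'"
  shows "C_group K A = C_group K B"
proof -
  interpret A: qt K "Zn n" A Gr by (rule qt_quantum_torus[OF A(1)])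
  interpret B: qt K "Zn n" B Gr' by (rule qt_quantum_torus[OF B(1)])
  obtain f p where f: "f \<in> ring_iso A B"
    "\<And>k x. k \<in> carrier K \<Longrightarrow> x \<in> carrier A \<Longrightarrow> f (k \<odot>\<^bsub>A\<^esub> x) = k \<odot>\<^bsub>B\<^esub> f x"
    "p \<in> iso (Zn n) (Zn n)" "\<And>\<gamma>. \<gamma> \<in> carrier (Zn n) \<Longrightarrow> f ` Gr \<gamma> = Gr' (p \<gamma>)"
    using graded_isoE[OF iso] by metis
  have fm: "f (x \<otimes>\<^bsub>A\<^esub> y) = f x \<otimes>\<^bsub>B\<^esub> f y" if "x \<in> carrier A" "y \<in> carrier A" for x y
    using f(1) that by (simp add: ring_iso_def Ring.ring_hom_def)
  have fh: "f \<in> Ring.ring_hom A B" and inj: "inj_on f (carrier A)" using f(1) by (auto simp: ring_iso_def bij_betw_def)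
  have f0: "f \<zero>\<^bsub>A\<^esub> = \<zero>\<^bsub>B\<^esub>" using ring_hom_zero[OF fh A.R.ring_axioms B.R.ring_axioms] .
  have nz: "f x \<noteq> \<zero>\<^bsub>B\<^esub>" if "x \<in> carrier A" "x \<noteq> \<zero>\<^bsub>A\<^esub>" for x
    using inj_onD[OF inj, of x "\<zero>\<^bsub>A\<^esub>"] that f0 by auto
  have pb: "bij_betw p (carrier (Zn n)) (carrier (Zn n))" using f(3) by (simp add: iso_def)
  have pc: "p \<gamma> \<in> carrier (Zn n)" if "\<gamma> \<in> carrier (Zn n)" for \<gamma> using pb that by (auto simp: bij_betw_def)
  have l: "B.lam (p \<gamma>) (p \<gamma>') = A.lam \<gamma> \<gamma>'" if g: "\<gamma> \<in> carrier (Zn n)" "\<gamma>' \<in> carrier (Zn n)" for \<gamma> \<gamma>'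
  proof -
    obtain x where x: "x \<in> Gr \<gamma>" "x \<noteq> \<zero>\<^bsub>A\<^esub>" using A.Gr_nonzero g by blast
    obtain y where y: "y \<in> Gr \<gamma>'" "y \<noteq> \<zero>\<^bsub>A\<^esub>" using A.Gr_nonzero g by blast
    have c: "x \<in> carrier A" "y \<in> carrier A" using A.Gr_sub x y g by auto
    have k: "A.lam \<gamma> \<gamma>' \<in> carrier K" using A.lam(1)[OF g] by simp
    have im: "f x \<in> Gr' (p \<gamma>)" "f y \<in> Gr' (p \<gamma>')" using f(4) g x(1) y(1) by blast+
    have "f x \<otimes>\<^bsub>B\<^esub> f y = A.lam \<gamma> \<gamma>' \<odot>\<^bsub>B\<^esub> (f y \<otimes>\<^bsub>B\<^esub> f x)"
      using arg_cong[OF A.lam(2)[OF g x(1) y(1)], of f] c k by (simp add: fm f(2))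
    then show ?thesis
      by (intro B.lam_eqI[OF pc[OF g(1)] pc[OF g(2)] im nz[OF c(1) x(2)] nz[OF c(2) y(2)] k])
  qed
  have surj: "p ` carrier (Zn n) = carrier (Zn n)" using pb by (simp add: bij_betw_def)
  have "A.lams = B.lams"
  proof (intro Set.set_eqI iffI)
    fix k assume "k \<in> A.lams"
    then obtain \<gamma> \<gamma>' where g: "\<gamma> \<in> carrier (Zn n)" "\<gamma>' \<in> carrier (Zn n)" "k = A.lam \<gamma> \<gamma>'" by (auto simp: A.lams_def)
    then show "k \<in> B.lams" using l[OF g(1,2)] B.lamsI[OF pc[OF g(1)] pc[OF g(2)]] by simp
  next
    fix k assume "k \<in> B.lams"
    then obtain \<delta> \<delta>' where d: "\<delta> \<in> carrier (Zn n)" "\<delta>' \<in> carrier (Zn n)" "k = B.lam \<delta> \<delta>'" by (auto simp: B.lams_def)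
    from d(1) obtain \<gamma> where "\<gamma> \<in> carrier (Zn n)" "\<delta> = p \<gamma>" using surj by (metis imageE)
    moreover from d(2) obtain \<gamma>' where "\<gamma>' \<in> carrier (Zn n)" "\<delta>' = p \<gamma>'" using surj by (metis imageE)
    ultimately have g: "\<gamma> \<in> carrier (Zn n)" "\<gamma>' \<in> carrier (Zn n)" "\<delta> = p \<gamma>" "\<delta>' = p \<gamma>'" by simp_all
    then show "k \<in> A.lams" using l[OF g(1,2)] d(3) A.lamsI[OF g(1,2)] by simp
  qed
  then show ?thesis using A.commutator_group_rational(1)[OF A(2)] B.commutator_group_rational(1)[OF B(2)] by simp
qed

section \<open>Classification\<close>

lemma order_of_int_pow:
  assumes K: "field K" and q: "q \<in> Units K" and m: "0 < order_of K q"
  shows "int (order_of K (q [^]\<^bsub>K\<^esub> (a::int))) = int (order_of K q) div gcd a (int (order_of K q))"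
proof -
  interpret field K by (rule K)
  interpret U: group "units_of K" by (rule units_group)
  define m where "m = int (order_of K q)"
  have m0: "0 < m" using m by (simp add: m_def)
  define g where "g = gcd a m"
  have g: "0 < g" using m0 by (simp add: g_def)
  have qa: "q [^]\<^bsub>K\<^esub> a \<in> Units K" using q by simp
  have "coprime (a div g) (m div g)"
    unfolding g_def by (rule div_gcd_coprime) (use m0 in simp)
  then have c: "m div g dvd a div g * k \<longleftrightarrow> m div g dvd k" for k
    by (simp add: coprime_commute coprime_dvd_mult_right_iff)
  have "m = g * (m div g)" "a = g * (a div g)" by (auto simp: g_def)
  then have d: "m dvd a * k \<longleftrightarrow> m div g dvd k" for k
    using c[of k] g by (metis dvd_mult_cancel_left less_irrefl mult.assoc)
  have mg: "0 < m div g" using m0 g by (simp add: g_def pos_imp_zdiv_pos_iff zdvd_imp_le)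
  have "U.ord (q [^]\<^bsub>K\<^esub> a) = nat (m div g)"
    unfolding U.ord_unique[OF qa[unfolded units_of_carrier[symmetric]]]
  proof
    fix k :: nat
    have "(q [^]\<^bsub>K\<^esub> a) [^]\<^bsub>units_of K\<^esub> k = q [^]\<^bsub>K\<^esub> (a * int k)"
      using int_pow_times[OF q, of a "int k"] units_of_pow[OF qa, of k] by (simp add: int_pow_int)
    moreover have "\<one>\<^bsub>units_of K\<^esub> = q [^]\<^bsub>K\<^esub> (0::int)" by (simp add: units_of_one)
    ultimately have "(q [^]\<^bsub>K\<^esub> a) [^]\<^bsub>units_of K\<^esub> k = \<one>\<^bsub>units_of K\<^esub> \<longleftrightarrow> m dvd a * int k"
      using int_pow_eq_iff[OF q, of "a * int k" 0] by (simp add: m_def cong_0_iff)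
    also have "\<dots> \<longleftrightarrow> nat (m div g) dvd k" unfolding d using mg by (simp add: nat_dvd_iff)
    finally show "(q [^]\<^bsub>K\<^esub> a) [^]\<^bsub>units_of K\<^esub> k = \<one>\<^bsub>units_of K\<^esub> \<longleftrightarrow> nat (m div g) dvd k" .
  qed
  then show ?thesis using mg unfolding order_of_def[of K "q [^]\<^bsub>K\<^esub> a"] by (simp add: m_def g_def)
qed

text \<open>For \<open>m = 1\<close> there are no blocks by convention. Otherwise
  \<open>h 1 = 1\<close> is itself a proper divisor of \<open>m\<close> and divides everything, so a
  chain given from index 2 on is the same as one from index 1 on.\<close>

lemma torus_data_iff:
  assumes K: "field K" and q: "q \<in> Units K" and m: "0 < order_of K q"
  shows "torus_data K n q s h z \<longleftrightarrow> standard_data (order_of K q) n s h z"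
proof -
  interpret field K by (rule K)
  interpret U: group "units_of K" by (rule units_group)
  let ?m = "order_of K q"
  have one: "q = \<one>\<^bsub>K\<^esub> \<longleftrightarrow> ?m = 1"
    using U.ord_eq_1[of q] q by (simp add: order_of_def units_of_carrier units_of_one)
  have P: "h i \<in> P_set ?m - {0} \<longleftrightarrow> 0 < h i \<and> h i < int ?m \<and> h i dvd int ?m" for i
    using P_set_iff[OF m, of "h i"] by auto
  have ord: "order_of K (q [^]\<^bsub>K\<^esub> (int z * h s)) = order_of K (q [^]\<^bsub>K\<^esub> h s) \<longleftrightarrow> gcd (int z * h s) (int ?m) = h s"
    if "0 < h s" "h s dvd int ?m"
  proof -
    have "gcd (h s) (int ?m) = h s" using that by (simp add: gcd_proj1_if_dvd_int)
    then have "order_of K (q [^]\<^bsub>K\<^esub> (int z * h s)) = order_of K (q [^]\<^bsub>K\<^esub> h s) \<longleftrightarrow>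
        int ?m div gcd (int z * h s) (int ?m) = int ?m div h s"
      unfolding of_nat_eq_iff[symmetric, where 'a = int] order_of_int_pow[OF K q m] by simp
    also have "\<dots> \<longleftrightarrow> gcd (int z * h s) (int ?m) = h s"
    proof
      assume eq: "int ?m div gcd (int z * h s) (int ?m) = int ?m div h s"
      have "int ?m = (int ?m div h s) * gcd (int z * h s) (int ?m)" unfolding eq[symmetric] by simp
      moreover have "int ?m = (int ?m div h s) * h s" using that by simp
      ultimately show "gcd (int z * h s) (int ?m) = h s"
        using m by (metis mult_left_cancel mult_zero_left of_nat_0 of_nat_eq_iff less_irrefl)
    qed simp
    finally show ?thesis .
  qed
  have h1: "0 < h 1 \<and> h 1 < int ?m \<and> h 1 dvd int ?m" if "h 1 = 1" "?m \<noteq> 1" using that m by simp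
  have chain: "(\<forall>i\<in>{2..<s}. dvd_mod ?m (h i) (h (i + 1))) \<longleftrightarrow> (\<forall>i\<in>{1..<s}. h i dvd h (i + 1))"
    if "\<forall>i\<in>{2..s}. 0 < h i \<and> h i < int ?m \<and> h i dvd int ?m" "h 1 = 1"
  proof -
    have "dvd_mod ?m (h i) (h (i + 1)) \<longleftrightarrow> h i dvd h (i + 1)" if "i \<in> {2..<s}" for i
      using \<open>\<forall>i\<in>{2..s}. _ i\<close> that by (intro dvd_mod_iff_dvd) auto
    moreover have "{1..<s} \<subseteq> insert 1 {2..<s}" by auto
    ultimately show ?thesis using that(2) by (auto simp del: One_nat_def)
  qed
  have range: "(\<forall>i\<in>{1..s}. 0 < h i \<and> h i < int ?m \<and> h i dvd int ?m) \<longleftrightarrow> (\<forall>i\<in>{2..s}. 0 < h i \<and> h i < int ?m \<and> h i dvd int ?m)"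
    if "h 1 = 1" "s = 0 \<longleftrightarrow> ?m = 1"
  proof (cases "s = 0")
    case False
    then have "{1..s} = insert 1 {2..s}" by auto
    then show ?thesis using h1 that False by simp
  qed simp
  show ?thesis
  proof
    assume t: "torus_data K n q s h z"
    then have a: "2 * s \<le> n" "s = 0 \<longleftrightarrow> ?m = 1" "h 1 = 1" "\<forall>i\<in>{2..s}. 0 < h i \<and> h i < int ?m \<and> h i dvd int ?m"
      "\<forall>i\<in>{2..<s}. dvd_mod ?m (h i) (h (i + 1))"
      unfolding torus_data_def one P by simp_all
    have r: "\<forall>i\<in>{1..s}. 0 < h i \<and> h i < int ?m \<and> h i dvd int ?m" using range a by simp
    have "if 0 < s \<and> 2 * s = n then 1 \<le> z \<and> gcd (int z * h s) (int ?m) = h s else z = 1"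
      using t r ord unfolding torus_data_def by (auto split: if_splits)
    then show "standard_data ?m n s h z"
      unfolding standard_data_def divisor_chain_def using a r chain[OF a(4,3)] by simp
  next
    assume t: "standard_data ?m n s h z"
    then have a: "2 * s \<le> n" "s = 0 \<longleftrightarrow> ?m = 1" "h 1 = 1" "\<forall>i\<in>{1..s}. 0 < h i \<and> h i < int ?m \<and> h i dvd int ?m"
      "\<forall>i\<in>{1..<s}. h i dvd h (i + 1)"
      unfolding standard_data_def divisor_chain_def by simp_all
    have r: "\<forall>i\<in>{2..s}. 0 < h i \<and> h i < int ?m \<and> h i dvd int ?m" using a(4) by simp
    have "if 0 < s \<and> 2 * s = n then 1 \<le> z \<and> order_of K (q [^]\<^bsub>K\<^esub> (int z * h s)) = order_of K (q [^]\<^bsub>K\<^esub> h s) else z = 1"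
      using t a(4) ord unfolding standard_data_def by (auto split: if_splits)
    then show "torus_data K n q s h z"
      unfolding torus_data_def one P using a r chain[OF r a(3)] by simp
  qed
qed

text \<open>From here on the algebras enter only through the matrix \<open>M\<close>: the tensor
  product is replaced by the torus algebra of its normal form, and graded isomorphism by
  congruence.\<close>

lemma described_by_iff:
  assumes A: "quantum_torus K (Zn n) A Gr" "has_form K n q A Gr M" and q: "q \<in> Units K" and m: "0 < order_of K q"
  shows "described_by K n q A Gr s h z \<longleftrightarrow> standard_data (order_of K q) n s h z \<and>
    congr (order_of K q) n M (N_mat n s (h(s := int z * h s)))"
proof -
  interpret A: qt K "Zn n" A Gr by (rule qt_quantum_torus[OF A(1)])
  have K: "field K" ..
  show ?thesis
  proof (cases "2 * s \<le> n")
    case True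
    note st = standard_torus_graded_iso[OF K q True, where h = h and z = z]
    have "graded_iso K (Zn n) A Gr (standard_torus K n q s h z) (standard_grading K n q s h z) \<longleftrightarrow>
        graded_iso K (Zn n) A Gr (torus_algebra K n q (N_mat n s (h(s := int z * h s)))) (line K)"
      by (rule iffI) (rule graded_iso_trans[OF _ st(1)] graded_iso_trans[OF _ st(2)], assumption)+
    then show ?thesis
      unfolding described_by_def torus_data_iff[OF K q m] graded_iso_torus_algebra_iff[OF A q N_mat_alt[OF True]]
      by simp
  next
    case False
    then show ?thesis
      unfolding described_by_def torus_data_iff[OF K q m] standard_data_def divisor_chain_def by simp
  qed
qed

text \<open>The \<open>z\<close> obtained is a unit modulo \<open>m\<close>, which is more than the
  order condition demands; for such \<open>z\<close> the coset criterion can be read in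
  \<int>/(m).\<close>

lemma described_by_exists:
  assumes A: "quantum_torus K (Zn n) A Gr" "rational K A" and q: "q \<in> Units K"
    and C: "C_group K A = generate (units_of K) {q}"
  shows "\<exists>s h z. described_by K n q A Gr s h z \<and> coprime z (order_of K q)"
proof -
  note m = C_group_generator(2)[OF A q C]
  obtain M where M: "has_form K n q A Gr M"
    "\<And>p. prime p \<Longrightarrow> p dvd int (order_of K q) \<Longrightarrow> \<exists>i<n. \<exists>j<n. \<not> p dvd M $$ (i,j)"
    using C_group_generator(3)[OF A q C] by blast
  have "alt_mat n M" using M(1) by (simp add: has_form_def)
  from standard_form_mod[OF m this M(2)] obtain s h z where d: "divisor_chain (order_of K q) n s h"
    "s = 0 \<longleftrightarrow> order_of K q = 1" "h 1 = 1" "coprime z (order_of K q)"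
    "if 0 < s \<and> 2 * s = n then 1 \<le> z else z = 1"
    "congr (order_of K q) n M (N_mat n s (h(s := int z * h s)))" by blast
  have "gcd (int z * h s) (int (order_of K q)) = h s" if "0 < s"
  proof -
    have hs: "0 < h s" "h s dvd int (order_of K q)" using d(1) that by (auto simp: divisor_chain_def)
    have "coprime (int z) (int (order_of K q))" using d(4) by simp
    then have "gcd (int z * h s) (int (order_of K q)) = gcd (h s) (int (order_of K q))"
      by (simp add: gcd_mult_left_left_cancel coprime_commute)
    then show ?thesis using hs by (simp add: gcd_proj1_if_dvd_int)
  qed
  then have "standard_data (order_of K q) n s h z" unfolding standard_data_def using d by auto
  then have "described_by K n q A Gr s h z \<and> coprime z (order_of K q)"
    using described_by_iff[OF A(1) M(1) q m] d by blast
  then show ?thesis by blast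
qed

lemma described_by_graded_iso_iff:
  assumes A: "quantum_torus K (Zn n) A Gr" "rational K A" and A': "quantum_torus K (Zn n) A' Gr'" "rational K A'"
    and q: "q \<in> Units K" and C: "C_group K A = generate (units_of K) {q}" "C_group K A' = generate (units_of K) {q}"
    and D: "described_by K n q A Gr s h z" "described_by K n q A' Gr' s' h' z'"
  shows "coprime z (order_of K q) \<Longrightarrow> coprime z' (order_of K q) \<Longrightarrow>
      graded_iso K (Zn n) A Gr A' Gr' \<longleftrightarrow> s = s' \<and> (\<forall>i\<in>{2..s}. h i = h' i) \<and>
        in_pm_coset (order_of K q) z' z (D_group (order_of K q) n s h)"
    and "graded_iso K (Zn n) A Gr A' Gr' \<longleftrightarrow> s = s' \<and> (\<forall>i\<in>{2..s}. h i = h' i) \<and>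
        in_pm_coset (order_of K (q [^]\<^bsub>K\<^esub> h s)) z' z (D_group (order_of K q) n s h)"
    and "graded_iso K (Zn n) A Gr A' Gr' \<Longrightarrow> 0 < s \<Longrightarrow> [(int z)\<^sup>2 * h s = (int z')\<^sup>2 * h s] (mod int (order_of K q))"
proof -
  interpret A: qt K "Zn n" A Gr by (rule qt_quantum_torus[OF A(1)])
  interpret U: group "units_of K" by (rule A.F.units_group)
  have K: "field K" ..
  note m = C_group_generator(2)[OF A q C(1)]
  obtain M where M: "has_form K n q A Gr M" using C_group_generator(3)[OF A q C(1)] by blast
  obtain M' where M': "has_form K n q A' Gr' M'" using C_group_generator(3)[OF A' q C(2)] by blast
  let ?N = "N_mat n s (h(s := int z * h s))" and ?N' = "N_mat n s' (h'(s' := int z' * h' s'))"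
  have S: "standard_data (order_of K q) n s h z" "congr (order_of K q) n M ?N"
    using D(1) described_by_iff[OF A(1) M q m] by auto
  have S': "standard_data (order_of K q) n s' h' z'" "congr (order_of K q) n M' ?N'"
    using D(2) described_by_iff[OF A'(1) M' q m] by auto
  have s: "2 * s \<le> n" "2 * s' \<le> n" using S(1) S'(1) by (auto simp: standard_data_def divisor_chain_def)
  have c: "M \<in> carrier_mat n n" "M' \<in> carrier_mat n n" using M M' by (auto simp: has_form_def alt_mat_def)
  have N: "?N \<in> carrier_mat n n" "?N' \<in> carrier_mat n n" using N_mat_carrier s by auto
  have "graded_iso K (Zn n) A Gr A' Gr' \<longleftrightarrow> congr (order_of K q) n M M'" by (rule graded_iso_iff_congr[OF A(1) M q A'(1) M'])
  also have "\<dots> \<longleftrightarrow> congr (order_of K q) n ?N ?N'"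
  proof
    assume "congr (order_of K q) n M M'"
    from congr_trans[OF congr_trans[OF congr_sym[OF S(2) c(1)] this N(1)] S'(2) N(1)]
    show "congr (order_of K q) n ?N ?N'" .
  next
    assume "congr (order_of K q) n ?N ?N'"
    from congr_trans[OF congr_trans[OF S(2) this c(1)] congr_sym[OF S'(2) c(2)] c(1)]
    show "congr (order_of K q) n M M'" .
  qed
  finally have iso: "graded_iso K (Zn n) A Gr A' Gr' \<longleftrightarrow> congr (order_of K q) n ?N ?N'" .
  \<comment> \<open>For \<open>s = 0\<close> the value \<open>h 0\<close> is arbitrary, but then
    \<open>m = 1\<close> and both sides are 1.\<close>
  have l: "int (order_of K q) div (if s = 0 then 1 else h s) = int (order_of K (q [^]\<^bsub>K\<^esub> h s))"
  proof (cases "s = 0")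
    case True
    then have "order_of K q = 1" using S(1) by (simp add: standard_data_def)
    then show ?thesis using True order_of_int_pow[OF K q m, of "h s"] by simp
  next
    case False
    then have "0 < h s" "h s dvd int (order_of K q)" using S(1) by (auto simp: standard_data_def divisor_chain_def)
    then show ?thesis using False order_of_int_pow[OF K q m, of "h s"] by (simp add: gcd_proj1_if_dvd_int)
  qed
  note cl = standard_forms_congruent_iff[OF m S(1) S'(1), unfolded l]
  show "coprime z (order_of K q) \<Longrightarrow> coprime z' (order_of K q) \<Longrightarrow>
      graded_iso K (Zn n) A Gr A' Gr' \<longleftrightarrow> s = s' \<and> (\<forall>i\<in>{2..s}. h i = h' i) \<and>
        in_pm_coset (order_of K q) z' z (D_group (order_of K q) n s h)"
    unfolding iso in_pm_coset_def by (rule cl(2))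
  show "graded_iso K (Zn n) A Gr A' Gr' \<longleftrightarrow> s = s' \<and> (\<forall>i\<in>{2..s}. h i = h' i) \<and>
        in_pm_coset (order_of K (q [^]\<^bsub>K\<^esub> h s)) z' z (D_group (order_of K q) n s h)"
    unfolding iso in_pm_coset_def by (rule cl(1))
  show "graded_iso K (Zn n) A Gr A' Gr' \<Longrightarrow> 0 < s \<Longrightarrow> [(int z)\<^sup>2 * h s = (int z')\<^sup>2 * h s] (mod int (order_of K q))"
    unfolding iso by (rule cl(3))
qed

text \<open>The isomorphism criterion appears in two forms because the data determine the torus only
  through \<open>z\<close> modulo \<open>l\<close>, the order of the \<open>h s\<close>-th power of
  \<open>q\<close>: adding \<open>l\<close> to \<open>z\<close> leaves the torus unchanged but may
  destroy coprimality to \<open>m\<close>. The first form is the coset condition in \<int>/(m), for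
  \<open>z\<close> and \<open>z'\<close> coprime to \<open>m\<close>; the second is the condition
  modulo \<open>l\<close>, for arbitrary data. Existence is asserted with \<open>z\<close> coprime
  to \<open>m\<close>, so that both forms apply to it.\<close>

theorem mainTheorem1:
  fixes K :: "('k, 'e) ring_scheme" and n :: nat
  assumes "field K"
  shows
    "(\<forall>(A :: ('k, 'a) module) Gr. quantum_torus K (Zn n) A Gr \<and> rational K A \<longrightarrow>
        commutator_group A = (\<lambda>k. k \<odot>\<^bsub>A\<^esub> \<one>\<^bsub>A\<^esub>) ` C_group K A \<and>
        cyclic_group ((units_of K)\<lparr>carrier := C_group K A\<rparr>) \<and>
        (\<forall>q\<in>Units K. C_group K A = generate (units_of K) {q} \<longrightarrow>
           card (C_group K A) = order_of K q \<and>
           (\<exists>s h z. described_by K n q A Gr s h z \<and> coprime z (order_of K q)))) \<and>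
     (\<forall>(A :: ('k, 'a) module) Gr (A' :: ('k, 'b) module) Gr'.
        quantum_torus K (Zn n) A Gr \<and> rational K A \<and>
        quantum_torus K (Zn n) A' Gr' \<and> rational K A' \<and>
        graded_iso K (Zn n) A Gr A' Gr' \<longrightarrow>
        C_group K A = C_group K A' \<and>
        (\<forall>q\<in>Units K. C_group K A = generate (units_of K) {q} \<longrightarrow>
           (\<exists>s h z s' h' z'.
              described_by K n q A Gr s h z \<and> coprime z (order_of K q) \<and>
              described_by K n q A' Gr' s' h' z' \<and> coprime z' (order_of K q)))) \<and>
     (\<forall>(A :: ('k, 'a) module) Gr (A' :: ('k, 'b) module) Gr' q s h z s' h' z'.
        quantum_torus K (Zn n) A Gr \<and> rational K A \<and>
        quantum_torus K (Zn n) A' Gr' \<and> rational K A' \<and>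
        q \<in> Units K \<and> C_group K A = generate (units_of K) {q} \<and>
        C_group K A' = generate (units_of K) {q} \<and>
        described_by K n q A Gr s h z \<and> described_by K n q A' Gr' s' h' z' \<longrightarrow>
        (coprime z (order_of K q) \<and> coprime z' (order_of K q) \<longrightarrow>
           (graded_iso K (Zn n) A Gr A' Gr' \<longleftrightarrow>
              s = s' \<and> (\<forall>i\<in>{2..s}. h i = h' i) \<and>
              in_pm_coset (order_of K q) z' z (D_group (order_of K q) n s h))) \<and>
        (graded_iso K (Zn n) A Gr A' Gr' \<longleftrightarrow>
           s = s' \<and> (\<forall>i\<in>{2..s}. h i = h' i) \<and>
           in_pm_coset (order_of K (q [^]\<^bsub>K\<^esub> h s)) z' z (D_group (order_of K q) n s h)) \<and>
        (graded_iso K (Zn n) A Gr A' Gr' \<and> 0 < s \<longrightarrow>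
           [(int z)\<^sup>2 * h s = (int z')\<^sup>2 * h s] (mod int (order_of K q))))"
proof -
  note r = qt.commutator_group_rational(2)[OF qt_quantum_torus]
  show ?thesis
  proof (intro conjI allI impI ballI; elim conjE)
    fix A :: "('k, 'a) module" and Gr
    assume A: "quantum_torus K (Zn n) A Gr" "rational K A"
    show "commutator_group A = (\<lambda>k. k \<odot>\<^bsub>A\<^esub> \<one>\<^bsub>A\<^esub>) ` C_group K A" by (rule r[OF A])
    show "cyclic_group ((units_of K)\<lparr>carrier := C_group K A\<rparr>)" by (rule C_group_cyclic[OF A])
    fix q assume q: "q \<in> Units K" "C_group K A = generate (units_of K) {q}"
    show "card (C_group K A) = order_of K q" by (rule C_group_generator(1)[OF A q])
    show "\<exists>s h z. described_by K n q A Gr s h z \<and> coprime z (order_of K q)"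
      by (rule described_by_exists[OF A q])
  next
    fix A :: "('k, 'a) module" and Gr and A' :: "('k, 'b) module" and Gr'
    assume A: "quantum_torus K (Zn n) A Gr" "rational K A" and A': "quantum_torus K (Zn n) A' Gr'" "rational K A'"
      and iso: "graded_iso K (Zn n) A Gr A' Gr'"
    show C: "C_group K A = C_group K A'" by (rule C_group_graded_iso[OF A A' iso])
    fix q assume q: "q \<in> Units K" "C_group K A = generate (units_of K) {q}"
    obtain s h z where d: "described_by K n q A Gr s h z" "coprime z (order_of K q)"
      using described_by_exists[OF A q] by blast
    obtain s' h' z' where d': "described_by K n q A' Gr' s' h' z'" "coprime z' (order_of K q)"
      using described_by_exists[OF A' q(1) q(2)[unfolded C]] by blast
    show "\<exists>s h z s' h' z'. described_by K n q A Gr s h z \<and> coprime z (order_of K q) \<and>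
        described_by K n q A' Gr' s' h' z' \<and> coprime z' (order_of K q)"
      by (intro exI conjI) (rule d d')+
  next
    fix A :: "('k, 'a) module" and Gr and A' :: "('k, 'b) module" and Gr' q s h z s' h' z'
    assume A: "quantum_torus K (Zn n) A Gr" "rational K A" and A': "quantum_torus K (Zn n) A' Gr'" "rational K A'"
      and q: "q \<in> Units K" and C: "C_group K A = generate (units_of K) {q}" "C_group K A' = generate (units_of K) {q}"
      and D: "described_by K n q A Gr s h z" "described_by K n q A' Gr' s' h' z'"
    note c = described_by_graded_iso_iff[OF A A' q C D]
    show "graded_iso K (Zn n) A Gr A' Gr' \<longleftrightarrow> s = s' \<and> (\<forall>i\<in>{2..s}. h i = h' i) \<and>
        in_pm_coset (order_of K q) z' z (D_group (order_of K q) n s h)"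
      if "coprime z (order_of K q)" "coprime z' (order_of K q)" by (rule c(1)[OF that])
    show "graded_iso K (Zn n) A Gr A' Gr' \<longleftrightarrow> s = s' \<and> (\<forall>i\<in>{2..s}. h i = h' i) \<and>
        in_pm_coset (order_of K (q [^]\<^bsub>K\<^esub> h s)) z' z (D_group (order_of K q) n s h)" by (rule c(2))
    show "[(int z)\<^sup>2 * h s = (int z')\<^sup>2 * h s] (mod int (order_of K q))"
      if "graded_iso K (Zn n) A Gr A' Gr'" "0 < s" by (rule c(3)[OF that])
  qed
qed

end
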